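(* Let $N\ge2$. For $\beta>0$ and $n\geq 1$ let $\theta=(\theta^1,\dots,\theta^N)$ be the spin $O(N)$ model on the torus $\mathbb{T}_n$ at inverse temperature $\beta$, rooted to point north at $0$, i.e. $\theta^N(0)=1$. For any choice of $n=n_\beta$ with $n_\beta\to\infty$ as $\beta\to\infty$, the rescaled field $\sqrt\beta\,(\theta^1,\dots,\theta^{N-1})$ converges in law as $\beta\to\infty$, on compact subsets (i.e. for every finite $F\subset\mathbb{Z}^2$, the restriction to $F$ converges in law), to the $(N-1)$-vectorial GFF on $\mathbb{Z}^2$ rooted to be $0$ at $0$.
   Context: $\mathbb{T}_n=(\mathbb{Z}/n\mathbb{Z})^2$ is the two-dimensional discrete torus with nearest-neighbour edges; finite subsets of $\mathbb{Z}^2$ are identified with subsets of $\mathbb{T}_n$ for $n$ large. The spin $O(N)$ model on $\mathbb{T}_n$ at inverse temperature $\beta$ is the probability measure on $(\mathbb{S}^{N-1})^{\mathbb{T}_n}$ proportional to $\exp\big(\beta\sum_{i\sim j}\theta(i)\cdot\theta(j)\big)\prod_i\lambda_{\mathbb{S}^{N-1}}(d\theta(i))$, where $\lambda_{\mathbb{S}^{N-1}}$ is the uniform measure on the unit sphere $\mathbb{S}^{N-1}\subset\mathbb{R}^N$; the rooted model is this measure with the spin at $0$ fixed to be $(0,\dots,0,1)$. The $M$-vectorial GFF on $\mathbb{Z}^2$ rooted at $0$ has $M$ independent coordinates, each a centred Gaussian field on $\mathbb{Z}^2$ vanishing at $0$ whose covariance is the Green's function of $-\Delta$ killed at $0$,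 where $\Delta f(x)=\sum_{y\sim x}(f(y)-f(x))$. *)

theory Defs
  imports "HOL-Probability.Probability"
begin

section \<open>The lattice and the torus\<close>

definition neighbours :: "int \<times> int \<Rightarrow> (int \<times> int) set" where
  "neighbours x = {y. \<bar>fst x - fst y\<bar> + \<bar>snd x - snd y\<bar> = 1}"

definition laplacian :: "(int \<times> int \<Rightarrow> real) \<Rightarrow> int \<times> int \<Rightarrow> real" where
  "laplacian f x = (\<Sum>y\<in>neighbours x. f y - f x)"

text \<open>
  The torus is represented by residues in the square from \<open>0\<close> to \<open>n - 1\<close>; a point of the lattice
  is identified with its residue, which for large \<open>n\<close> is injective on any given finite set.
\<close>

definition torus :: "nat \<Rightarrow> (int \<times> int) set" where
  "torus n = {0..<int n} \<times> {0..<int n}"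

definition torus_proj :: "nat \<Rightarrow> int \<times> int \<Rightarrow> int \<times> int" where
  "torus_proj n x = (fst x mod int n, snd x mod int n)"

definition torus_adj :: "nat \<Rightarrow> int \<times> int \<Rightarrow> int \<times> int \<Rightarrow> bool" where
  "torus_adj n x y \<longleftrightarrow> x \<in> torus n \<and> y \<in> torus n \<and> (\<exists>z\<in>neighbours x. torus_proj n z = y)"


section \<open>The spin model\<close>

text \<open>
  The uniform probability measure on the unit sphere (the normalized cone measure): the law of
  \<open>x / norm x\<close> for \<open>x\<close> uniform in the unit ball. It is considered as a Borel measure on the
  ambient space.
\<close>

definition sphere_measure :: "'a::euclidean_space measure" where
  "sphere_measure = distr (uniform_measure lborel (ball 0 1)) borel sgn"

text \<open>Every unordered edge is counted once, whence the factor one half.\<close>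

definition spin_energy :: "nat \<Rightarrow> (int \<times> int \<Rightarrow> 'a::euclidean_space) \<Rightarrow> real" where
  "spin_energy n \<theta> = (\<Sum>x\<in>torus n. \<Sum>y | torus_adj n x y. \<theta> x \<bullet> \<theta> y) / 2"

text \<open>
  The Gibbs measure whose single-site reference measures are \<open>\<rho>\<close>. The spin model itself has
  \<open>\<rho> = (\<lambda>_. sphere_measure)\<close>; rooting replaces \<open>\<rho> 0\<close> by a Dirac mass.
\<close>

definition spin_gibbs ::
  "real \<Rightarrow> nat \<Rightarrow> (int \<times> int \<Rightarrow> 'a::euclidean_space measure) \<Rightarrow> (int \<times> int \<Rightarrow> 'a) measure" where
  "spin_gibbs \<beta> n \<rho> =
     (let R = Pi\<^sub>M (torus n) \<rho>;
          Z = (\<integral>\<theta>. exp (\<beta> * spin_energy n \<theta>) \<partial>R)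
      in density R (\<lambda>\<theta>. ennreal (exp (\<beta> * spin_energy n \<theta>) / Z)))"

definition spin_model :: "real \<Rightarrow> nat \<Rightarrow> (int \<times> int \<Rightarrow> 'a::euclidean_space) measure" where
  "spin_model \<beta> n = spin_gibbs \<beta> n (\<lambda>_. sphere_measure)"

definition rooted_spin_model ::
  "real \<Rightarrow> nat \<Rightarrow> 'a::euclidean_space \<Rightarrow> (int \<times> int \<Rightarrow> 'a) measure" where
  "rooted_spin_model \<beta> n v = spin_gibbs \<beta> n ((\<lambda>_. sphere_measure)(0 := return borel v))"


section \<open>The Gaussian free field\<close>

text \<open>
  \<open>killed_walk m x y\<close> is the probability that simple random walk from \<open>x\<close> is at \<open>y\<close> after \<open>m\<close>
  steps without having visited \<open>0\<close> (at any time up to and including \<open>m\<close>). Since the negative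
  Laplacian killed at \<open>0\<close> is four times the identity minus the killed transition matrix, its
  Green's function is a quarter of the expected number of visits.
\<close>

primrec killed_walk :: "nat \<Rightarrow> int \<times> int \<Rightarrow> int \<times> int \<Rightarrow> real" where
  "killed_walk 0 x y = (if x = y \<and> x \<noteq> 0 then 1 else 0)"
| "killed_walk (Suc m) x y = (if x = 0 then 0 else (\<Sum>z\<in>neighbours x. killed_walk m z y) / 4)"

definition green0 :: "int \<times> int \<Rightarrow> int \<times> int \<Rightarrow> real" where
  "green0 x y = (\<Sum>m. killed_walk m x y) / 4"

definition centred_normal :: "real \<Rightarrow> real measure" where
  "centred_normal \<sigma> = (if \<sigma> = 0 then return borel 0 else density lborel (normal_density 0 \<sigma>))"

definition centred_gaussian_field :: "'w measure \<Rightarrow> ('i \<Rightarrow> 'w \<Rightarrow> real) \<Rightarrow> ('i \<Rightarrow> 'i \<Rightarrow> real) \<Rightarrow> bool" where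
  "centred_gaussian_field M X C \<longleftrightarrow>
     prob_space M \<and>
     (\<forall>i. X i \<in> borel_measurable M) \<and>
     (\<forall>J c. finite J \<longrightarrow>
        (\<exists>\<sigma>\<ge>0. distr M borel (\<lambda>\<omega>. \<Sum>i\<in>J. c i * X i \<omega>) = centred_normal \<sigma>)) \<and>
     (\<forall>i j. (\<integral>\<omega>. X i \<omega> * X j \<omega> \<partial>M) = C i j)"

text \<open>The coordinates are labelled by \<open>K\<close>, so this is the \<open>card K\<close>-vectorial field.\<close>

definition rooted_vectorial_gff ::
  "'w measure \<Rightarrow> 'k set \<Rightarrow> ('k \<Rightarrow> int \<times> int \<Rightarrow> 'w \<Rightarrow> real) \<Rightarrow> bool" where
  "rooted_vectorial_gff M K \<phi> \<longleftrightarrow>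
     prob_space M \<and>
     (\<forall>k\<in>K. centred_gaussian_field M (\<phi> k) green0 \<and> (AE \<omega> in M. \<phi> k 0 \<omega> = 0)) \<and>
     prob_space.indep_vars M (\<lambda>_. Pi\<^sub>M UNIV (\<lambda>_. borel)) (\<lambda>k \<omega> x. \<phi> k x \<omega>) K"


section \<open>Convergence in law\<close>

definition converges_weakly ::
  "'a topology \<Rightarrow> ('i \<Rightarrow> 'a measure) \<Rightarrow> 'a measure \<Rightarrow> 'i filter \<Rightarrow> bool" where
  "converges_weakly X \<mu> \<nu> G \<longleftrightarrow>
     (\<forall>f. continuous_map X euclideanreal f \<longrightarrow> bounded (f ` topspace X) \<longrightarrow>
        ((\<lambda>i. \<integral>x. f x \<partial>\<mu> i) \<longlongrightarrow> (\<integral>x. f x \<partial>\<nu>)) G)"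

definition law_on :: "'w measure \<Rightarrow> 'i set \<Rightarrow> ('w \<Rightarrow> 'i \<Rightarrow> real) \<Rightarrow> ('i \<Rightarrow> real) measure" where
  "law_on M A X = distr M (Pi\<^sub>M A (\<lambda>_. borel)) (\<lambda>\<omega>. restrict (X \<omega>) A)"


section \<open>The Green's function is well defined\<close>

lemma neighbours_eq:
  "neighbours x = {(fst x + 1, snd x), (fst x - 1, snd x), (fst x, snd x + 1), (fst x, snd x - 1)}"
  by (cases x) (auto simp: neighbours_def)

lemma finite_neighbours [simp]: "finite (neighbours x)"
  by (simp add: neighbours_eq)

lemma card_neighbours [simp]: "card (neighbours x) = 4"
  by (simp add: neighbours_eq)

lemma killed_walk_nonneg: "0 \<le> killed_walk m x y"
  by (induction m arbitrary: x) (auto intro: sum_nonneg)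

lemma killed_walk_0 [simp]: "killed_walk m 0 y = 0"
  by (cases m) auto

lemma killed_walk_to_0 [simp]: "killed_walk m x 0 = 0"
  by (induction m arbitrary: x) auto

lemma exists_closer_neighbour:
  assumes "\<bar>fst z\<bar> + \<bar>snd z\<bar> = int (Suc d)"
  shows "\<exists>w\<in>neighbours z. \<bar>fst w\<bar> + \<bar>snd w\<bar> = int d"
proof (cases "fst z = 0")
  case True
  then show ?thesis
    using assms by (cases "snd z > 0") (auto simp: neighbours_eq)
next
  case False
  then show ?thesis
    using assms by (cases "fst z > 0") (auto simp: neighbours_eq)
qed

lemma summable_killed_walk: "summable (\<lambda>m. killed_walk m x y)"
proof (cases "y = 0")
  case True
  then show ?thesis by simp
next
  case False
  define g where "g m x = (\<Sum>k\<le>m. killed_walk k x y)" for m x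
  have nonneg: "0 \<le> g m x" for m x
    unfolding g_def by (intro sum_nonneg killed_walk_nonneg)
  have mono: "g m x \<le> g (Suc m) x" for m x
    unfolding g_def by (simp add: killed_walk_nonneg del: killed_walk.simps)
  have root: "g m 0 = 0" for m
    unfolding g_def by simp
  have step: "g (Suc m) x = (if x = y then 1 else 0) + (\<Sum>z\<in>neighbours x. g m z) / 4"
    if "x \<noteq> 0" for m x
  proof -
    have "g (Suc m) x = killed_walk 0 x y + (\<Sum>k\<le>m. killed_walk (Suc k) x y)"
      unfolding g_def by (rule sum.atMost_Suc_shift)
    also have "(\<Sum>k\<le>m. killed_walk (Suc k) x y) = (\<Sum>z\<in>neighbours x. g m z) / 4"
      using that unfolding g_def
      by (simp add: sum_divide_distrib) (rule sum.swap)
    finally show ?thesis using that by simp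
  qed
  have le_top: "g m x \<le> g m y" for m x
  proof (induction m arbitrary: x)
    case 0
    then show ?case using False by (simp add: g_def)
  next
    case (Suc m)
    show ?case
    proof (cases "x = 0 \<or> x = y")
      case True
      then show ?thesis using root nonneg[of "Suc m" y] by auto
    next
      case False
      then have "g (Suc m) x = (\<Sum>z\<in>neighbours x. g m z) / 4"
        by (simp add: step)
      also have "\<dots> \<le> (\<Sum>z\<in>neighbours x. g m y) / 4"
        by (intro divide_right_mono sum_mono Suc.IH) auto
      also have "\<dots> = g m y" by simp
      also have "\<dots> \<le> g (Suc m) y" by (rule mono)
      finally show ?thesis .
    qed
  qed
  have avg: "(\<Sum>z\<in>neighbours x. g m z) / 4 \<le> (3 * g m y + g m w) / 4"
    if "w \<in> neighbours x" for m x w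
  proof -
    have "(\<Sum>z\<in>neighbours x. g m z) = g m w + (\<Sum>z\<in>neighbours x - {w}. g m z)"
      using that by (simp add: sum.remove)
    also have "(\<Sum>z\<in>neighbours x - {w}. g m z) \<le> (\<Sum>z\<in>neighbours x - {w}. g m y)"
      by (intro sum_mono le_top)
    also have "\<dots> = 3 * g m y" using that by simp
    finally show ?thesis by simp
  qed
  have near: "g m z \<le> (1 - (1/4) ^ d) * g m y"
    if "\<bar>fst z\<bar> + \<bar>snd z\<bar> = int d" "int d < \<bar>fst y\<bar> + \<bar>snd y\<bar>" for m z d
    using that
  proof (induction d arbitrary: z)
    case 0
    then have "fst z = 0 \<and> snd z = 0" by linarith
    then have "z = 0" by (simp add: prod_eq_iff)
    then show ?case by (simp add: root)
  next
    case (Suc d)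
    obtain w where w: "w \<in> neighbours z" "\<bar>fst w\<bar> + \<bar>snd w\<bar> = int d"
      using exists_closer_neighbour[OF Suc.prems(1)] by blast
    have z: "z \<noteq> 0" "z \<noteq> y" using Suc.prems by auto
    have "g m z \<le> g (Suc m) z" by (rule mono)
    also have "\<dots> = (\<Sum>z\<in>neighbours z. g m z) / 4" using z by (simp add: step)
    also have "\<dots> \<le> (3 * g m y + g m w) / 4" by (rule avg[OF w(1)])
    also have "\<dots> \<le> (3 * g m y + (1 - (1/4) ^ d) * g m y) / 4"
      using Suc.IH[OF w(2)] Suc.prems by simp
    also have "\<dots> = (1 - (1/4) ^ Suc d) * g m y" by (simp add: field_simps)
    finally show ?case .
  qed
  have "\<bar>fst y\<bar> + \<bar>snd y\<bar> > 0" using False by (auto simp: prod_eq_iff)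
  then obtain d where d: "\<bar>fst y\<bar> + \<bar>snd y\<bar> = int (Suc d)"
    by (metis Suc_pred' zero_less_imp_eq_int)
  obtain w where w: "w \<in> neighbours y" "\<bar>fst w\<bar> + \<bar>snd w\<bar> = int d"
    using exists_closer_neighbour[OF d] by blast
  have bound: "g m y \<le> 4 ^ Suc d" for m
  proof -
    have "g m y \<le> g (Suc m) y" by (rule mono)
    also have "\<dots> = 1 + (\<Sum>z\<in>neighbours y. g m z) / 4" using False by (simp add: step)
    also have "\<dots> \<le> 1 + (3 * g m y + g m w) / 4" using avg[OF w(1)] by simp
    also have "\<dots> \<le> 1 + (3 * g m y + (1 - (1/4) ^ d) * g m y) / 4"
      using near[OF w(2)] d by simp
    also have "\<dots> = 1 + g m y - (1/4) ^ Suc d * g m y" by (simp add: field_simps)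
    finally have "(1/4) ^ Suc d * g m y \<le> 1" by simp
    then show ?thesis by (simp add: power_one_over field_simps)
  qed
  show ?thesis
  proof (rule summableI_nonneg_bounded)
    show "(\<Sum>i<m. killed_walk i x y) \<le> 4 ^ Suc d" for m
    proof -
      have "(\<Sum>i<m. killed_walk i x y) \<le> g m x"
        unfolding g_def by (intro sum_mono2) (auto simp: killed_walk_nonneg)
      also have "\<dots> \<le> 4 ^ Suc d" using le_top bound by (rule order_trans)
      finally show ?thesis .
    qed
  qed (rule killed_walk_nonneg)
qed

lemma green0_0 [simp]: "green0 0 y = 0"
  by (simp add: green0_def)

lemma laplacian_green0:
  assumes "x \<noteq> 0"
  shows "- laplacian (\<lambda>z. green0 z y) x = (if x = y then 1 else 0)"
proof -
  have "(\<Sum>m. killed_walk m x y) = killed_walk 0 x y + (\<Sum>m. killed_walk (Suc m) x y)"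
    using suminf_split_head[OF summable_killed_walk, of x y] by simp
  also have "(\<Sum>m. killed_walk (Suc m) x y) = (\<Sum>z\<in>neighbours x. \<Sum>m. killed_walk m z y) / 4"
    using assms
    by (simp add: suminf_divide summable_sum summable_killed_walk suminf_sum)
  finally have "4 * green0 x y = killed_walk 0 x y + (\<Sum>z\<in>neighbours x. green0 z y)"
    by (simp add: green0_def sum_divide_distrib)
  then show ?thesis
    using assms by (simp add: laplacian_def sum_subtractf)
qed


section \<open>The sphere measure is the uniform one\<close>

lemma sets_sphere_measure [simp]: "sets sphere_measure = sets borel"
  by (simp add: sphere_measure_def)

lemma prob_space_sphere_measure: "prob_space (sphere_measure :: 'a::euclidean_space measure)"
proof -
  have "prob_space (uniform_measure lborel (ball (0::'a) 1))"
    by (rule prob_space_uniform_measure)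
      (use emeasure_lborel_ball_finite[of "0::'a" 1] content_ball_pos[of 1 "0::'a"] in
        \<open>auto simp: emeasure_eq_measure2 measure_def\<close>)
  then show ?thesis
    unfolding sphere_measure_def
    by (rule prob_space.prob_space_distr) simp
qed

lemma AE_sphere_measure: "AE x in sphere_measure. x \<in> sphere (0::'a::euclidean_space) 1"
proof -
  have "AE x in uniform_measure lborel (ball (0::'a) 1). sgn x \<in> sphere 0 1"
  proof (rule AE_uniform_measureI)
    show "AE x in lborel. x \<in> ball (0::'a) 1 \<longrightarrow> sgn x \<in> sphere 0 1"
      using AE_lborel_singleton[of "0::'a"] by eventually_elim (simp add: norm_sgn)
  qed simp
  then show ?thesis
    unfolding sphere_measure_def by (subst AE_distr_iff) auto
qed

lemma distr_sphere_measure_orthogonal: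
  fixes f :: "real ^ 'n::{finite,wellorder} \<Rightarrow> real ^ 'n::_"
  assumes f: "orthogonal_transformation f"
  shows "distr sphere_measure borel f = sphere_measure"
proof (rule measure_eqI)
  fix A :: "(real ^ 'n::_) set"
  assume "A \<in> sets (distr sphere_measure borel f)"
  then have A [measurable]: "A \<in> sets borel" by simp
  have lin: "linear f" and norm_f: "\<And>x. norm (f x) = norm x"
    using f by (auto simp: orthogonal_transformation)
  then have [measurable]: "f \<in> borel_measurable borel"
    by (intro borel_measurable_continuous_onI linear_continuous_on linear_conv_bounded_linear[THEN iffD1])
  define B where "B = ball 0 1 \<inter> sgn -` A"
  have B [measurable]: "B \<in> sets borel"
    unfolding B_def by (intro sets.Int measurable_sets_borel[OF borel_measurable_sgn]) auto
  have sgn_f: "sgn (f x) = f (sgn x)" for x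
    by (simp add: sgn_div_norm norm_f linear_scale[OF lin])
  have pre: "ball 0 1 \<inter> sgn -` f -` A = f -` B"
    by (auto simp: B_def sgn_f norm_f)
  have inv: "f -` B = inv f ` B"
    using orthogonal_transformation_bij[OF f] by (rule bij_vimage_eq_inv_image)
  have fin: "bounded B" unfolding B_def by (rule bounded_subset[OF bounded_ball]) auto
  then have lm: "B \<in> lmeasurable" by (intro bounded_set_imp_lmeasurable) (auto simp: B)
  have "emeasure lebesgue (inv f ` B) = emeasure lebesgue B"
    using measurable_orthogonal_image[OF orthogonal_transformation_inv[OF f] lm]
      measure_orthogonal_image[OF orthogonal_transformation_inv[OF f] lm] lm
    by (simp add: emeasure_eq_measure2)
  moreover have "inv f ` B \<in> sets borel"
    unfolding inv[symmetric] using measurable_sets_borel[of f borel B] by simp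
  ultimately have "emeasure lborel (f -` B) = emeasure lborel B"
    by (simp add: inv)
  moreover have em: "emeasure sphere_measure C
      = emeasure lborel (ball 0 1 \<inter> sgn -` C) / emeasure lborel (ball (0::real^'n::_) 1)"
    if "C \<in> sets borel" for C :: "(real ^ 'n::_) set"
    using that measurable_sets_borel[OF borel_measurable_sgn that]
    unfolding sphere_measure_def by (simp add: emeasure_distr)
  moreover have "f -` A \<in> sets borel"
    using measurable_sets_borel[of f borel A] A by simp
  moreover have "emeasure (distr sphere_measure borel f) A = emeasure sphere_measure (f -` A)"
    using A by (subst emeasure_distr) (simp_all add: sphere_measure_def)
  ultimately show "emeasure (distr sphere_measure borel f) A = emeasure sphere_measure A"
    using A by (simp add: pre em flip: B_def)
qed simp

end

theory Submission
  imports Defs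
begin

text \<open>
  Reflection positivity of the Gaussian interaction \<open>exp (- \<beta> / 2 * (dist u v)\<^sup>2)\<close> gives Gaussian domination on
  the torus, hence an infrared bound: gradient observables of the spins have second moments of order
  \<open>1 / \<beta>\<close>, uniformly in the size of the torus. By rotation invariance the bound survives the rooting, and by
  recurrence of the plane the dual norm on the torus is controlled by the one on the lattice.

  Rotating one spin in the plane of the root direction \<open>v\<close> and an orthogonal direction \<open>e\<close> yields a Ward
  identity. Summed against the killed walk Green's function cut off after finitely many steps, it says that for
  a linear observable \<open>Y\<close> of the rescaled transversal field the function \<open>t \<mapsto> E (cos (t * Y + a))\<close> satisfies
  \<open>u' = - t * \<sigma>\<^sup>2 * u\<close> up to an error, which is small by the infrared bound. So \<open>Y\<close> is asymptotically centred
  Gaussian with the variance \<open>\<sigma>\<^sup>2\<close> of the free field. Together with the second moment bounds this gives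
  convergence in law, by approximating bounded continuous functions by trigonometric polynomials.
\<close>

section \<open>Invariance of the uniform measure on the sphere\<close>

text \<open>The torus may grow at any speed relative to \<open>\<beta>\<close>, so no estimate may
  depend on its size. On a very large torus distant spins no longer point along \<open>v\<close>,
  which rules out an expansion around the constant configuration. Therefore only spins in a fixed
  ball are compared with \<open>v\<close>. There the defect 1 - \<theta>(x) . v is quadratic in
  \<theta>(x) - v, hence of mean order 1/\<beta>, and survives the factor sqrt \<beta> of the
  rescaling.

  The price of locality is the cutoff of the Green's function after M steps. It leaves a remainder,
  the pairing of the field with the M-step killed evolution of the observable, spread over a ball
  that grows with M. Sitewise bounds do not make it small; the dual form of the infrared bound does,
  through the tail of the Green series beyond time 2M. So M is fixed first, then \<beta> tends to
  infinity, and M is large only to make this tail and the error in the variance small.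

  Reflections need the same single-site measure everywhere. The infrared bound is therefore proved
  without a root, and it passes to the rooted model only for quantities invariant under a common
  rotation of all spins.\<close>

lemma lborel_eqI_translation_invariant:
  fixes M :: "'a::euclidean_space measure"
  assumes sets [measurable_cong]: "sets M = sets borel"
    and inv: "\<And>c. distr M borel ((+) c) = M"
    and ball: "\<And>r. emeasure M (ball 0 r) = emeasure lborel (ball (0::'a) r)"
  shows "M = lborel"
proof -
  have sf: "sigma_finite_measure M"
  proof
    have "(\<Union>n::nat. ball (0::'a) (real n)) = UNIV"
      by (auto simp: reals_Archimedean2)
    moreover have "space M = UNIV" using sets_eq_imp_space_eq[OF sets] by simp
    moreover have "emeasure M (ball 0 (real n)) \<noteq> \<infinity>" for n
      using emeasure_lborel_ball_finite[of "0::'a" "real n"] by (simp add: ball less_top)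
    ultimately show "\<exists>A. countable A \<and> A \<subseteq> sets M \<and> \<Union> A = space M \<and> (\<forall>a\<in>A. emeasure M a \<noteq> \<infinity>)"
      by (intro exI[of _ "range (\<lambda>n::nat. ball (0::'a) (real n))"]) (auto simp: sets)
  qed
  interpret M: sigma_finite_measure M by (rule sf)
  interpret P: pair_sigma_finite M "lborel :: 'a measure" ..
  interpret Q: pair_sigma_finite "lborel :: 'a measure" M ..
  define B where "B = ball (0::'a) 1"
  have B [measurable]: "B \<in> sets borel" by (simp add: B_def)
  have shift: "(\<integral>\<^sup>+x. f (c + x) \<partial>M) = (\<integral>\<^sup>+x. f x \<partial>M)" if [measurable]: "f \<in> borel_measurable borel" for f c
    by (subst (2) inv[of c, symmetric]) (simp add: nn_integral_distr)
  have shiftl: "(\<integral>\<^sup>+x. f (c + x) \<partial>lborel) = (\<integral>\<^sup>+x. f x \<partial>lborel)"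
    if [measurable]: "f \<in> borel_measurable borel" for f and c :: 'a
    by (subst (2) lborel_distr_plus[of c, symmetric]) (simp add: nn_integral_distr)
  have refl: "(\<integral>\<^sup>+y. f (c - y) \<partial>lborel) = (\<integral>\<^sup>+x. f x \<partial>lborel)"
    if [measurable]: "f \<in> borel_measurable borel" for f and c :: 'a
    using nn_integral_real_affine
    by (subst (2) lborel_affine[of "-1" c])
       (simp_all add: nn_integral_density nn_integral_distr)
  show ?thesis
  proof (rule measure_eqI)
    fix A assume "A \<in> sets M"
    then have A [measurable]: "A \<in> sets borel" by (simp add: sets)
    \<comment> \<open>Tonelli with shifts on both sides trades \<open>M\<close> on \<open>A\<close>
      and Lebesgue on \<open>B\<close> for Lebesgue on \<open>A\<close> and \<open>M\<close> on
      \<open>B\<close>; on the unit ball \<open>B\<close> the two measures agree by hypothesis, so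
      \<open>B\<close> cancels.\<close>
    have "emeasure M A * emeasure lborel B = (\<integral>\<^sup>+x. indicator A x * (\<integral>\<^sup>+y. indicator B y \<partial>lborel) \<partial>M)"
      by (simp add: nn_integral_multc)
    also have "\<dots> = (\<integral>\<^sup>+x. \<integral>\<^sup>+y. indicator A x * indicator B (x + y) \<partial>lborel \<partial>M)"
      using shiftl[of "indicator B"] by (subst nn_integral_cmult) simp_all
    also have "\<dots> = (\<integral>\<^sup>+y. \<integral>\<^sup>+x. indicator A x * indicator B (x + y) \<partial>M \<partial>lborel)"
      by (rule P.Fubini'[symmetric]) measurable
    also have "\<dots> = (\<integral>\<^sup>+y. \<integral>\<^sup>+x. indicator A (x - y) * indicator B x \<partial>M \<partial>lborel)"
      using shift[of "\<lambda>x. indicator A x * indicator B (x + y)" "- y" for y]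
      by (intro nn_integral_cong[of lborel]) (simp add: algebra_simps)
    also have "\<dots> = (\<integral>\<^sup>+x. \<integral>\<^sup>+y. indicator A (x - y) * indicator B x \<partial>lborel \<partial>M)"
      by (rule P.Fubini') measurable
    also have "\<dots> = (\<integral>\<^sup>+x. emeasure lborel A * indicator B x \<partial>M)"
      using refl[of "indicator A"] by (subst nn_integral_multc) simp_all
    also have "\<dots> = emeasure lborel A * emeasure lborel B"
      by (subst nn_integral_cmult_indicator) (simp_all add: sets ball B_def)
    finally have "emeasure M A * emeasure lborel B = emeasure lborel A * emeasure lborel B" .
    moreover have "emeasure lborel B \<noteq> \<infinity>" "emeasure lborel B \<noteq> 0"
      using emeasure_lborel_ball_finite[of "0::'a" 1] content_ball_pos[of 1 "0::'a"]
      by (auto simp: measure_def B_def)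
    ultimately show "emeasure M A = emeasure lborel A"
      by (metis antisym ennreal_mult_le_mult_iff mult.commute order_refl infinity_ennreal_def)
  qed (simp add: sets)
qed

text \<open>The image measure is translation invariant because \<open>T\<close> is onto, and it
  gives balls around 0 the right mass because \<open>T\<close> preserves norms; no determinant is
  involved.\<close>

lemma lborel_distr_isometry:
  fixes T :: "'a::euclidean_space \<Rightarrow> 'a"
  assumes lin: "linear T" and norm: "\<And>x. norm (T x) = norm x"
  shows "distr lborel borel T = lborel"
proof (rule lborel_eqI_translation_invariant)
  have inj: "inj T"
    using lin norm by (simp add: linear_injective_0) (metis norm_eq_zero)
  then have surj: "surj T"
    using linear_injective_imp_surjective[OF lin] by simp
  have [measurable]: "T \<in> borel_measurable borel"
    using lin by (intro borel_measurable_continuous_onI linear_continuous_on) (simp add: linear_conv_bounded_linear)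
  show "distr (distr lborel borel T) borel ((+) c) = distr lborel borel T" for c
  proof -
    obtain c' where c': "c = T c'" using surj by blast
    have "distr (distr lborel borel T) borel ((+) c) = distr (distr lborel borel ((+) c')) borel T"
      by (simp add: distr_distr comp_def c' linear_add[OF lin])
    then show ?thesis by (simp add: lborel_distr_plus)
  qed
  show "emeasure (distr lborel borel T) (ball 0 r) = emeasure lborel (ball (0::'a) r)" for r
  proof -
    have "T -` ball 0 r = ball 0 r" by (auto simp: norm)
    then show ?thesis by (simp add: emeasure_distr)
  qed
qed simp

text \<open>Rotation invariance on an arbitrary Euclidean space, whereas
  \<open>distr_sphere_measure_orthogonal\<close> concerns coordinates with a well-ordered index
  type. \<open>T\<close> commutes with \<open>sgn\<close> and maps the unit ball to itself.\<close>

lemma distr_sphere_measure_isometry: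
  fixes T :: "'a::euclidean_space \<Rightarrow> 'a"
  assumes lin: "linear T" and norm: "\<And>x. norm (T x) = norm x"
  shows "distr sphere_measure borel T = sphere_measure"
proof (rule measure_eqI)
  fix A :: "'a set"
  assume "A \<in> sets (distr sphere_measure borel T)"
  then have A [measurable]: "A \<in> sets borel" by simp
  have [measurable]: "T \<in> borel_measurable borel"
    using lin by (intro borel_measurable_continuous_onI linear_continuous_on) (simp add: linear_conv_bounded_linear)
  have sgn_T: "sgn (T x) = T (sgn x)" for x
    by (simp add: sgn_div_norm norm linear_scale[OF lin])
  have em: "emeasure sphere_measure C
      = emeasure lborel (ball 0 1 \<inter> sgn -` C) / emeasure lborel (ball (0::'a) 1)"
    if "C \<in> sets borel" for C :: "'a set"
    using that measurable_sets_borel[OF borel_measurable_sgn that]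
    unfolding sphere_measure_def by (simp add: emeasure_distr)
  have TA: "T -` A \<in> sets borel"
    using measurable_sets_borel[of T borel A] A by simp
  have SA: "ball 0 1 \<inter> sgn -` A \<in> sets borel"
    by (intro sets.Int measurable_sets_borel[OF borel_measurable_sgn]) auto
  have "emeasure lborel (ball 0 1 \<inter> sgn -` T -` A) = emeasure lborel (T -` (ball 0 1 \<inter> sgn -` A))"
    by (rule arg_cong[where f = "emeasure lborel"]) (auto simp: norm sgn_T)
  also have "\<dots> = emeasure (distr lborel borel T) (ball 0 1 \<inter> sgn -` A)"
    using SA by (simp add: emeasure_distr)
  also have "\<dots> = emeasure lborel (ball 0 1 \<inter> sgn -` A)"
    by (simp add: lborel_distr_isometry[OF lin norm])
  finally show "emeasure (distr sphere_measure borel T) A = emeasure sphere_measure A"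
    using A TA by (subst emeasure_distr) (simp_all add: em, simp add: sphere_measure_def)
qed simp

lemma exists_isometry_of_norm_eq:
  fixes u v :: "'a::euclidean_space"
  assumes "norm u = norm v"
  obtains T where "linear T" "\<And>x. norm (T x) = norm x" "T u = v"
proof -
  define w where "w = u - v"
  \<comment> \<open>Reflection in the hyperplane orthogonal to \<open>u - v\<close>; when
    \<open>u = v\<close> it degenerates to the identity.\<close>
  define T where "T x = x - (2 * (x \<bullet> w) / (w \<bullet> w)) *\<^sub>R w" for x
  have "linear T"
    unfolding T_def by (intro linearI) (auto simp: algebra_simps inner_add_left add_divide_distrib)
  moreover have "norm (T x) = norm x" for x
  proof (cases "w = 0")
    case False
    have "T x \<bullet> T x = x \<bullet> x"
      using False unfolding T_def
      by (simp add: inner_diff_left inner_diff_right inner_commute field_simps power2_eq_square)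
    then show ?thesis by (simp add: norm_eq_sqrt_inner)
  qed (simp add: T_def)
  moreover have "T u = v"
  proof (cases "w = 0")
    case False
    have "u \<bullet> u = v \<bullet> v" using assms by (simp add: norm_eq)
    then have "2 * (u \<bullet> w) = w \<bullet> w"
      by (simp add: w_def inner_diff_left inner_diff_right inner_commute)
    then show ?thesis using False by (simp add: T_def w_def)
  qed (simp add: T_def w_def)
  ultimately show ?thesis using that by blast
qed

lemma distr_PiM_coordinatewise:
  assumes I: "finite I" and prob: "\<And>i. i \<in> I \<Longrightarrow> prob_space (M i)"
    and T: "\<And>i. i \<in> I \<Longrightarrow> T i \<in> measurable (M i) (M i)"
    and inv: "\<And>i. i \<in> I \<Longrightarrow> distr (M i) (M i) (T i) = M i"
  shows "distr (PiM I M) (PiM I M) (\<lambda>\<omega>. \<lambda>i\<in>I. T i (\<omega> i)) = PiM I M"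
proof -
  \<comment> \<open>Outside \<open>I\<close> a point mass is inserted, so that the whole family
    consists of probability spaces.\<close>
  define N where "N i = (if i \<in> I then M i else return (count_space UNIV) undefined)" for i
  have N: "prob_space (N i)" for i
    using prob by (auto simp: N_def intro: prob_space_return)
  interpret N: product_prob_space N by (intro product_prob_spaceI N)
  have PN: "PiM I N = PiM I M" by (intro PiM_cong) (auto simp: N_def)
  have TN [measurable]: "i \<in> I \<Longrightarrow> T i \<in> measurable (N i) (N i)" for i using T by (simp add: N_def)
  have meas: "(\<lambda>\<omega>. \<lambda>i\<in>I. T i (\<omega> i)) \<in> measurable (PiM I N) (PiM I N)"
    by measurable
  have "distr (PiM I N) (PiM I N) (\<lambda>\<omega>. \<lambda>i\<in>I. T i (\<omega> i)) = PiM I N"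
  proof (rule N.PiM_eqI[OF I])
    fix A assume A: "\<And>i. i \<in> I \<Longrightarrow> A i \<in> sets (N i)"
    have "(\<lambda>\<omega>. \<lambda>i\<in>I. T i (\<omega> i)) -` Pi\<^sub>E I A \<inter> space (PiM I N) = (\<Pi>\<^sub>E i\<in>I. T i -` A i \<inter> space (N i))"
      by (auto simp: space_PiM PiE_iff)
    then have "emeasure (distr (PiM I N) (PiM I N) (\<lambda>\<omega>. \<lambda>i\<in>I. T i (\<omega> i))) (Pi\<^sub>E I A)
        = (\<Prod>i\<in>I. emeasure (N i) (T i -` A i \<inter> space (N i)))"
      using A TN meas I by (subst emeasure_distr) (auto intro!: N.emeasure_PiM sets_PiM_I_finite dest: measurable_sets[OF TN])
    also have "\<dots> = (\<Prod>i\<in>I. emeasure (N i) (A i))"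
    proof (rule prod.cong[OF refl])
      fix i assume i: "i \<in> I"
      then have "emeasure (N i) (T i -` A i \<inter> space (N i)) = emeasure (distr (N i) (N i) (T i)) (A i)"
        using A TN by (subst emeasure_distr) auto
      then show "emeasure (N i) (T i -` A i \<inter> space (N i)) = emeasure (N i) (A i)"
        using i inv by (simp add: N_def)
    qed
    finally show "emeasure (distr (PiM I N) (PiM I N) (\<lambda>\<omega>. \<lambda>i\<in>I. T i (\<omega> i))) (Pi\<^sub>E I A) = \<dots>" .
  qed simp
  then show ?thesis by (simp add: PN)
qed

text \<open>Dominated convergence of the difference quotients, which the mean value bound controls
  by \<open>B\<close>. For this the exceptional null set in \<open>bound\<close> must not depend on
  \<open>t\<close>.\<close>

lemma has_real_derivative_integral:
  fixes G G' :: "real \<Rightarrow> 'a \<Rightarrow> real"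
  assumes M: "finite_measure M"
    and meas: "\<And>t. G t \<in> borel_measurable M" "\<And>t. G' t \<in> borel_measurable M"
    and int: "\<And>t. integrable M (G t)"
    and deriv: "\<And>t \<omega>. ((\<lambda>t. G t \<omega>) has_real_derivative G' t \<omega>) (at t)"
    and bound: "AE \<omega> in M. \<forall>t. \<bar>G' t \<omega>\<bar> \<le> B"
  shows "((\<lambda>t. \<integral>\<omega>. G t \<omega> \<partial>M) has_real_derivative (\<integral>\<omega>. G' t \<omega> \<partial>M)) (at t)"
proof -
  interpret finite_measure M by (rule M)
  have "((\<lambda>s. ((\<integral>\<omega>. G s \<omega> \<partial>M) - (\<integral>\<omega>. G t \<omega> \<partial>M)) / (s - t)) \<longlongrightarrow> (\<integral>\<omega>. G' t \<omega> \<partial>M)) (at t within UNIV)"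
    unfolding tendsto_at_iff_sequentially comp_def
  proof (intro allI impI)
    fix X :: "nat \<Rightarrow> real" assume X: "\<forall>i. X i \<in> UNIV - {t}" and lim: "X \<longlonglongrightarrow> t"
    have "(\<lambda>i. \<integral>\<omega>. (G (X i) \<omega> - G t \<omega>) / (X i - t) \<partial>M) \<longlonglongrightarrow> (\<integral>\<omega>. G' t \<omega> \<partial>M)"
    proof (rule integral_dominated_convergence[where w = "\<lambda>_. B"])
      show "AE \<omega> in M. (\<lambda>i. (G (X i) \<omega> - G t \<omega>) / (X i - t)) \<longlonglongrightarrow> G' t \<omega>"
      proof (rule AE_I2)
        fix \<omega>
        have "((\<lambda>s. (G s \<omega> - G t \<omega>) / (s - t)) \<longlongrightarrow> G' t \<omega>) (at t)"
          using deriv[of \<omega> t] by (simp add: has_field_derivative_iff)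
        then show "(\<lambda>i. (G (X i) \<omega> - G t \<omega>) / (X i - t)) \<longlonglongrightarrow> G' t \<omega>"
          using X lim unfolding tendsto_at_iff_sequentially comp_def by blast
      qed
      show "AE \<omega> in M. norm ((G (X i) \<omega> - G t \<omega>) / (X i - t)) \<le> B" for i
        using bound
      proof eventually_elim
        case (elim \<omega>)
        have "\<bar>G (X i) \<omega> - G t \<omega>\<bar> \<le> B * \<bar>X i - t\<bar>"
          using field_differentiable_bound[of UNIV "\<lambda>t. G t \<omega>" "\<lambda>t. G' t \<omega>" B "X i" t] deriv elim
          by auto
        then show ?case using X by (auto simp: field_simps)
      qed
    qed (use meas in auto)
    then show "(\<lambda>i. ((\<integral>\<omega>. G (X i) \<omega> \<partial>M) - (\<integral>\<omega>. G t \<omega> \<partial>M)) / (X i - t)) \<longlonglongrightarrow> (\<integral>\<omega>. G' t \<omega> \<partial>M)"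
      using int by simp
  qed
  then show ?thesis by (simp add: has_field_derivative_iff)
qed

section \<open>Reflection positivity and Gaussian domination\<close>

text \<open>The source of reflection positivity: the coupling between a site and its mirror image is
  an integral over an auxiliary point \<open>y\<close> of a function of \<open>u\<close> times the
  same function of \<open>v\<close>. It holds because |u - y|^2 + |v - y|^2 is twice the squared
  distance of \<open>y\<close> to the midpoint plus |u - v|^2 / 2.\<close>

lemma gaussian_midpoint:
  fixes u v :: "'a::euclidean_space"
  assumes "\<beta> > 0"
  shows "(\<integral>\<^sup>+y. ennreal (exp (- \<beta> * (norm (u - y))\<^sup>2)) * ennreal (exp (- \<beta> * (norm (v - y))\<^sup>2)) \<partial>lborel)
    = ennreal (sqrt (pi / (2 * \<beta>)) ^ DIM('a)) * ennreal (exp (- \<beta> / 2 * (norm (u - v))\<^sup>2))"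
proof -
  define m where "m = (1/2) *\<^sub>R (u + v)"
  have id: "(norm (u - y))\<^sup>2 + (norm (v - y))\<^sup>2 = 2 * (norm (y - m))\<^sup>2 + (norm (u - v))\<^sup>2 / 2" for y
    unfolding m_def power2_norm_eq_inner
    by (simp add: inner_diff_left inner_diff_right inner_add_left inner_add_right inner_commute field_simps)
  \<comment> \<open>The standard deviation for which the normal density is proportional to exp (- 2
    \<beta> t^2).\<close>
  define s where "s = 1 / sqrt (4 * \<beta>)"
  have s: "s > 0" "s\<^sup>2 = 1 / (4 * \<beta>)" using assms by (auto simp: s_def power_divide)
  have one: "(\<integral>\<^sup>+t. ennreal (exp (- (2 * \<beta>) * t\<^sup>2)) \<partial>lborel) = ennreal (sqrt (pi / (2 * \<beta>)))"
  proof -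
    have "exp (- (2 * \<beta>) * t\<^sup>2) = sqrt (pi / (2 * \<beta>)) * normal_density 0 s t" for t
      using assms unfolding normal_density_def by (simp add: s(2) field_simps real_sqrt_divide)
    then have "(\<integral>\<^sup>+t. ennreal (exp (- (2 * \<beta>) * t\<^sup>2)) \<partial>lborel)
        = ennreal (sqrt (pi / (2 * \<beta>))) * (\<integral>\<^sup>+t. ennreal (normal_density 0 s t) \<partial>lborel)"
      using assms by (simp add: ennreal_mult nn_integral_cmult)
    also have "(\<integral>\<^sup>+t. ennreal (normal_density 0 s t) \<partial>lborel) = 1"
      using s(1) by (simp add: nn_integral_eq_integral)
    finally show ?thesis by simp
  qed
  have "(\<integral>\<^sup>+y. ennreal (exp (- \<beta> * (norm (u - y))\<^sup>2)) * ennreal (exp (- \<beta> * (norm (v - y))\<^sup>2)) \<partial>lborel)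
      = (\<integral>\<^sup>+y. ennreal (exp (- \<beta> / 2 * (norm (u - v))\<^sup>2)) * ennreal (exp (- (2 * \<beta>) * (norm (y - m))\<^sup>2)) \<partial>lborel)"
  proof (intro nn_integral_cong)
    fix y
    have "- \<beta> * (norm (u - y))\<^sup>2 + - \<beta> * (norm (v - y))\<^sup>2 = - \<beta> / 2 * (norm (u - v))\<^sup>2 + - (2 * \<beta>) * (norm (y - m))\<^sup>2"
      using arg_cong[OF id[of y], of "\<lambda>z. - \<beta> * z"] by (simp add: algebra_simps)
    then show "ennreal (exp (- \<beta> * (norm (u - y))\<^sup>2)) * ennreal (exp (- \<beta> * (norm (v - y))\<^sup>2))
        = ennreal (exp (- \<beta> / 2 * (norm (u - v))\<^sup>2)) * ennreal (exp (- (2 * \<beta>) * (norm (y - m))\<^sup>2))"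
      by (simp only: exp_add[symmetric] ennreal_mult'[symmetric] exp_ge_zero)
  qed
  also have "\<dots> = ennreal (exp (- \<beta> / 2 * (norm (u - v))\<^sup>2)) * (\<integral>\<^sup>+y. ennreal (exp (- (2 * \<beta>) * (norm (y - m))\<^sup>2))
      \<partial>lborel)"
    by (rule nn_integral_cmult) simp
  also have "(\<integral>\<^sup>+y. ennreal (exp (- (2 * \<beta>) * (norm (y - m))\<^sup>2)) \<partial>lborel)
      = (\<integral>\<^sup>+y. ennreal (exp (- (2 * \<beta>) * (norm y)\<^sup>2)) \<partial>(lborel :: 'a measure))"
    by (subst lborel_distr_plus[of m, symmetric]) (simp add: nn_integral_distr)
  also have "\<dots> = (\<integral>\<^sup>+y. (\<Prod>b\<in>Basis. ennreal (exp (- (2 * \<beta>) * (y \<bullet> b)\<^sup>2))) \<partial>(lborel :: 'a measure))"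
  proof (intro nn_integral_cong)
    fix y :: 'a
    have "(norm y)\<^sup>2 = (\<Sum>b\<in>Basis. (y \<bullet> b)\<^sup>2)"
      by (subst power2_norm_eq_inner, subst euclidean_inner) (simp add: power2_eq_square)
    then show "ennreal (exp (- (2 * \<beta>) * (norm y)\<^sup>2)) = (\<Prod>b\<in>Basis. ennreal (exp (- (2 * \<beta>) * (y \<bullet> b)\<^sup>2)))"
      by (simp add: prod_ennreal exp_sum[symmetric] sum_distrib_left sum_negf)
  qed
  also have "\<dots> = ennreal (sqrt (pi / (2 * \<beta>))) ^ DIM('a)"
    by (subst nn_integral_lborel_prod) (simp_all add: one[simplified])
  finally show ?thesis using assms by (simp add: ennreal_power mult.commute)
qed

section \<open>Reflections of a finite graph\<close>

definition pair_sum :: "'v set \<Rightarrow> ('v \<Rightarrow> 'v \<Rightarrow> bool) \<Rightarrow> ('a \<Rightarrow> 'a \<Rightarrow> real) \<Rightarrow> ('v \<Rightarrow> 'a) \<Rightarrow> real" where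
  "pair_sum V adj e \<eta> = (\<Sum>x\<in>V. \<Sum>y\<in>V. if adj x y then e (\<eta> x) (\<eta> y) else 0)"

definition sq_dist :: "'a::real_normed_vector \<Rightarrow> 'a \<Rightarrow> real" where
  "sq_dist a b = (norm (a - b))\<^sup>2"

lemma sq_dist_commute: "sq_dist a b = sq_dist b a"
  by (simp add: sq_dist_def norm_minus_commute)

text \<open>\<open>pair_sum\<close> runs over ordered pairs, so every edge counts twice and each
  edge carries the coupling exp (- \<beta> / 2 |.|^2) that \<open>gaussian_midpoint\<close>
  factorizes. The shift \<open>h\<close> plays the part of an external field.\<close>

definition shifted_partition ::
  "'a::euclidean_space measure \<Rightarrow> real \<Rightarrow> 'v set \<Rightarrow> ('v \<Rightarrow> 'v \<Rightarrow> bool) \<Rightarrow> ('v \<Rightarrow> 'a) \<Rightarrow> ennreal" where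
  "shifted_partition \<rho> \<beta> V adj h =
     (\<integral>\<^sup>+\<theta>. ennreal (exp (- \<beta> / 4 * pair_sum V adj sq_dist (\<lambda>x. \<theta> x + h x))) \<partial>PiM V (\<lambda>_. \<rho>))"

locale graph_reflection =
  fixes V L :: "'v set" and adj :: "'v \<Rightarrow> 'v \<Rightarrow> bool" and \<sigma> :: "'v \<Rightarrow> 'v"
  assumes finite_V: "finite V"
    and adj_sym: "adj x y \<Longrightarrow> adj y x"
    and L_subset: "L \<subseteq> V"
    and \<sigma>_V: "x \<in> V \<Longrightarrow> \<sigma> x \<in> V"
    and \<sigma>_\<sigma>: "x \<in> V \<Longrightarrow> \<sigma> (\<sigma> x) = x"
    and adj_\<sigma>: "x \<in> V \<Longrightarrow> y \<in> V \<Longrightarrow> adj x y \<Longrightarrow> adj (\<sigma> x) (\<sigma> y)"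
    and disj: "x \<in> L \<Longrightarrow> \<sigma> x \<notin> L"
    and fixed: "x \<in> V \<Longrightarrow> x \<notin> L \<Longrightarrow> \<sigma> x \<notin> L \<Longrightarrow> \<sigma> x = x"
    and crossing: "x \<in> L \<Longrightarrow> y \<in> L \<Longrightarrow> adj x (\<sigma> y) \<Longrightarrow> y = x"
begin

definition "R = \<sigma> ` L"
definition "F = V - L - R"
definition "C = {x\<in>L. adj x (\<sigma> x)}"

lemma finite_sets [simp]: "finite L" "finite R" "finite F" "finite C" "finite V"
  using finite_V finite_subset[OF L_subset finite_V] by (auto simp: R_def F_def C_def)

lemma in_V: "x \<in> L \<Longrightarrow> x \<in> V" "x \<in> R \<Longrightarrow> x \<in> V" "x \<in> F \<Longrightarrow> x \<in> V" "x \<in> C \<Longrightarrow> x \<in> V"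
  using L_subset \<sigma>_V by (auto simp: R_def F_def C_def)

lemma \<sigma>_F: "x \<in> F \<Longrightarrow> \<sigma> x = x"
  by (rule fixed) (auto simp: F_def R_def image_iff, metis \<sigma>_\<sigma>)

lemma adj_\<sigma>_iff: "x \<in> V \<Longrightarrow> y \<in> V \<Longrightarrow> adj (\<sigma> x) (\<sigma> y) \<longleftrightarrow> adj x y"
  using adj_\<sigma> \<sigma>_\<sigma> \<sigma>_V by metis

lemma V_eq: "V = F \<union> (L \<union> R)" and disjoint: "F \<inter> (L \<union> R) = {}" "L \<inter> R = {}"
  using in_V disj by (auto simp: F_def R_def)

lemma inj_\<sigma>: "inj_on \<sigma> L"
  using in_V \<sigma>_\<sigma> by (intro inj_onI) metis

lemma sum_V: "(\<Sum>x\<in>V. f x) = (\<Sum>x\<in>F. f x) + (\<Sum>x\<in>L. f x) + (\<Sum>x\<in>L. f (\<sigma> x))" for f :: "'v \<Rightarrow> real"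
proof -
  have "(\<Sum>x\<in>V. f x) = (\<Sum>x\<in>F. f x) + ((\<Sum>x\<in>L. f x) + (\<Sum>x\<in>R. f x))"
    using disjoint by (subst arg_cong[OF V_eq, of "sum f"]) (simp add: sum.union_disjoint)
  also have "(\<Sum>x\<in>R. f x) = (\<Sum>x\<in>L. f (\<sigma> x))"
    unfolding R_def using inj_\<sigma> by (simp add: sum.reindex)
  finally show ?thesis by simp
qed

text \<open>The share of the left half: edges between \<open>L\<close> and \<open>F\<close> occur in
  both orders, whence the factor 2, and edges inside \<open>F\<close> are split evenly between the
  halves.\<close>

definition half_sum :: "('a \<Rightarrow> 'a \<Rightarrow> real) \<Rightarrow> ('v \<Rightarrow> 'a) \<Rightarrow> real" where
  "half_sum e \<eta> = (\<Sum>x\<in>L. \<Sum>y\<in>L. if adj x y then e (\<eta> x) (\<eta> y) else 0)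
     + 2 * (\<Sum>x\<in>L. \<Sum>y\<in>F. if adj x y then e (\<eta> x) (\<eta> y) else 0)
     + (\<Sum>x\<in>F. \<Sum>y\<in>F. if adj x y then e (\<eta> x) (\<eta> y) else 0) / 2"

lemma half_sum_cong: "(\<And>x. x \<in> L \<union> F \<Longrightarrow> \<eta> x = \<eta>' x) \<Longrightarrow> half_sum e \<eta> = half_sum e \<eta>'"
  unfolding half_sum_def by (auto intro!: arg_cong2[where f = "(+)"] sum.cong)

text \<open>Once the values on \<open>F\<close> are fixed, only the crossing edges over
  \<open>C\<close> couple the two halves.\<close>

lemma pair_sum_decomp:
  assumes e: "\<And>a b. e a b = e b a"
  shows "pair_sum V adj e \<eta> = half_sum e \<eta> + half_sum e (\<eta> \<circ> \<sigma>) + 2 * (\<Sum>x\<in>C. e (\<eta> x) (\<eta> (\<sigma> x)))"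
proof -
  define \<phi> where "\<phi> x y = (if adj x y then e (\<eta> x) (\<eta> y) else 0)" for x y
  have sym: "\<phi> x y = \<phi> y x" for x y
    using e adj_sym by (auto simp: \<phi>_def)
  have sw: "(\<Sum>x\<in>A. \<Sum>y\<in>B. \<phi> (f x) (g y)) = (\<Sum>x\<in>B. \<Sum>y\<in>A. \<phi> (g x) (f y))" for A B and f g :: "'v \<Rightarrow> 'v"
    by (subst sum.swap) (simp add: sym[of "f _"])
  have LR: "(\<Sum>x\<in>L. \<Sum>y\<in>L. \<phi> x (\<sigma> y)) = (\<Sum>x\<in>C. e (\<eta> x) (\<eta> (\<sigma> x)))"
  proof -
    have "(\<Sum>y\<in>L. \<phi> x (\<sigma> y)) = (if adj x (\<sigma> x) then e (\<eta> x) (\<eta> (\<sigma> x)) else 0)" if x: "x \<in> L" for x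
    proof -
      have "(\<Sum>y\<in>L. \<phi> x (\<sigma> y)) = (\<Sum>y\<in>L. if y = x then \<phi> x (\<sigma> x) else 0)"
        using crossing[OF x] by (intro sum.cong) (auto simp: \<phi>_def)
      then show ?thesis using x by (simp add: \<phi>_def)
    qed
    then have "(\<Sum>x\<in>L. \<Sum>y\<in>L. \<phi> x (\<sigma> y)) = (\<Sum>x\<in>L. if adj x (\<sigma> x) then e (\<eta> x) (\<eta> (\<sigma> x)) else 0)"
      by (rule sum.cong[OF refl])
    also have "\<dots> = (\<Sum>x\<in>C. e (\<eta> x) (\<eta> (\<sigma> x)))"
      unfolding C_def by (rule sum.inter_filter[symmetric]) simp
    finally show ?thesis .
  qed
  have RR: "(\<Sum>x\<in>L. \<Sum>y\<in>L. \<phi> (\<sigma> x) (\<sigma> y)) = (\<Sum>x\<in>L. \<Sum>y\<in>L. if adj x y then e ((\<eta> \<circ> \<sigma>) x) ((\<eta> \<circ> \<sigma>) y) else 0)"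
    by (intro sum.cong refl) (simp add: \<phi>_def adj_\<sigma>_iff in_V)
  have RF: "(\<Sum>x\<in>L. \<Sum>y\<in>F. \<phi> (\<sigma> x) y) = (\<Sum>x\<in>L. \<Sum>y\<in>F. if adj x y then e ((\<eta> \<circ> \<sigma>) x) ((\<eta> \<circ> \<sigma>) y) else 0)"
  proof (intro sum.cong refl)
    fix x y assume "x \<in> L" "y \<in> F"
    then have "adj (\<sigma> x) y \<longleftrightarrow> adj x y" using adj_\<sigma>_iff[of x y] in_V \<sigma>_F by auto
    then show "\<phi> (\<sigma> x) y = (if adj x y then e ((\<eta> \<circ> \<sigma>) x) ((\<eta> \<circ> \<sigma>) y) else 0)"
      using \<sigma>_F[OF \<open>y \<in> F\<close>] by (simp add: \<phi>_def)
  qed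
  have FF: "(\<Sum>x\<in>F. \<Sum>y\<in>F. \<phi> x y) = (\<Sum>x\<in>F. \<Sum>y\<in>F. if adj x y then e ((\<eta> \<circ> \<sigma>) x) ((\<eta> \<circ> \<sigma>) y) else 0)"
    by (intro sum.cong refl) (simp add: \<phi>_def \<sigma>_F)
  have "pair_sum V adj e \<eta> = (\<Sum>x\<in>V. \<Sum>y\<in>V. \<phi> x y)"
    by (simp add: pair_sum_def \<phi>_def)
  also have "\<dots> = (\<Sum>x\<in>F. \<Sum>y\<in>F. \<phi> x y) + (\<Sum>x\<in>F. \<Sum>y\<in>L. \<phi> x y) + (\<Sum>x\<in>F. \<Sum>y\<in>L. \<phi> x (\<sigma> y))
      + ((\<Sum>x\<in>L. \<Sum>y\<in>F. \<phi> x y) + (\<Sum>x\<in>L. \<Sum>y\<in>L. \<phi> x y) + (\<Sum>x\<in>L. \<Sum>y\<in>L. \<phi> x (\<sigma> y)))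
      + ((\<Sum>x\<in>L. \<Sum>y\<in>F. \<phi> (\<sigma> x) y) + (\<Sum>x\<in>L. \<Sum>y\<in>L. \<phi> (\<sigma> x) y) + (\<Sum>x\<in>L. \<Sum>y\<in>L. \<phi> (\<sigma> x) (\<sigma> y)))"
    by (simp only: sum_V sum.distrib)
  also have "(\<Sum>x\<in>F. \<Sum>y\<in>L. \<phi> x y) = (\<Sum>x\<in>L. \<Sum>y\<in>F. \<phi> x y)"
    using sw[of "\<lambda>x. x" "\<lambda>x. x"] by simp
  also have "(\<Sum>x\<in>F. \<Sum>y\<in>L. \<phi> x (\<sigma> y)) = (\<Sum>x\<in>L. \<Sum>y\<in>F. \<phi> (\<sigma> x) y)"
    using sw[of "\<lambda>x. x" \<sigma>] by simp
  also have "(\<Sum>x\<in>L. \<Sum>y\<in>L. \<phi> (\<sigma> x) y) = (\<Sum>x\<in>L. \<Sum>y\<in>L. \<phi> x (\<sigma> y))"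
    using sw[of "\<lambda>x. x" \<sigma>] by simp
  finally have "pair_sum V adj e \<eta> = (\<Sum>x\<in>F. \<Sum>y\<in>F. \<phi> x y) + 2 * (\<Sum>x\<in>L. \<Sum>y\<in>F. \<phi> x y)
      + 2 * (\<Sum>x\<in>L. \<Sum>y\<in>F. \<phi> (\<sigma> x) y) + (\<Sum>x\<in>L. \<Sum>y\<in>L. \<phi> x y) + 2 * (\<Sum>x\<in>L. \<Sum>y\<in>L. \<phi> x (\<sigma> y))
      + (\<Sum>x\<in>L. \<Sum>y\<in>L. \<phi> (\<sigma> x) (\<sigma> y))" by linarith
  moreover have "half_sum e \<eta> = (\<Sum>x\<in>L. \<Sum>y\<in>L. \<phi> x y) + 2 * (\<Sum>x\<in>L. \<Sum>y\<in>F. \<phi> x y) + (\<Sum>x\<in>F. \<Sum>y\<in>F. \<phi> x y) / 2"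
    by (simp add: half_sum_def \<phi>_def)
  moreover have "half_sum e (\<eta> \<circ> \<sigma>) = (\<Sum>x\<in>L. \<Sum>y\<in>L. \<phi> (\<sigma> x) (\<sigma> y)) + 2 * (\<Sum>x\<in>L. \<Sum>y\<in>F. \<phi> (\<sigma> x) y)
      + (\<Sum>x\<in>F. \<Sum>y\<in>F. \<phi> x y) / 2"
    unfolding half_sum_def RR RF FF by simp
  ultimately show ?thesis using LR by linarith
qed

lemma half_sum_measurable:
  assumes e: "(\<lambda>(a, b). e a b) \<in> borel_measurable (borel \<Otimes>\<^sub>M borel)"
    and f: "\<And>x. x \<in> L \<union> F \<Longrightarrow> (\<lambda>\<omega>. f \<omega> x) \<in> borel_measurable M"
  shows "(\<lambda>\<omega>. half_sum e (f \<omega>)) \<in> borel_measurable M"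
proof -
  have "(\<lambda>\<omega>. if adj x y then e (f \<omega> x) (f \<omega> y) else 0) \<in> borel_measurable M"
    if "x \<in> L \<union> F" "y \<in> L \<union> F" for x y
    using measurable_compose[OF measurable_Pair[OF f f] e] that by simp
  then show ?thesis unfolding half_sum_def
    by (intro borel_measurable_add borel_measurable_times borel_measurable_divide borel_measurable_sum) auto
qed

definition "reflL h = (\<lambda>x. if x \<in> R then h (\<sigma> x) else h x)"
definition "reflR h = (\<lambda>x. if x \<in> L then h (\<sigma> x) else h x)"

lemma reflL_eq: "x \<in> L \<union> F \<Longrightarrow> reflL h x = h x" "x \<in> L \<union> F \<Longrightarrow> reflL h (\<sigma> x) = h x"
  and reflR_eq: "x \<in> L \<union> F \<Longrightarrow> reflR h x = h (\<sigma> x)" "x \<in> L \<union> F \<Longrightarrow> reflR h (\<sigma> x) = h (\<sigma> x)"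
  using disjoint in_V(1,3) \<sigma>_\<sigma> \<sigma>_F disj
  by (auto simp: reflL_def reflR_def R_def) (metis \<sigma>_\<sigma> in_V(1))+

text \<open>Each reflected function repeats one half twice and is constant along every crossing
  edge, so exactly the crossing contributions are lost. With \<open>e\<close> counting unequal
  values, this loss is what drives a minimizer to be constant.\<close>

lemma pair_sum_reflL_reflR:
  assumes e: "\<And>a b. e a b = e b a" "\<And>a. e a a = 0"
  shows "pair_sum V adj e (reflL h) + pair_sum V adj e (reflR h)
    = 2 * pair_sum V adj e h - 4 * (\<Sum>x\<in>C. e (h x) (h (\<sigma> x)))"
proof -
  have "half_sum e (reflL h) = half_sum e h" "half_sum e (reflL h \<circ> \<sigma>) = half_sum e h"
    "half_sum e (reflR h) = half_sum e (h \<circ> \<sigma>)" "half_sum e (reflR h \<circ> \<sigma>) = half_sum e (h \<circ> \<sigma>)"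
    by (rule half_sum_cong; simp add: reflL_eq reflR_eq)+
  moreover have "(\<Sum>x\<in>C. e (reflL h x) (reflL h (\<sigma> x))) = 0" "(\<Sum>x\<in>C. e (reflR h x) (reflR h (\<sigma> x))) = 0"
    by (rule sum.neutral; auto simp: C_def reflL_eq reflR_eq e(2))+
  ultimately show ?thesis by (simp add: pair_sum_decomp[OF e(1)])
qed

end

text \<open>The right half is parametrized by the left one through \<open>\<sigma>\<close>, so that
  both halves are integrated against the same product measure over \<open>L\<close>.\<close>

lemma (in graph_reflection) nn_integral_PiM_split:
  fixes \<rho> :: "'a measure"
  assumes \<rho>: "prob_space \<rho>" and f [measurable]: "f \<in> borel_measurable (PiM V (\<lambda>_. \<rho>))"
  shows "(\<integral>\<^sup>+\<theta>. f \<theta> \<partial>PiM V (\<lambda>_. \<rho>)) =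
    (\<integral>\<^sup>+w. \<integral>\<^sup>+u. \<integral>\<^sup>+v. f (merge F (L \<union> R) (w, merge L R (u, \<lambda>x\<in>R. v (\<sigma> x))))
       \<partial>PiM L (\<lambda>_. \<rho>) \<partial>PiM L (\<lambda>_. \<rho>) \<partial>PiM F (\<lambda>_. \<rho>))"
proof -
  interpret \<rho>: prob_space \<rho> by (rule \<rho>)
  interpret product_sigma_finite "\<lambda>_::'v. \<rho>" by standard
  have re: "distr (PiM L (\<lambda>_. \<rho>)) (PiM R (\<lambda>_. \<rho>)) (\<lambda>\<omega>. \<lambda>x\<in>R. \<omega> (\<sigma> x)) = PiM R (\<lambda>_. \<rho>)"
    using in_V \<sigma>_\<sigma> \<rho> by (intro distr_PiM_reindex) (auto simp: R_def inj_on_def)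
  have [measurable]: "(\<lambda>\<omega>. \<lambda>x\<in>R. \<omega> (\<sigma> x)) \<in> measurable (PiM L (\<lambda>_. \<rho>)) (PiM R (\<lambda>_. \<rho>))"
    using in_V \<sigma>_\<sigma> by (intro measurable_restrict measurable_component_singleton) (auto simp: R_def)
  have fV: "f \<in> borel_measurable (PiM (F \<union> (L \<union> R)) (\<lambda>_. \<rho>))"
    using f by (simp add: V_eq[symmetric])
  have "(\<integral>\<^sup>+\<theta>. f \<theta> \<partial>PiM V (\<lambda>_. \<rho>)) = (\<integral>\<^sup>+\<theta>. f \<theta> \<partial>PiM (F \<union> (L \<union> R)) (\<lambda>_. \<rho>))"
    by (simp add: V_eq[symmetric])
  also have "\<dots> = (\<integral>\<^sup>+w. \<integral>\<^sup>+z. f (merge F (L \<union> R) (w, z)) \<partial>PiM (L \<union> R) (\<lambda>_. \<rho>) \<partial>PiM F (\<lambda>_. \<rho>))"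
    using disjoint fV by (intro product_nn_integral_fold) auto
  also have "\<dots> = (\<integral>\<^sup>+w. \<integral>\<^sup>+u. \<integral>\<^sup>+v. f (merge F (L \<union> R) (w, merge L R (u, \<lambda>x\<in>R. v (\<sigma> x))))
       \<partial>PiM L (\<lambda>_. \<rho>) \<partial>PiM L (\<lambda>_. \<rho>) \<partial>PiM F (\<lambda>_. \<rho>))"
  proof (intro nn_integral_cong)
    fix w assume w: "w \<in> space (PiM F (\<lambda>_. \<rho>))"
    have fw [measurable]: "(\<lambda>z. f (merge F (L \<union> R) (w, z))) \<in> borel_measurable (PiM (L \<union> R) (\<lambda>_. \<rho>))"
      using measurable_compose[OF measurable_Pair1'[OF w] measurable_compose[OF measurable_merge fV]] by simp
    have "(\<integral>\<^sup>+z. f (merge F (L \<union> R) (w, z)) \<partial>PiM (L \<union> R) (\<lambda>_. \<rho>))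
        = (\<integral>\<^sup>+u. \<integral>\<^sup>+v. f (merge F (L \<union> R) (w, merge L R (u, v))) \<partial>PiM R (\<lambda>_. \<rho>) \<partial>PiM L (\<lambda>_. \<rho>))"
      using disjoint by (intro product_nn_integral_fold fw) auto
    also have "\<dots> = (\<integral>\<^sup>+u. \<integral>\<^sup>+v. f (merge F (L \<union> R) (w, merge L R (u, \<lambda>x\<in>R. v (\<sigma> x))))
        \<partial>PiM L (\<lambda>_. \<rho>) \<partial>PiM L (\<lambda>_. \<rho>))"
    proof (intro nn_integral_cong)
      fix u assume u: "u \<in> space (PiM L (\<lambda>_. \<rho>))"
      have "(\<lambda>v. f (merge F (L \<union> R) (w, merge L R (u, v)))) \<in> borel_measurable (PiM R (\<lambda>_. \<rho>))"
        using measurable_compose[OF measurable_Pair1'[OF u] measurable_compose[OF measurable_merge fw]] by simp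
      then show "(\<integral>\<^sup>+v. f (merge F (L \<union> R) (w, merge L R (u, v))) \<partial>PiM R (\<lambda>_. \<rho>))
        = (\<integral>\<^sup>+v. f (merge F (L \<union> R) (w, merge L R (u, \<lambda>x\<in>R. v (\<sigma> x)))) \<partial>PiM L (\<lambda>_. \<rho>))"
        by (subst re[symmetric]) (simp add: nn_integral_distr)
    qed
    finally show "(\<integral>\<^sup>+z. f (merge F (L \<union> R) (w, z)) \<partial>PiM (L \<union> R) (\<lambda>_. \<rho>)) = \<dots>" .
  qed
  finally show ?thesis .
qed

lemma pair_sum_measurable:
  assumes e: "(\<lambda>(a, b). e a b) \<in> borel_measurable (borel \<Otimes>\<^sub>M borel)"
    and f: "\<And>x. x \<in> V \<Longrightarrow> (\<lambda>\<omega>. f \<omega> x) \<in> borel_measurable M"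
  shows "(\<lambda>\<omega>. pair_sum V adj e (f \<omega>)) \<in> borel_measurable M"
proof -
  have "(\<lambda>\<omega>. if adj x y then e (f \<omega> x) (f \<omega> y) else 0) \<in> borel_measurable M"
    if "x \<in> V" "y \<in> V" for x y
    using measurable_compose[OF measurable_Pair[OF f f] e] that by simp
  then show ?thesis unfolding pair_sum_def
    by (intro borel_measurable_sum) auto
qed

lemma sq_dist_measurable [measurable]:
  "(\<lambda>(a, b). sq_dist a b :: real) \<in> borel_measurable (borel \<Otimes>\<^sub>M (borel :: 'a::euclidean_space measure))"
  unfolding sq_dist_def by measurable

section \<open>The partition function as an inner product of two halves\<close>

context graph_reflection
begin

definition half_weight :: "real \<Rightarrow> ('v \<Rightarrow> 'a::euclidean_space) \<Rightarrow> ('v \<Rightarrow> 'a) \<Rightarrow> ('v \<Rightarrow> 'a) \<Rightarrow> ennreal" where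
  "half_weight \<beta> h w u = ennreal (exp (- \<beta> / 4 * half_sum sq_dist (\<lambda>x. (if x \<in> F then w x else u x) + h x)))"

text \<open>One of the two factors of \<open>gaussian_midpoint\<close>, taken over all crossing
  edges; \<open>y\<close> holds one auxiliary point for each of them.\<close>

definition cross_weight :: "real \<Rightarrow> ('v \<Rightarrow> 'a::euclidean_space) \<Rightarrow> ('v \<Rightarrow> 'a) \<Rightarrow> ('v \<Rightarrow> 'a) \<Rightarrow> ennreal" where
  "cross_weight \<beta> h u y = (\<Prod>x\<in>C. ennreal (exp (- \<beta> * (norm (u x + h x - y x))\<^sup>2)))"

text \<open>The partition function of one half, given the spins on the mirror (first component) and
  the auxiliary points of the crossing edges (second component).\<close>

definition half_partition ::
  "'a::euclidean_space measure \<Rightarrow> real \<Rightarrow> ('v \<Rightarrow> 'a) \<Rightarrow> ('v \<Rightarrow> 'a) \<times> ('v \<Rightarrow> 'a) \<Rightarrow> ennreal" where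
  "half_partition \<rho> \<beta> h p = (\<integral>\<^sup>+u. half_weight \<beta> h (fst p) u * cross_weight \<beta> h u (snd p) \<partial>PiM L (\<lambda>_. \<rho>))"

lemma half_partition_cong:
  assumes "\<And>x. x \<in> L \<union> F \<Longrightarrow> h x = h' x"
  shows "half_partition \<rho> \<beta> h = half_partition \<rho> \<beta> h'"
proof -
  have "half_weight \<beta> h w u = half_weight \<beta> h' w u" for w u
    using assms unfolding half_weight_def by (subst half_sum_cong) auto
  moreover have "cross_weight \<beta> h u y = cross_weight \<beta> h' u y" for u y
    using assms unfolding cross_weight_def by (intro prod.cong) (auto simp: C_def)
  ultimately show ?thesis by (auto simp: half_partition_def fun_eq_iff)
qed

lemma half_weight_measurable:
  assumes "\<And>x. x \<in> F \<Longrightarrow> (\<lambda>\<omega>. f \<omega> x) \<in> borel_measurable M" "\<And>x. x \<in> L \<Longrightarrow> (\<lambda>\<omega>. g \<omega> x) \<in> borel_measurable M"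
  shows "(\<lambda>\<omega>. half_weight \<beta> h (f \<omega>) (g \<omega>)) \<in> borel_measurable M"
proof -
  have "(\<lambda>\<omega>. half_sum sq_dist (\<lambda>x. (if x \<in> F then f \<omega> x else g \<omega> x) + h x)) \<in> borel_measurable M"
  proof (rule half_sum_measurable[OF sq_dist_measurable])
    fix x assume "x \<in> L \<union> F"
    then show "(\<lambda>\<omega>. (if x \<in> F then f \<omega> x else g \<omega> x) + h x) \<in> borel_measurable M"
      using assms by (cases "x \<in> F") auto
  qed
  then show ?thesis unfolding half_weight_def by measurable
qed

lemma cross_weight_measurable:
  assumes "\<And>x. x \<in> C \<Longrightarrow> (\<lambda>\<omega>. f \<omega> x) \<in> borel_measurable M" "\<And>x. x \<in> C \<Longrightarrow> (\<lambda>\<omega>. g \<omega> x) \<in> borel_measurable M"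
  shows "(\<lambda>\<omega>. cross_weight \<beta> h (f \<omega>) (g \<omega>)) \<in> borel_measurable M"
proof -
  have "(\<lambda>\<omega>. ennreal (exp (- \<beta> * (norm (f \<omega> x + h x - g \<omega> x))\<^sup>2))) \<in> borel_measurable M" if "x \<in> C" for x
    using assms[OF that] by measurable
  then show ?thesis unfolding cross_weight_def by measurable
qed

lemma cross_weight_integral:
  fixes h h' :: "'v \<Rightarrow> 'a::euclidean_space"
  assumes "\<beta> > 0"
  shows "(\<integral>\<^sup>+y. cross_weight \<beta> h u y * cross_weight \<beta> h' v y \<partial>PiM C (\<lambda>_. lborel))
    = ennreal (sqrt (pi / (2 * \<beta>)) ^ DIM('a)) ^ card C * (\<Prod>x\<in>C. ennreal (exp (- \<beta> / 2 * (norm (u x + h x - (v x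
        + h' x)))\<^sup>2)))"
proof -
  interpret product_sigma_finite "\<lambda>_::'v. lborel :: 'a measure" by standard
  have "(\<integral>\<^sup>+y. cross_weight \<beta> h u y * cross_weight \<beta> h' v y \<partial>PiM C (\<lambda>_. lborel))
    = (\<integral>\<^sup>+y. (\<Prod>x\<in>C. ennreal (exp (- \<beta> * (norm (u x + h x - y x))\<^sup>2)) * ennreal (exp (- \<beta> * (norm (v x
        + h' x - y x))\<^sup>2))) \<partial>PiM C (\<lambda>_. lborel))"
    by (simp add: cross_weight_def prod.distrib)
  also have "\<dots> = (\<Prod>x\<in>C. \<integral>\<^sup>+z. ennreal (exp (- \<beta> * (norm (u x + h x - z))\<^sup>2)) * ennreal (exp (- \<beta> * (norm (v x
      + h' x - z))\<^sup>2)) \<partial>lborel)"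
    by (rule product_nn_integral_prod) auto
  also have "\<dots> = (\<Prod>x\<in>C. ennreal (sqrt (pi / (2 * \<beta>)) ^ DIM('a)) * ennreal (exp (- \<beta> / 2 * (norm (u x + h x - (v x
      + h' x)))\<^sup>2)))"
    by (simp only: gaussian_midpoint[OF assms])
  finally show ?thesis by (simp add: prod.distrib)
qed

text \<open>Given the mirror spins and the auxiliary points, the halves are independent. Reading the
  right half through \<open>\<sigma>\<close> turns its factor into the left factor for
  \<open>h \<circ> \<sigma>\<close>, so the partition function is an inner product in L2 of these
  data, up to the Gaussian normalization of each crossing edge.\<close>

lemma
  fixes h :: "'v \<Rightarrow> 'a::euclidean_space"
  assumes \<rho>: "prob_space \<rho>" and sets [measurable_cong]: "sets \<rho> = sets borel" and \<beta>: "\<beta> > 0"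
  shows shifted_partition_factor: "ennreal (sqrt (pi / (2 * \<beta>)) ^ DIM('a)) ^ card C * shifted_partition \<rho> \<beta> V adj h =
    (\<integral>\<^sup>+p. half_partition \<rho> \<beta> h p * half_partition \<rho> \<beta> (h \<circ> \<sigma>) p \<partial>(PiM F (\<lambda>_. \<rho>) \<Otimes>\<^sub>M PiM C (\<lambda>_. lborel)))"
    and half_partition_measurable:
      "half_partition \<rho> \<beta> h \<in> borel_measurable (PiM F (\<lambda>_. \<rho>) \<Otimes>\<^sub>M PiM C (\<lambda>_. lborel))"
proof -
  interpret \<rho>: prob_space \<rho> by (rule \<rho>)
  interpret product_sigma_finite "\<lambda>_::'v. \<rho>" by standard
  interpret B: product_sigma_finite "\<lambda>_::'v. lborel :: 'a measure" by standard
  interpret PL: finite_product_sigma_finite "\<lambda>_::'v. \<rho>" L by standard simp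
  interpret PF: finite_product_sigma_finite "\<lambda>_::'v. \<rho>" F by standard simp
  interpret PC: finite_product_sigma_finite "\<lambda>_::'v. lborel :: 'a measure" C by standard simp
  interpret LC: pair_sigma_finite "PiM L (\<lambda>_. \<rho>)" "PiM C (\<lambda>_. lborel :: 'a measure)" ..
  let ?PL = "PiM L (\<lambda>_. \<rho>)" and ?PF = "PiM F (\<lambda>_. \<rho>)" and ?PC = "PiM C (\<lambda>_. lborel :: 'a measure)"
  have comp: "(\<lambda>\<omega>. \<omega> x) \<in> borel_measurable (PiM A (\<lambda>_. \<rho>))" if "x \<in> A" for A and x :: 'v
    using measurable_component_singleton[OF that, of "\<lambda>_. \<rho>"] sets by (simp cong: measurable_cong_sets)
  have compl: "(\<lambda>\<omega>. \<omega> x) \<in> borel_measurable ?PC" if "x \<in> C" for x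
    using measurable_component_singleton[OF that, of "\<lambda>_. lborel"] by simp
  let ?G = "\<lambda>h w u y. half_weight \<beta> h w u * cross_weight \<beta> h u y"
  have hw: "half_weight \<beta> k w \<in> borel_measurable ?PL" for k w
    by (rule half_weight_measurable) (auto intro: comp)
  have cw: "(\<lambda>(u, y). cross_weight \<beta> k u y) \<in> borel_measurable (?PL \<Otimes>\<^sub>M ?PC)" for k
    unfolding split_beta
    by (rule cross_weight_measurable)
       (auto simp: C_def intro!: measurable_compose[OF measurable_fst comp] measurable_compose[OF measurable_snd compl])
  have G [measurable]: "(\<lambda>(u, y). ?G k w u y) \<in> borel_measurable (?PL \<Otimes>\<^sub>M ?PC)" for k w
    unfolding split_beta
    by (intro borel_measurable_times_ennreal measurable_compose[OF measurable_fst hw] cw[unfolded split_beta])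
  have half: "half_partition \<rho> \<beta> k \<in> borel_measurable (?PF \<Otimes>\<^sub>M ?PC)" for k
  proof -
    have "(\<lambda>(p, u). ?G k (fst p) u (snd p)) \<in> borel_measurable ((?PF \<Otimes>\<^sub>M ?PC) \<Otimes>\<^sub>M ?PL)"
      unfolding split_beta
      by (intro borel_measurable_times_ennreal half_weight_measurable cross_weight_measurable)
         (auto simp: C_def intro!: measurable_compose[OF measurable_snd comp]
            measurable_compose[OF measurable_fst measurable_compose[OF measurable_fst comp]]
            measurable_compose[OF measurable_fst measurable_compose[OF measurable_snd compl]])
    from PL.borel_measurable_nn_integral[OF this] show ?thesis
      unfolding half_partition_def by simp
  qed
  show "half_partition \<rho> \<beta> h \<in> borel_measurable (?PF \<Otimes>\<^sub>M ?PC)" by (rule half)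
  let ?c = "ennreal (sqrt (pi / (2 * \<beta>)) ^ DIM('a)) ^ card C"
  let ?f = "\<lambda>\<theta>. ennreal (exp (- \<beta> / 4 * pair_sum V adj sq_dist (\<lambda>x. \<theta> x + h x)))"
  have f: "?f \<in> borel_measurable (PiM V (\<lambda>_. \<rho>))"
  proof -
    have "(\<lambda>\<theta>. pair_sum V adj sq_dist (\<lambda>x. \<theta> x + h x)) \<in> borel_measurable (PiM V (\<lambda>_. \<rho>))"
      by (intro pair_sum_measurable sq_dist_measurable borel_measurable_add comp) auto
    then show ?thesis by measurable
  qed
  have weight: "?c * ?f (merge F (L \<union> R) (w, merge L R (u, \<lambda>x\<in>R. v (\<sigma> x))))
      = (\<integral>\<^sup>+y. ?G h w u y * ?G (h \<circ> \<sigma>) w v y \<partial>?PC)"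
    if "u \<in> space ?PL" "v \<in> space ?PL" for w u v
  proof -
    define \<theta> where "\<theta> = merge F (L \<union> R) (w, merge L R (u, \<lambda>x\<in>R. v (\<sigma> x)))"
    define \<eta> where "\<eta> = (\<lambda>x. \<theta> x + h x)"
    have th: "x \<in> F \<Longrightarrow> \<theta> x = w x" "x \<in> L \<Longrightarrow> \<theta> x = u x" "x \<in> L \<Longrightarrow> \<theta> (\<sigma> x) = v x"
       "x \<in> F \<Longrightarrow> \<theta> (\<sigma> x) = w x" for x
      using disjoint in_V disj \<sigma>_\<sigma> \<sigma>_F by (auto simp: \<theta>_def merge_def R_def)
    have LF: "x \<in> L \<Longrightarrow> x \<notin> F" for x by (auto simp: F_def)
    have T1: "half_sum sq_dist \<eta> = half_sum sq_dist (\<lambda>x. (if x \<in> F then w x else u x) + h x)"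
      by (rule half_sum_cong) (auto simp: \<eta>_def th LF)
    have T2: "half_sum sq_dist (\<eta> \<circ> \<sigma>) = half_sum sq_dist (\<lambda>x. (if x \<in> F then w x else v x) + (h \<circ> \<sigma>) x)"
      by (rule half_sum_cong) (auto simp: \<eta>_def th LF)
    have T3: "(\<Sum>x\<in>C. sq_dist (\<eta> x) (\<eta> (\<sigma> x))) = (\<Sum>x\<in>C. (norm (u x + h x - (v x + (h \<circ> \<sigma>) x)))\<^sup>2)"
      by (intro sum.cong refl) (auto simp: \<eta>_def th C_def sq_dist_def)
    have lin: "- \<beta> / 4 * (a + b + 2 * c) = - \<beta> / 4 * a + - \<beta> / 4 * b + - \<beta> / 2 * c" for a b c
      by (simp add: field_simps)
    have "- \<beta> / 4 * pair_sum V adj sq_dist \<eta> =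
      - \<beta> / 4 * half_sum sq_dist (\<lambda>x. (if x \<in> F then w x else u x) + h x)
      + - \<beta> / 4 * half_sum sq_dist (\<lambda>x. (if x \<in> F then w x else v x) + (h \<circ> \<sigma>) x)
      + (\<Sum>x\<in>C. - \<beta> / 2 * (norm (u x + h x - (v x + (h \<circ> \<sigma>) x)))\<^sup>2)"
      by (simp only: pair_sum_decomp[OF sq_dist_commute] T1 T2 T3 lin sum_distrib_left[symmetric])
    then have "?f \<theta> = half_weight \<beta> h w u * half_weight \<beta> (h \<circ> \<sigma>) w v
        * (\<Prod>x\<in>C. ennreal (exp (- \<beta> / 2 * (norm (u x + h x - (v x + (h \<circ> \<sigma>) x)))\<^sup>2)))"
      unfolding half_weight_def \<eta>_def
      by (simp only: exp_add exp_sum[OF finite_sets(4)] prod_ennreal exp_ge_zero ennreal_mult' prod_nonneg mult_nonneg_nonneg)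
    then have "?c * ?f \<theta> = half_weight \<beta> h w u * half_weight \<beta> (h \<circ> \<sigma>) w v
        * (\<integral>\<^sup>+y. cross_weight \<beta> h u y * cross_weight \<beta> (h \<circ> \<sigma>) v y \<partial>?PC)"
      by (simp only: cross_weight_integral[OF \<beta>] mult_ac)
    also have "\<dots> = (\<integral>\<^sup>+y. half_weight \<beta> h w u * half_weight \<beta> (h \<circ> \<sigma>) w v * (cross_weight \<beta> h u y
        * cross_weight \<beta> (h \<circ> \<sigma>) v y) \<partial>?PC)"
    proof (rule nn_integral_cmult[symmetric])
      have "cross_weight \<beta> k u' \<in> borel_measurable ?PC" for k u'
        by (rule cross_weight_measurable) (auto intro: compl)
      then show "(\<lambda>y. cross_weight \<beta> h u y * cross_weight \<beta> (h \<circ> \<sigma>) v y) \<in> borel_measurable ?PC"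
        by measurable
    qed
    finally show ?thesis unfolding \<theta>_def by (simp only: mult_ac)
  qed
  have "?c * shifted_partition \<rho> \<beta> V adj h = (\<integral>\<^sup>+\<theta>. ?c * ?f \<theta> \<partial>PiM V (\<lambda>_. \<rho>))"
    unfolding shifted_partition_def using f by (rule nn_integral_cmult[symmetric])
  also have "\<dots> = (\<integral>\<^sup>+w. \<integral>\<^sup>+u. \<integral>\<^sup>+v. ?c * ?f (merge F (L \<union> R) (w, merge L R (u, \<lambda>x\<in>R. v (\<sigma> x))))
       \<partial>?PL \<partial>?PL \<partial>?PF)"
    using f by (intro nn_integral_PiM_split[OF \<rho>] borel_measurable_times_ennreal borel_measurable_const)
  also have "\<dots> = (\<integral>\<^sup>+w. \<integral>\<^sup>+u. \<integral>\<^sup>+v. \<integral>\<^sup>+y. ?G h w u y * ?G (h \<circ> \<sigma>) w v y \<partial>?PC \<partial>?PL \<partial>?PL \<partial>?PF)"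
    by (intro nn_integral_cong weight)
  \<comment> \<open>Tonelli moves the auxiliary points \<open>y\<close> outside; for fixed
    \<open>w\<close> and \<open>y\<close> the integrals over \<open>u\<close> and \<open>v\<close>
    then factor.\<close>
  also have "\<dots> = (\<integral>\<^sup>+w. \<integral>\<^sup>+y. half_partition \<rho> \<beta> h (w, y) * half_partition \<rho> \<beta> (h \<circ> \<sigma>) (w, y) \<partial>?PC \<partial>?PF)"
  proof (intro nn_integral_cong)
    fix w
    have Gy: "?G k w u \<in> borel_measurable ?PC" if "u \<in> space ?PL" for k u
      using measurable_compose[OF measurable_Pair1'[OF that] G[of k w]] by simp
    have Gu: "(\<lambda>u. ?G k w u y) \<in> borel_measurable ?PL" if "y \<in> space ?PC" for k y
      using measurable_compose[OF measurable_Pair2'[OF that] G[of k w]] by simp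
    have Gint [measurable]: "(\<lambda>y. \<integral>\<^sup>+v. ?G k w v y \<partial>?PL) \<in> borel_measurable ?PC" for k
      using PL.borel_measurable_nn_integral[of "\<lambda>y v. ?G k w v y" ?PC] G[of k w]
      by (simp add: measurable_split_conv split_beta measurable_pair_swap_iff[of _ ?PC])
    have "(\<integral>\<^sup>+u. \<integral>\<^sup>+v. \<integral>\<^sup>+y. ?G h w u y * ?G (h \<circ> \<sigma>) w v y \<partial>?PC \<partial>?PL \<partial>?PL)
        = (\<integral>\<^sup>+u. \<integral>\<^sup>+y. ?G h w u y * (\<integral>\<^sup>+v. ?G (h \<circ> \<sigma>) w v y \<partial>?PL) \<partial>?PC \<partial>?PL)"
    proof (intro nn_integral_cong)
      fix u assume u: "u \<in> space ?PL"
      have "(\<integral>\<^sup>+v. \<integral>\<^sup>+y. ?G h w u y * ?G (h \<circ> \<sigma>) w v y \<partial>?PC \<partial>?PL)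
          = (\<integral>\<^sup>+y. \<integral>\<^sup>+v. ?G h w u y * ?G (h \<circ> \<sigma>) w v y \<partial>?PL \<partial>?PC)"
        using borel_measurable_times_ennreal[OF measurable_compose[OF measurable_snd Gy[OF u, of h]]
            G[of "h \<circ> \<sigma>" w, unfolded split_beta]]
        by (intro LC.Fubini'[symmetric]) (simp add: split_beta)
      also have "\<dots> = (\<integral>\<^sup>+y. ?G h w u y * (\<integral>\<^sup>+v. ?G (h \<circ> \<sigma>) w v y \<partial>?PL) \<partial>?PC)"
        using Gu by (intro nn_integral_cong nn_integral_cmult)
      finally show "(\<integral>\<^sup>+v. \<integral>\<^sup>+y. ?G h w u y * ?G (h \<circ> \<sigma>) w v y \<partial>?PC \<partial>?PL) = \<dots>" .
    qed
    also have "\<dots> = (\<integral>\<^sup>+y. \<integral>\<^sup>+u. ?G h w u y * (\<integral>\<^sup>+v. ?G (h \<circ> \<sigma>) w v y \<partial>?PL) \<partial>?PL \<partial>?PC)"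
      using borel_measurable_times_ennreal[OF G[of h w, unfolded split_beta]
          measurable_compose[OF measurable_snd Gint[of "h \<circ> \<sigma>"]]]
      by (intro LC.Fubini'[symmetric]) (simp add: split_beta)
    also have "\<dots> = (\<integral>\<^sup>+y. (\<integral>\<^sup>+u. ?G h w u y \<partial>?PL) * (\<integral>\<^sup>+v. ?G (h \<circ> \<sigma>) w v y \<partial>?PL) \<partial>?PC)"
      using Gu by (intro nn_integral_cong nn_integral_multc)
    finally show "(\<integral>\<^sup>+u. \<integral>\<^sup>+v. \<integral>\<^sup>+y. ?G h w u y * ?G (h \<circ> \<sigma>) w v y \<partial>?PC \<partial>?PL \<partial>?PL)
        = (\<integral>\<^sup>+y. half_partition \<rho> \<beta> h (w, y) * half_partition \<rho> \<beta> (h \<circ> \<sigma>) (w, y) \<partial>?PC)"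
      by (simp add: half_partition_def)
  qed
  also have "\<dots> = (\<integral>\<^sup>+p. half_partition \<rho> \<beta> h p * half_partition \<rho> \<beta> (h \<circ> \<sigma>) p \<partial>(?PF \<Otimes>\<^sub>M ?PC))"
    using PC.nn_integral_fst[of "\<lambda>p. half_partition \<rho> \<beta> h p * half_partition \<rho> \<beta> (h \<circ> \<sigma>) p" ?PF] half by simp
  finally show "?c * shifted_partition \<rho> \<beta> V adj h =
    (\<integral>\<^sup>+p. half_partition \<rho> \<beta> h p * half_partition \<rho> \<beta> (h \<circ> \<sigma>) p \<partial>(?PF \<Otimes>\<^sub>M ?PC))" .
qed

text \<open>Cauchy-Schwarz for the inner product above: \<open>reflL h\<close> and
  \<open>reflR h\<close> are those shifts whose two halves coincide, so their partition functions
  are the squared norms of the two factors. The normalization is positive and finite and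
  cancels.\<close>

lemma reflection_positivity:
  fixes h :: "'v \<Rightarrow> 'a::euclidean_space"
  assumes \<rho>: "prob_space \<rho>" and sets: "sets \<rho> = sets borel" and \<beta>: "\<beta> > 0"
  shows "(shifted_partition \<rho> \<beta> V adj h)\<^sup>2
    \<le> shifted_partition \<rho> \<beta> V adj (reflL h) * shifted_partition \<rho> \<beta> V adj (reflR h)"
proof -
  let ?c = "ennreal (sqrt (pi / (2 * \<beta>)) ^ DIM('a)) ^ card C" and ?Z = "shifted_partition \<rho> \<beta> V adj"
  let ?A = "half_partition \<rho> \<beta> h" and ?B = "half_partition \<rho> \<beta> (h \<circ> \<sigma>)"
  let ?M = "PiM F (\<lambda>_. \<rho>) \<Otimes>\<^sub>M PiM C (\<lambda>_. lborel)"
  note factor = shifted_partition_factor[OF \<rho> sets \<beta>]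
  have "half_partition \<rho> \<beta> (reflL h) = ?A" "half_partition \<rho> \<beta> (reflL h \<circ> \<sigma>) = ?A"
    "half_partition \<rho> \<beta> (reflR h) = ?B" "half_partition \<rho> \<beta> (reflR h \<circ> \<sigma>) = ?B"
    by (rule half_partition_cong; simp add: reflL_eq reflR_eq)+
  then have L: "?c * ?Z (reflL h) = (\<integral>\<^sup>+p. (?A p)\<^sup>2 \<partial>?M)" and R: "?c * ?Z (reflR h) = (\<integral>\<^sup>+p. (?B p)\<^sup>2 \<partial>?M)"
    by (simp_all add: factor power2_eq_square)
  have "?c\<^sup>2 * (?Z h)\<^sup>2 = (\<integral>\<^sup>+p. ?A p * ?B p \<partial>?M)\<^sup>2"
    by (simp add: factor[symmetric] power_mult_distrib)
  also have "\<dots> \<le> (\<integral>\<^sup>+p. (?A p)\<^sup>2 \<partial>?M) * (\<integral>\<^sup>+p. (?B p)\<^sup>2 \<partial>?M)"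
    by (intro Cauchy_Schwarz_nn_integral half_partition_measurable \<rho> sets \<beta>)
  also have "\<dots> = (?c * ?Z (reflL h)) * (?c * ?Z (reflR h))" by (simp only: L R)
  also have "\<dots> = ?c\<^sup>2 * (?Z (reflL h) * ?Z (reflR h))" by (simp only: power2_eq_square mult_ac)
  finally show ?thesis
    using \<beta> by (subst (asm) ennreal_mult_le_mult_iff) (auto simp: ennreal_power power_eq_top_ennreal)
qed

end

section \<open>From reflection positivity to Gaussian domination\<close>

lemma shifted_partition_cong:
  assumes "\<And>x. x \<in> V \<Longrightarrow> h x = h' x"
  shows "shifted_partition \<rho> \<beta> V adj h = shifted_partition \<rho> \<beta> V adj h'"
proof -
  have "pair_sum V adj sq_dist (\<lambda>x. \<theta> x + h x) = pair_sum V adj sq_dist (\<lambda>x. \<theta> x + h' x)" for \<theta>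
    unfolding pair_sum_def using assms by (intro sum.cong) auto
  then show ?thesis by (simp add: shifted_partition_def)
qed

lemma shifted_partition_const:
  "shifted_partition \<rho> \<beta> V adj (\<lambda>_. c) = shifted_partition \<rho> \<beta> V adj (\<lambda>_. 0)"
  unfolding shifted_partition_def pair_sum_def sq_dist_def by (simp only: add_diff_cancel_right add_0_right)

lemma pair_sum_nonneg: "(\<And>a b. 0 \<le> e a b) \<Longrightarrow> 0 \<le> pair_sum V adj e \<eta>"
  unfolding pair_sum_def by (intro sum_nonneg) auto

lemma sq_dist_nonneg: "0 \<le> sq_dist a b"
  by (simp add: sq_dist_def)

lemma shifted_partition_bounds:
  fixes h :: "'v \<Rightarrow> 'a::euclidean_space"
  assumes \<rho>: "prob_space \<rho>" and sets [measurable_cong]: "sets \<rho> = sets borel" and \<beta>: "\<beta> > 0"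
  shows "shifted_partition \<rho> \<beta> V adj h \<le> 1" "shifted_partition \<rho> \<beta> V adj h \<noteq> 0"
proof -
  interpret \<rho>: prob_space \<rho> by (rule \<rho>)
  interpret PV: prob_space "PiM V (\<lambda>_. \<rho>)" by (intro prob_space_PiM \<rho>)
  have comp: "(\<lambda>\<omega>. \<omega> x) \<in> borel_measurable (PiM V (\<lambda>_. \<rho>))" if "x \<in> V" for x
    using measurable_component_singleton[OF that, of "\<lambda>_. \<rho>"] sets by (simp cong: measurable_cong_sets)
  have "(\<lambda>\<theta>. pair_sum V adj sq_dist (\<lambda>x. \<theta> x + h x)) \<in> borel_measurable (PiM V (\<lambda>_. \<rho>))"
    by (intro pair_sum_measurable sq_dist_measurable borel_measurable_add comp) auto
  then have f: "(\<lambda>\<theta>. ennreal (exp (- \<beta> / 4 * pair_sum V adj sq_dist (\<lambda>x. \<theta> x + h x))))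
      \<in> borel_measurable (PiM V (\<lambda>_. \<rho>))" by measurable
  have "shifted_partition \<rho> \<beta> V adj h \<le> (\<integral>\<^sup>+\<theta>. 1 \<partial>PiM V (\<lambda>_. \<rho>))"
    unfolding shifted_partition_def
    using \<beta> by (intro nn_integral_mono) (simp add: pair_sum_nonneg sq_dist_nonneg)
  then show "shifted_partition \<rho> \<beta> V adj h \<le> 1"
    by (simp add: PV.emeasure_space_1)
  show "shifted_partition \<rho> \<beta> V adj h \<noteq> 0"
    unfolding shifted_partition_def using f by (simp add: nn_integral_0_iff_AE ennreal_eq_0_iff not_le)
qed

text \<open>
  Reflections only rearrange the values of \<open>h\<close>, so the maximum may be taken over the finitely many
  functions with values in \<open>h ` V\<close>; among the maximizers, one with the fewest non-constant edges
  is constant.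
\<close>

lemma gaussian_domination:
  fixes h :: "'v \<Rightarrow> 'a::euclidean_space"
  assumes \<rho>: "prob_space \<rho>" and sets: "sets \<rho> = sets borel" and \<beta>: "\<beta> > 0"
    and V: "finite V"
    and reflect: "\<And>x y. x \<in> V \<Longrightarrow> y \<in> V \<Longrightarrow> adj x y \<Longrightarrow> \<exists>L \<sigma>. graph_reflection V L adj \<sigma> \<and> x \<in> L \<and> \<sigma> x = y"
    and connected: "\<And>\<eta> :: 'v \<Rightarrow> 'a. (\<And>x y. x \<in> V \<Longrightarrow> y \<in> V \<Longrightarrow> adj x y \<Longrightarrow> \<eta> x = \<eta> y) \<Longrightarrow> \<exists>c. \<forall>x\<in>V. \<eta> x = c"
  shows "shifted_partition \<rho> \<beta> V adj h \<le> shifted_partition \<rho> \<beta> V adj (\<lambda>_. 0)"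
proof -
  let ?Z = "shifted_partition \<rho> \<beta> V adj"
  \<comment> \<open>Extensional functions are used to keep \<open>W\<close> finite; restricting to
    \<open>V\<close> changes neither the partition function nor the edge count.\<close>
  define W where "W = (\<Pi>\<^sub>E x\<in>V. h ` V)"
  define m where "m = Max (?Z ` W)"
  define K where "K = {k \<in> W. ?Z k = m}"
  define e :: "'a \<Rightarrow> 'a \<Rightarrow> real" where "e a b = of_bool (a \<noteq> b)" for a b
  let ?N = "pair_sum V adj e"
  have W: "finite W" "restrict h V \<in> W" using V by (auto simp: W_def intro!: finite_PiE)
  then have le_m: "?Z k \<le> m" if "k \<in> W" for k using that by (simp add: m_def)
  have "m \<in> ?Z ` W" unfolding m_def using W by (intro Max_in) auto
  then have K: "finite K" "K \<noteq> {}" using W by (auto simp: K_def)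
  define k where "k = arg_min_on ?N K"
  have k: "k \<in> K" and k_min: "\<And>k'. k' \<in> K \<Longrightarrow> ?N k \<le> ?N k'"
    unfolding k_def using K arg_min_if_finite[OF K, of ?N] by (auto simp: not_less[symmetric])
  have "k x = k y" if xy: "x \<in> V" "y \<in> V" "adj x y" for x y
  proof (rule ccontr)
    assume neq: "k x \<noteq> k y"
    obtain L \<sigma> where refl: "graph_reflection V L adj \<sigma>" and x: "x \<in> L" "\<sigma> x = y"
      using reflect[OF xy] by blast
    interpret graph_reflection V L adj \<sigma> by (rule refl)
    have mem: "restrict (reflL k) V \<in> W" "restrict (reflR k) V \<in> W"
      using k in_V \<sigma>_V by (auto simp: K_def W_def reflL_def reflR_def PiE_iff)
    have ZN: "?Z (restrict k' V) = ?Z k'" "?N (restrict k' V) = ?N k'" for k'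
      by (rule shifted_partition_cong) (auto simp: pair_sum_def intro!: sum.cong)
    have le: "?Z (reflL k) \<le> m" "?Z (reflR k) \<le> m" using le_m[OF mem(1)] le_m[OF mem(2)] by (simp_all add: ZN)
    have m: "m \<noteq> 0" "m < \<infinity>"
    proof -
      have mk: "m = ?Z k" using k by (simp add: K_def)
      show "m \<noteq> 0" unfolding mk by (rule shifted_partition_bounds[OF \<rho> sets \<beta>])
      have "m \<le> 1" unfolding mk by (rule shifted_partition_bounds[OF \<rho> sets \<beta>])
      then show "m < \<infinity>" by (simp add: order.strict_trans1)
    qed
    \<comment> \<open>Both factors are at most \<open>m\<close> and their product is at least its
      square, so both reflections of \<open>k\<close> are maximizers again.\<close>
    have "m * m \<le> ?Z (reflL k) * ?Z (reflR k)"
      using reflection_positivity[OF \<rho> sets \<beta>, of k] k by (simp add: K_def power2_eq_square)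
    then have "m * m \<le> m * ?Z (reflR k)" "m * m \<le> m * ?Z (reflL k)"
      using mult_right_mono[OF le(1), of "?Z (reflR k)"] mult_left_mono[OF le(2), of "?Z (reflL k)"]
      by (auto simp: mult.commute)
    then have "m \<le> ?Z (reflR k)" "m \<le> ?Z (reflL k)"
      using m by (auto simp: ennreal_mult_le_mult_iff)
    then have "restrict (reflL k) V \<in> K" "restrict (reflR k) V \<in> K"
      using le mem by (auto simp: K_def ZN)
    \<comment> \<open>Minimality of \<open>k\<close> among the maximizers meets the exact loss of
      \<open>pair_sum_reflL_reflR\<close>; no non-constant crossing edge can remain, not even the
      edge from \<open>x\<close> to \<open>y\<close>.\<close>
    then have "2 * ?N k \<le> ?N (reflL k) + ?N (reflR k)"
      using k_min[of "restrict (reflL k) V"] k_min[of "restrict (reflR k) V"] by (simp add: ZN)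
    also have "\<dots> = 2 * ?N k - 4 * (\<Sum>x\<in>C. e (k x) (k (\<sigma> x)))"
      by (rule pair_sum_reflL_reflR) (auto simp: e_def)
    finally have "(\<Sum>x\<in>C. e (k x) (k (\<sigma> x))) \<le> 0" by simp
    moreover have "e (k x) (k (\<sigma> x)) \<le> (\<Sum>x\<in>C. e (k x) (k (\<sigma> x)))"
      using x xy by (intro member_le_sum) (auto simp: C_def e_def)
    ultimately show False using neq x by (simp add: e_def)
  qed
  then obtain c where "\<forall>x\<in>V. k x = c" using connected by blast
  then have "?Z k = ?Z (\<lambda>_. c)" by (intro shifted_partition_cong) auto
  then have "m = ?Z (\<lambda>_. 0)" using k shifted_partition_const[of \<rho> \<beta> V adj c] by (simp add: K_def)
  moreover have "?Z (restrict h V) = ?Z h" by (rule shifted_partition_cong) simp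
  ultimately show ?thesis using le_m[OF W(2)] by simp
qed

section \<open>Reflections of the torus\<close>

definition cyclic_adj :: "nat \<Rightarrow> int \<Rightarrow> int \<Rightarrow> bool" where
  "cyclic_adj n i j \<longleftrightarrow> j = i + 1 \<or> i = j + 1 \<or> (i = 0 \<and> j = int n - 1) \<or> (j = 0 \<and> i = int n - 1)"

lemma cyclic_succ_pred:
  assumes "0 \<le> i" "i < int n"
  shows "(i + 1) mod int n = (if i + 1 = int n then 0 else i + 1)"
    "(i - 1) mod int n = (if i = 0 then int n - 1 else i - 1)"
proof -
  show "(i + 1) mod int n = (if i + 1 = int n then 0 else i + 1)" using assms by auto
  have "(- 1) mod int n = int n - 1" using assms by (simp add: zmod_minus1)
  then show "(i - 1) mod int n = (if i = 0 then int n - 1 else i - 1)" using assms by auto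
qed

lemma cyclic_adj_iff:
  assumes "0 \<le> i" "i < int n" "0 \<le> k" "k < int n"
  shows "k = (i + 1) mod int n \<or> k = (i - 1) mod int n \<longleftrightarrow> cyclic_adj n i k"
  using assms by (auto simp: cyclic_succ_pred cyclic_adj_def)

text \<open>Replaces residues by explicit wrap-around cases, which linear arithmetic decides in the
  reflection arguments.\<close>

lemma torus_adj_iff:
  "torus_adj n x y \<longleftrightarrow> x \<in> torus n \<and> y \<in> torus n \<and>
     (snd x = snd y \<and> cyclic_adj n (fst x) (fst y) \<or> fst x = fst y \<and> cyclic_adj n (snd x) (snd y))"
proof (cases "x \<in> torus n \<and> y \<in> torus n")
  case True
  obtain a b c d where [simp]: "x = (a, b)" "y = (c, d)" by (cases x; cases y)
  have r: "0 \<le> a" "a < int n" "0 \<le> b" "b < int n" "0 \<le> c" "c < int n" "0 \<le> d" "d < int n"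
    using True by (auto simp: torus_def)
  have "torus_adj n x y \<longleftrightarrow> (c, d) = ((a + 1) mod int n, b) \<or> (c, d) = ((a - 1) mod int n, b)
      \<or> (c, d) = (a, (b + 1) mod int n) \<or> (c, d) = (a, (b - 1) mod int n)"
    using True r by (auto simp: torus_adj_def neighbours_eq torus_proj_def)
  also have "\<dots> \<longleftrightarrow> snd x = snd y \<and> cyclic_adj n (fst x) (fst y) \<or> fst x = fst y \<and> cyclic_adj n (snd x) (snd y)"
    using cyclic_adj_iff[OF r(1,2,5,6)] cyclic_adj_iff[OF r(3,4,7,8)] by auto
  finally show ?thesis using True by simp
qed (auto simp: torus_adj_def)

lemma finite_torus [simp]: "finite (torus n)"
  by (simp add: torus_def)

lemma torus_adj_sym: "torus_adj n x y \<Longrightarrow> torus_adj n y x"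
  by (auto simp: torus_adj_iff cyclic_adj_def)

text \<open>Conjugation by a graph automorphism moves the mirror, so one explicit reflection of the
  torus yields one for every edge.\<close>

lemma graph_reflection_conjugate:
  assumes "graph_reflection V L adj \<sigma>"
    and \<tau>: "\<And>x. x \<in> V \<Longrightarrow> \<tau> x \<in> V" "\<And>x. x \<in> V \<Longrightarrow> \<tau>' x \<in> V"
      "\<And>x. x \<in> V \<Longrightarrow> \<tau>' (\<tau> x) = x" "\<And>x. x \<in> V \<Longrightarrow> \<tau> (\<tau>' x) = x"
    and adj: "\<And>x y. x \<in> V \<Longrightarrow> y \<in> V \<Longrightarrow> adj x y \<Longrightarrow> adj (\<tau> x) (\<tau> y)"
      "\<And>x y. x \<in> V \<Longrightarrow> y \<in> V \<Longrightarrow> adj x y \<Longrightarrow> adj (\<tau>' x) (\<tau>' y)"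
  shows "graph_reflection V (\<tau> ` L) adj (\<tau> \<circ> \<sigma> \<circ> \<tau>')"
proof -
  interpret graph_reflection V L adj \<sigma> by fact
  have mem: "\<tau> x \<in> \<tau> ` L \<longleftrightarrow> x \<in> L" if "x \<in> V" for x
    using that \<tau>(3) in_V(1) by (metis image_iff)
  show ?thesis
  proof
    fix x y assume "x \<in> \<tau> ` L" "y \<in> \<tau> ` L" and a: "adj x ((\<tau> \<circ> \<sigma> \<circ> \<tau>') y)"
    then obtain u v where uv: "u \<in> L" "v \<in> L" "x = \<tau> u" "y = \<tau> v" by blast
    then have "adj (\<tau>' (\<tau> u)) (\<tau>' (\<tau> (\<sigma> v)))"
      using a in_V \<sigma>_V \<tau> by (intro adj(2)) auto
    then have "adj u (\<sigma> v)" using uv in_V \<sigma>_V \<tau> by simp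
    then show "y = x" using crossing uv by blast
  next
    fix x assume x: "x \<in> V" "x \<notin> \<tau> ` L" "(\<tau> \<circ> \<sigma> \<circ> \<tau>') x \<notin> \<tau> ` L"
    then have "\<tau>' x \<notin> L" "\<sigma> (\<tau>' x) \<notin> L" using mem \<tau> \<sigma>_V by (metis, auto)
    then have "\<sigma> (\<tau>' x) = \<tau>' x" using fixed \<tau>(2)[OF x(1)] by simp
    then show "(\<tau> \<circ> \<sigma> \<circ> \<tau>') x = x" using x \<tau> by simp
  next
    fix x assume "x \<in> \<tau> ` L"
    then obtain u where "u \<in> L" "x = \<tau> u" by blast
    then show "(\<tau> \<circ> \<sigma> \<circ> \<tau>') x \<notin> \<tau> ` L" using mem \<tau> \<sigma>_V in_V disj by simp
  next
    fix x y assume "adj x y" then show "adj y x" by (rule adj_sym)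
  next
    fix x y assume "x \<in> V" "y \<in> V" "adj x y"
    then show "adj ((\<tau> \<circ> \<sigma> \<circ> \<tau>') x) ((\<tau> \<circ> \<sigma> \<circ> \<tau>') y)"
      using \<tau> \<sigma>_V adj adj_\<sigma> by simp
  qed (use \<tau> \<sigma>_V \<sigma>_\<sigma> in_V in auto)
qed

definition edge_reflectable :: "nat \<Rightarrow> int \<times> int \<Rightarrow> int \<times> int \<Rightarrow> bool" where
  "edge_reflectable n x y \<longleftrightarrow> (\<exists>L \<sigma>. graph_reflection (torus n) L (torus_adj n) \<sigma> \<and> x \<in> L \<and> \<sigma> x = y)"

lemma edge_reflectable_map:
  assumes "edge_reflectable n x y"
    and \<tau>: "\<And>x. x \<in> torus n \<Longrightarrow> \<tau> x \<in> torus n" "\<And>x. x \<in> torus n \<Longrightarrow> \<tau>' x \<in> torus n"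
      "\<And>x. x \<in> torus n \<Longrightarrow> \<tau>' (\<tau> x) = x" "\<And>x. x \<in> torus n \<Longrightarrow> \<tau> (\<tau>' x) = x"
    and adj: "\<And>x y. torus_adj n x y \<Longrightarrow> torus_adj n (\<tau> x) (\<tau> y)"
      "\<And>x y. torus_adj n x y \<Longrightarrow> torus_adj n (\<tau>' x) (\<tau>' y)"
  shows "edge_reflectable n (\<tau> x) (\<tau> y)"
proof -
  obtain L \<sigma> where r: "graph_reflection (torus n) L (torus_adj n) \<sigma>" "x \<in> L" "\<sigma> x = y"
    using assms(1) by (auto simp: edge_reflectable_def)
  have "graph_reflection (torus n) (\<tau> ` L) (torus_adj n) (\<tau> \<circ> \<sigma> \<circ> \<tau>')"
    by (rule graph_reflection_conjugate[OF r(1)]) (use \<tau> adj in auto)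
  moreover have "x \<in> torus n" using graph_reflection.in_V(1)[OF r(1)] r(2) by blast
  ultimately show ?thesis unfolding edge_reflectable_def using r \<tau>(3)
    by (intro exI[of _ "\<tau> ` L"] exI[of _ "\<tau> \<circ> \<sigma> \<circ> \<tau>'"]) auto
qed

lemma edge_reflectable_sym:
  assumes "edge_reflectable n x y"
  shows "edge_reflectable n y x"
proof -
  obtain L \<sigma> where r: "graph_reflection (torus n) L (torus_adj n) \<sigma>" "x \<in> L" "\<sigma> x = y"
    using assms by (auto simp: edge_reflectable_def)
  interpret graph_reflection "torus n" L "torus_adj n" \<sigma> by (rule r)
  have "edge_reflectable n (\<sigma> x) (\<sigma> y)"
    using \<sigma>_V \<sigma>_\<sigma> adj_\<sigma> by (intro edge_reflectable_map[OF assms, of \<sigma> \<sigma>]) (auto simp: torus_adj_def)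
  moreover have "\<sigma> (\<sigma> x) = x" using r(2) \<sigma>_\<sigma> in_V(1) by blast
  ultimately show ?thesis using r(3) by simp
qed

text \<open>The map i to n - 1 - i exchanges the ends of the wrap-around edge. The strict inequality
  defining \<open>L\<close> leaves the middle column on the mirror when \<open>n\<close> is odd, so
  both parities are covered. Crossing edges occur at the wrap-around and, for even \<open>n\<close>,
  in the middle.\<close>

lemma edge_reflectable_base:
  assumes "n \<ge> 2" "0 \<le> j" "j < int n"
  shows "edge_reflectable n (0, j) (int n - 1, j)"
proof -
  define L where "L = {x \<in> torus n. 2 * fst x < int n - 1}"
  define \<sigma> where "\<sigma> x = (int n - 1 - fst x, snd x)" for x :: "int \<times> int"
  have "graph_reflection (torus n) L (torus_adj n) \<sigma>"
  proof
    fix x y assume "x \<in> L" "y \<in> L" "torus_adj n x (\<sigma> y)"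
    then have r: "0 \<le> fst x" "0 \<le> fst y" "2 * fst x < int n - 1" "2 * fst y < int n - 1"
      and adj: "snd x = snd y \<and> cyclic_adj n (fst x) (int n - 1 - fst y) \<or> fst x = int n - 1 - fst y"
      by (auto simp: torus_adj_iff L_def \<sigma>_def torus_def)
    then have "snd x = snd y \<and> cyclic_adj n (fst x) (int n - 1 - fst y)" by linarith
    moreover from this r have "fst y = fst x" unfolding cyclic_adj_def by linarith
    ultimately show "y = x" by (simp add: prod_eq_iff)
  next
    fix x y assume "torus_adj n x y"
    moreover have "cyclic_adj n i k \<Longrightarrow> cyclic_adj n (int n - 1 - i) (int n - 1 - k)" for i k
      by (auto simp: cyclic_adj_def)
    ultimately show "torus_adj n (\<sigma> x) (\<sigma> y)"
      by (auto simp: torus_adj_iff \<sigma>_def torus_def)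
  next
    show "finite (torus n)" by simp
  next
    fix x y assume "torus_adj n x y" then show "torus_adj n y x" by (rule torus_adj_sym)
  qed (auto simp: L_def \<sigma>_def torus_def)
  then show ?thesis unfolding edge_reflectable_def
    using assms by (intro exI[of _ L] exI[of _ \<sigma>]) (auto simp: L_def \<sigma>_def torus_def)
qed

lemma edge_reflectable_left:
  assumes n: "n \<ge> 2" and x: "x \<in> torus n"
  shows "edge_reflectable n x (if fst x = 0 then int n - 1 else fst x - 1, snd x)"
proof -
  obtain a j where [simp]: "x = (a, j)" by (cases x)
  have a: "0 \<le> a" "a < int n" "0 \<le> j" "j < int n" using x by (auto simp: torus_def)
  \<comment> \<open>Cyclic shift by \<open>b\<close>, written without \<open>mod\<close>; it carries
    the wrap-around edge to the edge between columns \<open>a\<close> and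
    \<open>a - 1\<close>.\<close>
  define s where "s b i = (if i + b < int n then i + b else i + b - int n)" for b i
  have cyc: "cyclic_adj n (s b i) (s b k)"
    if "0 \<le> i" "i < int n" "0 \<le> k" "k < int n" "0 \<le> b" "b \<le> int n" "cyclic_adj n i k" for b i k
    using that n unfolding s_def cyclic_adj_def by auto
  have s: "0 \<le> s b i" "s b i < int n" "s (int n - b) (s b i) = i" "s b (s (int n - b) i) = i"
    if "0 \<le> i" "i < int n" "0 \<le> b" "b \<le> int n" for b i
    using that unfolding s_def by auto
  have "edge_reflectable n ((\<lambda>x. (s a (fst x), snd x)) (0, j)) ((\<lambda>x. (s a (fst x), snd x)) (int n - 1, j))"
    by (rule edge_reflectable_map[OF edge_reflectable_base[OF n a(3,4)], where \<tau>'
        = "\<lambda>x. (s (int n - a) (fst x), snd x)"])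
      (use a in \<open>auto simp: torus_adj_iff torus_def cyc s\<close>)
  moreover have "s a 0 = a" "s a (int n - 1) = (if a = 0 then int n - 1 else a - 1)"
    using a by (auto simp: s_def)
  ultimately show ?thesis by (simp split: if_splits)
qed

lemma torus_edge_reflectable:
  assumes n: "n \<ge> 2" and xy: "torus_adj n x y"
  shows "edge_reflectable n x y"
proof -
  have mem: "x \<in> torus n" "y \<in> torus n" using xy by (auto simp: torus_adj_def)
  have left: "edge_reflectable n x y"
    if "x \<in> torus n" "snd x = snd y" "fst y = (if fst x = 0 then int n - 1 else fst x - 1)" for x y
    using edge_reflectable_left[OF n that(1)] that(2) that(3)[symmetric] by simp
  have horizontal: "edge_reflectable n x y"
    if "x \<in> torus n" "y \<in> torus n" "snd x = snd y" "cyclic_adj n (fst x) (fst y)" for x y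
  proof -
    have "fst y = (if fst x = 0 then int n - 1 else fst x - 1) \<or> fst x = (if fst y = 0 then int n - 1 else fst y - 1)"
      using that unfolding cyclic_adj_def torus_def by auto
    then show ?thesis using that left edge_reflectable_sym by metis
  qed
  have "edge_reflectable n x y" if "fst x = fst y" "cyclic_adj n (snd x) (snd y)"
  proof -
    have sw: "prod.swap z \<in> torus n" if "z \<in> torus n" for z using that by (auto simp: torus_def)
    have adj: "torus_adj n (prod.swap z) (prod.swap w)" if "torus_adj n z w" for z w
      using that sw unfolding torus_adj_iff by auto
    have "edge_reflectable n (prod.swap x) (prod.swap y)"
      using that by (intro horizontal sw mem) simp_all
    from edge_reflectable_map[OF this, of prod.swap prod.swap] sw adj show ?thesis by simp
  qed
  then show ?thesis using horizontal[OF mem] xy unfolding torus_adj_iff by blast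
qed

lemma torus_proj_mem: "n \<ge> 1 \<Longrightarrow> torus_proj n x \<in> torus n"
  by (auto simp: torus_proj_def torus_def)

lemma torus_proj_id: "x \<in> torus n \<Longrightarrow> torus_proj n x = x"
  by (auto simp: torus_proj_def torus_def)

lemma torus_proj_zero [simp]: "torus_proj n 0 = 0"
  by (simp add: torus_proj_def zero_prod_def)

lemma torus_adj_proj:
  assumes "n \<ge> 1" "y \<in> neighbours x"
  shows "torus_adj n (torus_proj n x) (torus_proj n y)"
proof -
  let ?z = "(fst (torus_proj n x) + (fst y - fst x), snd (torus_proj n x) + (snd y - snd x))"
  have "?z \<in> neighbours (torus_proj n x)" using assms(2) by (auto simp: neighbours_def)
  moreover have "torus_proj n ?z = torus_proj n y"
    by (simp add: torus_proj_def mod_add_left_eq)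
  ultimately show ?thesis using assms(1) torus_proj_mem unfolding torus_adj_def by blast
qed

lemma torus_connected:
  assumes n: "n \<ge> 1"
    and \<eta>: "\<And>x y. torus_adj n x y \<Longrightarrow> \<eta> x = \<eta> y" and x: "x \<in> torus n"
  shows "\<eta> x = \<eta> 0"
proof -
  have "\<bar>fst x\<bar> + \<bar>snd x\<bar> = int d \<Longrightarrow> \<eta> (torus_proj n x) = \<eta> 0" for d x
  proof (induction d arbitrary: x)
    case 0
    then have "x = 0" by (auto simp: prod_eq_iff)
    then show ?case by simp
  next
    case (Suc d)
    obtain w where "w \<in> neighbours x" "\<bar>fst w\<bar> + \<bar>snd w\<bar> = int d"
      using exists_closer_neighbour[OF Suc.prems] by blast
    then show ?case using Suc.IH \<eta>[OF torus_adj_proj[OF n]] by metis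
  qed
  from this[of x "nat (\<bar>fst x\<bar> + \<bar>snd x\<bar>)"] show ?thesis using x by (simp add: torus_proj_id)
qed

lemma torus_gaussian_domination:
  fixes h :: "int \<times> int \<Rightarrow> 'a::euclidean_space"
  assumes "prob_space \<rho>" "sets \<rho> = sets borel" "\<beta> > 0" "n \<ge> 2"
  shows "shifted_partition \<rho> \<beta> (torus n) (torus_adj n) h \<le> shifted_partition \<rho> \<beta> (torus n) (torus_adj n) (\<lambda>_. 0)"
proof (rule gaussian_domination)
  show "\<exists>L \<sigma>. graph_reflection (torus n) L (torus_adj n) \<sigma> \<and> x \<in> L \<and> \<sigma> x = y" if "torus_adj n x y" for x y
    using torus_edge_reflectable[OF assms(4) that] by (simp add: edge_reflectable_def)
  show "\<exists>c. \<forall>x\<in>torus n. \<eta> x = c"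
    if "\<And>x y. x \<in> torus n \<Longrightarrow> y \<in> torus n \<Longrightarrow> torus_adj n x y \<Longrightarrow> \<eta> x = \<eta> y" for \<eta> :: "int \<times> int \<Rightarrow> 'a"
  proof (intro exI[of _ "\<eta> 0"] ballI)
    fix x assume "x \<in> torus n"
    moreover have "\<And>x y. torus_adj n x y \<Longrightarrow> \<eta> x = \<eta> y" using that unfolding torus_adj_def by blast
    ultimately show "\<eta> x = \<eta> 0" using assms(4) by (intro torus_connected[of n \<eta>]) auto
  qed
qed (simp_all add: assms)

section \<open>The infrared bound\<close>

lemma weighted_Cauchy_Schwarz:
  fixes f g w :: "'b \<Rightarrow> real"
  assumes "\<And>x. 0 \<le> w x"
    and int: "integrable M (\<lambda>x. w x * (f x)\<^sup>2)" "integrable M (\<lambda>x. w x * (g x)\<^sup>2)" "integrable M (\<lambda>x. w x * (f x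
        * g x))"
  shows "(\<integral>x. w x * (f x * g x) \<partial>M)\<^sup>2 \<le> (\<integral>x. w x * (f x)\<^sup>2 \<partial>M) * (\<integral>x. w x * (g x)\<^sup>2 \<partial>M)"
proof -
  define P Q S where "P = (\<integral>x. w x * (f x)\<^sup>2 \<partial>M)" and "Q = (\<integral>x. w x * (f x * g x) \<partial>M)"
    and "S = (\<integral>x. w x * (g x)\<^sup>2 \<partial>M)"
  have quad: "0 \<le> P - 2 * t * Q + t\<^sup>2 * S" for t
  proof -
    have "0 \<le> (\<integral>x. w x * (f x - t * g x)\<^sup>2 \<partial>M)" using assms(1) by (intro integral_nonneg_AE) simp
    also have "(\<lambda>x. w x * (f x - t * g x)\<^sup>2) = (\<lambda>x. w x * (f x)\<^sup>2 - (2 * t) * (w x * (f x * g x))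
        + t\<^sup>2 * (w x * (g x)\<^sup>2))"
      by (auto simp: power2_eq_square algebra_simps)
    also have "(\<integral>x. w x * (f x)\<^sup>2 - (2 * t) * (w x * (f x * g x)) + t\<^sup>2 * (w x * (g x)\<^sup>2) \<partial>M) = P - 2 * t * Q + t\<^sup>2 * S"
      using int by (simp add: P_def Q_def S_def)
    finally show ?thesis .
  qed
  have S: "0 \<le> S" unfolding S_def using assms(1) by (intro integral_nonneg_AE) simp
  have "Q\<^sup>2 \<le> P * S"
  proof (cases "S = 0")
    case True
    have "Q = 0"
    proof (rule ccontr)
      assume "Q \<noteq> 0"
      \<comment> \<open>For \<open>S = 0\<close> the quadratic is affine in \<open>t\<close>, and
        this choice gives it the value -1.\<close>
      then show False using quad[of "(P + 1) / (2 * Q)"] True by simp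
    qed
    then show ?thesis using True by simp
  next
    case False
    have "0 \<le> S * (P - 2 * (Q / S) * Q + (Q / S)\<^sup>2 * S)" by (intro mult_nonneg_nonneg quad S)
    also have "\<dots> = P * S - Q\<^sup>2" using False by (simp add: field_simps power2_eq_square)
    finally show ?thesis by simp
  qed
  then show ?thesis by (simp add: P_def Q_def S_def)
qed

text \<open>The quadratic term has half its optimal coefficient, which affects only the constants of
  the infrared bound.\<close>

lemma exp_add_exp_minus_ge:
  fixes u :: real
  shows "2 + u\<^sup>2 / 2 \<le> exp u + exp (- u)"
proof -
  have "2 + \<bar>u\<bar>\<^sup>2 / 2 \<le> exp \<bar>u\<bar> + exp (- \<bar>u\<bar>)"
    using exp_lower_Taylor_quadratic[of "\<bar>u\<bar>"] exp_ge_add_one_self[of "- \<bar>u\<bar>"] by simp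
  then show ?thesis by (cases "u \<ge> 0") (auto simp: add.commute)
qed

section \<open>Dirichlet form and moments of linear fields on the torus\<close>

definition energy_form :: "nat \<Rightarrow> (int \<times> int \<Rightarrow> 'a::real_inner) \<Rightarrow> (int \<times> int \<Rightarrow> 'a) \<Rightarrow> real" where
  "energy_form n \<theta> h = (\<Sum>x\<in>torus n. \<Sum>y\<in>torus n. if torus_adj n x y then (\<theta> x - \<theta> y) \<bullet> (h x - h y) else 0) / 2"

abbreviation torus_energy :: "nat \<Rightarrow> (int \<times> int \<Rightarrow> 'a::real_inner) \<Rightarrow> real" where
  "torus_energy n h \<equiv> energy_form n h h"

lemma pair_sum_sq_dist: "pair_sum (torus n) (torus_adj n) sq_dist h = 2 * torus_energy n h"
  by (simp add: pair_sum_def energy_form_def sq_dist_def power2_norm_eq_inner cong: if_cong)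

lemma torus_energy_nonneg: "0 \<le> torus_energy n h"
  unfolding energy_form_def by (auto intro!: sum_nonneg divide_nonneg_nonneg)

lemma energy_form_add: "torus_energy n (\<lambda>x. \<theta> x + h x) = torus_energy n \<theta> + 2 * energy_form n \<theta> h + torus_energy n h"
proof -
  have "torus_energy n (\<lambda>x. \<theta> x + h x) = (\<Sum>x\<in>torus n. \<Sum>y\<in>torus n.
     (if torus_adj n x y then (\<theta> x - \<theta> y) \<bullet> (\<theta> x - \<theta> y) else 0)
         + 2 * (if torus_adj n x y then (\<theta> x - \<theta> y) \<bullet> (h x - h y) else 0)
       + (if torus_adj n x y then (h x - h y) \<bullet> (h x - h y) else 0)) / 2"
    unfolding energy_form_def
    by (intro arg_cong[where f = "\<lambda>x. x / 2"] sum.cong refl)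
      (auto simp: inner_add_left inner_add_right inner_diff_left inner_diff_right inner_commute)
  then show ?thesis
    by (simp add: energy_form_def sum.distrib sum_distrib_left[symmetric] add_divide_distrib)
qed

lemma energy_form_scaleR: "energy_form n \<theta> (\<lambda>x. s *\<^sub>R h x) = s * energy_form n \<theta> h"
  unfolding energy_form_def sum_divide_distrib sum_distrib_left
  by (intro sum.cong refl) (auto simp: scaleR_diff_right[symmetric])

lemma energy_form_commute: "energy_form n \<theta> h = energy_form n h \<theta>"
  unfolding energy_form_def by (simp add: inner_commute cong: if_cong)

lemma energy_form_bound:
  assumes "\<And>x. x \<in> torus n \<Longrightarrow> norm (\<theta> x) \<le> 1"
  shows "\<bar>energy_form n \<theta> h\<bar> \<le> (\<Sum>x\<in>torus n. \<Sum>y\<in>torus n. norm (h x - h y))"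
proof -
  have "\<bar>energy_form n \<theta> h\<bar> \<le> (\<Sum>x\<in>torus n. \<Sum>y\<in>torus n. \<bar>if torus_adj n x y then (\<theta> x - \<theta> y) \<bullet> (h x - h y) else 0\<bar>) / 2"
    unfolding energy_form_def by (auto intro!: divide_right_mono order_trans[OF sum_abs] sum_mono)
  also have "\<dots> \<le> (\<Sum>x\<in>torus n. \<Sum>y\<in>torus n. 2 * norm (h x - h y)) / 2"
  proof (intro divide_right_mono sum_mono)
    fix x y assume xy: "x \<in> torus n" "y \<in> torus n"
    have "\<bar>(\<theta> x - \<theta> y) \<bullet> (h x - h y)\<bar> \<le> norm (\<theta> x - \<theta> y) * norm (h x - h y)"
      by (rule Cauchy_Schwarz_ineq2)
    also have "\<dots> \<le> 2 * norm (h x - h y)"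
      using assms[OF xy(1)] assms[OF xy(2)] norm_triangle_ineq4[of "\<theta> x" "\<theta> y"] by (intro mult_right_mono) auto
    finally show "\<bar>if torus_adj n x y then (\<theta> x - \<theta> y) \<bullet> (h x - h y) else 0\<bar> \<le> 2 * norm (h x - h y)"
      by simp
  qed simp
  also have "\<dots> = (\<Sum>x\<in>torus n. \<Sum>y\<in>torus n. norm (h x - h y))"
    by (simp add: sum_distrib_left[symmetric])
  finally show ?thesis .
qed

lemma energy_form_measurable:
  fixes f h :: "'b \<Rightarrow> int \<times> int \<Rightarrow> 'c::euclidean_space"
  assumes "\<And>x. x \<in> torus n \<Longrightarrow> (\<lambda>\<theta>. f \<theta> x) \<in> borel_measurable M" "\<And>x. x \<in> torus n \<Longrightarrow> (\<lambda>\<theta>. h \<theta> x) \<in> borel_measurable M"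
  shows "(\<lambda>\<theta>. energy_form n (f \<theta>) (h \<theta>)) \<in> borel_measurable M"
proof -
  have "(\<lambda>\<theta>. if torus_adj n x y then (f \<theta> x - f \<theta> y) \<bullet> (h \<theta> x - h \<theta> y) else 0) \<in> borel_measurable M"
    if "x \<in> torus n" "y \<in> torus n" for x y
    using assms(1)[OF that(1)] assms(1)[OF that(2)] assms(2)[OF that(1)] assms(2)[OF that(2)]
    by (cases "torus_adj n x y") (simp_all add: borel_measurable_inner borel_measurable_diff)
  then show ?thesis unfolding energy_form_def by (intro borel_measurable_divide borel_measurable_sum) auto
qed

text \<open>The unrooted model: reflections require the same single-site measure at all sites. The
  bound on the norms makes every linear field essentially bounded, hence integrable together with
  its exponentials.\<close>

locale torus_spins =
  fixes \<rho> :: "'a::euclidean_space measure" and \<beta> :: real and n :: nat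
  assumes prob: "prob_space \<rho>" and sets_\<rho>: "sets \<rho> = sets borel"
    and AE_norm: "AE x in \<rho>. norm x \<le> 1"
    and \<beta>_pos: "\<beta> > 0" and n_ge: "n \<ge> 2"
begin

abbreviation "reference \<equiv> PiM (torus n) (\<lambda>_. \<rho>)"

definition weight :: "(int \<times> int \<Rightarrow> 'a) \<Rightarrow> real" where
  "weight \<theta> = exp (- \<beta> / 2 * torus_energy n \<theta>)"

lemma weight_pos: "0 < weight \<theta>" and weight_le_1: "weight \<theta> \<le> 1" and weight_nonneg: "0 \<le> weight \<theta>"
  using \<beta>_pos torus_energy_nonneg[of n \<theta>] by (auto simp: weight_def)

sublocale reference: prob_space reference
  by (intro prob_space_PiM prob)

lemma component_measurable: "x \<in> torus n \<Longrightarrow> (\<lambda>\<theta>. \<theta> x) \<in> borel_measurable reference"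
  using measurable_component_singleton[of x "torus n" "\<lambda>_. \<rho>"] sets_\<rho> by (simp cong: measurable_cong_sets)

lemma AE_reference: "AE \<theta> in reference. \<forall>x\<in>torus n. norm (\<theta> x) \<le> 1"
proof (rule AE_finite_allI)
  fix x assume "x \<in> torus n"
  then show "AE \<theta> in reference. norm (\<theta> x) \<le> 1"
    using AE_norm prob by (intro AE_PiM_component) auto
qed simp

lemma weight_measurable [measurable]: "weight \<in> borel_measurable reference"
proof -
  have "(\<lambda>\<theta>. torus_energy n \<theta>) \<in> borel_measurable reference"
    by (intro energy_form_measurable component_measurable)
  then show ?thesis unfolding weight_def[abs_def] by measurable
qed

lemma integrable_weight_mult:
  assumes [measurable]: "f \<in> borel_measurable reference"
    and "AE \<theta> in reference. \<bar>f \<theta>\<bar> \<le> (B::real)"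
  shows "integrable reference (\<lambda>\<theta>. weight \<theta> * f \<theta>)"
proof (rule reference.integrable_const_bound)
  show "AE \<theta> in reference. norm (weight \<theta> * f \<theta>) \<le> B"
    using assms(2)
  proof eventually_elim
    case (elim \<theta>)
    have "norm (weight \<theta> * f \<theta>) \<le> 1 * \<bar>f \<theta>\<bar>"
      using weight_nonneg weight_le_1 by (simp add: abs_mult mult_left_le_one_le)
    then show ?case using elim by simp
  qed
qed measurable

definition mass :: real where "mass = (\<integral>\<theta>. weight \<theta> \<partial>reference)"

lemma mass_pos: "0 < mass"
proof -
  have "integrable reference weight" using integrable_weight_mult[of "\<lambda>_. 1" 1] by simp
  then have "mass \<noteq> 0"
    unfolding mass_def using weight_nonneg weight_pos
    by (subst integral_nonneg_eq_0_iff_AE) (auto simp: less_imp_neq[THEN not_sym] reference.AE_False)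
  moreover have "0 \<le> mass" unfolding mass_def using weight_nonneg by (intro integral_nonneg_AE) simp
  ultimately show ?thesis by simp
qed

lemma linear_field_measurable: "(\<lambda>\<theta>. energy_form n \<theta> h) \<in> borel_measurable reference"
  by (intro energy_form_measurable component_measurable borel_measurable_const)

lemma AE_linear_field_bound:
  "AE \<theta> in reference. \<bar>energy_form n \<theta> h\<bar> \<le> (\<Sum>x\<in>torus n. \<Sum>y\<in>torus n. norm (h x - h y))"
  using AE_reference by eventually_elim (rule energy_form_bound, blast)

text \<open>Expanding the square in the shifted exponent gives the weight, the linear field paired
  with \<open>h\<close>, and a term in \<open>h\<close> alone that leaves the integral. Gaussian
  domination thus bounds the exponential moments of linear fields by those of a Gaussian.\<close>

lemma gaussian_domination_integral:
  "(\<integral>\<theta>. weight \<theta> * exp (- \<beta> * energy_form n \<theta> h) \<partial>reference) \<le> exp (\<beta> / 2 * torus_energy n h) * mass"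
proof -
  note [measurable] = linear_field_measurable
  have eq: "- \<beta> / 4 * pair_sum (torus n) (torus_adj n) sq_dist (\<lambda>x. \<theta> x + h x)
      = (- \<beta> / 2 * torus_energy n \<theta>) + (- \<beta> * energy_form n \<theta> h) + (- (\<beta> / 2 * torus_energy n h))" for \<theta>
    unfolding pair_sum_sq_dist energy_form_add by (simp add: algebra_simps)
  have int: "integrable reference (\<lambda>\<theta>. weight \<theta> * exp (- \<beta> * energy_form n \<theta> k))" for k
  proof (rule integrable_weight_mult)
    show "AE \<theta> in reference. \<bar>exp (- \<beta> * energy_form n \<theta> k)\<bar> \<le> exp (\<beta> * (\<Sum>x\<in>torus n. \<Sum>y\<in>torus n. norm (k x - k y)))"
      using AE_linear_field_bound[of k]
    proof eventually_elim
      case (elim \<theta>)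
      then show ?case
        using mult_left_mono[of "- energy_form n \<theta> k" "\<Sum>x\<in>torus n. \<Sum>y\<in>torus n. norm (k x - k y)" \<beta>] \<beta>_pos
        by simp
    qed
  qed measurable
  have Z: "shifted_partition \<rho> \<beta> (torus n) (torus_adj n) k
      = ennreal (exp (- (\<beta> / 2 * torus_energy n k)) * (\<integral>\<theta>. weight \<theta> * exp (- \<beta> * energy_form n \<theta> k) \<partial>reference))"
    if "k = h \<or> k = (\<lambda>_. 0)" for k
  proof -
    have "shifted_partition \<rho> \<beta> (torus n) (torus_adj n) k
        = (\<integral>\<^sup>+\<theta>. ennreal (exp (- (\<beta> / 2 * torus_energy n k))) * ennreal (weight \<theta> * exp (- \<beta> * energy_form n \<theta> k))
            \<partial>reference)"
      unfolding shifted_partition_def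
      by (intro nn_integral_cong)
        (simp only: pair_sum_sq_dist energy_form_add weight_def exp_add[symmetric] ennreal_mult'[symmetric] exp_ge_zero,
         simp add: algebra_simps)
    also have "\<dots> = ennreal (exp (- (\<beta> / 2 * torus_energy n k))) * ennreal (\<integral>\<theta>. weight \<theta> * exp (- \<beta>
        * energy_form n \<theta> k) \<partial>reference)"
      using int weight_nonneg by (subst nn_integral_cmult) (auto simp: nn_integral_eq_integral)
    finally show ?thesis by (simp add: ennreal_mult')
  qed
  have z: "energy_form n \<theta> (\<lambda>_. 0) = 0" for \<theta> :: "int \<times> int \<Rightarrow> 'a" by (simp add: energy_form_def cong: if_cong)
  have "exp (- (\<beta> / 2 * torus_energy n h)) * (\<integral>\<theta>. weight \<theta> * exp (- \<beta> * energy_form n \<theta> h) \<partial>reference) \<le> mass"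
    using torus_gaussian_domination[OF prob sets_\<rho> \<beta>_pos n_ge, of h] mass_pos
    by (simp add: Z z mass_def ennreal_le_iff)
  then show ?thesis by (simp add: exp_minus field_simps)
qed

text \<open>Averaging the exponential bound over \<open>h\<close> and \<open>- h\<close> cancels odd
  terms and leaves a quadratic lower bound. A fixed amplitude is used instead of the limit of small
  amplitudes; this accounts for the factor 4.\<close>

lemma linear_field_second_moment:
  "(\<integral>\<theta>. weight \<theta> * (energy_form n \<theta> h)\<^sup>2 \<partial>reference) \<le> 4 * torus_energy n h / \<beta> * mass"
proof -
  note [measurable] = linear_field_measurable
  define q where "q = (\<integral>\<theta>. weight \<theta> * (energy_form n \<theta> h)\<^sup>2 \<partial>reference)"
  define E where "E = torus_energy n h"
  let ?K = "\<Sum>x\<in>torus n. \<Sum>y\<in>torus n. norm (h x - h y)"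
  have intB: "integrable reference (\<lambda>\<theta>. weight \<theta> * (energy_form n \<theta> h)\<^sup>2)"
  proof (rule integrable_weight_mult)
    show "AE \<theta> in reference. \<bar>(energy_form n \<theta> h)\<^sup>2\<bar> \<le> ?K\<^sup>2"
      using AE_linear_field_bound[of h] by eventually_elim (simp add: abs_le_square_iff[symmetric])
  qed measurable
  have int1: "integrable reference weight" using integrable_weight_mult[of "\<lambda>_. 1" 1] by simp
  have intE: "integrable reference (\<lambda>\<theta>. weight \<theta> * exp (c * energy_form n \<theta> h))" for c
  proof (rule integrable_weight_mult)
    show "AE \<theta> in reference. \<bar>exp (c * energy_form n \<theta> h)\<bar> \<le> exp (\<bar>c\<bar> * ?K)"
      using AE_linear_field_bound[of h]
    proof eventually_elim
      case (elim \<theta>)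
      have "c * energy_form n \<theta> h \<le> \<bar>c\<bar> * \<bar>energy_form n \<theta> h\<bar>" by (simp add: abs_mult[symmetric])
      also have "\<dots> \<le> \<bar>c\<bar> * ?K" using elim by (intro mult_left_mono) auto
      finally show ?case by simp
    qed
  qed measurable
  have main: "(\<beta> * s)\<^sup>2 / 4 * q \<le> (exp (\<beta> / 2 * (s\<^sup>2 * E)) - 1) * mass" for s
  proof -
    have dom: "(\<integral>\<theta>. weight \<theta> * exp (- \<beta> * t * energy_form n \<theta> h) \<partial>reference) \<le> exp (\<beta> / 2 * (t\<^sup>2 * E)) * mass" for t
      using gaussian_domination_integral[of "\<lambda>x. t *\<^sub>R h x"]
      by (simp add: energy_form_scaleR energy_form_commute[of n "\<lambda>x. t *\<^sub>R h x"] E_def power2_eq_square mult.assoc)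
    have "(\<integral>\<theta>. 2 * weight \<theta> + (\<beta> * s)\<^sup>2 / 2 * (weight \<theta> * (energy_form n \<theta> h)\<^sup>2) \<partial>reference)
        \<le> (\<integral>\<theta>. weight \<theta> * exp (- \<beta> * s * energy_form n \<theta> h) + weight \<theta> * exp (- \<beta> * (- s) * energy_form n \<theta> h)
            \<partial>reference)"
    proof (rule integral_mono)
      fix \<theta>
      show "2 * weight \<theta> + (\<beta> * s)\<^sup>2 / 2 * (weight \<theta> * (energy_form n \<theta> h)\<^sup>2)
          \<le> weight \<theta> * exp (- \<beta> * s * energy_form n \<theta> h) + weight \<theta> * exp (- \<beta> * (- s) * energy_form n \<theta> h)"
        using mult_left_mono[OF exp_add_exp_minus_ge[of "\<beta> * s * energy_form n \<theta> h"] weight_nonneg[of \<theta>]]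
        by (simp add: power_mult_distrib algebra_simps)
    qed (use int1 intB in \<open>auto intro!: Bochner_Integration.integrable_add intE[of "- \<beta> * s", simplified] intE[of "\<beta>
        * s", simplified]\<close>)
    then have "2 * mass + (\<beta> * s)\<^sup>2 / 2 * q \<le> 2 * (exp (\<beta> / 2 * (s\<^sup>2 * E)) * mass)"
      using dom[of s] dom[of "- s"] int1 intB intE[of "- \<beta> * s"] intE[of "\<beta> * s"]
      by (simp add: mass_def q_def)
    then show ?thesis by (simp add: field_simps)
  qed
  have E: "0 \<le> E" unfolding E_def by (rule torus_energy_nonneg)
  have "q \<le> 4 * E / \<beta> * mass"
  proof (cases "E = 0")
    case True
    then show ?thesis using main[of 1] \<beta>_pos by (simp add: zero_le_mult_iff mult_le_0_iff)
  next
    case False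
    \<comment> \<open>Chosen so that the exponent on the right of \<open>main\<close> equals 1,
      after which exp 1 - 1 \<le> 2 suffices.\<close>
    define s where "s = sqrt (2 / (\<beta> * E))"
    have s2: "s\<^sup>2 = 2 / (\<beta> * E)" using E \<beta>_pos by (simp add: s_def)
    have "(\<beta> * s)\<^sup>2 / 4 * q \<le> (exp 1 - 1) * mass"
      using main[of s] False \<beta>_pos by (simp add: s2)
    also have "\<dots> \<le> 2 * mass" using exp_le mass_pos by (intro mult_right_mono) auto
    finally have "(\<beta> * s)\<^sup>2 / 4 * q \<le> 2 * mass" .
    moreover have "(\<beta> * s)\<^sup>2 / 4 = \<beta> / (2 * E)"
      using False \<beta>_pos s2 by (simp add: power_mult_distrib power2_eq_square[of \<beta>])
    ultimately have "\<beta> / (2 * E) * q \<le> 2 * mass" by simp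
    then show ?thesis using False E \<beta>_pos by (simp add: field_simps)
  qed
  then show ?thesis by (simp add: q_def E_def)
qed

end

context torus_spins
begin

lemma zero_mem: "0 \<in> torus n"
  using n_ge by (simp add: torus_def zero_prod_def)

text \<open>
  Duality: for \<open>Y = (\<Sum>x. r x * X x)\<close> with \<open>X x = (\<theta> x - \<theta> 0) \<bullet> b\<close>, the second moment bound is applied to the
  gradient of \<open>g x = E (X x * Y)\<close>, so that no Poisson equation has to be solved.
\<close>

lemma infrared_coordinate:
  assumes b: "norm b = 1" and A_nonneg: "0 \<le> A"
    and A: "\<And>h :: int \<times> int \<Rightarrow> real. h 0 = 0 \<Longrightarrow> (\<Sum>x\<in>torus n. r x * h x)\<^sup>2 \<le> A * torus_energy n h"
  shows "(\<integral>\<theta>. weight \<theta> * (\<Sum>x\<in>torus n. r x * ((\<theta> x - \<theta> 0) \<bullet> b))\<^sup>2 \<partial>reference) \<le> 4 * A / \<beta> * mass"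
proof -
  note [measurable] = linear_field_measurable
  define X where "X x \<theta> = (\<theta> x - \<theta> 0) \<bullet> b" for x and \<theta> :: "int \<times> int \<Rightarrow> 'a"
  define Y where "Y \<theta> = (\<Sum>x\<in>torus n. r x * X x \<theta>)" for \<theta>
  define g where "g x = (\<integral>\<theta>. weight \<theta> * (X x \<theta> * Y \<theta>) \<partial>reference)" for x
  define S where "S = (\<integral>\<theta>. weight \<theta> * (Y \<theta>)\<^sup>2 \<partial>reference)"
  define K where "K = 2 * (\<Sum>x\<in>torus n. \<bar>r x\<bar>)"
  have X_meas [measurable]: "X x \<in> borel_measurable reference" if "x \<in> torus n" for x
    unfolding X_def[abs_def] using that zero_mem
    by (intro borel_measurable_inner borel_measurable_diff component_measurable) auto
  have Y_meas [measurable]: "Y \<in> borel_measurable reference"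
    unfolding Y_def[abs_def] by measurable
  have AE_X: "AE \<theta> in reference. \<forall>x\<in>torus n. \<bar>X x \<theta>\<bar> \<le> 2"
    using AE_reference
  proof eventually_elim
    case (elim \<theta>)
    show ?case
    proof
      fix x assume x: "x \<in> torus n"
      have "\<bar>X x \<theta>\<bar> \<le> norm (\<theta> x - \<theta> 0) * norm b" unfolding X_def by (rule Cauchy_Schwarz_ineq2)
      also have "\<dots> \<le> norm (\<theta> x) + norm (\<theta> 0)" using b norm_triangle_ineq4[of "\<theta> x" "\<theta> 0"] by simp
      also have "\<dots> \<le> 2" using elim[THEN bspec, OF x] elim[THEN bspec, OF zero_mem] by simp
      finally show "\<bar>X x \<theta>\<bar> \<le> 2" .
    qed
  qed
  then have AE_Y: "AE \<theta> in reference. \<bar>Y \<theta>\<bar> \<le> K"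
  proof eventually_elim
    case (elim \<theta>)
    have "\<bar>Y \<theta>\<bar> \<le> (\<Sum>x\<in>torus n. \<bar>r x * X x \<theta>\<bar>)" unfolding Y_def by (rule sum_abs)
    also have "\<dots> \<le> (\<Sum>x\<in>torus n. \<bar>r x\<bar> * 2)" using elim by (intro sum_mono) (auto simp: abs_mult mult_left_mono)
    finally show ?case by (simp add: K_def sum_distrib_left mult.commute)
  qed
  have int_XY: "integrable reference (\<lambda>\<theta>. weight \<theta> * (X x \<theta> * Y \<theta>))" if "x \<in> torus n" for x
  proof (rule integrable_weight_mult)
    show "AE \<theta> in reference. \<bar>X x \<theta> * Y \<theta>\<bar> \<le> 2 * K"
      using AE_X AE_Y by eventually_elim (use that in \<open>auto simp: abs_mult intro!: mult_mono\<close>)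
  qed (use that in measurable)
  have int_Y2: "integrable reference (\<lambda>\<theta>. weight \<theta> * (Y \<theta>)\<^sup>2)"
  proof (rule integrable_weight_mult)
    show "AE \<theta> in reference. \<bar>(Y \<theta>)\<^sup>2\<bar> \<le> K\<^sup>2"
      using AE_Y by eventually_elim (simp add: abs_le_square_iff[symmetric])
  qed measurable
  have Sg: "S = (\<Sum>x\<in>torus n. r x * g x)"
  proof -
    have "weight \<theta> * (Y \<theta>)\<^sup>2 = (\<Sum>x\<in>torus n. r x * (weight \<theta> * (X x \<theta> * Y \<theta>)))" for \<theta>
    proof -
      have "(\<Sum>x\<in>torus n. r x * (weight \<theta> * (X x \<theta> * Y \<theta>))) = weight \<theta> * ((\<Sum>x\<in>torus n. r x * X x \<theta>) * Y \<theta>)"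
        by (simp add: sum_distrib_left sum_distrib_right mult_ac)
      then show ?thesis by (simp add: Y_def[symmetric] power2_eq_square)
    qed
    then show ?thesis unfolding S_def g_def using int_XY by simp
  qed
  let ?B = "\<lambda>\<theta>. energy_form n \<theta> (\<lambda>x. g x *\<^sub>R b)"
  have B_eq: "?B \<theta> = (\<Sum>x\<in>torus n. \<Sum>y\<in>torus n. if torus_adj n x y then (X x \<theta> - X y \<theta>) * (g x - g y) else 0) / 2" for \<theta>
  proof -
    have "(\<theta> x - \<theta> y) \<bullet> (g x *\<^sub>R b - g y *\<^sub>R b) = (X x \<theta> - X y \<theta>) * (g x - g y)" for x y
      unfolding X_def inner_diff_left[symmetric] scaleR_diff_left[symmetric] by simp
    then show ?thesis unfolding energy_form_def by (simp only:)
  qed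
  have E_eq: "torus_energy n (\<lambda>x. g x *\<^sub>R b) = torus_energy n g"
    unfolding energy_form_def using b
    by (simp add: scaleR_diff_left[symmetric] norm_eq_1 cong: if_cong)
  \<comment> \<open>By linearity: \<open>g x\<close> is the weighted integral of
    \<open>X x * Y\<close>, so pairing \<open>Y\<close> with the linear field of \<open>g\<close>
    reproduces the Dirichlet energy of \<open>g\<close>.\<close>
  have E_int: "torus_energy n g = (\<integral>\<theta>. weight \<theta> * (?B \<theta> * Y \<theta>) \<partial>reference)"
  proof -
    have "(\<integral>\<theta>. weight \<theta> * (?B \<theta> * Y \<theta>) \<partial>reference)
      = (\<integral>\<theta>. (\<Sum>x\<in>torus n. \<Sum>y\<in>torus n. (if torus_adj n x y then g x - g y else 0) / 2 *
            (weight \<theta> * (X x \<theta> * Y \<theta>) - weight \<theta> * (X y \<theta> * Y \<theta>))) \<partial>reference)"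
      unfolding B_eq sum_divide_distrib sum_distrib_left sum_distrib_right
      by (intro Bochner_Integration.integral_cong sum.cong refl) (simp add: algebra_simps)
    also have "\<dots> = (\<Sum>x\<in>torus n. \<Sum>y\<in>torus n. (if torus_adj n x y then g x - g y else 0) / 2 * (g x - g y))"
      using int_XY by (simp add: g_def)
    also have "\<dots> = torus_energy n g"
      unfolding energy_form_def sum_divide_distrib by (intro sum.cong refl) auto
    finally show ?thesis by simp
  qed
  let ?L = "\<Sum>x\<in>torus n. \<Sum>y\<in>torus n. norm (g x *\<^sub>R b - g y *\<^sub>R b)"
  have "(\<integral>\<theta>. weight \<theta> * (?B \<theta> * Y \<theta>) \<partial>reference)\<^sup>2
      \<le> (\<integral>\<theta>. weight \<theta> * (?B \<theta>)\<^sup>2 \<partial>reference) * (\<integral>\<theta>. weight \<theta> * (Y \<theta>)\<^sup>2 \<partial>reference)"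
  proof (rule weighted_Cauchy_Schwarz[OF weight_nonneg _ int_Y2])
    show "integrable reference (\<lambda>\<theta>. weight \<theta> * (?B \<theta>)\<^sup>2)"
    proof (rule integrable_weight_mult)
      show "AE \<theta> in reference. \<bar>(?B \<theta>)\<^sup>2\<bar> \<le> ?L\<^sup>2"
        using AE_linear_field_bound[of "\<lambda>x. g x *\<^sub>R b"] by eventually_elim (simp add: abs_le_square_iff[symmetric])
    qed measurable
    show "integrable reference (\<lambda>\<theta>. weight \<theta> * (?B \<theta> * Y \<theta>))"
    proof (rule integrable_weight_mult)
      show "AE \<theta> in reference. \<bar>?B \<theta> * Y \<theta>\<bar> \<le> ?L * K"
        using AE_linear_field_bound[of "\<lambda>x. g x *\<^sub>R b"] AE_Y
        by eventually_elim (auto simp: abs_mult intro!: mult_mono sum_nonneg)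
    qed measurable
  qed
  also have "\<dots> \<le> (4 * torus_energy n g / \<beta> * mass) * S"
    using linear_field_second_moment[of "\<lambda>x. g x *\<^sub>R b"] weight_nonneg
    by (intro mult_mono) (auto simp: E_eq S_def intro!: integral_nonneg_AE mult_nonneg_nonneg divide_nonneg_pos
       torus_energy_nonneg \<beta>_pos less_imp_le[OF mass_pos] AE_I2)
  finally have E2: "(torus_energy n g)\<^sup>2 \<le> (4 * torus_energy n g / \<beta> * mass) * S" by (simp add: E_int)
  have S_nonneg: "0 \<le> S" unfolding S_def using weight_nonneg by (intro integral_nonneg_AE) simp
  have g0: "g 0 = 0" by (simp add: g_def X_def)
  have "(\<Sum>x\<in>torus n. r x * (if x = 0 then 0 else g x))\<^sup>2 \<le> A * torus_energy n (\<lambda>x. if x = 0 then 0 else g x)"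
    by (rule A) simp
  moreover have "(if x = 0 then 0 else g x) = g x" for x using g0 by simp
  ultimately have S2: "S\<^sup>2 \<le> A * torus_energy n g" by (simp only: Sg)
  \<comment> \<open>\<open>E2\<close> loses one factor of the energy here. Together with
    \<open>S2\<close>, where the square of \<open>S\<close> is at most \<open>A\<close> times the
    energy, the energy and then one factor of \<open>S\<close> are eliminated.\<close>
  have E_le: "torus_energy n g \<le> 4 / \<beta> * mass * S"
  proof (cases "torus_energy n g = 0")
    case True
    then show ?thesis using S_nonneg mass_pos \<beta>_pos by simp
  next
    case False
    then have "torus_energy n g > 0" using torus_energy_nonneg[of n g] by linarith
    moreover have "torus_energy n g * torus_energy n g \<le> torus_energy n g * (4 / \<beta> * mass * S)"
      using E2 by (simp add: power2_eq_square mult_ac)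
    ultimately show ?thesis by (simp only: mult_le_cancel_left_pos)
  qed
  have "S \<le> 4 * A / \<beta> * mass"
  proof (cases "S = 0 \<and> A \<ge> 0")
    case True
    then show ?thesis using mass_pos \<beta>_pos by simp
  next
    case False
    then have "S > 0" using S_nonneg A_nonneg by auto
    have "S * S \<le> A * (4 / \<beta> * mass * S)"
      using S2 mult_left_mono[OF E_le A_nonneg] by (simp add: power2_eq_square)
    then have "S * S \<le> S * (4 * A / \<beta> * mass)" by (simp add: mult_ac)
    then show ?thesis using \<open>S > 0\<close> by (simp only: mult_le_cancel_left_pos)
  qed
  then show ?thesis by (simp add: S_def Y_def X_def)
qed

lemma infrared_bound:
  fixes A :: real
  assumes A_nonneg: "0 \<le> A"
    and A: "\<And>h :: int \<times> int \<Rightarrow> real. h 0 = 0 \<Longrightarrow> (\<Sum>x\<in>torus n. r x * h x)\<^sup>2 \<le> A * torus_energy n h"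
  shows "(\<integral>\<theta>. weight \<theta> * (norm (\<Sum>x\<in>torus n. r x *\<^sub>R (\<theta> x - \<theta> 0)))\<^sup>2 \<partial>reference) \<le> 4 * real DIM('a) * A / \<beta> * mass"
proof -
  have eq: "(norm (\<Sum>x\<in>torus n. r x *\<^sub>R (\<theta> x - \<theta> 0)))\<^sup>2 = (\<Sum>b\<in>Basis. (\<Sum>x\<in>torus n. r x * ((\<theta> x - \<theta> 0) \<bullet> b))\<^sup>2)"
    for \<theta> :: "int \<times> int \<Rightarrow> 'a"
    by (subst power2_norm_eq_inner, subst euclidean_inner) (simp add: power2_eq_square inner_sum_left)
  have int: "integrable reference (\<lambda>\<theta>. weight \<theta> * (\<Sum>x\<in>torus n. r x * ((\<theta> x - \<theta> 0) \<bullet> b))\<^sup>2)" if "b \<in> Basis" for b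
  proof (rule integrable_weight_mult)
    show "AE \<theta> in reference. \<bar>(\<Sum>x\<in>torus n. r x * ((\<theta> x - \<theta> 0) \<bullet> b))\<^sup>2\<bar> \<le> (\<Sum>x\<in>torus n. \<bar>r x\<bar> * 2)\<^sup>2"
      using AE_reference
    proof eventually_elim
      case (elim \<theta>)
      have "\<bar>\<Sum>x\<in>torus n. r x * ((\<theta> x - \<theta> 0) \<bullet> b)\<bar> \<le> (\<Sum>x\<in>torus n. \<bar>r x\<bar> * 2)"
      proof (rule order_trans[OF sum_abs], intro sum_mono)
        fix x assume x: "x \<in> torus n"
        have "\<bar>(\<theta> x - \<theta> 0) \<bullet> b\<bar> \<le> norm (\<theta> x - \<theta> 0) * norm b" by (rule Cauchy_Schwarz_ineq2)
        also have "\<dots> \<le> norm (\<theta> x) + norm (\<theta> 0)" using that norm_triangle_ineq4[of "\<theta> x" "\<theta> 0"] by simp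
        also have "\<dots> \<le> 2" using elim[THEN bspec, OF x] elim[THEN bspec, OF zero_mem] by simp
        finally show "\<bar>r x * ((\<theta> x - \<theta> 0) \<bullet> b)\<bar> \<le> \<bar>r x\<bar> * 2" by (simp add: abs_mult mult_left_mono)
      qed
      then show ?case by (simp add: abs_le_square_iff[symmetric])
    qed
    show "(\<lambda>\<theta>. (\<Sum>x\<in>torus n. r x * ((\<theta> x - \<theta> 0) \<bullet> b))\<^sup>2) \<in> borel_measurable reference"
      using zero_mem by (intro borel_measurable_power borel_measurable_sum borel_measurable_times borel_measurable_inner
        borel_measurable_diff component_measurable borel_measurable_const) auto
  qed
  have "(\<integral>\<theta>. weight \<theta> * (norm (\<Sum>x\<in>torus n. r x *\<^sub>R (\<theta> x - \<theta> 0)))\<^sup>2 \<partial>reference)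
     = (\<Sum>b\<in>Basis. \<integral>\<theta>. weight \<theta> * (\<Sum>x\<in>torus n. r x * ((\<theta> x - \<theta> 0) \<bullet> b))\<^sup>2 \<partial>reference)"
    unfolding eq sum_distrib_left using int by (rule Bochner_Integration.integral_sum)
  also have "\<dots> \<le> (\<Sum>b\<in>(Basis :: 'a set). 4 * A / \<beta> * mass)"
    by (intro sum_mono infrared_coordinate A_nonneg A) auto
  finally show ?thesis by (simp add: mult_ac)
qed

end

section \<open>Dirichlet forms on the lattice\<close>

definition l1_norm :: "int \<times> int \<Rightarrow> nat" where
  "l1_norm x = nat (\<bar>fst x\<bar> + \<bar>snd x\<bar>)"

definition l1_ball :: "nat \<Rightarrow> (int \<times> int) set" where
  "l1_ball R = {x. l1_norm x \<le> R}"

lemma neighbours_commute: "y \<in> neighbours x \<longleftrightarrow> x \<in> neighbours y"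
  by (auto simp: neighbours_def abs_minus_commute)

lemma l1_norm_0 [simp]: "l1_norm 0 = 0"
  by (simp add: l1_norm_def)

lemma l1_norm_eq_0_iff [simp]: "l1_norm x = 0 \<longleftrightarrow> x = 0"
  by (auto simp: l1_norm_def prod_eq_iff)

lemma l1_norm_neighbours: "y \<in> neighbours x \<Longrightarrow> l1_norm y = Suc (l1_norm x) \<or> l1_norm x = Suc (l1_norm y)"
proof -
  assume "y \<in> neighbours x"
  then have "int (l1_norm y) = int (l1_norm x) + 1 \<or> int (l1_norm x) = int (l1_norm y) + 1"
    by (auto simp: neighbours_eq l1_norm_def)
  then show ?thesis by linarith
qed

lemma l1_norm_neighbours_le: "y \<in> neighbours x \<Longrightarrow> l1_norm y \<le> Suc (l1_norm x)"
  using l1_norm_neighbours[of y x] by auto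

lemma l1_closer_neighbour:
  assumes "l1_norm x = Suc d"
  shows "\<exists>w\<in>neighbours x. l1_norm w = d"
proof -
  have "\<bar>fst x\<bar> + \<bar>snd x\<bar> = int (Suc d)" using assms by (simp add: l1_norm_def)
  then obtain w where "w \<in> neighbours x" "\<bar>fst w\<bar> + \<bar>snd w\<bar> = int d"
    using exists_closer_neighbour by blast
  then show ?thesis by (intro bexI[of _ w]) (auto simp: l1_norm_def)
qed

lemma finite_l1_ball [simp]: "finite (l1_ball R)"
proof (rule finite_subset)
  show "l1_ball R \<subseteq> {- int R..int R} \<times> {- int R..int R}"
    by (auto simp: l1_ball_def l1_norm_def)
qed simp

lemma card_l1_sphere: "card {x. l1_norm x = k} \<le> 6 * Suc k"
proof -
  let ?f = "\<lambda>(i, s :: int). (i, s * (int k - \<bar>i\<bar>))"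
  have "{x. l1_norm x = k} \<subseteq> ?f ` ({- int k..int k} \<times> {1, - 1})"
  proof
    fix x assume "x \<in> {x. l1_norm x = k}"
    then have x: "\<bar>fst x\<bar> + \<bar>snd x\<bar> = int k" by (auto simp: l1_norm_def)
    then have "x = ?f (fst x, if snd x \<ge> 0 then 1 else - 1)" by (auto simp: prod_eq_iff)
    moreover have "(fst x, if snd x \<ge> 0 then 1 else - 1 :: int) \<in> {- int k..int k} \<times> {1, - 1}"
      using x by auto
    ultimately show "x \<in> ?f ` ({- int k..int k} \<times> {1, - 1})" by blast
  qed
  then have "card {x. l1_norm x = k} \<le> card (?f ` ({- int k..int k} \<times> {1, - 1 :: int}))"
    by (intro card_mono) auto
  also have "\<dots> \<le> card ({- int k..int k} \<times> {1, - 1 :: int})" by (intro card_image_le) auto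
  also have "\<dots> \<le> 6 * Suc k" by (simp add: card_cartesian_product)
  finally show ?thesis .
qed

text \<open>Reverses all directed edges. The two finite windows may differ as long as edges leaving
  them carry the value 0.\<close>

lemma sum_neighbours_swap:
  fixes f :: "int \<times> int \<Rightarrow> int \<times> int \<Rightarrow> real"
  assumes fin: "finite S" "finite S'"
    and "\<And>x y. x \<in> S \<Longrightarrow> y \<in> neighbours x \<Longrightarrow> y \<notin> S' \<Longrightarrow> f x y = 0"
    and "\<And>x y. y \<in> S' \<Longrightarrow> x \<in> neighbours y \<Longrightarrow> x \<notin> S \<Longrightarrow> f x y = 0"
  shows "(\<Sum>x\<in>S. \<Sum>y\<in>neighbours x. f x y) = (\<Sum>y\<in>S'. \<Sum>x\<in>neighbours y. f x y)"
proof -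
  have "(\<Sum>x\<in>S. \<Sum>y\<in>neighbours x. f x y) = (\<Sum>(x, y)\<in>(SIGMA x:S. neighbours x). f x y)"
    using fin by (subst sum.Sigma) auto
  also have "\<dots> = (\<Sum>(x, y)\<in>{(x, y). x \<in> S \<and> y \<in> S' \<and> y \<in> neighbours x}. f x y)"
    using fin assms(3) by (intro sum.mono_neutral_right) auto
  also have "\<dots> = (\<Sum>(y, x)\<in>{(y, x). x \<in> S \<and> y \<in> S' \<and> y \<in> neighbours x}. f x y)"
    by (rule sum.reindex_bij_witness[of _ prod.swap prod.swap]) auto
  also have "\<dots> = (\<Sum>(y, x)\<in>(SIGMA y:S'. neighbours y). f x y)"
  proof (rule sum.mono_neutral_left)
    show "\<forall>p\<in>(SIGMA y:S'. neighbours y) - {(y, x). x \<in> S \<and> y \<in> S' \<and> y \<in> neighbours x}. (case p of (y, x) \<Rightarrow> f x y) = 0"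
    proof
      fix p assume p: "p \<in> (SIGMA y:S'. neighbours y) - {(y, x). x \<in> S \<and> y \<in> S' \<and> y \<in> neighbours x}"
      obtain y x where [simp]: "p = (y, x)" by (cases p)
      have "y \<in> S'" "x \<in> neighbours y" "x \<notin> S" using p neighbours_commute[of x y] by auto
      then show "(case p of (y, x) \<Rightarrow> f x y) = 0" using assms(4) by simp
    qed
  qed (use fin neighbours_commute in auto)
  also have "\<dots> = (\<Sum>y\<in>S'. \<Sum>x\<in>neighbours y. f x y)"
    using fin by (subst sum.Sigma) auto
  finally show ?thesis .
qed

text \<open>Directed edges starting in \<open>S\<close>: an edge inside \<open>S\<close> has weight
  1, one leaving \<open>S\<close> has weight 1/2. For functions supported away from the boundary
  this is the full Dirichlet form.\<close>

definition lattice_form :: "(int \<times> int) set \<Rightarrow> (int \<times> int \<Rightarrow> real) \<Rightarrow> (int \<times> int \<Rightarrow> real) \<Rightarrow> real" where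
  "lattice_form S g h = (\<Sum>x\<in>S. \<Sum>y\<in>neighbours x. (g x - g y) * (h x - h y)) / 2"

lemma lattice_form_nonneg: "0 \<le> lattice_form S h h"
  unfolding lattice_form_def by (auto intro!: sum_nonneg divide_nonneg_nonneg)

lemma lattice_form_by_parts:
  assumes S: "finite S" and supp: "\<And>x. h x \<noteq> 0 \<Longrightarrow> x \<in> S \<and> neighbours x \<subseteq> S"
  shows "lattice_form S g h = - (\<Sum>x\<in>S. h x * laplacian g x)"
proof -
  have "(\<Sum>x\<in>S. \<Sum>y\<in>neighbours x. (g x - g y) * h y) = (\<Sum>y\<in>S. \<Sum>x\<in>neighbours y. (g x - g y) * h y)"
    using S supp by (intro sum_neighbours_swap) auto
  also have "\<dots> = (\<Sum>x\<in>S. h x * laplacian g x)"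
    by (simp add: laplacian_def sum_distrib_left mult.commute)
  finally have 1: "(\<Sum>x\<in>S. \<Sum>y\<in>neighbours x. (g x - g y) * h y) = (\<Sum>x\<in>S. h x * laplacian g x)" .
  have 2: "(\<Sum>x\<in>S. \<Sum>y\<in>neighbours x. (g x - g y) * h x) = - (\<Sum>x\<in>S. h x * laplacian g x)"
    unfolding sum_negf[symmetric] laplacian_def sum_distrib_left
    by (intro sum.cong refl) (simp add: algebra_simps)
  have "(\<Sum>x\<in>S. \<Sum>y\<in>neighbours x. (g x - g y) * (h x - h y))
     = (\<Sum>x\<in>S. \<Sum>y\<in>neighbours x. (g x - g y) * h x) - (\<Sum>x\<in>S. \<Sum>y\<in>neighbours x. (g x - g y) * h y)"
    by (simp add: right_diff_distrib sum_subtractf)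
  then show ?thesis by (simp add: lattice_form_def 1 2)
qed

lemma lattice_form_Cauchy_Schwarz: "(lattice_form S g h)\<^sup>2 \<le> lattice_form S g g * lattice_form S h h"
proof (cases "finite S")
  case True
  let ?A = "SIGMA x:S. neighbours x"
  have eq: "lattice_form S a b = (\<Sum>p\<in>?A. (a (fst p) - a (snd p)) * (b (fst p) - b (snd p))) / 2" for a b
    using True unfolding lattice_form_def by (subst sum.Sigma) (auto simp: split_beta)
  have "(\<Sum>p\<in>?A. (g (fst p) - g (snd p)) * (h (fst p) - h (snd p)))\<^sup>2
     \<le> (\<Sum>p\<in>?A. (g (fst p) - g (snd p))\<^sup>2) * (\<Sum>p\<in>?A. (h (fst p) - h (snd p))\<^sup>2)"
    by (rule Cauchy_Schwarz_ineq_sum)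
  then show ?thesis unfolding eq by (simp add: power2_eq_square field_simps)
qed (simp add: lattice_form_def)

text \<open>The Dirichlet energy of a finitely supported function, expressed without a window; any
  finite set containing the support and its neighbours computes it as a
  \<open>lattice_form\<close>.\<close>

definition lattice_energy :: "(int \<times> int \<Rightarrow> real) \<Rightarrow> real" where
  "lattice_energy h = - (\<Sum>x | h x \<noteq> 0. h x * laplacian h x)"

lemma lattice_energy_eq:
  assumes S: "finite S" and supp: "\<And>x. h x \<noteq> 0 \<Longrightarrow> x \<in> S \<and> neighbours x \<subseteq> S"
  shows "lattice_energy h = lattice_form S h h"
proof -
  have "(\<Sum>x | h x \<noteq> 0. h x * laplacian h x) = (\<Sum>x\<in>S. h x * laplacian h x)"
    using S supp by (intro sum.mono_neutral_left) auto
  then show ?thesis by (simp add: lattice_energy_def lattice_form_by_parts[OF assms])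
qed

lemma l1_ball_neighbours: "x \<in> l1_ball R \<Longrightarrow> neighbours x \<subseteq> l1_ball (Suc R)"
  by (auto simp: l1_ball_def dest!: l1_norm_neighbours_le)

lemma l1_ball_mono: "R \<le> R' \<Longrightarrow> l1_ball R \<subseteq> l1_ball R'"
  by (auto simp: l1_ball_def)

lemma lattice_energy_ball:
  assumes "\<And>x. h x \<noteq> 0 \<Longrightarrow> x \<in> l1_ball R"
  shows "lattice_energy h = lattice_form (l1_ball (Suc R)) h h"
  using assms l1_ball_neighbours l1_ball_mono[of R "Suc R"] by (intro lattice_energy_eq) auto

section \<open>Recurrence: cutoffs of small energy\<close>

text \<open>
  The cutoff is radial with increments proportional to \<open>1 / k\<close>; its energy is of the order of the inverse of a
  partial sum of the harmonic series.
\<close>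

lemma exists_cutoff:
  assumes "\<epsilon> > 0"
  obtains \<psi> R where "\<And>x. \<psi> x \<noteq> 0 \<Longrightarrow> x \<in> l1_ball R" "\<And>x. x \<in> l1_ball \<rho> \<Longrightarrow> \<psi> x = 1"
    "\<And>x. 0 \<le> \<psi> x" "\<And>x. \<psi> x \<le> 1" "lattice_energy \<psi> \<le> \<epsilon>"
proof -
  define w where "w k = 1 / real (Suc k)" for k
  define S where "S K = (\<Sum>k\<in>{\<rho>..<K}. w k)" for K
  have w_pos: "0 < w k" for k by (simp add: w_def)
  \<comment> \<open>24 is 4 * 6. Charging each edge difference to its inner endpoint bounds the
    energy by four times the sum of squared radial increments over lattice points, and the sphere of
    radius k has at most 6 (k + 1) points.\<close>
  have "\<exists>K. 24 / \<epsilon> < S K \<and> \<rho> \<le> K"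
  proof (rule ccontr)
    assume "\<not> ?thesis"
    then have bound: "S K \<le> 24 / \<epsilon>" if "\<rho> \<le> K" for K using that by force
    have "summable (\<lambda>k. w (k + \<rho>))"
    proof (rule summableI_nonneg_bounded)
      show "(\<Sum>i<K. w (i + \<rho>)) \<le> 24 / \<epsilon>" for K
        using bound[of "K + \<rho>"] sum.shift_bounds_nat_ivl[of w 0 \<rho> K]
        by (simp add: S_def atLeast0LessThan)
    qed (use w_pos less_imp_le in auto)
    then have "summable w" by simp
    then have "summable (\<lambda>k. inverse (real k))"
      by (subst summable_Suc_iff[symmetric]) (simp add: w_def[abs_def] inverse_eq_divide)
    then show False using not_summable_harmonic[where 'a = real] by simp
  qed
  then obtain K where K: "24 / \<epsilon> < S K" "\<rho> \<le> K" by blast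
  define s where "s = S K"
  have s: "24 / \<epsilon> < s" "0 < s" using K assms by (auto simp: s_def intro: order.strict_trans[of 0 "24 / \<epsilon>"])
  define F where "F k = (\<Sum>j\<in>{max k \<rho>..<K}. w j) / s" for k
  define D where "D k = (if \<rho> \<le> k \<and> k < K then w k / s else 0)" for k
  have step: "F k = D k + F (Suc k)" for k
  proof (cases "\<rho> \<le> k \<and> k < K")
    case True
    then have "{max k \<rho>..<K} = insert k {max (Suc k) \<rho>..<K}" by auto
    then show ?thesis using True by (simp add: F_def D_def add_divide_distrib)
  next
    case False
    then have "{max k \<rho>..<K} = {max (Suc k) \<rho>..<K}" by auto
    then show ?thesis using False by (auto simp: F_def D_def)
  qed
  define \<psi> where "\<psi> x = F (l1_norm x)" for x
  have F_le: "F k \<le> 1" for k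
  proof -
    have "(\<Sum>j\<in>{max k \<rho>..<K}. w j) \<le> s"
      unfolding s_def S_def using w_pos by (intro sum_mono2) (auto simp: less_imp_le)
    then show ?thesis using s by (simp add: F_def)
  qed
  have F_nonneg: "0 \<le> F k" for k
    unfolding F_def using s w_pos by (auto intro!: divide_nonneg_pos sum_nonneg simp: less_imp_le)
  have supp: "x \<in> l1_ball K" if "\<psi> x \<noteq> 0" for x
  proof (rule ccontr)
    assume "x \<notin> l1_ball K"
    then have "K \<le> max (l1_norm x) \<rho>" by (auto simp: l1_ball_def)
    then show False using that by (simp add: \<psi>_def F_def)
  qed
  have one: "\<psi> x = 1" if "x \<in> l1_ball \<rho>" for x
    using that s by (simp add: \<psi>_def F_def l1_ball_def max_def s_def S_def)
  let ?d = "\<lambda>x. (D (l1_norm x))\<^sup>2"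
  have D_sum: "(\<Sum>x\<in>l1_ball (Suc (Suc K)). ?d x) \<le> 6 / s"
  proof -
    have "(\<Sum>x\<in>l1_ball (Suc (Suc K)). ?d x) = (\<Sum>k\<in>{..Suc (Suc K)}. \<Sum>x | x \<in> l1_ball (Suc (Suc K)) \<and> l1_norm x = k. ?d x)"
      by (rule sum.group[symmetric]) (simp_all, auto simp: l1_ball_def)
    also have "\<dots> = (\<Sum>k\<in>{..Suc (Suc K)}. real (card {x. l1_norm x = k}) * (D k)\<^sup>2)"
    proof (intro sum.cong refl)
      fix k assume "k \<in> {..Suc (Suc K)}"
      then have "{x. x \<in> l1_ball (Suc (Suc K)) \<and> l1_norm x = k} = {x. l1_norm x = k}" by (auto simp: l1_ball_def)
      then show "(\<Sum>x | x \<in> l1_ball (Suc (Suc K)) \<and> l1_norm x = k. ?d x) = real (card {x. l1_norm x = k}) * (D k)\<^sup>2"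
        by simp
    qed
    also have "\<dots> \<le> (\<Sum>k\<in>{..Suc (Suc K)}. real (6 * Suc k) * (D k)\<^sup>2)"
      using card_l1_sphere by (intro sum_mono mult_right_mono) (simp_all only: of_nat_le_iff zero_le_power2)
    also have "\<dots> = (\<Sum>k\<in>{..Suc (Suc K)}. 6 * (if \<rho> \<le> k \<and> k < K then w k / s\<^sup>2 else 0))"
    proof (intro sum.cong refl)
      fix k
      \<comment> \<open>The growth of the spheres cancels one of the two factors \<open>w k\<close>,
        so that the harmonic sum \<open>s\<close> appears again and one power of it cancels.\<close>
      have "real (Suc k) * w k = 1" by (simp add: w_def)
      then have "real (6 * Suc k) * (w k / s)\<^sup>2 = 6 * (w k / s\<^sup>2)"
        by (simp only: of_nat_mult of_nat_numeral power_divide power2_eq_square[of "w k"]) (simp del: of_nat_Suc)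
      then show "real (6 * Suc k) * (D k)\<^sup>2 = 6 * (if \<rho> \<le> k \<and> k < K then w k / s\<^sup>2 else 0)"
        by (simp add: D_def del: of_nat_Suc of_nat_mult)
    qed
    also have "\<dots> = 6 * (\<Sum>k\<in>{\<rho>..<K}. w k / s\<^sup>2)"
      unfolding sum_distrib_left[symmetric]
      by (intro arg_cong[where f = "(*) 6"] sum.mono_neutral_cong_right) auto
    also have "\<dots> = 6 / s"
      using s by (simp add: sum_divide_distrib[symmetric] s_def S_def power2_eq_square)
    finally show ?thesis .
  qed
  have "lattice_energy \<psi> = lattice_form (l1_ball (Suc K)) \<psi> \<psi>"
    by (rule lattice_energy_ball) (rule supp)
  also have "\<dots> \<le> (\<Sum>x\<in>l1_ball (Suc K). \<Sum>y\<in>neighbours x. ?d x + ?d y) / 2"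
    unfolding lattice_form_def
  proof (intro divide_right_mono sum_mono)
    fix x y assume "y \<in> neighbours x"
    then consider "l1_norm y = Suc (l1_norm x)" | "l1_norm x = Suc (l1_norm y)" using l1_norm_neighbours by blast
    then show "(\<psi> x - \<psi> y) * (\<psi> x - \<psi> y) \<le> ?d x + ?d y"
    proof cases
      case 1
      then have "\<psi> x - \<psi> y = D (l1_norm x)" using step[of "l1_norm x"] by (simp add: \<psi>_def)
      then show ?thesis by (simp add: power2_eq_square)
    next
      case 2
      then have "\<psi> x - \<psi> y = - D (l1_norm y)" using step[of "l1_norm y"] by (simp add: \<psi>_def)
      then show ?thesis by (simp add: power2_eq_square)
    qed
  qed simp
  also have "(\<Sum>x\<in>l1_ball (Suc K). \<Sum>y\<in>neighbours x. ?d x + ?d y)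
      = 4 * (\<Sum>x\<in>l1_ball (Suc K). ?d x) + (\<Sum>x\<in>l1_ball (Suc K). \<Sum>y\<in>neighbours x. ?d y)"
    by (simp add: sum.distrib sum_distrib_left)
  also have "(\<Sum>x\<in>l1_ball (Suc K). \<Sum>y\<in>neighbours x. ?d y)
      = (\<Sum>y\<in>l1_ball (Suc (Suc K)). \<Sum>x\<in>neighbours y. if x \<in> l1_ball (Suc K) then ?d y else 0)"
  proof -
    have "(\<Sum>x\<in>l1_ball (Suc K). \<Sum>y\<in>neighbours x. ?d y)
        = (\<Sum>x\<in>l1_ball (Suc K). \<Sum>y\<in>neighbours x. if x \<in> l1_ball (Suc K) then ?d y else 0)"
      by (intro sum.cong refl) simp
    also have "\<dots> = (\<Sum>y\<in>l1_ball (Suc (Suc K)). \<Sum>x\<in>neighbours y. if x \<in> l1_ball (Suc K) then ?d y else 0)"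
      using l1_ball_neighbours by (intro sum_neighbours_swap) auto
    finally show ?thesis .
  qed
  also have "(\<Sum>y\<in>l1_ball (Suc (Suc K)). \<Sum>x\<in>neighbours y. if x \<in> l1_ball (Suc K) then ?d y else 0)
      \<le> (\<Sum>y\<in>l1_ball (Suc (Suc K)). \<Sum>x\<in>neighbours y. ?d y)"
    by (intro sum_mono) simp
  also have "\<dots> = 4 * (\<Sum>y\<in>l1_ball (Suc (Suc K)). ?d y)" by (simp add: sum_distrib_left)
  also have "(\<Sum>x\<in>l1_ball (Suc K). ?d x) \<le> (\<Sum>x\<in>l1_ball (Suc (Suc K)). ?d x)"
    using l1_ball_mono[of "Suc K" "Suc (Suc K)"] by (intro sum_mono2) auto
  finally have "lattice_energy \<psi> \<le> 4 * (\<Sum>x\<in>l1_ball (Suc (Suc K)). ?d x)" by simp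
  also have "\<dots> \<le> 24 / s" using D_sum by simp
  also have "\<dots> \<le> \<epsilon>" using s assms by (simp add: field_simps)
  finally have "lattice_energy \<psi> \<le> \<epsilon>" .
  then show ?thesis using that[of \<psi> K] supp one F_le F_nonneg by (simp add: \<psi>_def)
qed

section \<open>The killed walk\<close>

lemma killed_walk_l1_norm: "killed_walk m x y \<noteq> 0 \<Longrightarrow> l1_norm x \<le> l1_norm y + m"
proof (induction m arbitrary: x)
  case (Suc m)
  then have "(\<Sum>z\<in>neighbours x. killed_walk m z y) \<noteq> 0" by (auto split: if_splits)
  then obtain z where z: "z \<in> neighbours x" "killed_walk m z y \<noteq> 0" by (meson sum.not_neutral_contains_not_neutral)
  then show ?case using Suc.IH[OF z(2)] l1_norm_neighbours[OF z(1)] by auto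
qed (auto split: if_splits)

text \<open>Recursion on the last step instead of the first. Together with the defining recursion it
  expresses reversibility of the killed walk.\<close>

lemma killed_walk_Suc_right:
  "killed_walk (Suc m) x y = (if y = 0 then 0 else (\<Sum>z\<in>neighbours y. killed_walk m x z) / 4)"
proof (induction m arbitrary: x)
  case 0
  show ?case
  proof (cases "x = 0 \<or> y = 0")
    case False
    have "(\<Sum>z\<in>neighbours x. killed_walk 0 z y) = (if y \<in> neighbours x then 1 else 0)"
    proof -
      have "(\<Sum>z\<in>neighbours x. killed_walk 0 z y) = (\<Sum>z\<in>neighbours x. if z = y then 1 else 0)"
        using False by (intro sum.cong refl) auto
      then show ?thesis by (simp add: sum.delta)
    qed
    moreover have "(\<Sum>z\<in>neighbours y. killed_walk 0 x z) = (if x \<in> neighbours y then 1 else 0)"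
      using False by (simp add: sum.delta)
    ultimately show ?thesis using False neighbours_commute[of x y] by simp
  qed auto
next
  case (Suc m)
  show ?case
  proof (cases "x = 0 \<or> y = 0")
    case False
    have "killed_walk (Suc (Suc m)) x y = (\<Sum>z\<in>neighbours x. killed_walk (Suc m) z y) / 4"
      using False by simp
    also have "\<dots> = (\<Sum>z\<in>neighbours x. (\<Sum>w\<in>neighbours y. killed_walk m z w) / 4) / 4"
      by (subst Suc.IH) (use False in simp)
    also have "\<dots> = (\<Sum>w\<in>neighbours y. (\<Sum>z\<in>neighbours x. killed_walk m z w) / 4) / 4"
      by (subst sum_divide_distrib[symmetric], subst sum_divide_distrib[symmetric], subst sum.swap) simp
    also have "\<dots> = (\<Sum>w\<in>neighbours y. killed_walk (Suc m) x w) / 4"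
      using False by simp
    finally show ?thesis using False by simp
  next
    case True
    then show ?thesis
    proof
      assume "x = 0" then show ?thesis by (simp del: killed_walk.simps)
    next
      assume "y = 0" then show ?thesis by (simp del: killed_walk.simps)
    qed
  qed
qed

text \<open>Both factors start at \<open>z\<close>; by reversibility the first is a path from
  \<open>x\<close> to \<open>z\<close>. The window must contain everything within \<open>j\<close>
  steps of \<open>x\<close>.\<close>

lemma killed_walk_Chapman_Kolmogorov:
  assumes "l1_norm x + j \<le> R"
  shows "(\<Sum>z\<in>l1_ball R. killed_walk j z x * killed_walk k z y) = killed_walk (j + k) x y"
  using assms
proof (induction j arbitrary: x)
  case 0
  have "(\<Sum>z\<in>l1_ball R. killed_walk 0 z x * killed_walk k z y) = (\<Sum>z\<in>l1_ball R. if z = x then killed_walk k x y else 0)"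
    by (intro sum.cong refl) auto
  also have "\<dots> = (if x \<in> l1_ball R then killed_walk k x y else 0)" by (rule sum.delta) simp
  also have "\<dots> = killed_walk k x y" using 0 by (simp add: l1_ball_def)
  finally show ?case by simp
next
  case (Suc j)
  show ?case
  proof (cases "x = 0")
    case False
    have "(\<Sum>z\<in>l1_ball R. killed_walk (Suc j) z x * killed_walk k z y)
        = (\<Sum>z\<in>l1_ball R. (\<Sum>w\<in>neighbours x. killed_walk j z w) / 4 * killed_walk k z y)"
      using False by (simp only: killed_walk_Suc_right if_False)
    also have "\<dots> = (\<Sum>w\<in>neighbours x. \<Sum>z\<in>l1_ball R. killed_walk j z w * killed_walk k z y) / 4"
      by (simp add: sum_divide_distrib sum_distrib_right) (rule sum.swap)
    also have "\<dots> = (\<Sum>w\<in>neighbours x. killed_walk (j + k) w y) / 4"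
      using Suc.prems by (intro arg_cong[where f
          = "\<lambda>x. x / 4"] sum.cong refl Suc.IH) (auto dest!: l1_norm_neighbours_le)
    finally show ?thesis using False by simp
  qed (simp del: killed_walk.simps)
qed

lemma summable_abs_comparison:
  fixes c a :: "nat \<Rightarrow> real"
  assumes "summable a" "\<And>j. \<bar>c j\<bar> \<le> a j"
  shows "(\<lambda>m. \<Sum>j. \<bar>c (j + 2 * m)\<bar>) \<longlonglongrightarrow> 0"
proof -
  have s: "summable (\<lambda>j. \<bar>c j\<bar>)"
    by (rule summable_comparison_test'[of a 0]) (simp_all add: assms)
  have "(\<lambda>m. \<Sum>j. \<bar>c (j + m)\<bar>) \<longlonglongrightarrow> 0"
    using suminf_exist_split[OF _ s]
    by (auto simp: LIMSEQ_iff)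
  moreover have "filterlim (\<lambda>m::nat. 2 * m) at_top at_top"
    by (rule filterlim_subseq) (simp add: strict_mono_def)
  ultimately show ?thesis by (rule filterlim_compose)
qed

section \<open>The killed transition semigroup acting on a finitely supported function\<close>

context
  fixes f :: "int \<times> int \<Rightarrow> real" and R0 :: nat
begin

definition evolved :: "nat \<Rightarrow> int \<times> int \<Rightarrow> real" where
  "evolved m z = (\<Sum>y\<in>l1_ball R0. f y * killed_walk m z y)"

definition walk_corr :: "nat \<Rightarrow> real" where
  "walk_corr m = (\<Sum>x\<in>l1_ball R0. \<Sum>y\<in>l1_ball R0. f x * f y * killed_walk m x y)"

text \<open>With P the killed transition operator, \<open>walk_corr m\<close> is the pairing of f
  with P^m f, and \<open>evolved m\<close> is P^m f. The Green energy of P^m f is a quarter of the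
  sum of the correlations from time 2m on; this is its absolute version, as correlations at odd
  times may be negative.\<close>

definition tail_green :: "nat \<Rightarrow> real" where
  "tail_green m = (\<Sum>j. \<bar>walk_corr (j + 2 * m)\<bar>) / 4"

lemma summable_walk_corr: "summable (\<lambda>j. \<bar>walk_corr j\<bar>)"
  and tail_green_tendsto: "tail_green \<longlonglongrightarrow> 0"
proof -
  let ?a = "\<lambda>j. \<Sum>x\<in>l1_ball R0. \<Sum>y\<in>l1_ball R0. \<bar>f x * f y\<bar> * killed_walk j x y"
  have a: "summable ?a"
    by (intro summable_sum summable_mult summable_killed_walk)
  have le: "\<bar>walk_corr j\<bar> \<le> ?a j" for j
    unfolding walk_corr_def
    by (intro order_trans[OF sum_abs] sum_mono) (simp add: abs_mult killed_walk_nonneg)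
  show "summable (\<lambda>j. \<bar>walk_corr j\<bar>)"
    by (rule summable_comparison_test'[OF a, of 0]) (simp add: le)
  have "(\<lambda>m. (\<Sum>j. \<bar>walk_corr (j + 2 * m)\<bar>) / 4) \<longlonglongrightarrow> 0 / 4"
    by (intro tendsto_divide tendsto_const summable_abs_comparison[OF a le]) simp
  then show "tail_green \<longlonglongrightarrow> 0" by (simp add: tail_green_def[abs_def])
qed

lemma evolved_tendsto: "(\<lambda>m. evolved m z) \<longlonglongrightarrow> 0"
proof -
  have "(\<lambda>m. \<Sum>y\<in>l1_ball R0. f y * killed_walk m z y) \<longlonglongrightarrow> (\<Sum>y\<in>l1_ball R0. f y * 0)"
    by (intro tendsto_sum tendsto_mult tendsto_const summable_LIMSEQ_zero summable_killed_walk)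
  then show ?thesis by (simp add: evolved_def)
qed

lemma evolved_support: "evolved m z \<noteq> 0 \<Longrightarrow> z \<in> l1_ball (R0 + m)"
proof -
  assume "evolved m z \<noteq> 0"
  then obtain y where "y \<in> l1_ball R0" "f y * killed_walk m z y \<noteq> 0"
    unfolding evolved_def by (meson sum.not_neutral_contains_not_neutral)
  then show ?thesis using killed_walk_l1_norm[of m z y] by (auto simp: l1_ball_def)
qed

lemma evolved_0 [simp]: "evolved m 0 = 0"
  by (simp add: evolved_def)

lemma evolved_Suc: "z \<noteq> 0 \<Longrightarrow> (\<Sum>w\<in>neighbours z. evolved m w) = 4 * evolved (Suc m) z"
proof -
  assume "z \<noteq> 0"
  then have "evolved (Suc m) z = (\<Sum>y\<in>l1_ball R0. f y * (\<Sum>w\<in>neighbours z. killed_walk m w y)) / 4"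
    unfolding evolved_def sum_divide_distrib by (intro sum.cong refl) simp
  moreover have "(\<Sum>w\<in>neighbours z. evolved m w) = (\<Sum>y\<in>l1_ball R0. f y * (\<Sum>w\<in>neighbours z. killed_walk m w y))"
    unfolding evolved_def sum_distrib_left by (rule sum.swap)
  ultimately show ?thesis by simp
qed

lemma evolved_inner:
  assumes "R0 + j \<le> R"
  shows "(\<Sum>z\<in>l1_ball R. evolved j z * evolved k z) = walk_corr (j + k)"
proof -
  have "(\<Sum>z\<in>l1_ball R. evolved j z * evolved k z)
    = (\<Sum>z\<in>l1_ball R. \<Sum>x\<in>l1_ball R0. \<Sum>y\<in>l1_ball R0. f x * f y * (killed_walk j z x * killed_walk k z y))"
    by (simp add: evolved_def sum_product mult_ac)
  also have "\<dots> = (\<Sum>x\<in>l1_ball R0. \<Sum>z\<in>l1_ball R. \<Sum>y\<in>l1_ball R0. f x * f y * (killed_walk j z x * killed_walk k z y))"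
    by (rule sum.swap)
  also have "\<dots> = (\<Sum>x\<in>l1_ball R0. \<Sum>y\<in>l1_ball R0. \<Sum>z\<in>l1_ball R. f x * f y * (killed_walk j z x * killed_walk k z y))"
    by (intro sum.cong refl sum.swap)
  also have "\<dots> = (\<Sum>x\<in>l1_ball R0. \<Sum>y\<in>l1_ball R0. f x * f y * killed_walk (j + k) x y)"
    unfolding sum_distrib_left[symmetric] using assms
    by (intro sum.cong refl arg_cong2[where f = "(*)"] killed_walk_Chapman_Kolmogorov) (auto simp: l1_ball_def)
  finally show ?thesis by (simp add: walk_corr_def)
qed

text \<open>The Green potential of \<open>evolved m\<close> cut off after \<open>M\<close> steps: a
  finitely supported approximate solution of a Poisson equation, to which summation by parts
  applies.\<close>

definition walk_green :: "nat \<Rightarrow> nat \<Rightarrow> int \<times> int \<Rightarrow> real" where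
  "walk_green m M z = (\<Sum>j<M. evolved (m + j) z) / 4"

lemma laplacian_walk_green:
  assumes "z \<noteq> 0"
  shows "- laplacian (walk_green m M) z = evolved m z - evolved (m + M) z"
proof (induction M)
  case (Suc M)
  have "laplacian (walk_green m (Suc M)) z = laplacian (walk_green m M) z + laplacian (evolved (m + M)) z / 4"
    unfolding laplacian_def walk_green_def by (simp add: sum.distrib sum_subtractf sum_divide_distrib add_divide_distrib diff_divide_distrib)
  also have "laplacian (evolved (m + M)) z = 4 * evolved (m + Suc M) z - 4 * evolved (m + M) z"
    using evolved_Suc[OF assms, of "m + M"] by (simp add: laplacian_def sum_subtractf)
  finally show ?case using Suc.IH by (simp add: field_simps)
qed (simp add: walk_green_def laplacian_def)

lemma walk_green_support: "walk_green m M z \<noteq> 0 \<Longrightarrow> z \<in> l1_ball (R0 + m + M)"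
proof -
  assume "walk_green m M z \<noteq> 0"
  then have "(\<Sum>j<M. evolved (m + j) z) \<noteq> 0" by (auto simp: walk_green_def)
  then obtain j where "j < M" "evolved (m + j) z \<noteq> 0"
    by (meson sum.not_neutral_contains_not_neutral lessThan_iff)
  then show ?thesis using evolved_support[of "m + j" z] by (auto simp: l1_ball_def)
qed

lemma walk_green_0 [simp]: "walk_green m M 0 = 0"
  by (simp add: walk_green_def)

lemma sum_telescope_le:
  fixes c :: "nat \<Rightarrow> real"
  assumes "summable (\<lambda>j. \<bar>c j\<bar>)"
  shows "(\<Sum>j<M. c j - c (j + M)) \<le> (\<Sum>j. \<bar>c j\<bar>)"
proof -
  have "(\<Sum>j<M. c j - c (j + M)) \<le> (\<Sum>j<M. \<bar>c j\<bar> + \<bar>c (j + M)\<bar>)" by (intro sum_mono) linarith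
  also have "\<dots> = (\<Sum>j<M. \<bar>c j\<bar>) + (\<Sum>j=0+M..<M+M. \<bar>c j\<bar>)"
    by (simp only: sum.distrib sum.shift_bounds_nat_ivl atLeast0LessThan)
  also have "\<dots> = (\<Sum>j<M + M. \<bar>c j\<bar>)"
    by (simp add: sum.atLeastLessThan_concat atLeast0LessThan[symmetric])
  also have "\<dots> \<le> (\<Sum>j. \<bar>c j\<bar>)" using assms by (intro sum_le_suminf) auto
  finally show ?thesis .
qed

text \<open>Pairing \<open>h\<close> with \<open>evolved m\<close> gives the Dirichlet form of
  \<open>h\<close> with the truncated potential, plus the pairing of \<open>h\<close> with
  \<open>evolved (m + M)\<close>. Cauchy-Schwarz handles the former, since the energy of the
  potential telescopes to at most \<open>tail_green m\<close>. The latter vanishes as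
  \<open>M\<close> grows, because \<open>h\<close> has finite support and the evolution decays
  pointwise.\<close>

lemma evolved_dual_bound:
  assumes h: "\<And>x. h x \<noteq> 0 \<Longrightarrow> x \<in> l1_ball Rh" and h0: "h 0 = 0"
  shows "(\<Sum>x\<in>l1_ball (R0 + m). evolved m x * h x)\<^sup>2 \<le> tail_green m * lattice_energy h"
proof -
  define T where "T = (\<Sum>x\<in>l1_ball (R0 + m). evolved m x * h x)"
  have "\<bar>T\<bar> \<le> sqrt (tail_green m * lattice_energy h) + \<bar>\<Sum>x\<in>l1_ball Rh. evolved (m + M) x * h x\<bar>" for M
  proof -
    define R where "R = R0 + m + M + Rh"
    have R: "R0 + m \<le> R" "Rh \<le> R" "R0 + m + M \<le> R" by (auto simp: R_def)
    let ?g = "walk_green m M"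
    let ?S = "l1_ball (Suc R)"
    have supp: "x \<in> ?S \<and> neighbours x \<subseteq> ?S" if "k x \<noteq> 0" "\<And>x. k x \<noteq> 0 \<Longrightarrow> x \<in> l1_ball R" for k :: "int \<times> int \<Rightarrow> real" and x
      using that(2)[OF that(1)] l1_ball_neighbours[of x R] l1_ball_mono[OF le_SucI[OF order_refl[of R]]] by blast
    have hR: "h x \<noteq> 0 \<Longrightarrow> x \<in> l1_ball R" for x using h R(2) l1_ball_mono by blast
    have gR: "?g x \<noteq> 0 \<Longrightarrow> x \<in> l1_ball R" for x using walk_green_support R(3) l1_ball_mono by blast
    \<comment> \<open>The Poisson equation fails at the root, so the test function has to vanish
      there; this holds for \<open>h\<close> by assumption and for the potential by killing.\<close>
    have lap: "k x * laplacian ?g x = - (k x * (evolved m x - evolved (m + M) x))" if "k 0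
        = 0" for k :: "int \<times> int \<Rightarrow> real" and x
      using that laplacian_walk_green[of x m M] by (cases "x = 0") (auto simp: algebra_simps minus_equation_iff)
    have gh: "lattice_form ?S ?g h = (\<Sum>x\<in>?S. h x * (evolved m x - evolved (m + M) x))"
      using lattice_form_by_parts[of ?S h ?g] supp hR h0 by (simp add: lap sum_negf)
    have gg: "lattice_form ?S ?g ?g = (\<Sum>x\<in>?S. ?g x * (evolved m x - evolved (m + M) x))"
      using lattice_form_by_parts[of ?S ?g ?g] supp gR by (simp add: lap sum_negf)
    have hh: "lattice_form ?S h h = lattice_energy h"
      using supp hR by (intro lattice_energy_eq[symmetric]) auto
    have "lattice_form ?S ?g ?g = (\<Sum>x\<in>?S. \<Sum>j<M. evolved (m + j) x * evolved m x - evolved (m + j) x * evolved (m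
        + M) x) / 4"
      unfolding gg walk_green_def by (simp add: sum_divide_distrib sum_distrib_right sum_subtractf right_diff_distrib)
    also have "\<dots> = (\<Sum>j<M. walk_corr ((m + j) + m) - walk_corr ((m + j) + (m + M))) / 4"
      using R by (subst sum.swap) (simp add: sum_subtractf evolved_inner)
    also have "\<dots> = (\<Sum>j<M. walk_corr (j + 2 * m) - walk_corr ((j + M) + 2 * m)) / 4"
      by (intro arg_cong[where f = "\<lambda>x. x / 4"] sum.cong refl arg_cong2[where f = "(-)"] arg_cong[where f
          = walk_corr]) auto
    also have "\<dots> \<le> tail_green m"
      unfolding tail_green_def using summable_walk_corr
      by (intro divide_right_mono sum_telescope_le) (auto intro: summable_ignore_initial_segment)
    finally have g_le: "lattice_form ?S ?g ?g \<le> tail_green m" .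
    have "(lattice_form ?S ?g h)\<^sup>2 \<le> tail_green m * lattice_energy h"
      using lattice_form_Cauchy_Schwarz[of ?S ?g h] mult_right_mono[OF g_le lattice_form_nonneg[of ?S h]]
      by (simp add: hh)
    then have "\<bar>lattice_form ?S ?g h\<bar> \<le> sqrt (tail_green m * lattice_energy h)"
      by (metis real_sqrt_abs real_sqrt_le_mono)
    moreover have "T = (\<Sum>x\<in>?S. h x * evolved m x)"
      unfolding T_def using R(1) l1_ball_mono[of "R0 + m" "Suc R"] evolved_support
      by (auto intro!: sum.mono_neutral_cong_left simp: mult.commute)
    moreover have "(\<Sum>x\<in>l1_ball Rh. evolved (m + M) x * h x) = (\<Sum>x\<in>?S. h x * evolved (m + M) x)"
    proof -
      have "h x = 0" if "x \<notin> l1_ball Rh" for x using h[of x] that by blast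
      then show ?thesis using R(2) l1_ball_mono[of "Rh" "Suc R"]
        by (auto intro!: sum.mono_neutral_cong_left simp: mult.commute)
    qed
    ultimately show ?thesis using gh by (simp add: right_diff_distrib sum_subtractf)
  qed
  then have le: "\<exists>N. \<forall>M\<ge>N. \<bar>T\<bar> \<le> sqrt (tail_green m * lattice_energy h) + \<bar>\<Sum>x\<in>l1_ball Rh. evolved (m + M) x * h x\<bar>"
    by blast
  have ev: "(\<lambda>M. evolved (m + M) x) \<longlonglongrightarrow> 0" for x
    using LIMSEQ_ignore_initial_segment[OF evolved_tendsto[of x], of m] by (simp only: add.commute[of m])
  have "(\<lambda>M. sqrt (tail_green m * lattice_energy h) + \<bar>\<Sum>x\<in>l1_ball Rh. evolved (m + M) x * h x\<bar>)
      \<longlonglongrightarrow> sqrt (tail_green m * lattice_energy h) + \<bar>\<Sum>x\<in>l1_ball Rh. 0 * h x\<bar>"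
    by (intro tendsto_add tendsto_const tendsto_rabs tendsto_sum tendsto_mult ev)
  from LIMSEQ_le_const[OF this le] have T: "\<bar>T\<bar> \<le> sqrt (tail_green m * lattice_energy h)" by simp
  have "0 \<le> tail_green m"
    unfolding tail_green_def using summable_ignore_initial_segment[OF summable_walk_corr, of "2 * m"]
    by (intro divide_nonneg_nonneg suminf_nonneg) simp_all
  moreover have "0 \<le> lattice_energy h"
    by (subst lattice_energy_ball[OF h]) (assumption, rule lattice_form_nonneg)
  ultimately have nn: "0 \<le> tail_green m * lattice_energy h" by simp
  have "T\<^sup>2 = \<bar>T\<bar>\<^sup>2" by simp
  also have "\<dots> \<le> (sqrt (tail_green m * lattice_energy h))\<^sup>2" using T by (intro power_mono) simp_all
  also have "\<dots> = tail_green m * lattice_energy h" using nn by simp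
  finally show ?thesis unfolding T_def .
qed

lemma walk_corr_sums: "walk_corr sums (4 * (\<Sum>x\<in>l1_ball R0. \<Sum>y\<in>l1_ball R0. f x * f y * green0 x y))"
proof -
  have "(\<lambda>m. killed_walk m x y) sums (4 * green0 x y)" for x y
    using summable_sums[OF summable_killed_walk[of x y]] by (simp add: green0_def)
  then have "walk_corr sums (\<Sum>x\<in>l1_ball R0. \<Sum>y\<in>l1_ball R0. f x * f y * (4 * green0 x y))"
    unfolding walk_corr_def[abs_def] by (intro sums_sum sums_mult)
  then show ?thesis by (simp add: sum_distrib_left mult_ac)
qed

end

section \<open>From the lattice to the torus\<close>

lemma torus_edge_bound:
  fixes H :: "int \<times> int \<Rightarrow> real"
  assumes "torus_adj n u v"
  shows "\<bar>H u - H v\<bar> \<le> sqrt (2 * torus_energy n H)"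
proof -
  have mem: "u \<in> torus n" "v \<in> torus n" using assms by (auto simp: torus_adj_def)
  let ?\<phi> = "\<lambda>x y. if torus_adj n x y then (H x - H y) * (H x - H y) else 0"
  have "(H u - H v) * (H u - H v) = ?\<phi> u v" using assms by simp
  also have "\<dots> \<le> (\<Sum>y\<in>torus n. ?\<phi> u y)" using mem by (intro member_le_sum[of v "torus n" "?\<phi> u"]) auto
  also have "\<dots> \<le> (\<Sum>x\<in>torus n. \<Sum>y\<in>torus n. ?\<phi> x y)"
    using mem by (intro member_le_sum[of u "torus n" "\<lambda>x. \<Sum>y\<in>torus n. ?\<phi> x y"]) (auto intro: sum_nonneg)
  also have "\<dots> = 2 * torus_energy n H" by (simp add: energy_form_def cong: if_cong)
  finally have "(H u - H v)\<^sup>2 \<le> 2 * torus_energy n H" by (simp add: power2_eq_square)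
  then show ?thesis by (metis real_sqrt_abs real_sqrt_le_mono)
qed

text \<open>Sums edge differences along a shortest lattice path from 0. Crude in \<open>x\<close>,
  but independent of the size of the torus.\<close>

lemma torus_path_bound:
  fixes H :: "int \<times> int \<Rightarrow> real"
  assumes n: "n \<ge> 1" and H: "H 0 = 0"
  shows "\<bar>H (torus_proj n x)\<bar> \<le> real (l1_norm x) * sqrt (2 * torus_energy n H)"
proof (induction "l1_norm x" arbitrary: x)
  case 0
  then have "x = 0" by (metis l1_norm_eq_0_iff)
  then show ?case using H by simp
next
  case (Suc d)
  obtain w where w: "w \<in> neighbours x" "l1_norm w = d" using l1_closer_neighbour Suc.hyps(2) by metis
  have "\<bar>H (torus_proj n x)\<bar> \<le> \<bar>H (torus_proj n w)\<bar> + \<bar>H (torus_proj n x) - H (torus_proj n w)\<bar>" by linarith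
  also have "\<dots> \<le> real d * sqrt (2 * torus_energy n H) + sqrt (2 * torus_energy n H)"
    using Suc.hyps(1)[of w] w torus_edge_bound[OF torus_adj_proj[OF n w(1)]] by (intro add_mono) auto
  also have "\<dots> = real (l1_norm x) * sqrt (2 * torus_energy n H)"
    by (simp add: Suc.hyps(2)[symmetric] algebra_simps)
  finally show ?case .
qed

lemma torus_proj_eqD:
  assumes "torus_proj n z = torus_proj n z'" "\<bar>fst z - fst z'\<bar> < int n" "\<bar>snd z - snd z'\<bar> < int n"
  shows "z = z'"
proof -
  have "a = b" if "a mod int n = b mod int n" "\<bar>a - b\<bar> < int n" for a b :: int
  proof (rule ccontr)
    assume "a \<noteq> b"
    then have "\<bar>a - b\<bar> > 0" by simp
    moreover have "int n dvd \<bar>a - b\<bar>" using that(1) by (simp add: mod_eq_dvd_iff)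
    ultimately have "int n \<le> \<bar>a - b\<bar>" by (intro zdvd_imp_le)
    then show False using that(2) by simp
  qed
  then show ?thesis using assms by (auto simp: torus_proj_def prod_eq_iff)
qed

lemma inj_on_torus_proj_l1_ball:
  assumes "2 * R < n"
  shows "inj_on (torus_proj n) (l1_ball R)"
proof (rule inj_onI)
  fix x y assume "x \<in> l1_ball R" "y \<in> l1_ball R" and eq: "torus_proj n x = torus_proj n y"
  then have "\<bar>fst x\<bar> + \<bar>snd x\<bar> \<le> int R" "\<bar>fst y\<bar> + \<bar>snd y\<bar> \<le> int R" by (auto simp: l1_ball_def l1_norm_def)
  then show "x = y" using assms by (intro torus_proj_eqD[OF eq]) linarith+
qed

lemma inj_on_torus_proj_neighbours:
  assumes "n \<ge> 3"
  shows "inj_on (torus_proj n) (neighbours x)"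
proof (rule inj_onI)
  fix y z assume "y \<in> neighbours x" "z \<in> neighbours x" and eq: "torus_proj n y = torus_proj n z"
  then have "\<bar>fst y - fst z\<bar> \<le> 2" "\<bar>snd y - snd z\<bar> \<le> 2" by (auto simp: neighbours_eq)
  then show "y = z" using assms by (intro torus_proj_eqD[OF eq]) linarith+
qed

lemma torus_adj_proj_iff:
  assumes "n \<ge> 1"
  shows "torus_adj n (torus_proj n x) y \<longleftrightarrow> y \<in> torus_proj n ` neighbours x"
proof
  assume "torus_adj n (torus_proj n x) y"
  then obtain z where z: "z \<in> neighbours (torus_proj n x)" "torus_proj n z = y" by (auto simp: torus_adj_def)
  let ?w = "(fst x + (fst z - fst (torus_proj n x)), snd x + (snd z - snd (torus_proj n x)))"
  have "?w \<in> neighbours x" using z(1) by (auto simp: neighbours_def)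
  moreover have "torus_proj n ?w = y"
  proof -
    have "(a + (b - a mod int n)) mod int n = b mod int n" for a b
      by (metis add.commute diff_add_cancel mod_add_right_eq)
    then show ?thesis using z(2) by (auto simp: torus_proj_def)
  qed
  ultimately show "y \<in> torus_proj n ` neighbours x" by blast
next
  assume "y \<in> torus_proj n ` neighbours x"
  then obtain z where "z \<in> neighbours x" "y = torus_proj n z" by blast
  then show "torus_adj n (torus_proj n x) y" using torus_adj_proj[OF assms] by simp
qed

text \<open>From size 3 on the four neighbours have distinct residues, so the torus has locally the
  edges of the lattice, without identifications.\<close>

lemma sum_torus_adj_proj:
  assumes n: "n \<ge> 3"
  shows "(\<Sum>y\<in>torus n. if torus_adj n (torus_proj n x) y then \<phi> y else 0)
      = (\<Sum>z\<in>neighbours x. \<phi> (torus_proj n z) :: 'b::comm_monoid_add)"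
proof -
  have n1: "n \<ge> 1" using n by simp
  have "(\<Sum>y\<in>torus n. if torus_adj n (torus_proj n x) y then \<phi> y else 0)
      = (\<Sum>y\<in>{y \<in> torus n. torus_adj n (torus_proj n x) y}. \<phi> y)"
    by (rule sum.inter_filter[symmetric]) simp
  also have "{y \<in> torus n. torus_adj n (torus_proj n x) y} = torus_proj n ` neighbours x"
    using torus_adj_proj_iff[OF n1] torus_proj_mem[OF n1] by auto
  also have "(\<Sum>y\<in>torus_proj n ` neighbours x. \<phi> y) = (\<Sum>z\<in>neighbours x. \<phi> (torus_proj n z))"
    using inj_on_torus_proj_neighbours[OF n] by (simp add: sum.reindex)
  finally show ?thesis .
qed

text \<open>
  A function on the torus is truncated and multiplied by a cutoff; recurrence makes the cost of the cutoff negligible.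
\<close>

lemma dual_bound_transfer:
  fixes r :: "int \<times> int \<Rightarrow> real"
  assumes A: "0 \<le> A"
    and dual: "\<And>h Rh. (\<And>x. h x \<noteq> 0 \<Longrightarrow> x \<in> l1_ball Rh) \<Longrightarrow> h 0 = 0 \<Longrightarrow> (\<Sum>x\<in>l1_ball \<rho>. r x * h x)\<^sup>2 \<le> A * lattice_energy h"
  obtains n0 where "\<And>n H. n \<ge> n0 \<Longrightarrow> H 0 = 0 \<Longrightarrow>
    (\<Sum>x\<in>l1_ball \<rho>. r x * H (torus_proj n x))\<^sup>2 \<le> 4 * A * torus_energy n (H :: int \<times> int \<Rightarrow> real)"
proof -
  \<comment> \<open>The cutoff will cost at most 2 a^2 \<epsilon> with a^2 = 2 \<rho>^2 E, so this
    value keeps the cost below 2 E; the summand 1 covers \<rho> = 0.\<close>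
  define \<epsilon> where "\<epsilon> = 1 / (2 * (real \<rho>)\<^sup>2 + 1)"
  have \<epsilon>: "\<epsilon> > 0" "2 * (real \<rho>)\<^sup>2 * \<epsilon> \<le> 1"
    by (auto simp: \<epsilon>_def add_pos_nonneg add_nonneg_pos divide_le_eq)
  obtain \<psi> R where \<psi>: "\<And>x. \<psi> x \<noteq> 0 \<Longrightarrow> x \<in> l1_ball R" "\<And>x. x \<in> l1_ball \<rho> \<Longrightarrow> \<psi> x = 1"
    "\<And>x. 0 \<le> \<psi> x" "\<And>x. \<psi> x \<le> 1" "lattice_energy \<psi> \<le> \<epsilon>"
    using exists_cutoff[OF \<epsilon>(1)] by blast
  show thesis
  proof (rule that[of "2 * Suc R + 3"])
    fix n and H :: "int \<times> int \<Rightarrow> real" assume n: "n \<ge> 2 * Suc R + 3" and H0: "H 0 = 0"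
    have n1: "n \<ge> 1" and n3: "n \<ge> 3" using n by auto
    define E where "E = torus_energy n H"
    have E: "0 \<le> E" unfolding E_def by (rule torus_energy_nonneg)
    \<comment> \<open>The bound of \<open>torus_path_bound\<close> on the ball of radius \<rho>:
      truncation at this level leaves the values of \<open>H\<close> on that ball untouched while
      bounding the function on the whole support of the cutoff.\<close>
    define a where "a = real \<rho> * sqrt (2 * E)"
    have a: "0 \<le> a" "a\<^sup>2 = 2 * (real \<rho>)\<^sup>2 * E" using E by (auto simp: a_def power_mult_distrib)
    define c where "c x = max (- a) (min a (H (torus_proj n x)))" for x
    define h where "h x = \<psi> x * c x" for x
    have c_abs: "\<bar>c x\<bar> \<le> a" for x using a by (auto simp: c_def)
    have c_diff: "\<bar>c x - c y\<bar> \<le> \<bar>H (torus_proj n x) - H (torus_proj n y)\<bar>" for x y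
      unfolding c_def by (auto simp: max_def min_def)
    have h_supp: "x \<in> l1_ball R" if "h x \<noteq> 0" for x using that \<psi>(1) by (auto simp: h_def)
    have h_eq: "h x = H (torus_proj n x)" if "x \<in> l1_ball \<rho>" for x
    proof -
      have "\<bar>H (torus_proj n x)\<bar> \<le> real (l1_norm x) * sqrt (2 * E)"
        unfolding E_def by (rule torus_path_bound[of n H x, OF n1 H0])
      also have "\<dots> \<le> a" unfolding a_def using that E by (intro mult_right_mono) (auto simp: l1_ball_def)
      finally show ?thesis using \<psi>(2)[OF that] by (auto simp: h_def c_def)
    qed
    have "0 \<in> l1_ball \<rho>" by (simp add: l1_ball_def)
    then have h0: "h 0 = 0" using h_eq[of 0] H0 by simp
    let ?S = "l1_ball (Suc R)"
    have "lattice_energy h = lattice_form ?S h h"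
      by (rule lattice_energy_ball) (rule h_supp)
    also have "\<dots> \<le> (\<Sum>x\<in>?S. \<Sum>y\<in>neighbours x. 2 * (H (torus_proj n x) - H (torus_proj n y))\<^sup>2
        + 2 * a\<^sup>2 * (\<psi> x - \<psi> y)\<^sup>2) / 2"
      unfolding lattice_form_def
    proof (intro divide_right_mono sum_mono)
      fix x y
      define P Q where "P = \<psi> x * (c x - c y)" and "Q = c y * (\<psi> x - \<psi> y)"
      have hPQ: "h x - h y = P + Q" by (simp add: h_def P_def Q_def algebra_simps)
      have "(P + Q) * (P + Q) \<le> 2 * P\<^sup>2 + 2 * Q\<^sup>2"
        using zero_le_power2[of "P - Q"] by (simp add: power2_eq_square algebra_simps)
      moreover have "P\<^sup>2 \<le> (H (torus_proj n x) - H (torus_proj n y))\<^sup>2"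
      proof -
        have "\<bar>P\<bar> \<le> 1 * \<bar>H (torus_proj n x) - H (torus_proj n y)\<bar>"
          unfolding P_def abs_mult using \<psi>(3,4)[of x] c_diff[of x y] by (intro mult_mono) auto
        then show ?thesis by (simp add: abs_le_square_iff[symmetric])
      qed
      moreover have "Q\<^sup>2 \<le> a\<^sup>2 * (\<psi> x - \<psi> y)\<^sup>2"
        unfolding Q_def power_mult_distrib using c_abs[of y] a(1)
        by (intro mult_right_mono) (auto simp: abs_le_square_iff[symmetric])
      ultimately show "(h x - h y) * (h x - h y)
          \<le> 2 * (H (torus_proj n x) - H (torus_proj n y))\<^sup>2 + 2 * a\<^sup>2 * (\<psi> x - \<psi> y)\<^sup>2"
        unfolding hPQ by linarith
    qed simp
    also have "\<dots> = (\<Sum>x\<in>?S. \<Sum>y\<in>neighbours x. (H (torus_proj n x) - H (torus_proj n y))\<^sup>2)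
        + 2 * a\<^sup>2 * lattice_form ?S \<psi> \<psi>"
      by (simp add: lattice_form_def sum.distrib sum_distrib_left[symmetric] power2_eq_square add_divide_distrib)
    also have "lattice_form ?S \<psi> \<psi> = lattice_energy \<psi>"
      by (rule lattice_energy_ball[symmetric]) (rule \<psi>(1))
    also have "(\<Sum>x\<in>?S. \<Sum>y\<in>neighbours x. (H (torus_proj n x) - H (torus_proj n y))\<^sup>2) \<le> 2 * E"
    proof -
      let ?\<phi> = "\<lambda>u. \<Sum>v\<in>torus n. if torus_adj n u v then (H u - H v)\<^sup>2 else 0"
      have "(\<Sum>x\<in>?S. \<Sum>y\<in>neighbours x. (H (torus_proj n x) - H (torus_proj n y))\<^sup>2) = (\<Sum>x\<in>?S. ?\<phi> (torus_proj n x))"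
        by (intro sum.cong refl sum_torus_adj_proj[OF n3, symmetric])
      \<comment> \<open>The window embeds injectively, so every vertex of the torus, and hence every
        directed edge, is met at most once.\<close>
      also have "\<dots> = (\<Sum>u\<in>torus_proj n ` ?S. ?\<phi> u)"
        using inj_on_torus_proj_l1_ball[of "Suc R" n] n by (subst sum.reindex) auto
      also have "\<dots> \<le> (\<Sum>u\<in>torus n. ?\<phi> u)"
        using torus_proj_mem[OF n1] by (intro sum_mono2) (auto intro!: sum_nonneg)
      also have "\<dots> = 2 * E" by (simp add: E_def energy_form_def power2_eq_square cong: if_cong)
      finally show ?thesis .
    qed
    also have "2 * a\<^sup>2 * lattice_energy \<psi> \<le> 2 * a\<^sup>2 * \<epsilon>" using \<psi>(5) by (intro mult_left_mono) auto
    also have "2 * a\<^sup>2 * \<epsilon> \<le> 2 * E"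
      using mult_right_mono[OF \<epsilon>(2) E] by (simp add: a(2) mult_ac)
    finally have "lattice_energy h \<le> 4 * E" by simp
    then have "A * lattice_energy h \<le> A * (4 * E)" using A by (rule mult_left_mono)
    moreover have "(\<Sum>x\<in>l1_ball \<rho>. r x * h x)\<^sup>2 \<le> A * lattice_energy h"
      using h_supp h0 by (rule dual)
    moreover have "(\<Sum>x\<in>l1_ball \<rho>. r x * h x) = (\<Sum>x\<in>l1_ball \<rho>. r x * H (torus_proj n x))"
      by (intro sum.cong refl) (simp add: h_eq)
    ultimately show "(\<Sum>x\<in>l1_ball \<rho>. r x * H (torus_proj n x))\<^sup>2 \<le> 4 * A * torus_energy n H"
      by (simp add: E_def)
  qed
qed

lemma point_dual_bound:
  fixes H :: "int \<times> int \<Rightarrow> real"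
  assumes "n \<ge> 1" "H 0 = 0"
  shows "(H (torus_proj n x))\<^sup>2 \<le> 2 * (real (l1_norm x))\<^sup>2 * torus_energy n H"
proof -
  have "\<bar>H (torus_proj n x)\<bar>\<^sup>2 \<le> (real (l1_norm x) * sqrt (2 * torus_energy n H))\<^sup>2"
    using torus_path_bound[of n H x] assms by (intro power_mono) auto
  then show ?thesis using torus_energy_nonneg[of n H] by (simp add: power_mult_distrib)
qed

section \<open>The rooted model\<close>

lemma sphere_torus_spins:
  assumes "\<beta> > 0" "n \<ge> 2"
  shows "torus_spins (sphere_measure :: 'a::euclidean_space measure) \<beta> n"
proof (rule torus_spins.intro)
  show "AE x in sphere_measure. norm (x :: 'a) \<le> 1"
    using AE_sphere_measure by eventually_elim simp
qed (simp_all add: assms prob_space_sphere_measure)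

locale rooted_spins =
  fixes \<beta> :: real and n :: nat and v :: "'a::euclidean_space"
  assumes \<beta>_pos: "\<beta> > 0" and n_ge: "n \<ge> 2" and v: "norm v = 1"
begin

sublocale torus_spins "sphere_measure :: 'a measure" \<beta> n
  by (rule sphere_torus_spins[OF \<beta>_pos n_ge])

definition base :: "int \<times> int \<Rightarrow> 'a measure" where
  "base = (\<lambda>_. sphere_measure)(0 := return borel v)"

abbreviation "rooted_reference \<equiv> PiM (torus n) base"

lemma sets_base [simp]: "sets (base x) = sets borel"
  by (simp add: base_def)

lemma prob_space_base: "prob_space (base x)"
  by (auto simp: base_def prob_space_sphere_measure intro: prob_space_return)

sublocale rooted: prob_space rooted_reference
  by (intro prob_space_PiM prob_space_base)

lemma sets_rooted_reference: "sets rooted_reference = sets reference"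
  by (intro sets_PiM_cong) auto

lemma measurable_rooted_reference: "measurable rooted_reference M = measurable reference M"
  by (rule measurable_cong_sets[OF sets_rooted_reference refl])

text \<open>Given the spin \<open>y\<close> at the root, an isometry taking \<open>y\<close> to
  \<open>v\<close> can be applied to all other spins without changing their product law. For an
  invariant integrand the conditional integral is thus the same for every unit vector
  \<open>y\<close>, and averaging over the root amounts to fixing it.\<close>

lemma nn_integral_rooted:
  assumes f: "f \<in> borel_measurable reference"
    and inv: "\<And>T \<theta>. linear T \<Longrightarrow> (\<And>x. norm (T x) = norm x) \<Longrightarrow> f (\<lambda>x\<in>torus n. T (\<theta> x)) = f \<theta>"
  shows "(\<integral>\<^sup>+\<theta>. f \<theta> \<partial>rooted_reference) = (\<integral>\<^sup>+\<theta>. f \<theta> \<partial>reference)"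
proof -
  define I where "I = torus n - {0}"
  have I: "finite I" "0 \<notin> I" "torus n = insert 0 I" using zero_mem by (auto simp: I_def)
  interpret S: prob_space "sphere_measure :: 'a measure" by (rule prob_space_sphere_measure)
  interpret P: product_sigma_finite "\<lambda>_::int \<times> int. sphere_measure :: 'a measure" by standard
  interpret B: product_sigma_finite base
  proof (rule product_sigma_finite.intro)
    fix x
    interpret prob_space "base x" by (rule prob_space_base)
    show "sigma_finite_measure (base x)" by unfold_locales
  qed
  have PI: "PiM I base = PiM I (\<lambda>_. sphere_measure)"
    using I(2) by (intro PiM_cong) (auto simp: base_def)
  define G where "G y = (\<integral>\<^sup>+x. f (x(0 := y)) \<partial>PiM I (\<lambda>_. sphere_measure))" for y
  have f': "f \<in> borel_measurable (PiM (insert 0 I) (\<lambda>_. sphere_measure))" using f by (simp add: I(3))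
  then have fb: "f \<in> borel_measurable (PiM (insert 0 I) base)"
    using measurable_rooted_reference[of "borel :: ennreal measure"] f by (simp add: I(3))
  have G_eq: "G y = G v" if y: "norm y = 1" for y
  proof -
    obtain T where T: "linear T" "\<And>x. norm (T x) = norm x" "T y = v"
      using exists_isometry_of_norm_eq[of y v] y v by auto
    have T_meas: "T \<in> borel_measurable borel"
      using T(1) by (intro borel_measurable_continuous_onI linear_continuous_on) (simp add: linear_conv_bounded_linear)
    have dT: "distr (PiM I (\<lambda>_. sphere_measure)) (PiM I (\<lambda>_. sphere_measure)) (\<lambda>\<omega>. \<lambda>i\<in>I. T (\<omega> i))
        = PiM I (\<lambda>_. sphere_measure)"
    proof (rule distr_PiM_coordinatewise[OF I(1)])
      show "T \<in> measurable sphere_measure sphere_measure"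
        using T_meas by (simp cong: measurable_cong_sets)
      have "distr sphere_measure sphere_measure T = distr sphere_measure borel T"
        by (intro distr_cong) auto
      then show "distr sphere_measure sphere_measure T = sphere_measure"
        using distr_sphere_measure_isometry[OF T(1,2)] by simp
    qed (rule prob_space_sphere_measure)
    have m: "(\<lambda>\<omega>. \<lambda>i\<in>I. T (\<omega> i)) \<in> measurable (PiM I (\<lambda>_. sphere_measure)) (PiM I (\<lambda>_. sphere_measure))"
      using T_meas by (intro measurable_restrict measurable_compose[OF measurable_component_singleton])
        (auto cong: measurable_cong_sets)
    have space_sphere: "v \<in> space (sphere_measure :: 'a measure)"
      using sets_eq_imp_space_eq[of "sphere_measure :: 'a measure" borel] by simp
    have fv: "(\<lambda>x. f (x(0 := v))) \<in> borel_measurable (PiM I (\<lambda>_. sphere_measure))"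
      using space_sphere
      by (intro measurable_compose[OF measurable_fun_upd[where J = I] f']) (auto intro: measurable_ident)
    have "G y = (\<integral>\<^sup>+x. f ((\<lambda>i\<in>I. T (x i))(0 := v)) \<partial>PiM I (\<lambda>_. sphere_measure))"
      unfolding G_def
    proof (rule nn_integral_cong)
      fix x :: "int \<times> int \<Rightarrow> 'a"
      have "f (x(0 := y)) = f (\<lambda>i\<in>torus n. T ((x(0 := y)) i))" by (rule inv[OF T(1,2), symmetric])
      also have "(\<lambda>i\<in>torus n. T ((x(0 := y)) i)) = (\<lambda>i\<in>I. T (x i))(0 := v)"
        using I T(3) by (auto simp: fun_eq_iff restrict_def)
      finally show "f (x(0 := y)) = f ((\<lambda>i\<in>I. T (x i))(0 := v))" .
    qed
    also have "\<dots> = (\<integral>\<^sup>+x. f (x(0 := v)) \<partial>distr (PiM I (\<lambda>_. sphere_measure)) (PiM I (\<lambda>_. sphere_measure)) (\<lambda>\<omega>. \<lambda>i\<in>I. T (\<omega> i)))"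
      using fv by (subst nn_integral_distr[OF m]) simp_all
    also have "\<dots> = G v" by (simp add: dT G_def)
    finally show ?thesis .
  qed
  have "(\<integral>\<^sup>+\<theta>. f \<theta> \<partial>reference) = (\<integral>\<^sup>+y. G y \<partial>sphere_measure)"
    using P.product_nn_integral_insert_rev[OF I(1,2) f'] by (simp add: I(3) G_def)
  also have "\<dots> = (\<integral>\<^sup>+y. G v \<partial>(sphere_measure :: 'a measure))"
    using AE_sphere_measure by (intro nn_integral_cong_AE) (auto elim!: eventually_mono simp: G_eq)
  also have "\<dots> = G v" by (simp add: S.emeasure_space_1)
  also have "\<dots> = (\<integral>\<^sup>+x. f (x(0 := v)) \<partial>PiM I base)" by (simp add: G_def PI)
  also have "\<dots> = (\<integral>\<^sup>+x. (\<integral>\<^sup>+y. f (x(0 := y)) \<partial>base 0) \<partial>PiM I base)"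
  proof (rule nn_integral_cong)
    fix x assume x: "x \<in> space (PiM I base)"
    have "(\<lambda>y. f (x(0 := y))) \<in> borel_measurable (base 0)"
      using measurable_comp[OF measurable_component_update[OF x I(2)] fb] unfolding comp_def .
    then have "(\<lambda>y. f (x(0 := y))) \<in> borel_measurable borel" by (simp cong: measurable_cong_sets)
    then show "f (x(0 := v)) = (\<integral>\<^sup>+y. f (x(0 := y)) \<partial>base 0)"
      by (simp add: base_def nn_integral_return)
  qed
  also have "\<dots> = (\<integral>\<^sup>+\<theta>. f \<theta> \<partial>rooted_reference)"
    using B.product_nn_integral_insert[OF I(1,2) fb] by (simp add: I(3))
  finally show ?thesis by simp
qed

lemma AE_rooted_reference:
  "AE \<theta> in rooted_reference. (\<forall>x\<in>torus n. norm (\<theta> x) = 1) \<and> \<theta> 0 = v"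
proof -
  have "AE \<theta> in rooted_reference. \<forall>x\<in>torus n. norm (\<theta> x) = 1"
  proof (rule AE_finite_allI)
    fix x assume "x \<in> torus n"
    moreover have "AE y in base x. norm y = 1"
    proof (cases "x = 0")
      case True
      show ?thesis unfolding True base_def fun_upd_same by (subst AE_return) (use v in auto)
    next
      case False
      then have "base x = sphere_measure" by (simp add: base_def)
      from arg_cong[OF this, of "\<lambda>M. AE y in M. norm y = 1"] show ?thesis
        using AE_sphere_measure[where 'a = 'a] by simp
    qed
    ultimately show "AE \<theta> in rooted_reference. norm (\<theta> x) = 1"
      using prob_space_base by (intro AE_PiM_component) auto
  qed simp
  moreover have "AE y in base 0. y = v"
    unfolding base_def fun_upd_same by (subst AE_return) auto
  then have "AE \<theta> in rooted_reference. \<theta> 0 = v"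
    by (intro AE_PiM_component prob_space_base zero_mem)
  moreover note calculation
  ultimately show ?thesis by eventually_elim simp
qed

lemma energy_form_restrict:
  "torus_energy n (\<lambda>x\<in>torus n. h x) = torus_energy n h"
  unfolding energy_form_def by (intro arg_cong[where f = "\<lambda>x. x / 2"] sum.cong refl) auto

lemma torus_energy_isometry:
  fixes \<theta> :: "int \<times> int \<Rightarrow> 'a"
  assumes T: "linear T" "\<And>x. norm (T x) = norm (x :: 'a)"
  shows "torus_energy n (\<lambda>x. T (\<theta> x)) = torus_energy n \<theta>"
proof -
  have "(T a - T b) \<bullet> (T a - T b) = (a - b) \<bullet> (a - b)" for a b
    using T(2)[of "a - b"] linear_diff[OF T(1), of a b] by (simp add: norm_eq)
  then show ?thesis unfolding energy_form_def by (simp cong: if_cong)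
qed

lemma weight_isometry:
  assumes "linear T" "\<And>x. norm (T x) = norm (x :: 'a)"
  shows "weight (\<lambda>x\<in>torus n. T (\<theta> x)) = weight \<theta>"
  using torus_energy_isometry[OF assms] by (simp add: weight_def energy_form_restrict)

lemma weight_measurable_rooted [measurable]: "weight \<in> borel_measurable rooted_reference"
  using weight_measurable by (simp add: measurable_rooted_reference)

lemma component_measurable_rooted: "x \<in> torus n \<Longrightarrow> (\<lambda>\<theta>. \<theta> x) \<in> borel_measurable rooted_reference"
  using component_measurable by (simp add: measurable_rooted_reference)

lemma integral_rooted:
  fixes f :: "(int \<times> int \<Rightarrow> 'a) \<Rightarrow> real"
  assumes f: "f \<in> borel_measurable reference" "\<And>\<theta>. 0 \<le> f \<theta>"
    and inv: "\<And>T \<theta>. linear T \<Longrightarrow> (\<And>x. norm (T x) = norm x) \<Longrightarrow> f (\<lambda>x\<in>torus n. T (\<theta> x)) = f \<theta>"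
  shows "(\<integral>\<theta>. weight \<theta> * f \<theta> \<partial>rooted_reference) = (\<integral>\<theta>. weight \<theta> * f \<theta> \<partial>reference)"
proof -
  have m: "(\<lambda>\<theta>. weight \<theta> * f \<theta>) \<in> borel_measurable reference" using f by measurable
  have "(\<integral>\<^sup>+\<theta>. ennreal (weight \<theta> * f \<theta>) \<partial>rooted_reference) = (\<integral>\<^sup>+\<theta>. ennreal (weight \<theta> * f \<theta>) \<partial>reference)"
    using m by (intro nn_integral_rooted) (auto simp: weight_isometry inv)
  then show ?thesis
    using m f weight_nonneg by (simp add: integral_eq_nn_integral measurable_rooted_reference)
qed

lemma mass_rooted: "(\<integral>\<theta>. weight \<theta> \<partial>rooted_reference) = mass"
  using integral_rooted[of "\<lambda>_. 1"] by (simp add: mass_def)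

text \<open>For unit vectors the inner product is 1 - |a - b|^2 / 2. The Gibbs factor and
  \<open>weight\<close> therefore differ by a constant, absorbed in the normalization.\<close>

lemma spin_energy_torus_energy:
  fixes \<theta> :: "int \<times> int \<Rightarrow> 'a"
  assumes "\<And>x. x \<in> torus n \<Longrightarrow> norm (\<theta> x) = 1"
  shows "spin_energy n \<theta> = (\<Sum>x\<in>torus n. \<Sum>y\<in>torus n. if torus_adj n x y then 1 else 0) / 2 - torus_energy n \<theta> / 2"
proof -
  have "(\<Sum>y | torus_adj n x y. \<theta> x \<bullet> \<theta> y) = (\<Sum>y\<in>torus n. if torus_adj n x y then \<theta> x \<bullet> \<theta> y else 0)" for x
  proof -
    have "{y. torus_adj n x y} = {y \<in> torus n. torus_adj n x y}" by (auto simp: torus_adj_def)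
    then show ?thesis by (simp add: sum.inter_filter)
  qed
  moreover have "(if torus_adj n x y then \<theta> x \<bullet> \<theta> y else 0)
      = (if torus_adj n x y then 1 else 0) - (if torus_adj n x y then (\<theta> x - \<theta> y) \<bullet> (\<theta> x - \<theta> y) else 0) / 2"
    if "x \<in> torus n" "y \<in> torus n" for x y
  proof -
    have "\<theta> x \<bullet> \<theta> x = 1" "\<theta> y \<bullet> \<theta> y = 1" using assms that by (simp_all add: norm_eq_1)
    then show ?thesis by (simp add: inner_diff_left inner_diff_right inner_commute field_simps)
  qed
  ultimately have "spin_energy n \<theta> = (\<Sum>x\<in>torus n. \<Sum>y\<in>torus n. (if torus_adj n x y then 1 else 0)
      - (if torus_adj n x y then (\<theta> x - \<theta> y) \<bullet> (\<theta> x - \<theta> y) else 0) / 2) / 2"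
    unfolding spin_energy_def by simp
  then show ?thesis
    by (simp add: energy_form_def sum_subtractf sum_divide_distrib[symmetric] diff_divide_distrib)
qed

abbreviation "model \<equiv> rooted_spin_model \<beta> n v"

lemma model_eq: "model = density rooted_reference (\<lambda>\<theta>. ennreal (weight \<theta> / mass))"
proof -
  let ?P = "(\<Sum>x\<in>torus n. \<Sum>y\<in>torus n. if torus_adj n x y then 1 else 0) :: real"
  let ?c = "exp (\<beta> * ?P / 2)"
  have w: "exp (\<beta> * spin_energy n \<theta>) = ?c * weight \<theta>" if "\<forall>x\<in>torus n. norm (\<theta> x) = 1" for \<theta> :: "int \<times> int \<Rightarrow> 'a"
  proof -
    have "\<beta> * spin_energy n \<theta> = \<beta> * ?P / 2 + - \<beta> / 2 * torus_energy n \<theta>"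
      using that by (subst spin_energy_torus_energy) (auto simp: algebra_simps diff_divide_distrib)
    then show ?thesis by (simp only: weight_def exp_add)
  qed
  have AEw: "AE \<theta> in rooted_reference. exp (\<beta> * spin_energy n \<theta>) = ?c * weight \<theta>"
    using AE_rooted_reference by eventually_elim (simp add: w)
  have adj: "finite {y. torus_adj n x y}" for x
    by (rule finite_subset[of _ "torus n"]) (auto simp: torus_adj_def)
  have m: "(\<lambda>\<theta>. exp (\<beta> * spin_energy n \<theta>)) \<in> borel_measurable rooted_reference"
    unfolding spin_energy_def
    by (intro borel_measurable_exp measurable_compose[OF _ borel_measurable_exp] borel_measurable_times borel_measurable_divide borel_measurable_sum borel_measurable_inner
      component_measurable_rooted borel_measurable_const) (auto simp: torus_adj_def)
  have Z: "(\<integral>\<theta>. exp (\<beta> * spin_energy n \<theta>) \<partial>rooted_reference) = ?c * mass"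
  proof -
    have "(\<integral>\<theta>. exp (\<beta> * spin_energy n \<theta>) \<partial>rooted_reference) = (\<integral>\<theta>. ?c * weight \<theta> \<partial>rooted_reference)"
      using m AEw by (intro integral_cong_AE) auto
    then show ?thesis by (simp add: mass_rooted)
  qed
  have "model = density rooted_reference (\<lambda>\<theta>. ennreal (exp (\<beta> * spin_energy n \<theta>) / (?c * mass)))"
    unfolding rooted_spin_model_def spin_gibbs_def Let_def base_def[symmetric] Z ..
  also have "\<dots> = density rooted_reference (\<lambda>\<theta>. ennreal (weight \<theta> / mass))"
  proof (rule density_cong)
    show "AE \<theta> in rooted_reference. ennreal (exp (\<beta> * spin_energy n \<theta>) / (?c * mass)) = ennreal (weight \<theta> / mass)"
      using AEw by eventually_elim simp
  qed (use m in measurable)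
  finally show ?thesis .
qed

lemma sets_model: "sets model = sets rooted_reference"
  by (simp add: model_eq)

lemma measurable_model: "measurable model M = measurable rooted_reference M"
  by (rule measurable_cong_sets[OF sets_model refl])

lemma integral_model:
  assumes "f \<in> borel_measurable rooted_reference"
  shows "(\<integral>\<theta>. f \<theta> \<partial>model) = (\<integral>\<theta>. weight \<theta> * f \<theta> \<partial>rooted_reference) / (mass :: real)"
proof -
  have "(\<integral>\<theta>. f \<theta> \<partial>model) = (\<integral>\<theta>. (weight \<theta> / mass) *\<^sub>R f \<theta> \<partial>rooted_reference)"
    unfolding model_eq using assms mass_pos weight_nonneg
        by (intro integral_density) (auto intro!: AE_I2 divide_nonneg_pos)
  then show ?thesis by (simp add: field_simps)
qed

lemma prob_space_model: "prob_space model"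
proof (rule prob_spaceI)
  have "emeasure model (space model) = (\<integral>\<^sup>+\<theta>. ennreal (weight \<theta> / mass) \<partial>rooted_reference)"
    unfolding model_eq by (subst emeasure_density) (auto intro!: nn_integral_cong)
  also have "\<dots> = ennreal (\<integral>\<theta>. weight \<theta> / mass \<partial>rooted_reference)"
  proof (rule nn_integral_eq_integral)
    show "integrable rooted_reference (\<lambda>\<theta>. weight \<theta> / mass)"
      by (rule rooted.integrable_const_bound[of _ "1 / mass"])
        (use weight_nonneg weight_le_1 mass_pos in \<open>auto intro!: AE_I2 divide_right_mono\<close>)
  qed (use weight_nonneg mass_pos in \<open>auto intro!: AE_I2 divide_nonneg_pos\<close>)
  also have "(\<integral>\<theta>. weight \<theta> / mass \<partial>rooted_reference) = 1"
    using mass_pos by (simp add: mass_rooted)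
  finally show "emeasure model (space model) = 1" by simp
qed

sublocale model: prob_space model
  by (rule prob_space_model)

lemma AE_model: "AE \<theta> in model. (\<forall>x\<in>torus n. norm (\<theta> x) = 1) \<and> \<theta> 0 = v"
proof -
  have "(\<lambda>\<theta>. ennreal (weight \<theta> / mass)) \<in> borel_measurable rooted_reference" by measurable
  then show ?thesis
    unfolding model_eq by (subst AE_density) (assumption, rule eventually_mono[OF AE_rooted_reference], blast)
qed

lemma component_measurable_model: "x \<in> torus n \<Longrightarrow> (\<lambda>\<theta>. \<theta> x) \<in> borel_measurable model"
  using component_measurable_rooted by (simp add: measurable_model)

text \<open>The norm of a weighted vector sum of differences is invariant under a common isometry,
  which a single coordinate of that sum is not; hence the full norm, and the dimension in the
  constant.\<close>

lemma rooted_infrared_bound: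
  fixes A :: real
  assumes A_nonneg: "0 \<le> A"
    and A: "\<And>h :: int \<times> int \<Rightarrow> real. h 0 = 0 \<Longrightarrow> (\<Sum>x\<in>torus n. r x * h x)\<^sup>2 \<le> A * torus_energy n h"
  shows "(\<integral>\<theta>. (norm (\<Sum>x\<in>torus n. r x *\<^sub>R (\<theta> x - \<theta> 0)))\<^sup>2 \<partial>model) \<le> 4 * real DIM('a) * A / \<beta>"
proof -
  let ?f = "\<lambda>\<theta>. (norm (\<Sum>x\<in>torus n. r x *\<^sub>R (\<theta> x - \<theta> 0 :: 'a)))\<^sup>2"
  have f: "?f \<in> borel_measurable reference"
  proof -
    have "(\<lambda>\<theta>. \<Sum>x\<in>torus n. r x *\<^sub>R (\<theta> x - \<theta> 0 :: 'a)) \<in> borel_measurable reference"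
      using zero_mem by (intro borel_measurable_sum borel_measurable_scaleR
        borel_measurable_diff borel_measurable_const component_measurable) auto
    then show ?thesis by measurable
  qed
  have "?f (\<lambda>x\<in>torus n. T (\<theta> x)) = ?f \<theta>" if T: "linear T" "\<And>x. norm (T x) = norm (x::'a)" for T \<theta>
  proof -
    have "(\<Sum>x\<in>torus n. r x *\<^sub>R ((\<lambda>x\<in>torus n. T (\<theta> x)) x - (\<lambda>x\<in>torus n. T (\<theta> x)) 0))
        = T (\<Sum>x\<in>torus n. r x *\<^sub>R (\<theta> x - \<theta> 0))"
      using zero_mem by (simp add: linear_sum[OF T(1)] linear_scale[OF T(1)] linear_diff[OF T(1)])
    then show ?thesis by (simp only: T(2))
  qed
  then have "(\<integral>\<theta>. weight \<theta> * ?f \<theta> \<partial>rooted_reference) = (\<integral>\<theta>. weight \<theta> * ?f \<theta> \<partial>reference)"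
    using f by (intro integral_rooted) auto
  also have "\<dots> \<le> 4 * real DIM('a) * A / \<beta> * mass" by (intro infrared_bound A_nonneg A)
  finally show ?thesis
    using f mass_pos by (simp add: integral_model measurable_rooted_reference field_simps)
qed

end

section \<open>The Ward identity\<close>

text \<open>For orthonormal \<open>e\<close> and \<open>u\<close>, the rotation by the angle
  \<open>s\<close> turning \<open>u\<close> towards \<open>e\<close> and fixing the orthogonal
  complement of their plane.\<close>

definition plane_rotation :: "'a::real_inner \<Rightarrow> 'a \<Rightarrow> real \<Rightarrow> 'a \<Rightarrow> 'a" where
  "plane_rotation e u s y = y + (cos s - 1) *\<^sub>R ((y \<bullet> e) *\<^sub>R e + (y \<bullet> u) *\<^sub>R u)
     + sin s *\<^sub>R ((y \<bullet> u) *\<^sub>R e - (y \<bullet> e) *\<^sub>R u)"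

lemma linear_plane_rotation: "linear (plane_rotation e u s)"
  unfolding plane_rotation_def by (intro linearI) (auto simp: algebra_simps inner_add_left)

lemma norm_plane_rotation:
  assumes "norm e = 1" "norm u = 1" "e \<bullet> u = 0"
  shows "norm (plane_rotation e u s y) = norm y"
proof -
  have eu: "e \<bullet> e = 1" "u \<bullet> u = 1" "e \<bullet> u = 0" "u \<bullet> e = 0" using assms by (auto simp: norm_eq_1 inner_commute)
  define a b c d where "a = y \<bullet> e" and "b = y \<bullet> u" and "c = cos s - 1" and "d = sin s"
  have "plane_rotation e u s y \<bullet> plane_rotation e u s y = y \<bullet> y + (a\<^sup>2 + b\<^sup>2) * (c\<^sup>2 + 2 * c + d\<^sup>2)"
    unfolding plane_rotation_def a_def[symmetric] b_def[symmetric] c_def[symmetric] d_def[symmetric]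
    by (simp add: inner_add_left inner_add_right inner_diff_left inner_diff_right eu inner_commute[of e y] inner_commute[of u y]
      a_def[symmetric] b_def[symmetric] power2_eq_square algebra_simps)
  also have "c\<^sup>2 + 2 * c + d\<^sup>2 = 0"
    using sin_cos_squared_add[of s] by (simp add: c_def d_def power2_eq_square algebra_simps)
  finally show ?thesis by (simp add: norm_eq)
qed

lemma torus_adj_irrefl: "n \<ge> 2 \<Longrightarrow> \<not> torus_adj n x x"
  by (auto simp: torus_adj_iff cyclic_adj_def torus_def)

lemma energy_form_single:
  fixes \<theta> :: "int \<times> int \<Rightarrow> 'a::real_inner"
  assumes x: "x \<in> torus n" and n: "n \<ge> 2"
  shows "energy_form n \<theta> (\<lambda>z. if z = x then d else 0) = (\<Sum>z\<in>torus n. if torus_adj n x z then (\<theta> x - \<theta> z) \<bullet> d else 0)"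
proof -
  let ?h = "\<lambda>z. if z = x then d else 0"
  let ?a = "\<lambda>w z. if torus_adj n w z then (\<theta> w - \<theta> z) \<bullet> ?h w else 0"
  have row: "(\<Sum>w\<in>torus n. \<Sum>z\<in>torus n. ?a w z) = (\<Sum>z\<in>torus n. if torus_adj n x z then (\<theta> x - \<theta> z) \<bullet> d else 0)"
  proof -
    have "(\<Sum>w\<in>torus n. \<Sum>z\<in>torus n. ?a w z) = (\<Sum>w\<in>{x}. \<Sum>z\<in>torus n. ?a w z)"
      using x by (intro sum.mono_neutral_right) (auto intro!: sum.neutral)
    then show ?thesis by (simp cong: if_cong)
  qed
  have "(\<Sum>w\<in>torus n. \<Sum>z\<in>torus n. if torus_adj n w z then (\<theta> w - \<theta> z) \<bullet> (?h w - ?h z) else 0)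
    = (\<Sum>w\<in>torus n. \<Sum>z\<in>torus n. ?a w z + ?a z w)"
  proof (intro sum.cong refl)
    fix w z
    have "torus_adj n w z \<longleftrightarrow> torus_adj n z w" using torus_adj_sym by blast
    then show "(if torus_adj n w z then (\<theta> w - \<theta> z) \<bullet> (?h w - ?h z) else 0) = ?a w z + ?a z w"
      by (simp add: inner_diff_left inner_diff_right)
  qed
  also have "\<dots> = (\<Sum>w\<in>torus n. \<Sum>z\<in>torus n. ?a w z) + (\<Sum>w\<in>torus n. \<Sum>z\<in>torus n. ?a z w)"
    by (simp only: sum.distrib)
  also have "(\<Sum>w\<in>torus n. \<Sum>z\<in>torus n. ?a z w) = (\<Sum>w\<in>torus n. \<Sum>z\<in>torus n. ?a w z)" by (rule sum.swap)
  finally show ?thesis unfolding energy_form_def by (simp only: row) simp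
qed

context rooted_spins
begin

definition neighbour_field :: "(int \<times> int \<Rightarrow> 'a) \<Rightarrow> int \<times> int \<Rightarrow> 'a" where
  "neighbour_field \<theta> x = (\<Sum>z\<in>torus n. if torus_adj n x z then \<theta> z else 0)"

text \<open>Preservation of the norm means that twice the inner product of \<theta>(x) and d plus
  |d|^2 vanishes. All terms proportional to the degree of \<open>x\<close> thus cancel, and only the
  coupling of \<open>d\<close> to the neighbouring spins is left.\<close>

lemma weight_update:
  assumes x: "x \<in> torus n" and eq: "norm (\<theta> x + d) = norm (\<theta> x)"
  shows "weight (\<lambda>z. \<theta> z + (if z = x then d else 0)) = weight \<theta> * exp (\<beta> * (d \<bullet> neighbour_field \<theta> x))"
proof -
  let ?h = "\<lambda>z. if z = x then d else 0"
  define m :: real where "m = (\<Sum>z\<in>torus n. if torus_adj n x z then 1 else 0)"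
  have 1: "energy_form n \<theta> ?h = m * (\<theta> x \<bullet> d) - d \<bullet> neighbour_field \<theta> x"
    unfolding energy_form_single[OF x n_ge] m_def neighbour_field_def sum_distrib_right inner_sum_right sum_subtractf[symmetric]
    by (intro sum.cong refl) (auto simp: inner_diff_left inner_diff_right inner_commute)
  have 2: "torus_energy n ?h = m * (d \<bullet> d)"
    unfolding energy_form_single[OF x n_ge] m_def sum_distrib_right
    using torus_adj_irrefl[OF n_ge, of x] by (intro sum.cong refl) auto
  have "(\<theta> x + d) \<bullet> (\<theta> x + d) = \<theta> x \<bullet> \<theta> x" using eq by (simp add: norm_eq)
  then have d: "2 * (\<theta> x \<bullet> d) + d \<bullet> d = 0" by (simp add: inner_add_left inner_add_right inner_commute)
  have "torus_energy n (\<lambda>z. \<theta> z + ?h z) = torus_energy n \<theta> + m * (2 * (\<theta> x \<bullet> d)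
      + d \<bullet> d) - 2 * (d \<bullet> neighbour_field \<theta> x)"
    by (simp add: energy_form_add 1 2 algebra_simps)
  then have E: "torus_energy n (\<lambda>z. \<theta> z + ?h z) = torus_energy n \<theta> - 2 * (d \<bullet> neighbour_field \<theta> x)"
    by (simp only: d)
  have "- \<beta> / 2 * torus_energy n (\<lambda>z. \<theta> z + ?h z) = - \<beta> / 2 * torus_energy n \<theta> + \<beta> * (d \<bullet> neighbour_field \<theta> x)"
    by (simp only: E) (simp add: algebra_simps)
  then show ?thesis by (simp only: weight_def exp_add)
qed

text \<open>The root is excluded because its Dirac mass is not rotation invariant.\<close>

lemma integral_rotate_site:
  assumes x: "x \<in> torus n" "x \<noteq> 0" and T: "linear T" "\<And>y. norm (T y) = norm (y :: 'a)"
    and f: "f \<in> borel_measurable rooted_reference"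
  shows "(\<integral>\<theta>. f (\<lambda>z\<in>torus n. if z = x then T (\<theta> z) else \<theta> z) \<partial>rooted_reference) = (\<integral>\<theta>. (f \<theta> :: real) \<partial>rooted_reference)"
proof -
  let ?T = "\<lambda>z. if z = x then T else (\<lambda>y. y)"
  have T_meas: "T \<in> borel_measurable borel"
    using T(1) by (intro borel_measurable_continuous_onI linear_continuous_on) (simp add: linear_conv_bounded_linear)
  have Tz: "?T z \<in> measurable (base z) (base z)" for z
    using T_meas by (simp add: measurable_cong_sets[OF sets_base sets_base])
  have dT: "distr rooted_reference rooted_reference (\<lambda>\<omega>. \<lambda>z\<in>torus n. ?T z (\<omega> z)) = rooted_reference"
  proof (rule distr_PiM_coordinatewise)
    fix z
    show "distr (base z) (base z) (?T z) = base z"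
    proof (cases "z = x")
      case True
      then have b: "base x = sphere_measure" using x(2) by (simp add: base_def)
      have "distr sphere_measure sphere_measure T = distr sphere_measure borel T"
        by (intro distr_cong) auto
      then show ?thesis using distr_sphere_measure_isometry[OF T] True by (simp add: b)
    qed (simp add: distr_id[unfolded id_def])
  qed (use Tz prob_space_base in auto)
  have m: "(\<lambda>\<omega>. \<lambda>z\<in>torus n. ?T z (\<omega> z)) \<in> measurable rooted_reference rooted_reference"
  proof (rule measurable_restrict)
    fix z assume z: "z \<in> torus n"
    show "(\<lambda>\<omega>. ?T z (\<omega> z)) \<in> measurable rooted_reference (base z)"
      using measurable_compose[OF measurable_component_singleton[OF z, of base] Tz[of z]] by simp
  qed
  have e: "(\<lambda>z\<in>torus n. ?T z (\<theta> z)) = (\<lambda>z\<in>torus n. if z = x then T (\<theta> z) else \<theta> z)" for \<theta>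
    by (auto simp: fun_eq_iff restrict_def)
  show ?thesis using integral_distr[OF m[unfolded e] f] by (simp only: dT[unfolded e])
qed

definition linear_obs :: "(int \<times> int \<Rightarrow> 'a) \<Rightarrow> (int \<times> int \<Rightarrow> 'a) \<Rightarrow> real" where
  "linear_obs q \<theta> = (\<Sum>z\<in>torus n. q z \<bullet> \<theta> z)"

lemma linear_obs_measurable: "linear_obs q \<in> borel_measurable rooted_reference"
  unfolding linear_obs_def[abs_def]
  by (intro borel_measurable_sum borel_measurable_inner borel_measurable_const component_measurable_rooted)

lemma neighbour_field_measurable: "(\<lambda>\<theta>. neighbour_field \<theta> x) \<in> borel_measurable rooted_reference"
proof -
  have "(\<lambda>\<theta>. if torus_adj n x z then \<theta> z else 0) \<in> borel_measurable rooted_reference" if "z \<in> torus n" for z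
    using component_measurable_rooted[OF that] by simp
  then show ?thesis unfolding neighbour_field_def by (rule borel_measurable_sum)
qed

lemma norm_neighbour_field_le:
  assumes "\<forall>x\<in>torus n. norm (\<theta> x) = 1"
  shows "norm (neighbour_field \<theta> x) \<le> real (card (torus n))"
proof -
  have "norm (neighbour_field \<theta> x) \<le> (\<Sum>z\<in>torus n. norm (if torus_adj n x z then \<theta> z else 0))"
    unfolding neighbour_field_def by (rule norm_sum)
  also have "\<dots> \<le> (\<Sum>z\<in>torus n. 1)" using assms by (intro sum_mono) auto
  finally show ?thesis by simp
qed

text \<open>The integral of weight times sin (t Y + a) is unchanged when the spin at
  \<open>x\<close> alone is rotated by \<open>s\<close> in the plane of \<open>u\<close> and
  \<open>e\<close>, so its derivative at \<open>s = 0\<close> is 0. The term with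
  \<open>\<beta>\<close> comes from the weight, the term with \<open>t\<close> from the
  observable.\<close>

lemma ward_identity:
  fixes e u :: 'a and q :: "int \<times> int \<Rightarrow> 'a"
  assumes x: "x \<in> torus n" "x \<noteq> 0" and eu: "norm e = 1" "norm u = 1" "e \<bullet> u = 0"
  shows "(\<integral>\<theta>. \<beta> * ((\<theta> x \<bullet> u) * (neighbour_field \<theta> x \<bullet> e) - (\<theta> x \<bullet> e) * (neighbour_field \<theta> x \<bullet> u)) * sin (t
      * linear_obs q \<theta> + a)
     + t * ((\<theta> x \<bullet> u) * (q x \<bullet> e) - (\<theta> x \<bullet> e) * (q x \<bullet> u)) * cos (t * linear_obs q \<theta> + a) \<partial>model) = 0"
proof -
  let ?R = rooted_reference and ?H = "\<lambda>\<theta>. neighbour_field \<theta> x" and ?Y = "linear_obs q"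
  note [measurable] = linear_obs_measurable neighbour_field_measurable component_measurable_rooted[OF x(1)]
  define P where "P \<theta> = (\<theta> x \<bullet> e) *\<^sub>R e + (\<theta> x \<bullet> u) *\<^sub>R u" for \<theta> :: "int \<times> int \<Rightarrow> 'a"
  define Q where "Q \<theta> = (\<theta> x \<bullet> u) *\<^sub>R e - (\<theta> x \<bullet> e) *\<^sub>R u" for \<theta> :: "int \<times> int \<Rightarrow> 'a"
  have [measurable]: "P \<in> borel_measurable ?R" "Q \<in> borel_measurable ?R"
    unfolding P_def[abs_def] Q_def[abs_def] by measurable
  \<comment> \<open>\<open>P\<close> is the projection of the spin to the plane and \<open>Q\<close>
    its quarter turn. Rotation multiplies the weight by exp (\<beta> X) and turns the observable
    into \<open>Z\<close>; primes denote derivatives in \<open>s\<close>.\<close>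
  define X where "X s \<theta> = (cos s - 1) * (P \<theta> \<bullet> ?H \<theta>) + sin s * (Q \<theta> \<bullet> ?H \<theta>)" for s \<theta>
  define Z where "Z s \<theta> = ?Y \<theta> + ((cos s - 1) * (P \<theta> \<bullet> q x) + sin s * (Q \<theta> \<bullet> q x))" for s \<theta>
  define X' where "X' s \<theta> = - sin s * (P \<theta> \<bullet> ?H \<theta>) + cos s * (Q \<theta> \<bullet> ?H \<theta>)" for s \<theta>
  define Z' where "Z' s \<theta> = - sin s * (P \<theta> \<bullet> q x) + cos s * (Q \<theta> \<bullet> q x)" for s \<theta>
  define G where "G s \<theta> = weight \<theta> * (exp (\<beta> * X s \<theta>) * sin (t * Z s \<theta> + a))" for s \<theta>
  define G' where "G' s \<theta> = weight \<theta> * (exp (\<beta> * X s \<theta>) * (\<beta> * X' s \<theta> * sin (t * Z s \<theta> + a)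
      + t * Z' s \<theta> * cos (t * Z s \<theta> + a)))" for s \<theta>
  have [measurable]: "X s \<in> borel_measurable ?R" "Z s \<in> borel_measurable ?R" "X' s \<in> borel_measurable ?R" "Z' s \<in> borel_measurable ?R" for s
    unfolding X_def[abs_def] Z_def[abs_def] X'_def[abs_def] Z'_def[abs_def] by measurable
  have G_meas: "G s \<in> borel_measurable ?R" "G' s \<in> borel_measurable ?R" for s
    unfolding G_def[abs_def] G'_def[abs_def] by measurable
  have deriv: "((\<lambda>s. G s \<theta>) has_real_derivative G' s \<theta>) (at s)" for s \<theta>
    unfolding G_def G'_def X_def Z_def X'_def Z'_def
    by (auto intro!: derivative_eq_intros simp: algebra_simps)
  \<comment> \<open>The following bounds depend on the size of the torus, which is harmless: they
    only justify differentiation under the integral at fixed size and temperature.\<close>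
  define m where "m = 2 * real (card (torus n))"
  define B where "B = exp (\<beta> * (3 * m)) * (\<beta> * (2 * m) + \<bar>t\<bar> * (2 * (2 * norm (q x))))"
  have bounds: "\<bar>P \<theta> \<bullet> ?H \<theta>\<bar> \<le> m" "\<bar>Q \<theta> \<bullet> ?H \<theta>\<bar> \<le> m" "\<bar>P \<theta> \<bullet> q x\<bar> \<le> 2 * norm (q x)" "\<bar>Q \<theta> \<bullet> q x\<bar> \<le> 2 * norm (q x)"
    if th: "\<forall>x\<in>torus n. norm (\<theta> x) = 1" for \<theta>
  proof -
    have c: "\<bar>\<theta> x \<bullet> e\<bar> \<le> 1" "\<bar>\<theta> x \<bullet> u\<bar> \<le> 1"
      using Cauchy_Schwarz_ineq2[of "\<theta> x" e] Cauchy_Schwarz_ineq2[of "\<theta> x" u] th x(1) eu by auto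
    have PQ: "norm (P \<theta>) \<le> 2" "norm (Q \<theta>) \<le> 2"
      unfolding P_def Q_def
      using c eu norm_triangle_ineq[of "(\<theta> x \<bullet> e) *\<^sub>R e" "(\<theta> x \<bullet> u) *\<^sub>R u"] norm_triangle_ineq4[of "(\<theta> x \<bullet> u) *\<^sub>R e" "(\<theta> x \<bullet> e) *\<^sub>R u"]
      by auto
    have H: "norm (?H \<theta>) \<le> real (card (torus n))" using th by (rule norm_neighbour_field_le)
    have *: "\<bar>y \<bullet> z\<bar> \<le> 2 * c" if "norm y \<le> 2" "norm z \<le> c" for y z :: 'a and c
      using Cauchy_Schwarz_ineq2[of y z] mult_mono[OF that] by (smt (verit) norm_ge_zero)
    show "\<bar>P \<theta> \<bullet> ?H \<theta>\<bar> \<le> m" "\<bar>Q \<theta> \<bullet> ?H \<theta>\<bar> \<le> m" "\<bar>P \<theta> \<bullet> q x\<bar> \<le> 2 * norm (q x)" "\<bar>Q \<theta> \<bullet> q x\<bar> \<le> 2 * norm (q x)"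
      unfolding m_def using PQ H by (auto intro!: *)
  qed
  have sc: "\<bar>sin s * y\<bar> \<le> c" "\<bar>cos s * y\<bar> \<le> c" "\<bar>(cos s - 1) * y\<bar> \<le> 2 * c" if "\<bar>y\<bar> \<le> c" for s y c :: real
  proof -
    have "\<bar>sin s\<bar> * \<bar>y\<bar> \<le> 1 * c" "\<bar>cos s\<bar> * \<bar>y\<bar> \<le> 1 * c" "\<bar>cos s - 1\<bar> * \<bar>y\<bar> \<le> 2 * c"
      using that abs_sin_le_one[of s] abs_cos_le_one[of s] by (intro mult_mono; linarith)+
    then show "\<bar>sin s * y\<bar> \<le> c" "\<bar>cos s * y\<bar> \<le> c" "\<bar>(cos s - 1) * y\<bar> \<le> 2 * c" by (simp_all add: abs_mult)
  qed
  have XZ_bounds: "X s \<theta> \<le> 3 * m" "\<bar>X' s \<theta>\<bar> \<le> 2 * m" "\<bar>Z' s \<theta>\<bar> \<le> 2 * (2 * norm (q x))"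
    if "\<forall>x\<in>torus n. norm (\<theta> x) = 1" for s \<theta>
  proof -
    have tri: "\<bar>p\<bar> \<le> c \<Longrightarrow> \<bar>q\<bar> \<le> d \<Longrightarrow> \<bar>- p + q\<bar> \<le> c + d" "\<bar>p\<bar> \<le> c \<Longrightarrow> \<bar>q\<bar> \<le> d \<Longrightarrow> p + q \<le> c + d"
      for p q c d :: real by linarith+
    have "X s \<theta> \<le> 2 * m + m"
      unfolding X_def by (intro tri sc bounds that)
    then show "X s \<theta> \<le> 3 * m" by simp
    have "\<bar>X' s \<theta>\<bar> \<le> m + m"
      unfolding X'_def mult_minus_left by (intro tri sc bounds that)
    then show "\<bar>X' s \<theta>\<bar> \<le> 2 * m" by simp
    have "\<bar>Z' s \<theta>\<bar> \<le> 2 * norm (q x) + 2 * norm (q x)"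
      unfolding Z'_def mult_minus_left by (intro tri sc bounds that)
    then show "\<bar>Z' s \<theta>\<bar> \<le> 2 * (2 * norm (q x))" by simp
  qed
  have B: "AE \<theta> in ?R. \<forall>s. \<bar>G' s \<theta>\<bar> \<le> B"
    using AE_rooted_reference
  proof eventually_elim
    case (elim \<theta>)
    then have th: "\<forall>x\<in>torus n. norm (\<theta> x) = 1" by blast
    show ?case
    proof
      fix s
      have "\<bar>\<beta> * X' s \<theta> * sin (t * Z s \<theta> + a)\<bar> \<le> \<beta> * (2 * m)"
        using sc(1)[of "\<beta> * X' s \<theta>" "\<beta> * (2 * m)" "t * Z s \<theta> + a"] XZ_bounds(2)[OF th, of s] \<beta>_pos
            by (simp add: abs_mult mult.commute)
      moreover have "\<bar>t * Z' s \<theta> * cos (t * Z s \<theta> + a)\<bar> \<le> \<bar>t\<bar> * (2 * (2 * norm (q x)))"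
        using sc(2)[of "t * Z' s \<theta>" "\<bar>t\<bar> * (2 * (2 * norm (q x)))" "t * Z s \<theta> + a"] XZ_bounds(3)[OF th, of s]
            by (simp add: abs_mult mult.commute mult_left_mono)
      ultimately have 1: "\<bar>\<beta> * X' s \<theta> * sin (t * Z s \<theta> + a) + t * Z' s \<theta> * cos (t * Z s \<theta> + a)\<bar>
          \<le> \<beta> * (2 * m) + \<bar>t\<bar> * (2 * (2 * norm (q x)))" by linarith
      have "exp (\<beta> * X s \<theta>) \<le> exp (\<beta> * (3 * m))" using XZ_bounds(1)[OF th, of s] \<beta>_pos by simp
      then have "exp (\<beta> * X s \<theta>) * \<bar>\<beta> * X' s \<theta> * sin (t * Z s \<theta> + a) + t * Z' s \<theta> * cos (t * Z s \<theta> + a)\<bar> \<le> B"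
        unfolding B_def by (intro mult_mono 1) auto
      then have "weight \<theta> * (exp (\<beta> * X s \<theta>) * \<bar>\<beta> * X' s \<theta> * sin (t * Z s \<theta> + a) + t * Z' s \<theta> * cos (t * Z s \<theta>
          + a)\<bar>) \<le> 1 * B"
        using weight_nonneg weight_le_1 by (intro mult_mono) auto
      then show "\<bar>G' s \<theta>\<bar> \<le> B" unfolding G'_def using weight_nonneg[of \<theta>] by (simp add: abs_mult)
    qed
  qed
  have int: "integrable ?R (G s)" for s
  proof (rule rooted.integrable_const_bound[of _ "exp (\<beta> * (3 * m))"])
    show "AE \<theta> in ?R. norm (G s \<theta>) \<le> exp (\<beta> * (3 * m))"
      using AE_rooted_reference
    proof eventually_elim
      case (elim \<theta>)
      then have th: "\<forall>x\<in>torus n. norm (\<theta> x) = 1" by blast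
      have "exp (\<beta> * X s \<theta>) \<le> exp (\<beta> * (3 * m))" using XZ_bounds(1)[OF th, of s] \<beta>_pos by simp
      then have "weight \<theta> * (exp (\<beta> * X s \<theta>) * \<bar>sin (t * Z s \<theta> + a)\<bar>) \<le> 1 * (exp (\<beta> * (3 * m)) * 1)"
        using weight_nonneg weight_le_1 abs_sin_le_one by (intro mult_mono) auto
      then show ?case unfolding G_def using weight_nonneg[of \<theta>] by (simp add: abs_mult)
    qed
  qed (rule G_meas)
  have const: "(\<integral>\<theta>. G s \<theta> \<partial>?R) = (\<integral>\<theta>. weight \<theta> * sin (t * ?Y \<theta> + a) \<partial>?R)" for s
  proof -
    let ?T = "plane_rotation e u s"
    let ?f = "\<lambda>\<theta>. weight \<theta> * sin (t * ?Y \<theta> + a)"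
    have "?f (\<lambda>z\<in>torus n. if z = x then ?T (\<theta> z) else \<theta> z) = G s \<theta>" for \<theta>
    proof -
      define d where "d = (cos s - 1) *\<^sub>R P \<theta> + sin s *\<^sub>R Q \<theta>"
      let ?\<theta>' = "\<lambda>z. \<theta> z + (if z = x then d else 0)"
      have T: "?T (\<theta> x) = \<theta> x + d" by (simp add: plane_rotation_def d_def P_def Q_def)
      have eq: "(\<lambda>z\<in>torus n. if z = x then ?T (\<theta> z) else \<theta> z) = (\<lambda>z\<in>torus n. ?\<theta>' z)"
        using T by (auto simp: fun_eq_iff restrict_def)
      have "weight (\<lambda>z\<in>torus n. ?\<theta>' z) = weight ?\<theta>'" by (simp add: weight_def energy_form_restrict)
      also have "\<dots> = weight \<theta> * exp (\<beta> * (d \<bullet> ?H \<theta>))"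
        using norm_plane_rotation[OF eu, of s "\<theta> x"] by (intro weight_update x) (simp add: T)
      also have "d \<bullet> ?H \<theta> = X s \<theta>" by (simp add: d_def X_def inner_add_left)
      finally have w: "weight (\<lambda>z\<in>torus n. ?\<theta>' z) = weight \<theta> * exp (\<beta> * X s \<theta>)" .
      have "?Y (\<lambda>z\<in>torus n. ?\<theta>' z) = (\<Sum>z\<in>torus n. q z \<bullet> \<theta> z + (if z = x then q x \<bullet> d else 0))"
        unfolding linear_obs_def by (intro sum.cong refl) (auto simp: inner_add_right)
      also have "\<dots> = ?Y \<theta> + q x \<bullet> d" using x by (simp add: sum.distrib linear_obs_def)
      also have "\<dots> = Z s \<theta>" by (simp add: Z_def d_def inner_add_right inner_commute)
      finally show ?thesis unfolding eq w by (simp add: G_def)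
    qed
    then show ?thesis
      using integral_rotate_site[OF x linear_plane_rotation norm_plane_rotation[OF eu], of ?f s] by simp
  qed
  have "((\<lambda>s. \<integral>\<theta>. G s \<theta> \<partial>?R) has_real_derivative (\<integral>\<theta>. G' 0 \<theta> \<partial>?R)) (at 0)"
    by (rule has_real_derivative_integral[OF _ G_meas int deriv B]) unfold_locales
  then have G0: "(\<integral>\<theta>. G' 0 \<theta> \<partial>?R) = 0"
    unfolding const using DERIV_const DERIV_unique by blast
  define F where "F \<theta> = \<beta> * ((\<theta> x \<bullet> u) * (?H \<theta> \<bullet> e) - (\<theta> x \<bullet> e) * (?H \<theta> \<bullet> u)) * sin (t * ?Y \<theta> + a)
     + t * ((\<theta> x \<bullet> u) * (q x \<bullet> e) - (\<theta> x \<bullet> e) * (q x \<bullet> u)) * cos (t * ?Y \<theta> + a)" for \<theta>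
  have F_meas: "F \<in> borel_measurable ?R"
    unfolding F_def[abs_def] by measurable
  have "G' 0 \<theta> = weight \<theta> * F \<theta>" for \<theta>
  proof -
    have "Q \<theta> \<bullet> y = (\<theta> x \<bullet> u) * (y \<bullet> e) - (\<theta> x \<bullet> e) * (y \<bullet> u)" for y
      unfolding Q_def inner_diff_left inner_scaleR_left by (simp add: inner_commute)
    then show ?thesis by (simp add: G'_def X_def Z_def X'_def Z'_def F_def)
  qed
  then have "(\<integral>\<theta>. F \<theta> \<partial>model) = 0"
    unfolding integral_model[OF F_meas] using G0 by (simp only: div_0)
  then show ?thesis by (simp only: F_def)
qed

end

section \<open>Cosine means of linear observables\<close>

lemma laplacian_symmetric:
  fixes g \<psi> :: "int \<times> int \<Rightarrow> real"
  assumes S: "finite S" and supp: "\<And>x. g x \<noteq> 0 \<Longrightarrow> x \<in> S \<and> neighbours x \<subseteq> S"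
  shows "(\<Sum>x\<in>S. g x * laplacian \<psi> x) = (\<Sum>x\<in>S. \<psi> x * laplacian g x)"
proof -
  have "(\<Sum>x\<in>S. \<Sum>y\<in>neighbours x. g x * \<psi> y) = (\<Sum>y\<in>S. \<Sum>x\<in>neighbours y. g x * \<psi> y)"
    using S supp by (intro sum_neighbours_swap) auto
  then show ?thesis
    by (simp add: laplacian_def sum_subtractf right_diff_distrib sum_distrib_left mult_ac)
qed

text \<open>The integrating factor exp (s t^2 / 2) turns the approximate equation into a small
  derivative; the mean value theorem and division by the factor at time 1 do the rest.\<close>

lemma real_ode_bound:
  fixes \<phi> \<phi>' :: "real \<Rightarrow> real"
  assumes deriv: "\<And>t. (\<phi> has_real_derivative \<phi>' t) (at t)"
    and bound: "\<And>t. 0 \<le> t \<Longrightarrow> t \<le> 1 \<Longrightarrow> \<bar>\<phi>' t + t * s * \<phi> t\<bar> \<le> \<epsilon>"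
  shows "\<bar>\<phi> 1 - \<phi> 0 * exp (- s / 2)\<bar> \<le> \<epsilon> * exp \<bar>s\<bar>"
proof -
  define F where "F t = \<phi> t * exp (s * t\<^sup>2 / 2)" for t
  have F: "(F has_real_derivative (\<phi>' t + t * s * \<phi> t) * exp (s * t\<^sup>2 / 2)) (at t)" for t
    unfolding F_def by (auto intro!: derivative_eq_intros deriv simp: algebra_simps)
  obtain t where t: "0 < t" "t < 1" "F 1 - F 0 = (1 - 0) * ((\<phi>' t + t * s * \<phi> t) * exp (s * t\<^sup>2 / 2))"
    using MVT2[of 0 1 F "\<lambda>t. (\<phi>' t + t * s * \<phi> t) * exp (s * t\<^sup>2 / 2)"] F by auto
  have t2: "t\<^sup>2 \<le> 1" using t(1,2) by (simp add: power_le_one)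
  have "s * t\<^sup>2 \<le> \<bar>s\<bar> * 1" using t2 by (intro mult_mono) auto
  then have e: "exp (s * t\<^sup>2 / 2) \<le> exp (\<bar>s\<bar> / 2)" by simp
  have \<epsilon>: "0 \<le> \<epsilon>" using bound[of 0] by simp
  have "\<bar>F 1 - F 0\<bar> \<le> \<epsilon> * exp (\<bar>s\<bar> / 2)"
    using t bound[of t] e \<epsilon> by (auto simp: abs_mult intro!: mult_mono)
  moreover have "\<phi> 1 - \<phi> 0 * exp (- s / 2) = (F 1 - F 0) * exp (- s / 2)"
    by (simp add: F_def left_diff_distrib exp_minus)
  ultimately have "\<bar>\<phi> 1 - \<phi> 0 * exp (- s / 2)\<bar> \<le> (\<epsilon> * exp (\<bar>s\<bar> / 2)) * exp (- s / 2)"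
    by (simp add: abs_mult mult_right_mono)
  also have "\<dots> \<le> \<epsilon> * exp (\<bar>s\<bar> / 2) * exp (\<bar>s\<bar> / 2)"
    using \<epsilon> by (intro mult_left_mono) auto
  also have "\<dots> = \<epsilon> * exp \<bar>s\<bar>" by (simp add: mult.assoc exp_add[symmetric])
  finally show ?thesis .
qed

context rooted_spins
begin

lemma n_ge_1: "n \<ge> 1" using n_ge by simp

lemma proj_measurable: "(\<lambda>\<theta>. \<theta> (torus_proj n x)) \<in> borel_measurable model"
  by (intro component_measurable_model torus_proj_mem n_ge_1)

lemma AE_proj: "AE \<theta> in model. (\<forall>x. norm (\<theta> (torus_proj n x)) = 1) \<and> \<theta> 0 = v"
  using AE_model by eventually_elim (use torus_proj_mem[OF n_ge_1] in auto)

lemma lattice_infrared: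
  fixes A :: real
  assumes A_nonneg: "0 \<le> A"
    and A: "\<And>H :: int \<times> int \<Rightarrow> real. H 0 = 0 \<Longrightarrow> (\<Sum>x\<in>l1_ball \<rho>. u x * H (torus_proj n x))\<^sup>2 \<le> A * torus_energy n H"
  shows "(\<integral>\<theta>. (norm (\<Sum>x\<in>l1_ball \<rho>. u x *\<^sub>R (\<theta> (torus_proj n x) - \<theta> 0)))\<^sup>2 \<partial>model) \<le> 4 * real DIM('a) * A / \<beta>"
proof -
  \<comment> \<open>The weights are pushed forward to residues; weights of points with the same
    residue add up, so no injectivity is required here.\<close>
  define r where "r z = (\<Sum>x\<in>l1_ball \<rho>. if z = torus_proj n x then u x else 0)" for z
  have r: "(\<Sum>z\<in>torus n. r z *\<^sub>R \<phi> z) = (\<Sum>x\<in>l1_ball \<rho>. u x *\<^sub>R \<phi> (torus_proj n x))" for \<phi> :: "int \<times> int \<Rightarrow> 'b::real_vector"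
  proof -
    have "(\<Sum>z\<in>torus n. r z *\<^sub>R \<phi> z) = (\<Sum>z\<in>torus n. \<Sum>x\<in>l1_ball \<rho>. if z
        = torus_proj n x then u x *\<^sub>R \<phi> (torus_proj n x) else 0)"
      unfolding r_def scaleR_left.sum by (intro sum.cong refl) auto
    also have "\<dots> = (\<Sum>x\<in>l1_ball \<rho>. \<Sum>z\<in>torus n. if z = torus_proj n x then u x *\<^sub>R \<phi> (torus_proj n x) else 0)"
      by (rule sum.swap)
    also have "\<dots> = (\<Sum>x\<in>l1_ball \<rho>. u x *\<^sub>R \<phi> (torus_proj n x))"
      using torus_proj_mem[OF n_ge_1] by (intro sum.cong refl) simp
    finally show ?thesis .
  qed
  have "(\<Sum>z\<in>torus n. r z * H z)\<^sup>2 \<le> A * torus_energy n H" if "H 0 = 0" for H :: "int \<times> int \<Rightarrow> real"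
    using A[of H, OF that] r[of H] by simp
  then have "(\<integral>\<theta>. (norm (\<Sum>x\<in>torus n. r x *\<^sub>R (\<theta> x - \<theta> 0)))\<^sup>2 \<partial>model) \<le> 4 * real DIM('a) * A / \<beta>"
    by (intro rooted_infrared_bound A_nonneg)
  then show ?thesis by (simp only: r)
qed

lemma integrable_bounded:
  fixes f :: "(int \<times> int \<Rightarrow> 'a) \<Rightarrow> real"
  assumes "f \<in> borel_measurable model" "\<And>\<theta>. (\<forall>x. norm (\<theta> (torus_proj n x)) = 1) \<Longrightarrow> \<theta> 0 = v \<Longrightarrow> \<bar>f \<theta>\<bar> \<le> B"
  shows "integrable model f"
proof (rule model.integrable_const_bound[of _ B])
  show "AE \<theta> in model. norm (f \<theta>) \<le> B"
    using AE_proj by eventually_elim (simp add: assms(2))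
qed (rule assms(1))

text \<open>The dual bound for a point evaluation. The quadratic growth in the distance is far from
  sharp, but it is uniform in \<open>n\<close>, and only sites in a fixed ball are ever
  inserted.\<close>

lemma site_second_moment:
  "(\<integral>\<theta>. (norm (\<theta> (torus_proj n x) - v))\<^sup>2 \<partial>model) \<le> 8 * real DIM('a) * (real (l1_norm x))\<^sup>2 / \<beta>"
proof -
  have x: "x \<in> l1_ball (l1_norm x)" by (simp add: l1_ball_def)
  have delta: "(\<Sum>y\<in>l1_ball (l1_norm x). (if y = x then 1 else 0) *\<^sub>R \<phi> y) = \<phi> x" for \<phi> :: "int \<times> int \<Rightarrow> 'b::real_vector"
    using x by (subst sum.cong[OF refl, of _ _ "\<lambda>y. if y = x then \<phi> x else 0"]) auto
  have "(\<Sum>y\<in>l1_ball (l1_norm x). (if y = x then 1 else 0) * H (torus_proj n y))\<^sup>2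
      \<le> (2 * (real (l1_norm x))\<^sup>2) * torus_energy n H"
    if "H 0 = 0" for H :: "int \<times> int \<Rightarrow> real"
    using point_dual_bound[of n H x] n_ge_1 that delta[of "\<lambda>y. H (torus_proj n y)"] by simp
  from lattice_infrared[OF _ this]
  have "(\<integral>\<theta>. (norm (\<Sum>y\<in>l1_ball (l1_norm x). (if y = x then 1 else 0) *\<^sub>R (\<theta> (torus_proj n y) - \<theta> 0)))\<^sup>2 \<partial>model)
      \<le> 4 * real DIM('a) * (2 * (real (l1_norm x))\<^sup>2) / \<beta>" by simp
  also have "(\<integral>\<theta>. (norm (\<Sum>y\<in>l1_ball (l1_norm x). (if y = x then 1 else 0) *\<^sub>R (\<theta> (torus_proj n y) - \<theta> 0)))\<^sup>2 \<partial>model)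
      = (\<integral>\<theta>. (norm (\<theta> (torus_proj n x) - \<theta> 0))\<^sup>2 \<partial>model)"
    by (simp only: delta)
  also have "\<dots> = (\<integral>\<theta>. (norm (\<theta> (torus_proj n x) - v))\<^sup>2 \<partial>model)"
  proof (rule integral_cong_AE)
    have m0: "(\<lambda>\<theta>. \<theta> 0) \<in> borel_measurable model" using component_measurable_model zero_mem by blast
    note [measurable] = proj_measurable[of x] m0
    show "(\<lambda>\<theta>. (norm (\<theta> (torus_proj n x) - \<theta> 0))\<^sup>2) \<in> borel_measurable model"
      "(\<lambda>\<theta>. (norm (\<theta> (torus_proj n x) - v))\<^sup>2) \<in> borel_measurable model" by measurable
    show "AE \<theta> in model. (norm (\<theta> (torus_proj n x) - \<theta> 0))\<^sup>2 = (norm (\<theta> (torus_proj n x) - v))\<^sup>2"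
      using AE_proj by eventually_elim simp
  qed
  finally show ?thesis by simp
qed

lemma sum_torus_collect:
  fixes F :: "int \<times> int \<Rightarrow> 'b::real_vector"
  shows "(\<Sum>z\<in>torus n. \<Sum>y\<in>S. if torus_proj n y = z then F y else 0) = (\<Sum>y\<in>S. F y)"
proof -
  have "(\<Sum>z\<in>torus n. \<Sum>y\<in>S. if torus_proj n y = z then F y else 0) = (\<Sum>y\<in>S. \<Sum>z\<in>torus n. if torus_proj n y
      = z then F y else 0)"
    by (rule sum.swap)
  then show ?thesis using torus_proj_mem[OF n_ge_1] by simp
qed

end

section \<open>Linear observables of the transversal spins and their cosine means\<close>

locale rooted_spins_obs = rooted_spins \<beta> n v for \<beta> n and v :: "'a::euclidean_space" +
  fixes Bs :: "'a set" and f :: "'a \<Rightarrow> int \<times> int \<Rightarrow> real" and R0 :: nat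
  assumes fin_Bs: "finite Bs" and norm_Bs: "\<And>e. e \<in> Bs \<Longrightarrow> norm e = 1"
    and orth: "\<And>e e'. e \<in> Bs \<Longrightarrow> e' \<in> Bs \<Longrightarrow> e \<noteq> e' \<Longrightarrow> e \<bullet> e' = 0"
    and orth_v: "\<And>e. e \<in> Bs \<Longrightarrow> e \<bullet> v = 0"
begin

definition obs :: "(int \<times> int \<Rightarrow> 'a) \<Rightarrow> real" where
  "obs \<theta> = sqrt \<beta> * (\<Sum>e\<in>Bs. \<Sum>y\<in>l1_ball R0. f e y * (\<theta> (torus_proj n y) \<bullet> e))"

text \<open>The coefficient field of \<open>obs\<close> on the torus. Collecting all points of the
  ball with the same residue makes \<open>linear_obs_vector\<close> true even when the ball wraps
  around.\<close>

definition obs_vector :: "int \<times> int \<Rightarrow> 'a" where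
  "obs_vector z = sqrt \<beta> *\<^sub>R (\<Sum>e\<in>Bs. \<Sum>y\<in>l1_ball R0. if torus_proj n y = z then f e y *\<^sub>R e else 0)"

definition f0 :: "'a \<Rightarrow> int \<times> int \<Rightarrow> real" where
  "f0 e x = (if x \<in> l1_ball R0 then f e x else 0)"

lemma linear_obs_vector: "linear_obs obs_vector \<theta> = obs \<theta>"
proof -
  have "linear_obs obs_vector \<theta> = sqrt \<beta> * (\<Sum>z\<in>torus n. \<Sum>e\<in>Bs. \<Sum>y\<in>l1_ball R0. if torus_proj n y
      = z then f e y * (\<theta> (torus_proj n y) \<bullet> e) else 0)"
    unfolding linear_obs_def obs_vector_def inner_scaleR_left inner_sum_left sum_distrib_left
    by (intro sum.cong refl) (auto simp: inner_commute)
  also have "\<dots> = sqrt \<beta> * (\<Sum>e\<in>Bs. \<Sum>z\<in>torus n. \<Sum>y\<in>l1_ball R0. if torus_proj n y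
      = z then f e y * (\<theta> (torus_proj n y) \<bullet> e) else 0)"
    by (subst sum.swap) simp
  finally show ?thesis by (simp only: sum_torus_collect obs_def)
qed

lemma obs_measurable [measurable]: "obs \<in> borel_measurable model"
  using linear_obs_measurable[of obs_vector] by (simp add: linear_obs_vector[abs_def] measurable_model)

lemma obs_vector_inner:
  assumes R: "R0 \<le> R" "2 * R < n" and x: "x \<in> l1_ball R"
  shows "e \<in> Bs \<Longrightarrow> obs_vector (torus_proj n x) \<bullet> e = sqrt \<beta> * f0 e x" "obs_vector (torus_proj n x) \<bullet> v = 0"
proof -
  have eq: "obs_vector (torus_proj n x) = sqrt \<beta> *\<^sub>R (\<Sum>e\<in>Bs. f0 e x *\<^sub>R e)"
  proof -
    have "(\<Sum>y\<in>l1_ball R0. if torus_proj n y = torus_proj n x then f e y *\<^sub>R e else 0) = f0 e x *\<^sub>R e" for e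
    proof -
      have "torus_proj n y = torus_proj n x \<longleftrightarrow> y = x" if "y \<in> l1_ball R0" for y
        using inj_on_torus_proj_l1_ball[OF R(2)] that x l1_ball_mono[OF R(1)] by (auto simp: inj_on_def)
      then have "(\<Sum>y\<in>l1_ball R0. if torus_proj n y = torus_proj n x then f e y *\<^sub>R e else 0) = (\<Sum>y\<in>l1_ball R0. if y
          = x then f e x *\<^sub>R e else 0)"
        by (intro sum.cong refl) auto
      then show ?thesis by (simp add: f0_def)
    qed
    then show ?thesis by (simp add: obs_vector_def)
  qed
  show "obs_vector (torus_proj n x) \<bullet> e = sqrt \<beta> * f0 e x" if e: "e \<in> Bs"
  proof -
    have "(\<Sum>e'\<in>Bs. f0 e' x * (e' \<bullet> e)) = (\<Sum>e'\<in>Bs. if e' = e then f0 e x else 0)"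
      using e orth norm_Bs by (intro sum.cong refl) (auto simp: norm_eq_1)
    then show ?thesis using e fin_Bs by (simp add: eq inner_sum_left)
  qed
  show "obs_vector (torus_proj n x) \<bullet> v = 0"
    by (simp add: eq inner_sum_left orth_v)
qed

lemma obs_bound:
  assumes "\<forall>x. norm (\<theta> (torus_proj n x)) = 1"
  shows "\<bar>obs \<theta>\<bar> \<le> sqrt \<beta> * (\<Sum>e\<in>Bs. \<Sum>y\<in>l1_ball R0. \<bar>f e y\<bar>)"
proof -
  have "\<bar>\<Sum>e\<in>Bs. \<Sum>y\<in>l1_ball R0. f e y * (\<theta> (torus_proj n y) \<bullet> e)\<bar> \<le> (\<Sum>e\<in>Bs. \<Sum>y\<in>l1_ball R0. \<bar>f e y\<bar>)"
  proof (intro order_trans[OF sum_abs] sum_mono)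
    fix e y assume e: "e \<in> Bs"
    have "\<bar>\<theta> (torus_proj n y) \<bullet> e\<bar> \<le> 1"
      using Cauchy_Schwarz_ineq2[of "\<theta> (torus_proj n y)" e] assms norm_Bs[OF e] by simp
    then show "\<bar>f e y * (\<theta> (torus_proj n y) \<bullet> e)\<bar> \<le> \<bar>f e y\<bar>"
      by (simp add: abs_mult mult_left_le)
  qed
  then show ?thesis using \<beta>_pos by (simp add: obs_def abs_mult mult_left_mono)
qed

text \<open>The phase \<open>a\<close> lets real cosines carry both parts of the characteristic
  function, and it survives differentiation in \<open>t\<close>.\<close>

definition cos_mean :: "real \<Rightarrow> real \<Rightarrow> real" where
  "cos_mean a t = (\<integral>\<theta>. cos (t * obs \<theta> + a) \<partial>model)"

lemma cos_mean_deriv: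
  "(cos_mean a has_real_derivative - (\<integral>\<theta>. obs \<theta> * sin (t * obs \<theta> + a) \<partial>model)) (at t)"
proof -
  let ?B = "sqrt \<beta> * (\<Sum>e\<in>Bs. \<Sum>y\<in>l1_ball R0. \<bar>f e y\<bar>)"
  have "((\<lambda>t. \<integral>\<theta>. cos (t * obs \<theta> + a) \<partial>model) has_real_derivative (\<integral>\<theta>. - (obs \<theta> * sin (t * obs \<theta> + a)) \<partial>model)) (at t)"
  proof (rule has_real_derivative_integral)
    show "finite_measure model" by unfold_locales
    show "integrable model (\<lambda>\<theta>. cos (t * obs \<theta> + a))" for t
      by (rule model.integrable_const_bound[of _ 1]) auto
    show "((\<lambda>t. cos (t * obs \<theta> + a)) has_real_derivative - (obs \<theta> * sin (t * obs \<theta> + a))) (at t)" for t \<theta>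
      by (auto intro!: derivative_eq_intros)
    show "AE \<theta> in model. \<forall>t. \<bar>- (obs \<theta> * sin (t * obs \<theta> + a))\<bar> \<le> ?B"
      using AE_proj
    proof eventually_elim
      case (elim \<theta>)
      show ?case
      proof
        fix t
        have "\<bar>obs \<theta>\<bar> * \<bar>sin (t * obs \<theta> + a)\<bar> \<le> ?B * 1"
          using obs_bound[of \<theta>] elim by (intro mult_mono) auto
        then show "\<bar>- (obs \<theta> * sin (t * obs \<theta> + a))\<bar> \<le> ?B" by (simp add: abs_mult)
      qed
    qed
  qed measurable
  then show ?thesis by (simp add: cos_mean_def[abs_def])
qed

lemma cos_mean_bound: "\<bar>cos_mean a t\<bar> \<le> 1"
proof -
  have i: "integrable model (\<lambda>\<theta>. cos (t * obs \<theta> + a))"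
    by (rule model.integrable_const_bound[of _ 1]) auto
  have "\<bar>cos_mean a t\<bar> \<le> (\<integral>\<theta>. \<bar>cos (t * obs \<theta> + a)\<bar> \<partial>model)"
    unfolding cos_mean_def by (rule integral_abs_bound)
  also have "\<dots> \<le> (\<integral>\<theta>. 1 \<partial>model)" using i by (intro integral_mono) auto
  finally show ?thesis by (simp add: model.prob_space)
qed

lemma cos_mean_0: "cos_mean a 0 = cos a"
  by (simp add: cos_mean_def model.prob_space)

end

section \<open>Linearization of the Ward identity around the root direction\<close>

lemma one_minus_inner_unit:
  fixes a b :: "'a::real_inner"
  assumes "norm a = 1" "norm b = 1"
  shows "1 - a \<bullet> b = (norm (a - b))\<^sup>2 / 2"
proof -
  have "a \<bullet> a = 1" "b \<bullet> b = 1" using assms by (simp_all add: norm_eq_1)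
  then show ?thesis by (simp add: power2_norm_eq_inner inner_diff_left inner_diff_right inner_commute)
qed

lemma evolved_initial: "evolved f R0 0 z = (if z \<in> l1_ball R0 \<and> z \<noteq> 0 then f z else 0)"
proof -
  have "evolved f R0 0 z = (\<Sum>y\<in>l1_ball R0. if y = z then (if z \<noteq> 0 then f z else 0) else 0)"
    unfolding evolved_def by (intro sum.cong refl) auto
  then show ?thesis by simp
qed

context rooted_spins_obs
begin

abbreviation (input) "p \<equiv> torus_proj n"

lemma neighbour_field_proj:
  "n \<ge> 3 \<Longrightarrow> neighbour_field \<theta> (p x) = (\<Sum>z\<in>neighbours x. \<theta> (p z))"
  unfolding neighbour_field_def by (rule sum_torus_adj_proj)

lemma abs_inner_le_1:
  assumes "norm a = 1" "norm b = 1" shows "\<bar>a \<bullet> b\<bar> \<le> (1 :: real)"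
  using Cauchy_Schwarz_ineq2[of a b] assms by simp

lemma sum_neighbours_measurable:
  "(\<lambda>\<theta>. \<Sum>z\<in>neighbours x. \<theta> (p z) \<bullet> e - \<theta> (p x) \<bullet> e) \<in> borel_measurable model"
  by (intro borel_measurable_sum borel_measurable_diff borel_measurable_inner proj_measurable borel_measurable_const)

lemma gradient_sin_integrable:
  assumes e: "e \<in> Bs"
  shows "integrable model (\<lambda>\<theta>. sqrt \<beta> * (\<Sum>z\<in>neighbours x. \<theta> (p z) \<bullet> e - \<theta> (p x) \<bullet> e) * sin (t * obs \<theta> + a))"
proof (rule integrable_bounded[where B = "sqrt \<beta> * 8 * 1"])
  fix \<theta> :: "int \<times> int \<Rightarrow> 'a" assume th: "\<forall>x. norm (\<theta> (p x)) = 1"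
  have "\<bar>\<Sum>z\<in>neighbours x. \<theta> (p z) \<bullet> e - \<theta> (p x) \<bullet> e\<bar> \<le> (\<Sum>z\<in>neighbours x. 2)"
  proof (intro order_trans[OF sum_abs] sum_mono)
    fix z
    show "\<bar>\<theta> (p z) \<bullet> e - \<theta> (p x) \<bullet> e\<bar> \<le> 2"
      using abs_inner_le_1[OF th[rule_format, of z] norm_Bs[OF e]] abs_inner_le_1[OF th[rule_format, of x] norm_Bs[OF e]] by linarith
  qed
  then show "\<bar>sqrt \<beta> * (\<Sum>z\<in>neighbours x. \<theta> (p z) \<bullet> e - \<theta> (p x) \<bullet> e) * sin (t * obs \<theta> + a)\<bar> \<le> sqrt \<beta> * 8 * 1"
    unfolding abs_mult using \<beta>_pos by (intro mult_mono abs_sin_le_one) auto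
next
  note [measurable] = sum_neighbours_measurable
  show "(\<lambda>\<theta>. sqrt \<beta> * (\<Sum>z\<in>neighbours x. \<theta> (p z) \<bullet> e - \<theta> (p x) \<bullet> e) * sin (t * obs \<theta> + a)) \<in> borel_measurable model"
    by measurable
qed

text \<open>The Ward identity at \<open>x\<close> with every \<theta> . v replaced by 1, which turns
  its drift into the lattice Laplacian of the transversal field. Each replacement costs a squared
  distance to \<open>v\<close>, of mean order 1/\<beta> by \<open>site_second_moment\<close>,
  against a prefactor sqrt \<beta>.\<close>

lemma local_ward:
  assumes x: "x \<noteq> 0" "x \<in> l1_ball R" and R: "R0 \<le> R" "2 * R < n" and n: "n \<ge> 3"
    and e: "e \<in> Bs" and t: "\<bar>t\<bar> \<le> 1" and \<beta>: "\<beta> \<ge> 1"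
  shows "\<bar>(\<integral>\<theta>. sqrt \<beta> * (\<Sum>z\<in>neighbours x. \<theta> (p z) \<bullet> e - \<theta> (p x) \<bullet> e) * sin (t * obs \<theta> + a) \<partial>model)
      + t * f0 e x * cos_mean a t\<bar>
    \<le> (8 + \<bar>f0 e x\<bar>) * (8 * real DIM('a) * (real (Suc R))\<^sup>2) / sqrt \<beta>"
proof -
  let ?N = "8 * real DIM('a) * (real (Suc R))\<^sup>2"
  \<comment> \<open>\<open>W\<close> is the exact drift and \<open>W0\<close> its linearization;
    \<open>I\<close> and \<open>J\<close> are the corresponding integrands, and \<open>K\<close>
    dominates their difference.\<close>
  define W where "W \<theta> = (\<theta> (p x) \<bullet> v) * ((\<Sum>z\<in>neighbours x. \<theta> (p z)) \<bullet> e) - (\<theta> (p x) \<bullet> e)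
      * ((\<Sum>z\<in>neighbours x. \<theta> (p z)) \<bullet> v)"
    for \<theta> :: "int \<times> int \<Rightarrow> 'a"
  define W0 where "W0 \<theta> = (\<Sum>z\<in>neighbours x. \<theta> (p z) \<bullet> e - \<theta> (p x) \<bullet> e)" for \<theta> :: "int \<times> int \<Rightarrow> 'a"
  define D where "D z \<theta> = (norm (\<theta> (p z) - v))\<^sup>2" for z and \<theta> :: "int \<times> int \<Rightarrow> 'a"
  define K where "K \<theta> = sqrt \<beta> * (\<Sum>z\<in>neighbours x. D x \<theta> + D z \<theta>) + \<bar>f0 e x\<bar> * D x \<theta>" for \<theta>
  define I where "I \<theta> = sqrt \<beta> * W \<theta> * sin (t * obs \<theta> + a) + t * f0 e x * (\<theta> (p x) \<bullet> v) * cos (t * obs \<theta> + a)" for \<theta>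
  define J where "J \<theta> = sqrt \<beta> * W0 \<theta> * sin (t * obs \<theta> + a) + t * f0 e x * cos (t * obs \<theta> + a)" for \<theta>
  note [measurable] = proj_measurable
  have D_meas [measurable]: "D z \<in> borel_measurable model" for z unfolding D_def[abs_def] by measurable
  have W_meas [measurable]: "W \<in> borel_measurable model" unfolding W_def[abs_def] by measurable
  have W0_meas [measurable]: "W0 \<in> borel_measurable model" unfolding W0_def[abs_def] by measurable
  have K_meas [measurable]: "K \<in> borel_measurable model" unfolding K_def[abs_def] by measurable
  have I_meas [measurable]: "I \<in> borel_measurable model" unfolding I_def[abs_def] by measurable
  have J_meas [measurable]: "J \<in> borel_measurable model" unfolding J_def[abs_def] by measurable
  have px: "p x \<in> torus n" "p x \<noteq> 0"
  proof -
    show "p x \<in> torus n" by (rule torus_proj_mem[OF n_ge_1])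
    show "p x \<noteq> 0"
    proof
      assume "p x = 0"
      then have "p x = p 0" by simp
      moreover have "0 \<in> l1_ball R" by (simp add: l1_ball_def)
      ultimately show False using inj_onD[OF inj_on_torus_proj_l1_ball[OF R(2)]] x by blast
    qed
  qed
  have ward: "(\<integral>\<theta>. I \<theta> \<partial>model) = 0"
  proof -
    have sq: "sqrt \<beta> * sqrt \<beta> = \<beta>" using \<beta>_pos by simp
    \<comment> \<open>\<open>obs_vector\<close> carries a factor sqrt \<beta>, so exactly one such
      factor comes out of the whole identity; dividing by it leaves the drift with sqrt \<beta> and
      the source with a coefficient of order 1.\<close>
    have eq: "\<beta> * W \<theta> * sin (t * obs \<theta> + a) + t * ((\<theta> (p x) \<bullet> v) * (sqrt \<beta> * f0 e x) - (\<theta> (p x) \<bullet> e) * 0) * cos (t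
        * obs \<theta> + a)
        = sqrt \<beta> * I \<theta>" for \<theta>
    proof -
      have "(s * s) * w * S + t * (y * (s * r) - z * 0) * C = s * (s * w * S + t * r * y * C)" for s w S r y z C :: real
        by (simp add: algebra_simps)
      from this[of "sqrt \<beta>"] show ?thesis unfolding sq I_def .
    qed
    have "(\<integral>\<theta>. sqrt \<beta> * I \<theta> \<partial>model) = 0"
      using ward_identity[OF px norm_Bs[OF e] v orth_v[OF e], where q = obs_vector and t = t and a = a]
      unfolding linear_obs_vector neighbour_field_proj[OF n] obs_vector_inner[OF R x(2)] obs_vector_inner(1)[OF R x(2) e]
        W_def[symmetric] eq .
    then show ?thesis using \<beta>_pos by simp
  qed
  have diff: "\<bar>J \<theta> - I \<theta>\<bar> \<le> K \<theta>" if th: "\<forall>x. norm (\<theta> (p x)) = 1" for \<theta>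
  proof -
    have D: "1 - \<theta> (p z) \<bullet> v = D z \<theta> / 2" "0 \<le> D z \<theta>" for z
      using one_minus_inner_unit[OF _ v, of "\<theta> (p z)"] th by (auto simp: D_def)
    have Dabs: "\<bar>1 - \<theta> (p z) \<bullet> v\<bar> \<le> D z \<theta>" for z using D[of z] by simp
    have ie: "\<bar>\<theta> (p z) \<bullet> e\<bar> \<le> 1" for z
      using abs_inner_le_1[OF th[rule_format, of z] norm_Bs[OF e]] .
    \<comment> \<open>The difference consists of defects 1 - \<theta> . v at \<open>x\<close> and at
      its neighbours, each times a factor bounded by 1. Four neighbours with two defects each give
      the constant 8.\<close>
    have "W0 \<theta> - W \<theta> = (\<Sum>z\<in>neighbours x. (1 - \<theta> (p x) \<bullet> v) * (\<theta> (p z) \<bullet> e) - (1 - \<theta> (p z) \<bullet> v) * (\<theta> (p x) \<bullet> e))"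
      unfolding W0_def W_def inner_sum_left sum_distrib_left sum_subtractf[symmetric]
      by (intro sum.cong refl) (simp add: algebra_simps)
    also have "\<bar>\<dots>\<bar> \<le> (\<Sum>z\<in>neighbours x. D x \<theta> + D z \<theta>)"
    proof (intro order_trans[OF sum_abs] sum_mono)
      fix z
      have "\<bar>(1 - \<theta> (p x) \<bullet> v) * (\<theta> (p z) \<bullet> e)\<bar> \<le> D x \<theta> * 1" "\<bar>(1 - \<theta> (p z) \<bullet> v) * (\<theta> (p x) \<bullet> e)\<bar> \<le> D z \<theta> * 1"
        unfolding abs_mult by (intro mult_mono Dabs ie D(2); simp)+
      then show "\<bar>(1 - \<theta> (p x) \<bullet> v) * (\<theta> (p z) \<bullet> e) - (1 - \<theta> (p z) \<bullet> v) * (\<theta> (p x) \<bullet> e)\<bar> \<le> D x \<theta> + D z \<theta>" by linarith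
    qed
    finally have WW: "\<bar>W0 \<theta> - W \<theta>\<bar> \<le> (\<Sum>z\<in>neighbours x. D x \<theta> + D z \<theta>)" .
    have "J \<theta> - I \<theta> = sqrt \<beta> * ((W0 \<theta> - W \<theta>) * sin (t * obs \<theta> + a))
        + f0 e x * (t * ((1 - \<theta> (p x) \<bullet> v) * cos (t * obs \<theta> + a)))"
      by (simp add: I_def J_def algebra_simps)
    also have "\<bar>\<dots>\<bar> \<le> sqrt \<beta> * \<bar>(W0 \<theta> - W \<theta>) * sin (t * obs \<theta> + a)\<bar>
        + \<bar>f0 e x\<bar> * \<bar>t * ((1 - \<theta> (p x) \<bullet> v) * cos (t * obs \<theta> + a))\<bar>"
      using \<beta>_pos by (intro order_trans[OF abs_triangle_ineq]) (simp add: abs_mult)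
    also have "\<dots> \<le> K \<theta>"
      unfolding K_def
    proof (intro add_mono mult_left_mono)
      have "\<bar>W0 \<theta> - W \<theta>\<bar> * \<bar>sin (t * obs \<theta> + a)\<bar> \<le> (\<Sum>z\<in>neighbours x. D x \<theta> + D z \<theta>) * 1"
        by (intro mult_mono WW abs_sin_le_one) (auto intro!: sum_nonneg add_nonneg_nonneg D)
      then show "\<bar>(W0 \<theta> - W \<theta>) * sin (t * obs \<theta> + a)\<bar> \<le> (\<Sum>z\<in>neighbours x. D x \<theta> + D z \<theta>)" by (simp add: abs_mult)
      have "\<bar>t\<bar> * (\<bar>1 - \<theta> (p x) \<bullet> v\<bar> * \<bar>cos (t * obs \<theta> + a)\<bar>) \<le> 1 * (D x \<theta> * 1)"
        using D[of x] t by (intro mult_mono abs_cos_le_one) auto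
      then show "\<bar>t * ((1 - \<theta> (p x) \<bullet> v) * cos (t * obs \<theta> + a))\<bar> \<le> D x \<theta>" by (simp add: abs_mult)
    qed (use \<beta>_pos in auto)
    finally show ?thesis .
  qed
  have D_int: "integrable model (D z)" for z
  proof (rule integrable_bounded[where B = 4])
    fix \<theta> :: "int \<times> int \<Rightarrow> 'a" assume th: "\<forall>x. norm (\<theta> (p x)) = 1"
    have "norm (\<theta> (p z) - v) \<le> 2" using norm_triangle_ineq4[of "\<theta> (p z)" v] th v by simp
    then have "(norm (\<theta> (p z) - v))\<^sup>2 \<le> 2\<^sup>2" by (intro power_mono) auto
    then show "\<bar>D z \<theta>\<bar> \<le> 4" by (simp add: D_def)
  qed measurable
  have D_mean: "(\<integral>\<theta>. D z \<theta> \<partial>model) \<le> ?N / \<beta>" if "l1_norm z \<le> Suc R" for z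
  proof -
    have "(real (l1_norm z))\<^sup>2 \<le> (real (Suc R))\<^sup>2" using that
        by (intro power_mono) (simp_all only: of_nat_le_iff of_nat_0_le_iff)
    then have "8 * real DIM('a) * (real (l1_norm z))\<^sup>2 / \<beta> \<le> ?N / \<beta>"
      using \<beta>_pos by (intro divide_right_mono mult_left_mono) auto
    then show ?thesis using site_second_moment[of z] unfolding D_def by linarith
  qed
  have K_int: "integrable model K" unfolding K_def[abs_def] using D_int by auto
  have xR: "l1_norm x \<le> Suc R" using x(2) by (simp add: l1_ball_def)
  have zR: "l1_norm z \<le> Suc R" if "z \<in> neighbours x" for z using l1_norm_neighbours_le[OF that] x(2)
      by (simp add: l1_ball_def)
  have "(\<integral>\<theta>. K \<theta> \<partial>model) = sqrt \<beta> * (\<Sum>z\<in>neighbours x. (\<integral>\<theta>. D x \<theta> \<partial>model) + (\<integral>\<theta>. D z \<theta> \<partial>model))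
      + \<bar>f0 e x\<bar> * (\<integral>\<theta>. D x \<theta> \<partial>model)"
    unfolding K_def using D_int by simp
  also have "\<dots> \<le> sqrt \<beta> * (\<Sum>z\<in>neighbours x. ?N / \<beta> + ?N / \<beta>) + \<bar>f0 e x\<bar> * (?N / \<beta>)"
    using \<beta>_pos by (intro add_mono mult_left_mono sum_mono D_mean xR zR) auto
  also have "\<dots> = 8 * (sqrt \<beta> * (?N / \<beta>)) + \<bar>f0 e x\<bar> * (?N / \<beta>)" by simp
  finally have K_mean: "(\<integral>\<theta>. K \<theta> \<partial>model) \<le> 8 * (sqrt \<beta> * (?N / \<beta>)) + \<bar>f0 e x\<bar> * (?N / \<beta>)" .
  \<comment> \<open>For \<beta> \<ge> 1 the source error of order 1/\<beta> is absorbed in the drift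
    error of order 1/sqrt \<beta>.\<close>
  have "?N / \<beta> = (?N / sqrt \<beta>) / sqrt \<beta>" using \<beta>_pos by simp
  moreover have "0 \<le> ?N / sqrt \<beta>" using \<beta>_pos by simp
  moreover have "1 \<le> sqrt \<beta>" using \<beta> by simp
  ultimately have N1: "?N / \<beta> \<le> ?N / sqrt \<beta>"
    using \<beta>_pos divide_left_mono[of 1 "sqrt \<beta>" "?N / sqrt \<beta>"] by simp_all
  have "s * (c / (s * s)) = c / s" if "s > 0" for s c :: real using that by simp
  from this[of "sqrt \<beta>" ?N] have N2: "sqrt \<beta> * (?N / \<beta>) = ?N / sqrt \<beta>"
    using \<beta>_pos by (simp del: times_divide_eq_right)
  have "\<bar>f0 e x\<bar> * (?N / \<beta>) \<le> \<bar>f0 e x\<bar> * (?N / sqrt \<beta>)" by (intro mult_left_mono N1) simp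
  then have K_le: "(\<integral>\<theta>. K \<theta> \<partial>model) \<le> (8 + \<bar>f0 e x\<bar>) * ?N / sqrt \<beta>"
    using K_mean unfolding N2 by (simp add: ring_distribs add_divide_distrib)
  have card4: "norm (\<Sum>z\<in>neighbours x. \<theta> (p z)) \<le> 4" if "\<forall>x. norm (\<theta> (p x)) = 1" for \<theta> :: "int \<times> int \<Rightarrow> 'a"
    using norm_sum[of "\<lambda>z. \<theta> (p z)" "neighbours x"] that by simp
  have W0_int: "integrable model (\<lambda>\<theta>. sqrt \<beta> * W0 \<theta> * sin (t * obs \<theta> + a))"
    unfolding W0_def by (rule gradient_sin_integrable[OF e])
  have cos_int: "integrable model (\<lambda>\<theta>. t * f0 e x * cos (t * obs \<theta> + a))"
  proof (rule integrable_bounded[where B = "1 * \<bar>f0 e x\<bar> * 1"])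
    show "\<bar>t * f0 e x * cos (t * obs \<theta> + a)\<bar> \<le> 1 * \<bar>f0 e x\<bar> * 1" for \<theta>
      unfolding abs_mult using t by (intro mult_mono abs_cos_le_one) auto
  qed measurable
  have J_int: "integrable model J"
    unfolding J_def[abs_def] by (intro Bochner_Integration.integrable_add W0_int cos_int)
  have JI_int: "integrable model (\<lambda>\<theta>. J \<theta> - I \<theta>)"
  proof (rule Bochner_Integration.integrable_bound[OF K_int])
    show "AE \<theta> in model. norm (J \<theta> - I \<theta>) \<le> norm (K \<theta>)"
      using AE_proj by eventually_elim (use diff in \<open>force intro: order_trans[OF _ abs_ge_self]\<close>)
  qed measurable
  have I_int: "integrable model I"
    using Bochner_Integration.integrable_diff[OF J_int JI_int] by simp
  have "(\<integral>\<theta>. sqrt \<beta> * W0 \<theta> * sin (t * obs \<theta> + a) \<partial>model) + t * f0 e x * cos_mean a t = (\<integral>\<theta>. J \<theta> \<partial>model)"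
    unfolding J_def cos_mean_def using W0_int cos_int by simp
  also have "\<dots> = (\<integral>\<theta>. J \<theta> - I \<theta> \<partial>model)" using J_int I_int ward by simp
  also have "\<bar>\<dots>\<bar> \<le> (\<integral>\<theta>. \<bar>J \<theta> - I \<theta>\<bar> \<partial>model)" by (rule integral_abs_bound)
  also have "\<dots> \<le> (\<integral>\<theta>. K \<theta> \<partial>model)"
  proof (rule integral_mono_AE)
    show "AE \<theta> in model. \<bar>J \<theta> - I \<theta>\<bar> \<le> K \<theta>"
      using AE_proj by eventually_elim (rule diff, simp)
  qed (use JI_int K_int in auto)
  also note K_le
  finally show ?thesis by (simp add: W0_def)
qed

text \<open>The Green potential of the coefficients, cut off after \<open>M\<close> steps: summing
  the local identities against it inverts the Laplacian up to \<open>remainder\<close>, while its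
  finite support keeps all sites in a fixed ball.\<close>

definition corrector :: "nat \<Rightarrow> 'a \<Rightarrow> int \<times> int \<Rightarrow> real" where
  "corrector M e = walk_green (f e) R0 0 M"

definition remainder :: "nat \<Rightarrow> 'a \<Rightarrow> (int \<times> int \<Rightarrow> 'a) \<Rightarrow> real" where
  "remainder M e \<theta> = (\<Sum>x\<in>l1_ball (R0 + M). evolved (f e) R0 M x * (\<theta> (p x) \<bullet> e))"

text \<open>Off the root the negative Laplacian of the corrector is the original coefficient
  function minus its \<open>M\<close>-step evolution. Moving the Laplacian onto the corrector
  therefore yields the unscaled observable minus the remainder.\<close>

lemma summation_by_parts:
  assumes e: "e \<in> Bs" and \<theta>0: "\<theta> 0 = v"
  shows "(\<Sum>x\<in>l1_ball (R0 + M). corrector M e x * (\<Sum>z\<in>neighbours x. \<theta> (p z) \<bullet> e - \<theta> (p x) \<bullet> e))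
    = - ((\<Sum>y\<in>l1_ball R0. f e y * (\<theta> (p y) \<bullet> e)) - remainder M e \<theta>)"
proof -
  let ?g = "corrector M e" and ?\<psi> = "\<lambda>x. \<theta> (p x) \<bullet> e"
  let ?R = "R0 + M" and ?S = "l1_ball (Suc (R0 + M))"
  have \<psi>0: "?\<psi> 0 = 0" using orth_v[OF e] \<theta>0 by (simp add: inner_commute)
  have g_supp: "x \<in> l1_ball ?R" if "?g x \<noteq> 0" for x
    using walk_green_support[of "f e" R0 0 M x] that by (simp add: corrector_def)
  have sub: "l1_ball ?R \<subseteq> ?S" "l1_ball R0 \<subseteq> ?S" by (intro l1_ball_mono; simp)+
  have "(\<Sum>x\<in>l1_ball ?R. ?g x * (\<Sum>z\<in>neighbours x. \<theta> (p z) \<bullet> e - \<theta> (p x) \<bullet> e)) = (\<Sum>x\<in>?S. ?g x * laplacian ?\<psi> x)"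
    unfolding laplacian_def using g_supp sub by (intro sum.mono_neutral_left) auto
  also have "\<dots> = (\<Sum>x\<in>?S. ?\<psi> x * laplacian ?g x)"
    using g_supp sub l1_ball_neighbours[of _ ?R] by (intro laplacian_symmetric) auto
  also have "\<dots> = (\<Sum>x\<in>?S. - (evolved (f e) R0 0 x * ?\<psi> x) + evolved (f e) R0 M x * ?\<psi> x)"
  proof (rule sum.cong[OF refl])
    fix x
    show "?\<psi> x * laplacian ?g x = - (evolved (f e) R0 0 x * ?\<psi> x) + evolved (f e) R0 M x * ?\<psi> x"
    proof (cases "x = 0")
      case True
      then show ?thesis using \<psi>0 by (simp del: torus_proj_zero)
    next
      case False
      have "laplacian ?g x = - (evolved (f e) R0 0 x - evolved (f e) R0 M x)"
        using laplacian_walk_green[OF False, of "f e" R0 0 M] by (simp add: corrector_def)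
      then show ?thesis by (simp only:) (simp add: algebra_simps)
    qed
  qed
  also have "\<dots> = - (\<Sum>x\<in>?S. evolved (f e) R0 0 x * ?\<psi> x) + (\<Sum>x\<in>?S. evolved (f e) R0 M x * ?\<psi> x)"
    by (simp only: sum.distrib sum_negf)
  also have "(\<Sum>x\<in>?S. evolved (f e) R0 0 x * ?\<psi> x) = (\<Sum>x\<in>l1_ball R0. f e x * ?\<psi> x)"
  proof (rule sum.mono_neutral_cong_right)
    show "evolved (f e) R0 0 x * ?\<psi> x = f e x * ?\<psi> x" if "x \<in> l1_ball R0" for x
      using that \<psi>0 by (cases "x = 0") (simp_all add: evolved_initial del: torus_proj_zero)
  qed (use sub in \<open>auto simp: evolved_initial\<close>)
  also have "(\<Sum>x\<in>?S. evolved (f e) R0 M x * ?\<psi> x) = remainder M e \<theta>"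
    unfolding remainder_def using evolved_support[of "f e" R0 M] sub by (intro sum.mono_neutral_right) auto
  finally show ?thesis by simp
qed

lemma corrector_inner: "(\<Sum>x\<in>l1_ball (R0 + M). corrector M e x * f0 e x) = (\<Sum>j<M. walk_corr (f e) R0 j) / 4"
proof -
  have "(\<Sum>x\<in>l1_ball (R0 + M). corrector M e x * f0 e x) = (\<Sum>x\<in>l1_ball R0. corrector M e x * f e x)"
    using l1_ball_mono[of R0 "R0 + M"] by (intro sum.mono_neutral_cong_right) (auto simp: f0_def)
  also have "\<dots> = (\<Sum>x\<in>l1_ball R0. \<Sum>j<M. evolved (f e) R0 j x * f e x) / 4"
    by (simp add: corrector_def walk_green_def sum_distrib_right sum_divide_distrib)
  also have "\<dots> = (\<Sum>j<M. \<Sum>x\<in>l1_ball R0. evolved (f e) R0 j x * f e x) / 4"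
    by (subst sum.swap) simp
  also have "\<dots> = (\<Sum>j<M. walk_corr (f e) R0 j) / 4"
    unfolding walk_corr_def evolved_def sum_distrib_right
    by (intro arg_cong[where f = "\<lambda>x. x / 4"] sum.cong refl) (simp add: mult_ac)
  finally show ?thesis .
qed

lemma remainder_measurable [measurable]: "remainder M e \<in> borel_measurable model"
  unfolding remainder_def[abs_def]
  by (intro borel_measurable_sum borel_measurable_times borel_measurable_inner borel_measurable_const proj_measurable)

lemma remainder_bound:
  assumes "\<forall>x. norm (\<theta> (p x)) = 1" "e \<in> Bs"
  shows "\<bar>remainder M e \<theta>\<bar> \<le> (\<Sum>x\<in>l1_ball (R0 + M). \<bar>evolved (f e) R0 M x\<bar>)"
  unfolding remainder_def
proof (intro order_trans[OF sum_abs] sum_mono)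
  fix x
  show "\<bar>evolved (f e) R0 M x * (\<theta> (p x) \<bullet> e)\<bar> \<le> \<bar>evolved (f e) R0 M x\<bar>"
    using abs_inner_le_1[of "\<theta> (p x)" e] assms norm_Bs by (simp add: abs_mult mult_left_le)
qed

text \<open>The first moment is bounded by the second, and the infrared bound with dual constant
  \<open>4 * tail_green\<close> gives the latter a factor 1/\<beta>, which exactly compensates sqrt
  \<beta>. The result does not depend on \<beta> or \<open>n\<close>, and the tail makes it small
  for large \<open>M\<close>.\<close>

lemma remainder_mean:
  assumes e: "e \<in> Bs"
    and tail: "\<And>H :: int \<times> int \<Rightarrow> real. H 0 = 0 \<Longrightarrow>
      (\<Sum>x\<in>l1_ball (R0 + M). evolved (f e) R0 M x * H (p x))\<^sup>2 \<le> 4 * tail_green (f e) R0 M * torus_energy n H"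
  shows "sqrt \<beta> * (\<integral>\<theta>. \<bar>remainder M e \<theta>\<bar> \<partial>model) \<le> sqrt (16 * real DIM('a) * tail_green (f e) R0 M)"
proof -
  let ?B = "\<Sum>x\<in>l1_ball (R0 + M). \<bar>evolved (f e) R0 M x\<bar>"
  let ?V = "\<lambda>\<theta>. \<Sum>x\<in>l1_ball (R0 + M). evolved (f e) R0 M x *\<^sub>R (\<theta> (p x) - \<theta> 0)"
  have tail_nonneg: "0 \<le> tail_green (f e) R0 M"
    unfolding tail_green_def
    using summable_ignore_initial_segment[OF summable_walk_corr[of "f e" R0], of "2 * M"]
    by (intro divide_nonneg_nonneg suminf_nonneg) simp_all
  have int1: "integrable model (\<lambda>\<theta>. \<bar>remainder M e \<theta>\<bar>)"
    by (rule integrable_bounded[where B = ?B]) (use remainder_bound[OF _ e] in auto)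
  have int2: "integrable model (\<lambda>\<theta>. (remainder M e \<theta>)\<^sup>2)"
  proof (rule integrable_bounded[where B = "?B\<^sup>2"])
    fix \<theta> :: "int \<times> int \<Rightarrow> 'a" assume "\<forall>x. norm (\<theta> (p x)) = 1"
    then have "\<bar>remainder M e \<theta>\<bar>\<^sup>2 \<le> ?B\<^sup>2" by (intro power_mono remainder_bound e) auto
    then show "\<bar>(remainder M e \<theta>)\<^sup>2\<bar> \<le> ?B\<^sup>2" by simp
  qed measurable
  have m0 [measurable]: "(\<lambda>\<theta>. \<theta> 0) \<in> borel_measurable model" using component_measurable_model zero_mem by blast
  note [measurable] = proj_measurable
  have V_meas: "(\<lambda>\<theta>. (norm (?V \<theta>))\<^sup>2) \<in> borel_measurable model" by measurable
  have dom: "(remainder M e \<theta>)\<^sup>2 \<le> (norm (?V \<theta>))\<^sup>2" if "\<theta> 0 = v" for \<theta>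
  proof -
    \<comment> \<open>Subtracting the root spin is free because \<open>e\<close> is orthogonal to
      \<open>v\<close>, and it produces the differences to which the infrared bound applies.\<close>
    have "remainder M e \<theta> = ?V \<theta> \<bullet> e"
      using orth_v[OF e] that by (simp add: remainder_def inner_sum_left inner_diff_left inner_commute[of v])
    then have "\<bar>remainder M e \<theta>\<bar> \<le> norm (?V \<theta>)"
      using Cauchy_Schwarz_ineq2[of "?V \<theta>" e] norm_Bs[OF e] by simp
    then show ?thesis by (simp add: abs_le_square_iff[symmetric])
  qed
  have V_int: "integrable model (\<lambda>\<theta>. (norm (?V \<theta>))\<^sup>2)"
  proof (rule integrable_bounded[where B = "(?B * 2)\<^sup>2", OF V_meas])
    fix \<theta> :: "int \<times> int \<Rightarrow> 'a" assume th: "\<forall>x. norm (\<theta> (p x)) = 1" and \<theta>0: "\<theta> 0 = v"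
    have "norm (?V \<theta>) \<le> ?B * 2"
      unfolding sum_distrib_right
    proof (rule sum_norm_le)
      fix x
      have "norm (\<theta> (p x) - \<theta> 0) \<le> 2" using norm_triangle_ineq4[of "\<theta> (p x)" "\<theta> 0"] th \<theta>0 v by simp
      then show "norm (evolved (f e) R0 M x *\<^sub>R (\<theta> (p x) - \<theta> 0)) \<le> \<bar>evolved (f e) R0 M x\<bar> * 2"
        by (simp add: mult_left_mono)
    qed
    then have "(norm (?V \<theta>))\<^sup>2 \<le> (?B * 2)\<^sup>2" by (intro power_mono) auto
    then show "\<bar>(norm (?V \<theta>))\<^sup>2\<bar> \<le> (?B * 2)\<^sup>2" by simp
  qed
  have "(\<integral>\<theta>. (remainder M e \<theta>)\<^sup>2 \<partial>model) \<le> (\<integral>\<theta>. (norm (?V \<theta>))\<^sup>2 \<partial>model)"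
  proof (rule integral_mono_AE[OF int2 V_int])
    show "AE \<theta> in model. (remainder M e \<theta>)\<^sup>2 \<le> (norm (?V \<theta>))\<^sup>2"
      using AE_proj by eventually_elim (rule dom, simp)
  qed
  also have "\<dots> \<le> 4 * real DIM('a) * (4 * tail_green (f e) R0 M) / \<beta>"
    using tail_nonneg tail by (intro lattice_infrared) auto
  finally have second: "(\<integral>\<theta>. (remainder M e \<theta>)\<^sup>2 \<partial>model) \<le> 16 * real DIM('a) * tail_green (f e) R0 M / \<beta>" by simp
  have "(\<integral>\<theta>. 1 * (\<bar>remainder M e \<theta>\<bar> * 1) \<partial>model)\<^sup>2
      \<le> (\<integral>\<theta>. 1 * (\<bar>remainder M e \<theta>\<bar>)\<^sup>2 \<partial>model) * (\<integral>\<theta>. 1 * 1\<^sup>2 \<partial>model)"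
    using int1 int2 by (intro weighted_Cauchy_Schwarz) auto
  then have "(\<integral>\<theta>. \<bar>remainder M e \<theta>\<bar> \<partial>model)\<^sup>2 \<le> 16 * real DIM('a) * tail_green (f e) R0 M / \<beta>"
    using second by (simp add: model.prob_space)
  then have "\<beta> * (\<integral>\<theta>. \<bar>remainder M e \<theta>\<bar> \<partial>model)\<^sup>2 \<le> 16 * real DIM('a) * tail_green (f e) R0 M"
    using \<beta>_pos by (simp add: field_simps)
  then have "sqrt (\<beta> * (\<integral>\<theta>. \<bar>remainder M e \<theta>\<bar> \<partial>model)\<^sup>2) \<le> sqrt (16 * real DIM('a) * tail_green (f e) R0 M)"
    by (rule real_sqrt_le_mono)
  moreover have "0 \<le> (\<integral>\<theta>. \<bar>remainder M e \<theta>\<bar> \<partial>model)" by (intro integral_nonneg_AE) simp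
  ultimately show ?thesis using \<beta>_pos by (simp add: real_sqrt_mult)
qed

end

section \<open>The approximate differential equation for cosine means\<close>

context rooted_spins_obs
begin

definition ward_const :: "nat \<Rightarrow> real" where
  "ward_const M = (\<Sum>e\<in>Bs. \<Sum>x\<in>l1_ball (R0 + M). \<bar>corrector M e x\<bar> *
     ((8 + \<bar>f0 e x\<bar>) * (8 * real DIM('a) * (real (Suc (R0 + M)))\<^sup>2)))"

text \<open>Sum of the local Ward identities against the corrector: the drifts become the observable
  minus the remainder, and the sources become the partial sum of the Green series, that is, the
  truncated variance. The integral with the sine is minus the derivative of
  \<open>cos_mean\<close>.\<close>

lemma obs_sin_mean:
  assumes n: "n \<ge> 3" "2 * (R0 + M) < n" and t: "\<bar>t\<bar> \<le> 1" and \<beta>: "\<beta> \<ge> 1"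
    and tail: "\<And>e H. e \<in> Bs \<Longrightarrow> (H :: int \<times> int \<Rightarrow> real) 0 = 0 \<Longrightarrow>
      (\<Sum>x\<in>l1_ball (R0 + M). evolved (f e) R0 M x * H (p x))\<^sup>2 \<le> 4 * tail_green (f e) R0 M * torus_energy n H"
  shows "\<bar>(\<integral>\<theta>. obs \<theta> * sin (t * obs \<theta> + a) \<partial>model) - t * (\<Sum>e\<in>Bs. (\<Sum>j<M. walk_corr (f e) R0 j) / 4) * cos_mean a t\<bar>
    \<le> ward_const M / sqrt \<beta> + (\<Sum>e\<in>Bs. sqrt (16 * real DIM('a) * tail_green (f e) R0 M))"
proof -
  let ?R = "R0 + M" and ?sin = "\<lambda>\<theta>. sin (t * obs \<theta> + a)"
  let ?W = "\<lambda>e x \<theta>. \<Sum>z\<in>neighbours x. \<theta> (p z) \<bullet> e - \<theta> (p x) \<bullet> e"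
  define T where "T e x = (\<integral>\<theta>. sqrt \<beta> * ?W e x \<theta> * ?sin \<theta> \<partial>model) + t * f0 e x * cos_mean a t" for e x
  define S where "S = (\<Sum>e\<in>Bs. (\<Sum>j<M. walk_corr (f e) R0 j) / 4)"
  have obs_int: "integrable model (\<lambda>\<theta>. obs \<theta> * ?sin \<theta>)"
  proof (rule integrable_bounded[where B = "sqrt \<beta> * (\<Sum>e\<in>Bs. \<Sum>y\<in>l1_ball R0. \<bar>f e y\<bar>) * 1"])
    fix \<theta> :: "int \<times> int \<Rightarrow> 'a" assume "\<forall>x. norm (\<theta> (p x)) = 1"
    then have "\<bar>obs \<theta>\<bar> \<le> sqrt \<beta> * (\<Sum>e\<in>Bs. \<Sum>y\<in>l1_ball R0. \<bar>f e y\<bar>)" by (rule obs_bound)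
    then show "\<bar>obs \<theta> * ?sin \<theta>\<bar> \<le> sqrt \<beta> * (\<Sum>e\<in>Bs. \<Sum>y\<in>l1_ball R0. \<bar>f e y\<bar>) * 1"
      unfolding abs_mult by (intro mult_mono abs_sin_le_one) auto
  qed measurable
  have rem_int: "integrable model (\<lambda>\<theta>. remainder M e \<theta>
      * ?sin \<theta>)" "integrable model (\<lambda>\<theta>. \<bar>remainder M e \<theta>\<bar>)" if e: "e \<in> Bs" for e
  proof -
    let ?B = "\<Sum>x\<in>l1_ball ?R. \<bar>evolved (f e) R0 M x\<bar>"
    show "integrable model (\<lambda>\<theta>. remainder M e \<theta> * ?sin \<theta>)"
    proof (rule integrable_bounded[where B = "?B * 1"])
      fix \<theta> :: "int \<times> int \<Rightarrow> 'a" assume "\<forall>x. norm (\<theta> (p x)) = 1"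
      then show "\<bar>remainder M e \<theta> * ?sin \<theta>\<bar> \<le> ?B * 1"
        unfolding abs_mult by (intro mult_mono abs_sin_le_one remainder_bound e) auto
    qed measurable
    show "integrable model (\<lambda>\<theta>. \<bar>remainder M e \<theta>\<bar>)"
      by (rule integrable_bounded[where B = ?B]) (use remainder_bound[OF _ e] in auto)
  qed
  have grad_int: "integrable model (\<lambda>\<theta>. sqrt \<beta> * ?W e x \<theta> * ?sin \<theta>)" if "e \<in> Bs" for e x
    by (rule gradient_sin_integrable[OF that])
  have sum_T: "(\<Sum>e\<in>Bs. \<Sum>x\<in>l1_ball ?R. corrector M e x * T e x)
      = - (\<integral>\<theta>. obs \<theta> * ?sin \<theta> \<partial>model) + sqrt \<beta> * (\<Sum>e\<in>Bs. \<integral>\<theta>. remainder M e \<theta> * ?sin \<theta> \<partial>model) + t * S * cos_mean a t"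
  proof -
    have "(\<Sum>e\<in>Bs. \<Sum>x\<in>l1_ball ?R. corrector M e x * T e x)
      = (\<Sum>e\<in>Bs. \<Sum>x\<in>l1_ball ?R. corrector M e x * (\<integral>\<theta>. sqrt \<beta> * ?W e x \<theta> * ?sin \<theta> \<partial>model))
       + (\<Sum>e\<in>Bs. \<Sum>x\<in>l1_ball ?R. t * cos_mean a t * (corrector M e x * f0 e x))"
      unfolding T_def sum.distrib[symmetric] by (intro sum.cong refl) (simp add: algebra_simps)
    also have "(\<Sum>e\<in>Bs. \<Sum>x\<in>l1_ball ?R. t * cos_mean a t * (corrector M e x * f0 e x)) = t * S * cos_mean a t"
      unfolding S_def corrector_inner[symmetric] sum_distrib_left sum_distrib_right by (simp add: mult_ac)
    also have "(\<Sum>e\<in>Bs. \<Sum>x\<in>l1_ball ?R. corrector M e x * (\<integral>\<theta>. sqrt \<beta> * ?W e x \<theta> * ?sin \<theta> \<partial>model))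
        = (\<integral>\<theta>. (\<Sum>e\<in>Bs. \<Sum>x\<in>l1_ball ?R. corrector M e x * (sqrt \<beta> * ?W e x \<theta> * ?sin \<theta>)) \<partial>model)"
    proof -
      have "(\<integral>\<theta>. (\<Sum>e\<in>Bs. \<Sum>x\<in>l1_ball ?R. corrector M e x * (sqrt \<beta> * ?W e x \<theta> * ?sin \<theta>)) \<partial>model)
          = (\<Sum>e\<in>Bs. \<integral>\<theta>. (\<Sum>x\<in>l1_ball ?R. corrector M e x * (sqrt \<beta> * ?W e x \<theta> * ?sin \<theta>)) \<partial>model)"
        by (intro Bochner_Integration.integral_sum Bochner_Integration.integrable_sum integrable_mult_right grad_int)
      also have "\<dots> = (\<Sum>e\<in>Bs. \<Sum>x\<in>l1_ball ?R. corrector M e x * (\<integral>\<theta>. sqrt \<beta> * ?W e x \<theta> * ?sin \<theta> \<partial>model))"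
      proof (rule sum.cong[OF refl])
        fix e assume e: "e \<in> Bs"
        have "(\<integral>\<theta>. (\<Sum>x\<in>l1_ball ?R. corrector M e x * (sqrt \<beta> * ?W e x \<theta> * ?sin \<theta>)) \<partial>model)
          = (\<Sum>x\<in>l1_ball ?R. \<integral>\<theta>. corrector M e x * (sqrt \<beta> * ?W e x \<theta> * ?sin \<theta>) \<partial>model)"
          by (intro Bochner_Integration.integral_sum integrable_mult_right grad_int e)
        also have "\<dots> = (\<Sum>x\<in>l1_ball ?R. corrector M e x * (\<integral>\<theta>. sqrt \<beta> * ?W e x \<theta> * ?sin \<theta> \<partial>model))"
          by (intro sum.cong refl integral_mult_right_zero)
        finally show "(\<integral>\<theta>. (\<Sum>x\<in>l1_ball ?R. corrector M e x * (sqrt \<beta> * ?W e x \<theta> * ?sin \<theta>)) \<partial>model)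
          = (\<Sum>x\<in>l1_ball ?R. corrector M e x * (\<integral>\<theta>. sqrt \<beta> * ?W e x \<theta> * ?sin \<theta> \<partial>model))" .
      qed
      finally show ?thesis by simp
    qed
    also have "\<dots> = (\<integral>\<theta>. - (obs \<theta> * ?sin \<theta>) + sqrt \<beta> * (\<Sum>e\<in>Bs. remainder M e \<theta> * ?sin \<theta>) \<partial>model)"
    proof (rule integral_cong_AE)
      note [measurable] = sum_neighbours_measurable
      show "(\<lambda>\<theta>. \<Sum>e\<in>Bs. \<Sum>x\<in>l1_ball ?R. corrector M e x * (sqrt \<beta> * ?W e x \<theta> * ?sin \<theta>)) \<in> borel_measurable model"
        by (intro borel_measurable_sum borel_measurable_times borel_measurable_const sum_neighbours_measurable) measurable
      show "(\<lambda>\<theta>. - (obs \<theta> * ?sin \<theta>) + sqrt \<beta> * (\<Sum>e\<in>Bs. remainder M e \<theta> * ?sin \<theta>)) \<in> borel_measurable model"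
        by measurable
      show "AE \<theta> in model. (\<Sum>e\<in>Bs. \<Sum>x\<in>l1_ball ?R. corrector M e x * (sqrt \<beta> * ?W e x \<theta> * ?sin \<theta>))
          = - (obs \<theta> * ?sin \<theta>) + sqrt \<beta> * (\<Sum>e\<in>Bs. remainder M e \<theta> * ?sin \<theta>)"
        using AE_proj
      proof eventually_elim
        case (elim \<theta>)
        have "(\<Sum>e\<in>Bs. \<Sum>x\<in>l1_ball ?R. corrector M e x * (sqrt \<beta> * ?W e x \<theta> * ?sin \<theta>))
            = (\<Sum>e\<in>Bs. \<Sum>x\<in>l1_ball ?R. (sqrt \<beta> * ?sin \<theta>) * (corrector M e x * ?W e x \<theta>))"
          by (intro sum.cong refl) (simp only: mult_ac)
        also have "\<dots> = sqrt \<beta> * ?sin \<theta> * (\<Sum>e\<in>Bs. \<Sum>x\<in>l1_ball ?R. corrector M e x * ?W e x \<theta>)"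
          by (simp only: sum_distrib_left[symmetric])
        also have "(\<Sum>e\<in>Bs. \<Sum>x\<in>l1_ball ?R. corrector M e x * ?W e x \<theta>)
            = (\<Sum>e\<in>Bs. - ((\<Sum>y\<in>l1_ball R0. f e y * (\<theta> (p y) \<bullet> e)) - remainder M e \<theta>))"
          using elim by (intro sum.cong refl summation_by_parts) auto
        also have "\<dots> = - (\<Sum>e\<in>Bs. \<Sum>y\<in>l1_ball R0. f e y * (\<theta> (p y) \<bullet> e)) + (\<Sum>e\<in>Bs. remainder M e \<theta>)"
          by (simp only: sum_negf sum_subtractf minus_diff_eq minus_add_distrib)
        finally show ?case by (simp add: obs_def sum_distrib_right[symmetric] algebra_simps)
      qed
    qed
    also have "\<dots> = - (\<integral>\<theta>. obs \<theta> * ?sin \<theta> \<partial>model) + sqrt \<beta> * (\<Sum>e\<in>Bs. \<integral>\<theta>. remainder M e \<theta> * ?sin \<theta> \<partial>model)"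
      using obs_int rem_int(1) by simp
    finally show ?thesis .
  qed
  have T_bound: "\<bar>\<Sum>e\<in>Bs. \<Sum>x\<in>l1_ball ?R. corrector M e x * T e x\<bar> \<le> ward_const M / sqrt \<beta>"
    unfolding ward_const_def sum_divide_distrib
  proof (intro order_trans[OF sum_abs] sum_mono)
    fix e x assume e: "e \<in> Bs" and x: "x \<in> l1_ball ?R"
    show "\<bar>corrector M e x * T e x\<bar> \<le> \<bar>corrector M e x\<bar> * ((8
        + \<bar>f0 e x\<bar>) * (8 * real DIM('a) * (real (Suc ?R))\<^sup>2)) / sqrt \<beta>"
    proof (cases "x = 0")
      case True
      then show ?thesis by (simp add: corrector_def)
    next
      case False
      have "\<bar>T e x\<bar> \<le> (8 + \<bar>f0 e x\<bar>) * (8 * real DIM('a) * (real (Suc ?R))\<^sup>2) / sqrt \<beta>"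
        unfolding T_def by (rule local_ward[OF False x _ n(2,1) e t \<beta>]) simp
      then have "\<bar>corrector M e x\<bar> * \<bar>T e x\<bar> \<le> \<bar>corrector M e x\<bar> * ((8
          + \<bar>f0 e x\<bar>) * (8 * real DIM('a) * (real (Suc ?R))\<^sup>2) / sqrt \<beta>)"
        by (rule mult_left_mono) simp
      then show ?thesis by (simp only: abs_mult times_divide_eq_right)
    qed
  qed
  have rem_bound: "\<bar>sqrt \<beta> * (\<Sum>e\<in>Bs. \<integral>\<theta>. remainder M e \<theta> * ?sin \<theta> \<partial>model)\<bar>
      \<le> (\<Sum>e\<in>Bs. sqrt (16 * real DIM('a) * tail_green (f e) R0 M))"
    unfolding sum_distrib_left
  proof (intro order_trans[OF sum_abs] sum_mono)
    fix e assume e: "e \<in> Bs"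
    have "\<bar>\<integral>\<theta>. remainder M e \<theta> * ?sin \<theta> \<partial>model\<bar> \<le> (\<integral>\<theta>. \<bar>remainder M e \<theta> * ?sin \<theta>\<bar> \<partial>model)"
      by (rule integral_abs_bound)
    also have "\<dots> \<le> (\<integral>\<theta>. \<bar>remainder M e \<theta>\<bar> \<partial>model)"
    proof (rule integral_mono)
      show "\<bar>remainder M e \<theta> * ?sin \<theta>\<bar> \<le> \<bar>remainder M e \<theta>\<bar>" for \<theta>
        using mult_left_mono[OF abs_sin_le_one[of "t * obs \<theta> + a"] abs_ge_zero[of "remainder M e \<theta>"]]
            by (simp add: abs_mult)
    qed (use rem_int[OF e] in auto)
    finally have "sqrt \<beta> * \<bar>\<integral>\<theta>. remainder M e \<theta> * ?sin \<theta> \<partial>model\<bar> \<le> sqrt \<beta> * (\<integral>\<theta>. \<bar>remainder M e \<theta>\<bar> \<partial>model)"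
      using \<beta>_pos by (intro mult_left_mono) auto
    also have "\<dots> \<le> sqrt (16 * real DIM('a) * tail_green (f e) R0 M)"
      using e tail[OF e] by (rule remainder_mean)
    finally show "\<bar>sqrt \<beta> * (\<integral>\<theta>. remainder M e \<theta> * ?sin \<theta> \<partial>model)\<bar> \<le> sqrt (16 * real DIM('a) * tail_green (f e) R0 M)"
      using \<beta>_pos by (simp add: abs_mult)
  qed
  show ?thesis using sum_T T_bound rem_bound unfolding S_def[symmetric] by linarith
qed

end

text \<open>The truncation \<open>M\<close> is chosen first, from the variance and the tail alone.
  Then \<beta> is taken large, so that \<open>n \<beta>\<close> passes all size thresholds for this
  \<open>M\<close> and the Ward error falls below the tolerance. \<open>real_ode_bound\<close>
  integrates the remaining defect from 0 to 1.\<close>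

theorem cos_mean_limit:
  fixes v :: "'a::euclidean_space" and f :: "'a \<Rightarrow> int \<times> int \<Rightarrow> real" and n :: "real \<Rightarrow> nat"
  assumes v: "norm v = 1" and fin: "finite Bs" and norm_Bs: "\<And>e. e \<in> Bs \<Longrightarrow> norm e = 1"
    and orth: "\<And>e e'. e \<in> Bs \<Longrightarrow> e' \<in> Bs \<Longrightarrow> e \<noteq> e' \<Longrightarrow> e \<bullet> e' = 0"
    and orth_v: "\<And>e. e \<in> Bs \<Longrightarrow> e \<bullet> v = 0"
    and n: "filterlim n at_top at_top"
  shows "((\<lambda>\<beta>. \<integral>\<theta>. cos (sqrt \<beta> * (\<Sum>e\<in>Bs. \<Sum>y\<in>l1_ball R0. f e y * (\<theta> (torus_proj (n \<beta>) y) \<bullet> e)) + a)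
      \<partial>rooted_spin_model \<beta> (n \<beta>) v)
    \<longlongrightarrow> cos a * exp (- (\<Sum>e\<in>Bs. \<Sum>x\<in>l1_ball R0. \<Sum>y\<in>l1_ball R0. f e x * f e y * green0 x y) / 2)) at_top"
proof -
  define s where "s = (\<Sum>e\<in>Bs. \<Sum>x\<in>l1_ball R0. \<Sum>y\<in>l1_ball R0. f e x * f e y * green0 x y)"
  define sM where "sM M = (\<Sum>e\<in>Bs. (\<Sum>j<M. walk_corr (f e) R0 j) / 4)" for M
  define rM where "rM M = (\<Sum>e\<in>Bs. sqrt (16 * real DIM('a) * tail_green (f e) R0 M))" for M
  have "sM \<longlonglongrightarrow> (\<Sum>e\<in>Bs. (4 * (\<Sum>x\<in>l1_ball R0. \<Sum>y\<in>l1_ball R0. f e x * f e y * green0 x y)) / 4)"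
    unfolding sM_def[abs_def]
    by (intro tendsto_sum tendsto_divide tendsto_const walk_corr_sums[unfolded sums_def]) simp
  then have sM: "sM \<longlonglongrightarrow> s" by (simp add: s_def)
  have "rM \<longlonglongrightarrow> (\<Sum>e\<in>Bs. sqrt (16 * real DIM('a) * 0))"
    unfolding rM_def[abs_def]
    by (intro tendsto_sum tendsto_real_sqrt tendsto_mult tendsto_const tail_green_tendsto)
  then have rM: "rM \<longlonglongrightarrow> 0" by simp
  show ?thesis unfolding s_def[symmetric]
  proof (rule tendstoI)
    fix \<epsilon> :: real assume "0 < \<epsilon>"
    \<comment> \<open>Three errors below \<delta> enter the differential equation (variance, tail
      and Ward error), and integrating it costs exp |s|; in total 3/4 of \<epsilon>.\<close>
    define \<delta> where "\<delta> = \<epsilon> / (4 * exp \<bar>s\<bar>)"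
    have \<delta>: "0 < \<delta>" using \<open>0 < \<epsilon>\<close> by (simp add: \<delta>_def)
    have "eventually (\<lambda>M. \<bar>sM M - s\<bar> < \<delta>) sequentially" "eventually (\<lambda>M. \<bar>rM M\<bar> < \<delta>) sequentially"
      using tendstoD[OF sM \<delta>] tendstoD[OF rM \<delta>] by (simp_all add: dist_real_def)
    then have "eventually (\<lambda>M. \<bar>sM M - s\<bar> < \<delta> \<and> \<bar>rM M\<bar> < \<delta>) sequentially" by (rule eventually_conj)
    then obtain M where M: "\<bar>sM M - s\<bar> < \<delta>" "\<bar>rM M\<bar> < \<delta>"
      by (auto simp: eventually_sequentially)
    have "\<exists>n0. \<forall>n\<ge>n0. \<forall>H :: int \<times> int \<Rightarrow> real. H 0 = 0 \<longrightarrow>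
      (\<Sum>x\<in>l1_ball (R0 + M). evolved (f e) R0 M x * H (torus_proj n x))\<^sup>2
          \<le> 4 * tail_green (f e) R0 M * torus_energy n H" for e
    proof -
      have "0 \<le> tail_green (f e) R0 M"
        unfolding tail_green_def
        using summable_ignore_initial_segment[OF summable_walk_corr[of "f e" R0], of "2 * M"]
        by (intro divide_nonneg_nonneg suminf_nonneg) simp_all
      then obtain n0 where "\<And>n H. n \<ge> n0 \<Longrightarrow> H 0 = 0 \<Longrightarrow>
          (\<Sum>x\<in>l1_ball (R0 + M). evolved (f e) R0 M x * H (torus_proj n x))\<^sup>2
              \<le> 4 * tail_green (f e) R0 M * torus_energy n (H :: int \<times> int \<Rightarrow> real)"
        using dual_bound_transfer[where A = "tail_green (f e) R0 M" and \<rho> = "R0 + M" and r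
            = "evolved (f e) R0 M"] evolved_dual_bound by blast
      then show ?thesis by blast
    qed
    then obtain n0 where n0: "\<And>e n H. n \<ge> n0 e \<Longrightarrow> (H :: int \<times> int \<Rightarrow> real) 0 = 0 \<Longrightarrow>
      (\<Sum>x\<in>l1_ball (R0 + M). evolved (f e) R0 M x * H (torus_proj n x))\<^sup>2 \<le> 4 * tail_green (f e) R0 M * torus_energy n H"
      by metis
    \<comment> \<open>The sum dominates each threshold \<open>n0 e\<close>; the other summands make
      the ball of radius \<open>R0 + M\<close> embed into the torus and the size at least 3.\<close>
    define n1 where "n1 = (\<Sum>e\<in>Bs. n0 e) + 2 * (R0 + M) + 3"
    have n1: "n0 e \<le> n1" if "e \<in> Bs" for e
      using member_le_sum[of e Bs n0] that fin by (simp add: n1_def)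
    \<comment> \<open>\<open>ward_const\<close> written out, since it must be known before \<beta>
      is chosen, whereas the locale is interpreted for each \<beta> separately.\<close>
    define C where "C = (\<Sum>e\<in>Bs. \<Sum>x\<in>l1_ball (R0 + M). \<bar>walk_green (f e) R0 0 M x\<bar> *
      ((8 + \<bar>if x \<in> l1_ball R0 then f e x else 0\<bar>) * (8 * real DIM('a) * (real (Suc (R0 + M)))\<^sup>2)))"
    have "eventually (\<lambda>\<beta>. n1 \<le> n \<beta>) at_top" using n by (simp add: filterlim_at_top)
    moreover have "eventually (\<lambda>\<beta>::real. 1 \<le> \<beta>) at_top" by (rule eventually_ge_at_top)
    moreover have "eventually (\<lambda>\<beta>. C / sqrt \<beta> < \<delta>) at_top"
    proof -
      have "((\<lambda>\<beta>. C / sqrt \<beta>) \<longlongrightarrow> 0) at_top"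
        by (intro tendsto_divide_0[OF tendsto_const] filterlim_at_top_imp_at_infinity sqrt_at_top)
      then show ?thesis using \<delta> by (rule order_tendstoD)
    qed
    ultimately show "eventually (\<lambda>\<beta>. dist (\<integral>\<theta>. cos (sqrt \<beta> * (\<Sum>e\<in>Bs. \<Sum>y\<in>l1_ball R0. f e y
        * (\<theta> (torus_proj (n \<beta>) y) \<bullet> e)) + a) \<partial>rooted_spin_model \<beta> (n \<beta>) v)
        (cos a * exp (- s / 2)) < \<epsilon>) at_top"
    proof eventually_elim
      case (elim \<beta>)
      interpret rooted_spins_obs \<beta> "n \<beta>" v Bs f R0
        by unfold_locales (use elim v fin norm_Bs orth orth_v in \<open>auto simp: n1_def\<close>)
      have nn: "n \<beta> \<ge> 3" "2 * (R0 + M) < n \<beta>" using elim(1) by (auto simp: n1_def)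
      have C_eq: "C = ward_const M" by (simp add: C_def ward_const_def corrector_def f0_def)
      have bound: "\<bar>- (\<integral>\<theta>. obs \<theta> * sin (t * obs \<theta> + a) \<partial>model) + t * s * cos_mean a t\<bar> \<le> 3 * \<delta>"
        if t: "0 \<le> t" "t \<le> 1" for t
      proof -
        have "\<bar>(\<integral>\<theta>. obs \<theta> * sin (t * obs \<theta> + a) \<partial>model) - t * sM M * cos_mean a t\<bar> \<le> C / sqrt \<beta> + rM M"
          unfolding sM_def rM_def C_eq
        proof (rule obs_sin_mean[OF nn])
          show "\<bar>t\<bar> \<le> 1" "1 \<le> \<beta>" using t elim(2) by auto
          show "(\<Sum>x\<in>l1_ball (R0 + M). evolved (f e) R0 M x * H (torus_proj (n \<beta>) x))\<^sup>2
              \<le> 4 * tail_green (f e) R0 M * torus_energy (n \<beta>) H" if "e \<in> Bs" "H 0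
                  = 0" for e and H :: "int \<times> int \<Rightarrow> real"
            using n1[OF that(1)] elim(1) by (intro n0 that(2)) simp
        qed
        moreover have "\<bar>t * sM M * cos_mean a t - t * s * cos_mean a t\<bar> \<le> \<bar>sM M - s\<bar>"
        proof -
          have "\<bar>t\<bar> * \<bar>sM M - s\<bar> * \<bar>cos_mean a t\<bar> \<le> 1 * \<bar>sM M - s\<bar> * 1"
            using t cos_mean_bound by (intro mult_mono) auto
          moreover have "t * sM M * cos_mean a t - t * s * cos_mean a t = t * (sM M - s) * cos_mean a t"
              by (simp add: algebra_simps)
          ultimately show ?thesis by (simp only: abs_mult) simp
        qed
        ultimately show ?thesis using M elim(3) by linarith
      qed
      have "\<bar>cos_mean a 1 - cos_mean a 0 * exp (- s / 2)\<bar> \<le> 3 * \<delta> * exp \<bar>s\<bar>"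
        by (rule real_ode_bound[OF cos_mean_deriv bound])
      also have "\<dots> < \<epsilon>" using \<open>0 < \<epsilon>\<close> by (simp add: \<delta>_def)
      finally show ?case by (simp add: cos_mean_0 dist_real_def cos_mean_def obs_def model.prob_space)
    qed
  qed
qed

section \<open>Cosine means of the free field\<close>

lemma centred_normal_eq_distr:
  assumes "\<sigma> > 0"
  shows "centred_normal \<sigma> = distr std_normal_distribution borel (\<lambda>x. \<sigma> * x)"
proof -
  interpret prob_space std_normal_distribution
    by (rule prob_space_normal_density) simp
  have "distributed std_normal_distribution lborel (\<lambda>x. x) (normal_density 0 1)"
    by (auto simp: distributed_def distr_id2)
  from normal_density_affine[OF this _ less_imp_neq[OF assms, symmetric], of 0]
  have "distributed std_normal_distribution lborel (\<lambda>x. \<sigma> * x) (normal_density 0 \<sigma>)"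
    using assms by simp
  then show ?thesis
    using assms by (simp add: centred_normal_def distributed_def cong: distr_cong)
qed

lemma char_centred_normal:
  assumes "\<sigma> \<ge> 0"
  shows "char (centred_normal \<sigma>) t = complex_of_real (exp (- (\<sigma> * t)\<^sup>2 / 2))"
proof (cases "\<sigma> = 0")
  case True
  then show ?thesis by (simp add: centred_normal_def char_def integral_return)
next
  case False
  then have "char (centred_normal \<sigma>) t = (CLINT x|std_normal_distribution. iexp (t * (\<sigma> * x)))"
    unfolding char_def using assms by (subst centred_normal_eq_distr) (auto simp: integral_distr)
  also have "\<dots> = char std_normal_distribution (\<sigma> * t)"
    by (simp add: char_def mult_ac)
  finally show ?thesis by (simp add: char_std_normal_distribution)
qed

lemma centred_normal_second_moment:
  assumes "\<sigma> \<ge> 0"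
  shows "integrable (centred_normal \<sigma>) (\<lambda>x. x\<^sup>2)" "(\<integral>x. x\<^sup>2 \<partial>centred_normal \<sigma>) = \<sigma>\<^sup>2"
proof -
  have "integrable (centred_normal \<sigma>) (\<lambda>x. x\<^sup>2) \<and> (\<integral>x. x\<^sup>2 \<partial>centred_normal \<sigma>) = \<sigma>\<^sup>2"
  proof (cases "\<sigma> = 0")
    case True
    have "integrable (return borel (0::real)) (\<lambda>x. x\<^sup>2)"
    proof -
      interpret prob_space "return borel (0::real)" by (rule prob_space_return) simp
      show ?thesis by (rule integrable_const_bound[of _ 0]) (auto simp: AE_return)
    qed
    then show ?thesis using True by (simp add: centred_normal_def integral_return)
  next
    case False
    then have s: "\<sigma> > 0" using assms by simp
    have i: "integrable lborel (\<lambda>x. normal_density 0 \<sigma> x * x\<^sup>2)"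
      using integrable_normal_moment[OF s, of 0 2] by simp
    have "(\<integral>x. normal_density 0 \<sigma> x * x\<^sup>2 \<partial>lborel) = \<sigma>\<^sup>2"
      using integral_normal_moment_even[OF s, of 0 1] by (simp add: numeral_2_eq_2 fact_reduce)
    then show ?thesis using False i
      by (simp add: centred_normal_def integrable_density integral_density)
  qed
  then show "integrable (centred_normal \<sigma>) (\<lambda>x. x\<^sup>2)" "(\<integral>x. x\<^sup>2 \<partial>centred_normal \<sigma>) = \<sigma>\<^sup>2" by auto
qed

lemma gaussian_field_square_integrable:
  assumes "centred_gaussian_field M X C"
  shows "integrable M (\<lambda>\<omega>. (X i \<omega>)\<^sup>2)"
proof -
  have X [measurable]: "X i \<in> borel_measurable M" for i using assms by (simp add: centred_gaussian_field_def)
  have "\<exists>\<sigma>\<ge>0. distr M borel (\<lambda>\<omega>. \<Sum>i\<in>{i}. (1::real) * X i \<omega>) = centred_normal \<sigma>"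
    by (rule assms[unfolded centred_gaussian_field_def, THEN conjunct2, THEN conjunct2, THEN conjunct1, rule_format]) simp
  then obtain \<sigma> where \<sigma>: "\<sigma> \<ge> 0" "distr M borel (\<lambda>\<omega>. \<Sum>i\<in>{i}. (1::real) * X i \<omega>) = centred_normal \<sigma>" by blast
  then have "distr M borel (X i) = centred_normal \<sigma>" by simp
  then have "integrable (distr M borel (X i)) (\<lambda>x. x\<^sup>2)" using centred_normal_second_moment[OF \<sigma>(1)] by simp
  then show ?thesis by (subst (asm) integrable_distr_eq) auto
qed

text \<open>Gaussianity of a combination is given with some standard deviation only; computing its
  second moment from the covariance identifies it. The products are integrable since squares
  are.\<close>

lemma gaussian_field_combination:
  assumes G: "centred_gaussian_field M X C" and J: "finite J"
  obtains \<sigma> where "\<sigma> \<ge> 0" "distr M borel (\<lambda>\<omega>. \<Sum>i\<in>J. c i * X i \<omega>) = centred_normal \<sigma>"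
    "\<sigma>\<^sup>2 = (\<Sum>i\<in>J. \<Sum>j\<in>J. c i * c j * C i j)"
proof -
  have X [measurable]: "X i \<in> borel_measurable M" for i using G by (simp add: centred_gaussian_field_def)
  have "\<exists>\<sigma>\<ge>0. distr M borel (\<lambda>\<omega>. \<Sum>i\<in>J. c i * X i \<omega>) = centred_normal \<sigma>"
    by (rule G[unfolded centred_gaussian_field_def, THEN conjunct2, THEN conjunct2, THEN conjunct1, rule_format, OF J])
  then obtain \<sigma> where \<sigma>: "\<sigma> \<ge> 0" "distr M borel (\<lambda>\<omega>. \<Sum>i\<in>J. c i * X i \<omega>) = centred_normal \<sigma>" by blast
  have int: "integrable M (\<lambda>\<omega>. X i \<omega> * X j \<omega>)" for i j
  proof (rule Bochner_Integration.integrable_bound)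
    show "integrable M (\<lambda>\<omega>. (X i \<omega>)\<^sup>2 + (X j \<omega>)\<^sup>2)"
      by (intro Bochner_Integration.integrable_add gaussian_field_square_integrable[OF G])
    show "AE \<omega> in M. norm (X i \<omega> * X j \<omega>) \<le> norm ((X i \<omega>)\<^sup>2 + (X j \<omega>)\<^sup>2)"
    proof (rule AE_I2)
      fix \<omega>
      have "2 * (\<bar>X i \<omega>\<bar> * \<bar>X j \<omega>\<bar>) \<le> (X i \<omega>)\<^sup>2 + (X j \<omega>)\<^sup>2"
        using sum_squares_bound[of "\<bar>X i \<omega>\<bar>" "\<bar>X j \<omega>\<bar>"] by (simp add: mult.assoc)
      moreover have "0 \<le> \<bar>X i \<omega>\<bar> * \<bar>X j \<omega>\<bar>" by simp
      ultimately have "\<bar>X i \<omega>\<bar> * \<bar>X j \<omega>\<bar> \<le> (X i \<omega>)\<^sup>2 + (X j \<omega>)\<^sup>2" by linarith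
      then show "norm (X i \<omega> * X j \<omega>) \<le> norm ((X i \<omega>)\<^sup>2 + (X j \<omega>)\<^sup>2)"
        by (simp add: abs_mult)
    qed
  qed measurable
  have "\<sigma>\<^sup>2 = (\<integral>x. x\<^sup>2 \<partial>distr M borel (\<lambda>\<omega>. \<Sum>i\<in>J. c i * X i \<omega>))"
    using centred_normal_second_moment(2)[OF \<sigma>(1)] \<sigma>(2) by simp
  also have "\<dots> = (\<integral>\<omega>. (\<Sum>i\<in>J. c i * X i \<omega>)\<^sup>2 \<partial>M)" by (rule integral_distr) measurable
  also have "\<dots> = (\<integral>\<omega>. (\<Sum>i\<in>J. \<Sum>j\<in>J. c i * c j * (X i \<omega> * X j \<omega>)) \<partial>M)"
    by (simp add: power2_eq_square sum_product mult_ac)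
  also have "\<dots> = (\<Sum>i\<in>J. \<Sum>j\<in>J. c i * c j * (\<integral>\<omega>. X i \<omega> * X j \<omega> \<partial>M))"
    using int by simp
  also have "\<dots> = (\<Sum>i\<in>J. \<Sum>j\<in>J. c i * c j * C i j)"
    using G by (simp add: centred_gaussian_field_def)
  finally show ?thesis using that \<sigma> by blast
qed

text \<open>Independence of the components factors the characteristic function at 1; multiplying by
  \<open>iexp a\<close> and taking the real part restores the phase.\<close>

lemma gff_cos_mean:
  fixes \<phi> :: "'k \<Rightarrow> int \<times> int \<Rightarrow> 'w \<Rightarrow> real"
  assumes gff: "rooted_vectorial_gff M K \<phi>" and K: "finite K" and B: "finite B"
  shows "(\<integral>\<omega>. cos ((\<Sum>k\<in>K. \<Sum>y\<in>B. c k y * \<phi> k y \<omega>) + a) \<partial>M)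
    = cos a * exp (- (\<Sum>k\<in>K. \<Sum>x\<in>B. \<Sum>y\<in>B. c k x * c k y * green0 x y) / 2)"
proof -
  interpret prob_space M using gff by (simp add: rooted_vectorial_gff_def)
  have G: "centred_gaussian_field M (\<phi> k) green0" if "k \<in> K" for k
    using gff that by (simp add: rooted_vectorial_gff_def)
  have \<phi>_meas: "\<phi> k y \<in> borel_measurable M" if "k \<in> K" for k y
    by (rule G[OF that, unfolded centred_gaussian_field_def, THEN conjunct2, THEN conjunct1, rule_format])
  define X where "X k \<omega> = (\<Sum>y\<in>B. c k y * \<phi> k y \<omega>)" for k \<omega>
  have X_meas: "X k \<in> borel_measurable M" if "k \<in> K" for k
    unfolding X_def[abs_def] using \<phi>_meas[OF that] by measurable
  have "indep_vars (\<lambda>_. borel) X K"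
  proof -
    have "indep_vars (\<lambda>_. Pi\<^sub>M UNIV (\<lambda>_. borel)) (\<lambda>k \<omega> x. \<phi> k x \<omega>) K"
      using gff by (simp add: rooted_vectorial_gff_def)
    then have "indep_vars (\<lambda>_. borel) (\<lambda>k \<omega>. (\<lambda>z. \<Sum>y\<in>B. c k y * z y) (\<lambda>x. \<phi> k x \<omega>)) K"
      by (rule indep_vars_compose2) measurable
    then show ?thesis by (simp add: X_def[abs_def])
  qed
  then have "char (distr M borel (\<lambda>\<omega>. \<Sum>k\<in>K. X k \<omega>)) 1 = (\<Prod>k\<in>K. char (distr M borel (X k)) 1)"
    by (rule char_distr_sum)
  also have "\<dots> = (\<Prod>k\<in>K. complex_of_real (exp (- (\<Sum>x\<in>B. \<Sum>y\<in>B. c k x * c k y * green0 x y) / 2)))"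
  proof (rule prod.cong[OF refl])
    fix k assume "k \<in> K"
    from gaussian_field_combination[OF G[OF this] B, of "c k"]
    obtain \<sigma> where \<sigma>: "\<sigma> \<ge> 0" "distr M borel (X k) = centred_normal \<sigma>"
      "\<sigma>\<^sup>2 = (\<Sum>x\<in>B. \<Sum>y\<in>B. c k x * c k y * green0 x y)"
      unfolding X_def[abs_def] by blast
    then show "char (distr M borel (X k)) 1 = complex_of_real (exp (- (\<Sum>x\<in>B. \<Sum>y\<in>B. c k x * c k y * green0 x y) / 2))"
      by (simp add: char_centred_normal)
  qed
  also have "\<dots> = complex_of_real (exp (- (\<Sum>k\<in>K. \<Sum>x\<in>B. \<Sum>y\<in>B. c k x * c k y * green0 x y) / 2))"
    using K by (simp add: exp_sum[symmetric] sum_negf sum_divide_distrib flip: of_real_prod)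
  finally have char: "char (distr M borel (\<lambda>\<omega>. \<Sum>k\<in>K. X k \<omega>)) 1
    = complex_of_real (exp (- (\<Sum>k\<in>K. \<Sum>x\<in>B. \<Sum>y\<in>B. c k x * c k y * green0 x y) / 2))" .
  define Y where "Y \<omega> = (\<Sum>k\<in>K. X k \<omega>)" for \<omega>
  have Y_meas [measurable]: "Y \<in> borel_measurable M" unfolding Y_def[abs_def] using X_meas by measurable
  have "char (distr M borel Y) 1 = (CLINT \<omega>|M. iexp (Y \<omega>))"
    unfolding char_def by (subst integral_distr) auto
  then have E: "(CLINT \<omega>|M. iexp (Y \<omega>)) = complex_of_real (exp (- (\<Sum>k\<in>K. \<Sum>x\<in>B. \<Sum>y\<in>B. c k x * c k y * green0 x y) / 2))"
    using char by (simp add: Y_def[abs_def])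
  have int: "integrable M (\<lambda>\<omega>. iexp (Y \<omega>))"
    by (rule integrable_const_bound[of _ 1]) auto
  have "(\<integral>\<omega>. cos (Y \<omega> + a) \<partial>M) = (\<integral>\<omega>. Re (iexp a * iexp (Y \<omega>)) \<partial>M)"
  proof (intro Bochner_Integration.integral_cong refl)
    fix \<omega>
    have "iexp a * iexp (Y \<omega>) = iexp (Y \<omega> + a)" by (simp add: exp_add[symmetric] algebra_simps)
    then show "cos (Y \<omega> + a) = Re (iexp a * iexp (Y \<omega>))" by (simp add: Re_exp)
  qed
  also have "\<dots> = Re (CLINT \<omega>|M. iexp a * iexp (Y \<omega>))"
    using int by (intro integral_Re) (rule integrable_mult_right)
  also have "(CLINT \<omega>|M. iexp a * iexp (Y \<omega>)) = iexp a * (CLINT \<omega>|M. iexp (Y \<omega>))"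
    by (rule integral_mult_right_zero)
  finally have "(\<integral>\<omega>. cos (Y \<omega> + a) \<partial>M)
      = Re (iexp a * complex_of_real (exp (- (\<Sum>k\<in>K. \<Sum>x\<in>B. \<Sum>y\<in>B. c k x * c k y * green0 x y) / 2)))"
    unfolding E .
  then show ?thesis by (simp add: X_def Y_def Re_exp)
qed

section \<open>From cosine means to weak convergence\<close>

text \<open>The algebra generated by constants and the sines of one frequency \<kappa> in the
  coordinates from \<open>J\<close>. Products enter one sine at a time, so an induction can convert
  each of them into a shift of frequencies.\<close>

inductive_set trig_ring :: "real \<Rightarrow> 'i set \<Rightarrow> (('i \<Rightarrow> real) \<Rightarrow> real) set" for \<kappa> J where
  const: "(\<lambda>_. c) \<in> trig_ring \<kappa> J"
| times: "h \<in> trig_ring \<kappa> J \<Longrightarrow> i \<in> J \<Longrightarrow> (\<lambda>x. sin (\<kappa> * x i) * h x) \<in> trig_ring \<kappa> J"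
| add: "h \<in> trig_ring \<kappa> J \<Longrightarrow> h' \<in> trig_ring \<kappa> J \<Longrightarrow> (\<lambda>x. h x + h' x) \<in> trig_ring \<kappa> J"

lemma trig_ring_scale: "h \<in> trig_ring \<kappa> J \<Longrightarrow> (\<lambda>x. c * h x) \<in> trig_ring \<kappa> J"
proof (induction rule: trig_ring.induct)
  case (times h i)
  then have "(\<lambda>x. sin (\<kappa> * x i) * (c * h x)) \<in> trig_ring \<kappa> J" by (intro trig_ring.times)
  then show ?case by (simp add: mult_ac)
next
  case (add h h')
  then have "(\<lambda>x. c * h x + c * h' x) \<in> trig_ring \<kappa> J" by (intro trig_ring.add)
  then show ?case by (simp add: distrib_left)
qed (rule trig_ring.const)

lemma trig_ring_mult: "h \<in> trig_ring \<kappa> J \<Longrightarrow> h' \<in> trig_ring \<kappa> J \<Longrightarrow> (\<lambda>x. h x * h' x) \<in> trig_ring \<kappa> J"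
proof (induction rule: trig_ring.induct)
  case (times h i)
  then have "(\<lambda>x. sin (\<kappa> * x i) * (h x * h' x)) \<in> trig_ring \<kappa> J" by (intro trig_ring.times)
  then show ?case by (simp add: mult_ac)
next
  case (add h1 h2)
  then have "(\<lambda>x. h1 x * h' x + h2 x * h' x) \<in> trig_ring \<kappa> J" by (intro trig_ring.add)
  then show ?case by (simp add: distrib_right)
qed (rule trig_ring_scale)

lemma trig_ring_continuous:
  fixes h :: "('i::countable \<Rightarrow> real) \<Rightarrow> real"
  shows "h \<in> trig_ring \<kappa> J \<Longrightarrow> continuous_on UNIV h"
proof (induction rule: trig_ring.induct)
  case (times h i)
  show ?case
    by (rule continuous_on_mult[OF continuous_on_sin[OF continuous_on_mult[OF continuous_on_const continuous_on_product_coordinates]] times.IH])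
qed (auto intro: continuous_intros)

lemma trig_ring_cong:
  "h \<in> trig_ring \<kappa> J \<Longrightarrow> (\<And>i. i \<in> J \<Longrightarrow> sin (\<kappa> * x i) = sin (\<kappa> * y i)) \<Longrightarrow> h x = h y"
  by (induction rule: trig_ring.induct) auto

lemma trig_ring_measurable:
  assumes "h \<in> trig_ring \<kappa> J" and X: "\<And>i. i \<in> J \<Longrightarrow> (\<lambda>\<omega>. X \<omega> i) \<in> borel_measurable M"
  shows "(\<lambda>\<omega>. h (X \<omega>)) \<in> borel_measurable M"
  using assms(1)
proof (induction rule: trig_ring.induct)
  case (times h i)
  note [measurable] = times.IH X[OF times.hyps(2)]
  show ?case by measurable
qed auto

lemma trig_ring_bounded: "h \<in> trig_ring \<kappa> J \<Longrightarrow> \<exists>B. \<forall>x. \<bar>h x\<bar> \<le> B"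
proof (induction rule: trig_ring.induct)
  case (times h i)
  then obtain B where B: "\<And>x. \<bar>h x\<bar> \<le> B" by blast
  have "\<bar>sin (\<kappa> * x i) * h x\<bar> \<le> 1 * B" for x
    unfolding abs_mult by (intro mult_mono abs_sin_le_one B) auto
  then show ?case by blast
next
  case (add h h')
  then obtain B B' where "\<And>x. \<bar>h x\<bar> \<le> B" "\<And>x. \<bar>h' x\<bar> \<le> B'" by blast
  then have "\<bar>h x + h' x\<bar> \<le> B + B'" for x by (intro order_trans[OF abs_triangle_ineq] add_mono)
  then show ?case by blast
qed auto

lemma trig_ring_cos_integrable:
  assumes k: "k \<in> trig_ring \<kappa> J" and P: "prob_space P" and Z: "\<forall>i\<in>J. (\<lambda>\<omega>. Z \<omega> i) \<in> borel_measurable P"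
  shows "integrable P (\<lambda>\<omega>. k (Z \<omega>) * cos ((\<Sum>i\<in>J. d i * Z \<omega> i) + e))"
proof -
  interpret prob_space P by fact
  obtain B where B: "\<And>x. \<bar>k x\<bar> \<le> B" using trig_ring_bounded[OF k] by blast
  have [measurable]: "(\<lambda>\<omega>. k (Z \<omega>)) \<in> borel_measurable P"
    using Z by (intro trig_ring_measurable[OF k]) auto
  have [measurable]: "(\<lambda>\<omega>. \<Sum>i\<in>J. d i * Z \<omega> i) \<in> borel_measurable P"
    using Z by (intro borel_measurable_sum borel_measurable_times borel_measurable_const) auto
  show ?thesis
  proof (rule integrable_const_bound[of _ "B * 1"])
    show "AE \<omega> in P. norm (k (Z \<omega>) * cos ((\<Sum>i\<in>J. d i * Z \<omega> i) + e)) \<le> B * 1"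
      unfolding real_norm_def abs_mult
      by (intro AE_I2 mult_mono abs_cos_le_one B order_trans[OF abs_ge_zero B]) simp
  qed measurable
qed

text \<open>The extra cosine with arbitrary coefficients and phase makes the induction work: sine
  times cosine is a combination of two cosines whose coefficients differ by \<kappa> at
  \<open>i\<close> and whose phases are shifted by pi / 2.\<close>

lemma trig_ring_tendsto:
  fixes X :: "'b \<Rightarrow> 'w \<Rightarrow> 'i \<Rightarrow> real"
  assumes h: "h \<in> trig_ring \<kappa> J" and J: "finite J"
    and ev: "eventually (\<lambda>b. prob_space (M b) \<and> (\<forall>i\<in>J. (\<lambda>\<omega>. X b \<omega> i) \<in> borel_measurable (M b))) G"
    and N: "prob_space N" "\<And>i. i \<in> J \<Longrightarrow> (\<lambda>\<omega>. Y \<omega> i) \<in> borel_measurable N"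
    and trig: "\<And>c a. ((\<lambda>b. \<integral>\<omega>. cos ((\<Sum>i\<in>J. c i * X b \<omega> i) + a) \<partial>M b) \<longlongrightarrow> (\<integral>\<omega>. cos ((\<Sum>i\<in>J. c i * Y \<omega> i) + a) \<partial>N)) G"
  shows "((\<lambda>b. \<integral>\<omega>. h (X b \<omega>) * cos ((\<Sum>i\<in>J. c i * X b \<omega> i) + a) \<partial>M b)
    \<longlongrightarrow> (\<integral>\<omega>. h (Y \<omega>) * cos ((\<Sum>i\<in>J. c i * Y \<omega> i) + a) \<partial>N)) G"
  using h
proof (induction arbitrary: c a rule: trig_ring.induct)
  case (const d)
  show ?case by (simp add: tendsto_mult[OF tendsto_const trig])
next
  case (times h i)
  note int = trig_ring_cos_integrable[OF times.hyps(1)]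
  let ?cp = "\<lambda>j. c j + (if j = i then \<kappa> else 0)" and ?cm = "\<lambda>j. c j - (if j = i then \<kappa> else 0)"
  have lin: "(\<Sum>j\<in>J. ?cp j * z j) = (\<Sum>j\<in>J. c j * z j) + \<kappa> * z i" "(\<Sum>j\<in>J. ?cm j * z j)
      = (\<Sum>j\<in>J. c j * z j) - \<kappa> * z i" for z
  proof -
    have "(\<Sum>j\<in>J. (if j = i then \<kappa> else 0) * z j) = (\<Sum>j\<in>J. if j = i then \<kappa> * z i else 0)" by (intro sum.cong) auto
    also have "\<dots> = \<kappa> * z i" using J times.hyps(2) by simp
    finally show "(\<Sum>j\<in>J. ?cp j * z j) = (\<Sum>j\<in>J. c j * z j) + \<kappa> * z i" "(\<Sum>j\<in>J. ?cm j * z j) = (\<Sum>j\<in>J. c j * z j) - \<kappa> * z i"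
      by (simp_all add: distrib_right left_diff_distrib sum.distrib sum_subtractf)
  qed
  have prod: "sin u * y * cos w = (1/2) * (y * cos ((w + u) + - pi / 2)) + (1/2) * (y * cos ((w - u)
      + pi / 2))" for u w y :: real
    by (simp add: cos_add sin_diff cos_diff sin_add algebra_simps)
  have eq: "sin (\<kappa> * z i) * h z * cos ((\<Sum>j\<in>J. c j * z j) + a)
      = (1/2) * (h z * cos ((\<Sum>j\<in>J. ?cp j * z j) + (a - pi / 2))) + (1/2) * (h z * cos ((\<Sum>j\<in>J. ?cm j * z j) + (a
          + pi / 2)))" for z
    unfolding lin by (subst prod) (simp add: algebra_simps)
  have split: "(\<integral>\<omega>. sin (\<kappa> * Z \<omega> i) * h (Z \<omega>) * cos ((\<Sum>j\<in>J. c j * Z \<omega> j) + a) \<partial>P)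
      = (1/2) * (\<integral>\<omega>. h (Z \<omega>) * cos ((\<Sum>j\<in>J. ?cp j * Z \<omega> j) + (a - pi / 2)) \<partial>P)
      + (1/2) * (\<integral>\<omega>. h (Z \<omega>) * cos ((\<Sum>j\<in>J. ?cm j * Z \<omega> j) + (a + pi / 2)) \<partial>P)"
    if "prob_space P" "\<forall>i\<in>J. (\<lambda>\<omega>. Z \<omega> i) \<in> borel_measurable P" for P :: "'z measure" and Z
    unfolding eq using int[OF that] by (subst Bochner_Integration.integral_add) (simp_all only: integrable_mult_right integral_mult_right_zero)
  have "((\<lambda>b. (1/2) * (\<integral>\<omega>. h (X b \<omega>) * cos ((\<Sum>j\<in>J. ?cp j * X b \<omega> j) + (a - pi / 2)) \<partial>M b)
      + (1/2) * (\<integral>\<omega>. h (X b \<omega>) * cos ((\<Sum>j\<in>J. ?cm j * X b \<omega> j) + (a + pi / 2)) \<partial>M b))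
    \<longlongrightarrow> (1/2) * (\<integral>\<omega>. h (Y \<omega>) * cos ((\<Sum>j\<in>J. ?cp j * Y \<omega> j) + (a - pi / 2)) \<partial>N)
      + (1/2) * (\<integral>\<omega>. h (Y \<omega>) * cos ((\<Sum>j\<in>J. ?cm j * Y \<omega> j) + (a + pi / 2)) \<partial>N)) G"
    by (intro tendsto_add tendsto_mult tendsto_const times.IH)
  moreover have "eventually (\<lambda>b. (1/2) * (\<integral>\<omega>. h (X b \<omega>) * cos ((\<Sum>j\<in>J. ?cp j * X b \<omega> j) + (a - pi / 2)) \<partial>M b)
      + (1/2) * (\<integral>\<omega>. h (X b \<omega>) * cos ((\<Sum>j\<in>J. ?cm j * X b \<omega> j) + (a + pi / 2)) \<partial>M b)
      = (\<integral>\<omega>. sin (\<kappa> * X b \<omega> i) * h (X b \<omega>) * cos ((\<Sum>j\<in>J. c j * X b \<omega> j) + a) \<partial>M b)) G"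
    using ev by eventually_elim (rule split[symmetric]; blast)
  ultimately have "((\<lambda>b. \<integral>\<omega>. sin (\<kappa> * X b \<omega> i) * h (X b \<omega>) * cos ((\<Sum>j\<in>J. c j * X b \<omega> j) + a) \<partial>M b)
    \<longlongrightarrow> (1/2) * (\<integral>\<omega>. h (Y \<omega>) * cos ((\<Sum>j\<in>J. ?cp j * Y \<omega> j) + (a - pi / 2)) \<partial>N)
      + (1/2) * (\<integral>\<omega>. h (Y \<omega>) * cos ((\<Sum>j\<in>J. ?cm j * Y \<omega> j) + (a + pi / 2)) \<partial>N)) G"
    by (rule Lim_transform_eventually)
  then show ?case using split[of N Y] N by simp
next
  case (add h h')
  note int = trig_ring_cos_integrable
  have split: "(\<integral>\<omega>. (h (Z \<omega>) + h' (Z \<omega>)) * cos ((\<Sum>j\<in>J. c j * Z \<omega> j) + a) \<partial>P)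
      = (\<integral>\<omega>. h (Z \<omega>) * cos ((\<Sum>j\<in>J. c j * Z \<omega> j) + a) \<partial>P) + (\<integral>\<omega>. h' (Z \<omega>) * cos ((\<Sum>j\<in>J. c j * Z \<omega> j) + a) \<partial>P)"
    if "prob_space P" "\<forall>i\<in>J. (\<lambda>\<omega>. Z \<omega> i) \<in> borel_measurable P" for P :: "'z measure" and Z
    unfolding distrib_right using int[OF add.hyps(1) that] int[OF add.hyps(2) that]
        by (rule Bochner_Integration.integral_add)
  have "((\<lambda>b. (\<integral>\<omega>. h (X b \<omega>) * cos ((\<Sum>j\<in>J. c j * X b \<omega> j) + a) \<partial>M b) + (\<integral>\<omega>. h' (X b \<omega>) * cos ((\<Sum>j\<in>J. c j * X b \<omega> j)
      + a) \<partial>M b))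
    \<longlongrightarrow> (\<integral>\<omega>. h (Y \<omega>) * cos ((\<Sum>j\<in>J. c j * Y \<omega> j) + a) \<partial>N) + (\<integral>\<omega>. h' (Y \<omega>) * cos ((\<Sum>j\<in>J. c j * Y \<omega> j) + a) \<partial>N)) G"
    by (intro tendsto_add add.IH)
  moreover have "eventually (\<lambda>b. (\<integral>\<omega>. h (X b \<omega>) * cos ((\<Sum>j\<in>J. c j * X b \<omega> j) + a) \<partial>M b)
      + (\<integral>\<omega>. h' (X b \<omega>) * cos ((\<Sum>j\<in>J. c j * X b \<omega> j) + a) \<partial>M b)
      = (\<integral>\<omega>. (h (X b \<omega>) + h' (X b \<omega>)) * cos ((\<Sum>j\<in>J. c j * X b \<omega> j) + a) \<partial>M b)) G"
    using ev by eventually_elim (rule split[symmetric]; blast)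
  ultimately have "((\<lambda>b. \<integral>\<omega>. (h (X b \<omega>) + h' (X b \<omega>)) * cos ((\<Sum>j\<in>J. c j * X b \<omega> j) + a) \<partial>M b)
    \<longlongrightarrow> (\<integral>\<omega>. h (Y \<omega>) * cos ((\<Sum>j\<in>J. c j * Y \<omega> j) + a) \<partial>N) + (\<integral>\<omega>. h' (Y \<omega>) * cos ((\<Sum>j\<in>J. c j * Y \<omega> j) + a) \<partial>N)) G"
    by (rule Lim_transform_eventually)
  then show ?case using split[of N Y] N by simp
qed

text \<open>
  Folds the line onto \<open>{- K..K}\<close> without changing \<open>sin (pi / (2 * K) * t)\<close>, hence without changing the
  trigonometric polynomials that approximate on the cube.
\<close>

definition fold_map :: "real \<Rightarrow> real \<Rightarrow> real" where
  "fold_map K t = 2 * K / pi * arcsin (sin (pi / (2 * K) * t))"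

lemma fold_map_props:
  assumes K: "K > 0"
  shows "\<bar>fold_map K t\<bar> \<le> K" "sin (pi / (2 * K) * fold_map K t) = sin (pi / (2 * K) * t)"
    "\<bar>t\<bar> \<le> K \<Longrightarrow> fold_map K t = t"
proof -
  have s: "- 1 \<le> sin u" "sin u \<le> 1" for u :: real by auto
  have b: "\<bar>arcsin (sin u)\<bar> \<le> pi / 2" for u :: real using arcsin_bounded[OF s[of u]] by (intro abs_leI) auto
  have "\<bar>fold_map K t\<bar> = 2 * K / pi * \<bar>arcsin (sin (pi / (2 * K) * t))\<bar>"
    using K by (simp add: fold_map_def abs_mult)
  also have "\<dots> \<le> 2 * K / pi * (pi / 2)" using K b by (intro mult_left_mono) auto
  finally show "\<bar>fold_map K t\<bar> \<le> K" using K by simp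
  have "pi / (2 * K) * fold_map K t = arcsin (sin (pi / (2 * K) * t))"
    using K by (simp add: fold_map_def)
  then show "sin (pi / (2 * K) * fold_map K t) = sin (pi / (2 * K) * t)" using s by (simp only: sin_arcsin)
  show "fold_map K t = t" if "\<bar>t\<bar> \<le> K"
  proof -
    have "\<bar>pi / (2 * K) * t\<bar> = pi / (2 * K) * \<bar>t\<bar>" using K by (simp add: abs_mult)
    also have "\<dots> \<le> pi / (2 * K) * K" using that K by (intro mult_left_mono) auto
    finally have "\<bar>pi / (2 * K) * t\<bar> \<le> pi / 2" using K by simp
    then have "arcsin (sin (pi / (2 * K) * t)) = pi / (2 * K) * t" by (intro arcsin_sin) linarith+
    then show ?thesis using K by (simp add: fold_map_def)
  qed
qed

text \<open>Coordinates outside \<open>J\<close> are pinned to \<open>undefined\<close>, as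
  \<open>restrict\<close> leaves them. The cube is then compact in the full function space, and
  distinct points differ at a coordinate in \<open>J\<close>.\<close>

definition cube :: "'i set \<Rightarrow> real \<Rightarrow> ('i \<Rightarrow> real) set" where
  "cube J K = (\<Pi>\<^sub>E i\<in>UNIV. if i \<in> J then {- K..K} else {undefined})"

lemma compact_cube: "compact (cube J K :: ('i::countable \<Rightarrow> real) set)"
proof -
  have "compactin (product_topology (\<lambda>_::'i. euclideanreal) UNIV) (cube J K)"
    unfolding cube_def by (subst compactin_PiE) auto
  then show ?thesis by (simp add: euclidean_product_topology)
qed

text \<open>Stone-Weierstrass on the cube. The frequency pi / (2 K) is chosen so that a single sine
  already separates the values of a coordinate.\<close>

lemma trig_ring_dense:
  fixes g :: "('i::countable \<Rightarrow> real) \<Rightarrow> real"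
  assumes K: "K > 0" and g: "continuous_on UNIV g" and e: "e > 0"
  obtains h where "h \<in> trig_ring (pi / (2 * K)) J" "\<And>x. x \<in> cube J K \<Longrightarrow> \<bar>g x - h x\<bar> < e"
proof -
  interpret function_ring_on "trig_ring (pi / (2 * K)) J" "cube J K"
  proof
    show "compact (cube J K)" by (rule compact_cube)
    show "continuous_on (cube J K) f" if "f \<in> trig_ring (pi / (2 * K)) J" for f
      using trig_ring_continuous[OF that] continuous_on_subset by blast
    fix x y assume x: "x \<in> cube J K" and y: "y \<in> cube J K" and "x \<noteq> y"
    then obtain i where i: "x i \<noteq> y i" by auto
    have iJ: "i \<in> J"
      using x y i by (auto simp: cube_def PiE_iff split: if_splits) (metis singletonD)
    have xy: "\<bar>x i\<bar> \<le> K" "\<bar>y i\<bar> \<le> K"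
      using x y iJ by (auto simp: cube_def PiE_iff abs_le_iff dest!: spec[of _ i])
    \<comment> \<open>The arguments stay between - pi / 2 and pi / 2, where the sine is injective;
      \<open>fold_map K\<close> inverts it there.\<close>
    have "sin (pi / (2 * K) * x i) \<noteq> sin (pi / (2 * K) * y i)"
    proof
      assume eq: "sin (pi / (2 * K) * x i) = sin (pi / (2 * K) * y i)"
      have "fold_map K (x i) = fold_map K (y i)" unfolding fold_map_def eq ..
      then show False using i fold_map_props(3)[OF K] xy by simp
    qed
    moreover have "(\<lambda>x. sin (pi / (2 * K) * x i) * 1) \<in> trig_ring (pi / (2 * K)) J"
      by (intro trig_ring.times trig_ring.const iJ)
    ultimately show "\<exists>f\<in>trig_ring (pi / (2 * K)) J. f x \<noteq> f y" by (intro bexI) auto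
  qed (auto intro: trig_ring.intros trig_ring_mult)
  obtain h where "h \<in> trig_ring (pi / (2 * K)) J" "\<forall>x\<in>cube J K. \<bar>g x - h x\<bar> < e"
    using Stone_Weierstrass_basic[OF continuous_on_subset[OF g] e] by blast
  then show ?thesis using that by blast
qed

text \<open>The approximation is good on the cube only, but \<open>h\<close> does not change when
  all coordinates are folded into it. Replacing the argument of \<open>g\<close> by the folded one
  costs nothing inside the cube; outside it costs 2 B, and there the sum of squares divided by
  \<open>K\<^sup>2\<close> is at least 1. Hence second moments control the error.\<close>

lemma trig_approximation_error:
  fixes g h :: "('i::countable \<Rightarrow> real) \<Rightarrow> real" and X :: "'w \<Rightarrow> 'i \<Rightarrow> real"
  assumes K: "K > 0" and J: "finite J" and M: "prob_space M"
    and h: "h \<in> trig_ring (pi / (2 * K)) J" and approx: "\<And>x. x \<in> cube J K \<Longrightarrow> \<bar>g x - h x\<bar> < e"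
    and B: "\<And>x. \<bar>g x\<bar> \<le> B" and g: "continuous_on UNIV g"
    and X: "\<And>i. i \<in> J \<Longrightarrow> (\<lambda>\<omega>. X \<omega> i) \<in> borel_measurable M"
    and X2: "\<And>i. i \<in> J \<Longrightarrow> integrable M (\<lambda>\<omega>. (X \<omega> i)\<^sup>2)"
  shows "\<bar>(\<integral>\<omega>. g (restrict (X \<omega>) J) \<partial>M) - (\<integral>\<omega>. h (X \<omega>) \<partial>M)\<bar> \<le> e + 2 * B / K\<^sup>2 * (\<Sum>i\<in>J. \<integral>\<omega>. (X \<omega> i)\<^sup>2 \<partial>M)"
proof -
  interpret prob_space M by fact
  have B0: "0 \<le> B" using abs_ge_zero B by (rule order_trans)
  have g_meas [measurable]: "(\<lambda>\<omega>. g (restrict (X \<omega>) J)) \<in> borel_measurable M"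
  proof -
    have "(\<lambda>\<omega>. restrict (X \<omega>) J) \<in> borel_measurable M"
    proof (rule measurable_coordinatewise_then_product)
      show "(\<lambda>\<omega>. restrict (X \<omega>) J i) \<in> borel_measurable M" for i
        using X by (cases "i \<in> J") simp_all
    qed
    then show ?thesis by (rule measurable_compose[OF _ borel_measurable_continuous_onI[OF g]])
  qed
  have h_meas [measurable]: "(\<lambda>\<omega>. h (X \<omega>)) \<in> borel_measurable M"
    by (rule trig_ring_measurable[OF h X])
  obtain Bh where Bh: "\<And>x. \<bar>h x\<bar> \<le> Bh" using trig_ring_bounded[OF h] by blast
  have int: "integrable M (\<lambda>\<omega>. g (restrict (X \<omega>) J))" "integrable M (\<lambda>\<omega>. h (X \<omega>))"
    by (rule integrable_const_bound[of _ B], use B in auto) (rule integrable_const_bound[of _ Bh], use Bh in auto)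
  have pointwise: "\<bar>g (restrict (X \<omega>) J) - h (X \<omega>)\<bar> \<le> e + 2 * B / K\<^sup>2 * (\<Sum>i\<in>J. (X \<omega> i)\<^sup>2)" for \<omega>
  proof -
    define x' where "x' = (\<lambda>i\<in>J. fold_map K (X \<omega> i))"
    have "x' \<in> cube J K"
      using fold_map_props(1)[OF K] by (auto simp: cube_def PiE_iff x'_def abs_le_iff)
        (smt (verit) fold_map_props(1)[OF K] abs_le_iff)+
    then have 1: "\<bar>g x' - h x'\<bar> < e" by (rule approx)
    have 2: "h x' = h (X \<omega>)"
      by (rule trig_ring_cong[OF h]) (simp only: x'_def restrict_apply' fold_map_props(2)[OF K])
    have 3: "\<bar>g (restrict (X \<omega>) J) - g x'\<bar> \<le> 2 * B / K\<^sup>2 * (\<Sum>i\<in>J. (X \<omega> i)\<^sup>2)"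
    proof (cases "\<forall>i\<in>J. \<bar>X \<omega> i\<bar> \<le> K")
      case True
      then have "restrict (X \<omega>) J = x'" by (auto simp: x'_def fun_eq_iff fold_map_props(3)[OF K])
      then show ?thesis using B0 by (simp add: sum_nonneg)
    next
      case False
      then obtain i where i: "i \<in> J" "K < \<bar>X \<omega> i\<bar>" by (auto simp: not_le)
      have "K\<^sup>2 \<le> \<bar>X \<omega> i\<bar>\<^sup>2" using i K by (intro power_mono) auto
      also have "\<dots> \<le> (\<Sum>i\<in>J. (X \<omega> i)\<^sup>2)"
        using member_le_sum[of i J "\<lambda>i. (X \<omega> i)\<^sup>2"] i J by simp
      finally have "2 * B / K\<^sup>2 * K\<^sup>2 \<le> 2 * B / K\<^sup>2 * (\<Sum>i\<in>J. (X \<omega> i)\<^sup>2)"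
        using B0 by (intro mult_left_mono) auto
      moreover have "\<bar>g (restrict (X \<omega>) J) - g x'\<bar> \<le> 2 * B"
        using B[of "restrict (X \<omega>) J"] B[of x'] by linarith
      ultimately show ?thesis using K by simp
    qed
    show ?thesis using 1 3 unfolding 2 by linarith
  qed
  have "\<bar>(\<integral>\<omega>. g (restrict (X \<omega>) J) \<partial>M) - (\<integral>\<omega>. h (X \<omega>) \<partial>M)\<bar> = \<bar>\<integral>\<omega>. g (restrict (X \<omega>) J) - h (X \<omega>) \<partial>M\<bar>"
    using int by simp
  also have "\<dots> \<le> (\<integral>\<omega>. \<bar>g (restrict (X \<omega>) J) - h (X \<omega>)\<bar> \<partial>M)" by (rule integral_abs_bound)
  also have "\<dots> \<le> (\<integral>\<omega>. e + 2 * B / K\<^sup>2 * (\<Sum>i\<in>J. (X \<omega> i)\<^sup>2) \<partial>M)"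
    using int X2 by (intro integral_mono pointwise) auto
  also have "\<dots> = e + 2 * B / K\<^sup>2 * (\<Sum>i\<in>J. \<integral>\<omega>. (X \<omega> i)\<^sup>2 \<partial>M)"
    using X2 by (simp add: prob_space)
  finally show ?thesis .
qed

text \<open>The uniform second moments replace tightness: with them, trigonometric polynomials
  approximate \<open>g\<close> in mean, uniformly along the filter, and for those polynomials
  convergence follows from the cosines.\<close>

theorem weak_convergence_of_cosines:
  fixes X :: "'b \<Rightarrow> 'w \<Rightarrow> 'i::countable \<Rightarrow> real" and Y :: "'v \<Rightarrow> 'i \<Rightarrow> real"
    and g :: "('i \<Rightarrow> real) \<Rightarrow> real"
  assumes J: "finite J"
    and ev: "eventually (\<lambda>b. prob_space (M b) \<and> (\<forall>i\<in>J. (\<lambda>\<omega>. X b \<omega> i) \<in> borel_measurable (M b)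
      \<and> integrable (M b) (\<lambda>\<omega>. (X b \<omega> i)\<^sup>2) \<and> (\<integral>\<omega>. (X b \<omega> i)\<^sup>2 \<partial>M b) \<le> C)) G"
    and N: "prob_space N" "\<And>i. i \<in> J \<Longrightarrow> (\<lambda>\<omega>. Y \<omega> i) \<in> borel_measurable N" "\<And>i. i \<in> J \<Longrightarrow> integrable N (\<lambda>\<omega>. (Y \<omega> i)\<^sup>2)"
    and trig: "\<And>c a. ((\<lambda>b. \<integral>\<omega>. cos ((\<Sum>i\<in>J. c i * X b \<omega> i) + a) \<partial>M b) \<longlongrightarrow> (\<integral>\<omega>. cos ((\<Sum>i\<in>J. c i * Y \<omega> i) + a) \<partial>N)) G"
    and g: "continuous_on UNIV g" and B: "\<And>x. \<bar>g x\<bar> \<le> B"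
  shows "((\<lambda>b. \<integral>\<omega>. g (restrict (X b \<omega>) J) \<partial>M b) \<longlongrightarrow> (\<integral>\<omega>. g (restrict (Y \<omega>) J) \<partial>N)) G"
proof (rule tendstoI)
  fix \<epsilon> :: real assume \<epsilon>: "0 < \<epsilon>"
  define D where "D = real (card J) * \<bar>C\<bar> + (\<Sum>i\<in>J. \<integral>\<omega>. (Y \<omega> i)\<^sup>2 \<partial>N)"
  have B0: "0 \<le> B" using abs_ge_zero B by (rule order_trans)
  have Y0: "0 \<le> (\<Sum>i\<in>J. \<integral>\<omega>. (Y \<omega> i)\<^sup>2 \<partial>N)" by (intro sum_nonneg integral_nonneg_AE) simp
  have D0: "0 \<le> D" unfolding D_def using Y0 by simp
  \<comment> \<open>Large enough for 2 B D / K^2 \<le> \<epsilon> / 8; the summand 1 gives K \<le>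
    K^2. The three errors, each at most \<epsilon> / 4, then add up to less than \<epsilon>.\<close>
  define K where "K = 1 + 16 * B * D / \<epsilon>"
  have K: "K > 0" "1 \<le> K" using B0 D0 \<epsilon> by (auto simp: K_def intro!: add_pos_nonneg)
  have KD: "2 * B / K\<^sup>2 * D \<le> \<epsilon> / 8"
  proof -
    have "16 * B * D / \<epsilon> \<le> K" by (simp add: K_def)
    also have "\<dots> \<le> K\<^sup>2" using K(2) by (simp add: power2_eq_square mult_le_cancel_left1)
    finally have "16 * B * D \<le> K\<^sup>2 * \<epsilon>" using \<epsilon> by (simp add: field_simps)
    then show ?thesis using K(1) by (simp add: field_simps)
  qed
  obtain h where h: "h \<in> trig_ring (pi / (2 * K)) J" "\<And>x. x \<in> cube J K \<Longrightarrow> \<bar>g x - h x\<bar> < \<epsilon> / 8"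
    using trig_ring_dense[OF K(1) g, of "\<epsilon> / 8" J] \<epsilon> by auto
  have ev': "eventually (\<lambda>b. prob_space (M b) \<and> (\<forall>i\<in>J. (\<lambda>\<omega>. X b \<omega> i) \<in> borel_measurable (M b))) G"
    using ev by eventually_elim blast
  have "((\<lambda>b. \<integral>\<omega>. h (X b \<omega>) * cos ((\<Sum>i\<in>J. 0 * X b \<omega> i) + 0) \<partial>M b) \<longlongrightarrow> (\<integral>\<omega>. h (Y \<omega>) * cos ((\<Sum>i\<in>J. 0 * Y \<omega> i) + 0) \<partial>N)) G"
    by (rule trig_ring_tendsto[OF h(1) J ev' N(1,2) trig])
  then have "((\<lambda>b. \<integral>\<omega>. h (X b \<omega>) \<partial>M b) \<longlongrightarrow> (\<integral>\<omega>. h (Y \<omega>) \<partial>N)) G" by simp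
  then have lim: "eventually (\<lambda>b. dist (\<integral>\<omega>. h (X b \<omega>) \<partial>M b) (\<integral>\<omega>. h (Y \<omega>) \<partial>N) < \<epsilon> / 4) G"
    using \<epsilon> by (intro tendstoD) auto
  have mono: "2 * B / K\<^sup>2 * s \<le> \<epsilon> / 8" if "s \<le> D" for s
    using mult_left_mono[OF that, of "2 * B / K\<^sup>2"] B0 KD by simp
  have "\<bar>(\<integral>\<omega>. g (restrict (Y \<omega>) J) \<partial>N) - (\<integral>\<omega>. h (Y \<omega>) \<partial>N)\<bar> \<le> \<epsilon> / 8 + 2 * B / K\<^sup>2 * (\<Sum>i\<in>J. \<integral>\<omega>. (Y \<omega> i)\<^sup>2 \<partial>N)"
    by (rule trig_approximation_error[OF K(1) J N(1) h B g N(2,3)])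
  moreover have "2 * B / K\<^sup>2 * (\<Sum>i\<in>J. \<integral>\<omega>. (Y \<omega> i)\<^sup>2 \<partial>N) \<le> \<epsilon> / 8" by (rule mono) (simp add: D_def)
  ultimately have Yerr: "\<bar>(\<integral>\<omega>. g (restrict (Y \<omega>) J) \<partial>N) - (\<integral>\<omega>. h (Y \<omega>) \<partial>N)\<bar> \<le> \<epsilon> / 8 + \<epsilon> / 8" by linarith
  show "eventually (\<lambda>b. dist (\<integral>\<omega>. g (restrict (X b \<omega>) J) \<partial>M b) (\<integral>\<omega>. g (restrict (Y \<omega>) J) \<partial>N) < \<epsilon>) G"
    using ev lim
  proof eventually_elim
    case (elim b)
    have "(\<Sum>i\<in>J. \<integral>\<omega>. (X b \<omega> i)\<^sup>2 \<partial>M b) \<le> (\<Sum>i\<in>J. \<bar>C\<bar>)" using elim(1) by (intro sum_mono) (meson abs_ge_self order_trans)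
    also have "\<dots> \<le> D" using Y0 by (simp add: D_def)
    finally have "2 * B / K\<^sup>2 * (\<Sum>i\<in>J. \<integral>\<omega>. (X b \<omega> i)\<^sup>2 \<partial>M b) \<le> \<epsilon> / 8" by (rule mono)
    moreover have "\<bar>(\<integral>\<omega>. g (restrict (X b \<omega>) J) \<partial>M b) - (\<integral>\<omega>. h (X b \<omega>) \<partial>M b)\<bar>
        \<le> \<epsilon> / 8 + 2 * B / K\<^sup>2 * (\<Sum>i\<in>J. \<integral>\<omega>. (X b \<omega> i)\<^sup>2 \<partial>M b)"
      using elim(1) by (intro trig_approximation_error[OF K(1) J _ h B g]) auto
    ultimately show ?case using elim(2) Yerr \<epsilon> unfolding dist_real_def by linarith
  qed
qed

section \<open>Convergence of the spin field\<close>

text \<open>Test functions are given on extensional functions over \<open>J\<close>; precomposition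
  with \<open>restrict\<close> makes them continuous on the whole function type, where the
  approximation takes place.\<close>

lemma continuous_on_restrict_product:
  fixes f :: "('i \<Rightarrow> real) \<Rightarrow> real"
  assumes "continuous_map (product_topology (\<lambda>_. euclideanreal) J) euclideanreal f"
  shows "continuous_on UNIV (\<lambda>x. f (restrict x J))"
proof -
  have "continuous_map (product_topology (\<lambda>_. euclideanreal) UNIV) (product_topology (\<lambda>_. euclideanreal) J) (\<lambda>x. restrict x J)"
    unfolding continuous_map_componentwise
    by (auto intro: continuous_map_product_projection)
  then have "continuous_map (product_topology (\<lambda>_. euclideanreal) UNIV) euclideanreal (f \<circ> (\<lambda>x. restrict x J))"
    using assms by (rule continuous_map_compose)
  then show ?thesis by (simp add: euclidean_product_topology o_def)
qed

lemma integral_law_on: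
  fixes f :: "('i::countable \<Rightarrow> real) \<Rightarrow> real"
  assumes f: "continuous_map (product_topology (\<lambda>_. euclideanreal) J) euclideanreal f"
    and X: "\<And>i. i \<in> J \<Longrightarrow> (\<lambda>\<omega>. X \<omega> i) \<in> borel_measurable M"
  shows "(\<integral>x. f x \<partial>law_on M J X) = (\<integral>\<omega>. f (restrict (X \<omega>) J) \<partial>M)"
proof -
  have "(\<lambda>x. restrict x J) \<in> borel_measurable (Pi\<^sub>M J (\<lambda>_. borel :: real measure))"
  proof (rule measurable_coordinatewise_then_product)
    show "(\<lambda>x. restrict x J i) \<in> borel_measurable (Pi\<^sub>M J (\<lambda>_. borel :: real measure))" for i
      by (cases "i \<in> J") simp_all
  qed
  from measurable_compose[OF this borel_measurable_continuous_onI[OF continuous_on_restrict_product[OF f]]]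
  have "(\<lambda>x. f (restrict x J)) \<in> borel_measurable (Pi\<^sub>M J (\<lambda>_. borel))" by simp
  moreover have "f x = f (restrict x J)" if "x \<in> space (Pi\<^sub>M J (\<lambda>_. borel :: real measure))" for x
    using that by (simp add: space_PiM PiE_restrict)
  ultimately have "f \<in> borel_measurable (Pi\<^sub>M J (\<lambda>_. borel))"
    using measurable_cong[of "Pi\<^sub>M J (\<lambda>_. borel :: real measure)" f "\<lambda>x. f (restrict x J)" borel] by blast
  then show ?thesis
    unfolding law_on_def by (intro integral_distr measurable_restrict X)
qed

lemma spin_field_cos_limit:
  fixes n :: "real \<Rightarrow> nat" and p :: "'n::finite" and \<phi> :: "'n \<Rightarrow> int \<times> int \<Rightarrow> 'w \<Rightarrow> real"
  assumes n: "filterlim n at_top at_top" and gff: "rooted_vectorial_gff \<Omega> (- {p}) \<phi>" and F: "finite F"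
  shows "((\<lambda>\<beta>. \<integral>\<theta>. cos ((\<Sum>i\<in>F \<times> - {p}. c i * (case i of (x, k) \<Rightarrow> sqrt \<beta> * \<theta> (torus_proj (n \<beta>) x) $ k)) + a)
        \<partial>rooted_spin_model \<beta> (n \<beta>) (axis p 1 :: real ^ 'n))
      \<longlongrightarrow> (\<integral>\<omega>. cos ((\<Sum>i\<in>F \<times> - {p}. c i * (case i of (x, k) \<Rightarrow> \<phi> k x \<omega>)) + a) \<partial>\<Omega>)) at_top"
proof -
  \<comment> \<open>A radius whose ball contains \<open>F\<close>: each norm is a summand.
    Coefficients are extended by 0 to the ball.\<close>
  define R0 where "R0 = (\<Sum>x\<in>F. l1_norm x)"
  have sub: "F \<subseteq> l1_ball R0" using F by (auto simp: l1_ball_def R0_def intro: member_le_sum)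
  define d where "d k y = (if y \<in> F then c (y, k) else 0)" for k y
  have regroup: "(\<Sum>i\<in>F \<times> - {p}. c i * (case i of (x, k) \<Rightarrow> \<psi> k x)) = (\<Sum>k\<in>- {p}. \<Sum>y\<in>l1_ball R0. d k y * \<psi> k y)"
    for \<psi> :: "'n \<Rightarrow> int \<times> int \<Rightarrow> real"
  proof -
    have "(\<Sum>i\<in>F \<times> - {p}. c i * (case i of (x, k) \<Rightarrow> \<psi> k x)) = (\<Sum>x\<in>F. \<Sum>k\<in>- {p}. c (x, k) * \<psi> k x)"
      by (simp add: sum.cartesian_product split_def)
    also have "\<dots> = (\<Sum>k\<in>- {p}. \<Sum>x\<in>F. c (x, k) * \<psi> k x)" by (rule sum.swap)
    also have "\<dots> = (\<Sum>k\<in>- {p}. \<Sum>y\<in>l1_ball R0. d k y * \<psi> k y)"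
      by (intro sum.cong refl sum.mono_neutral_cong_left finite_l1_ball sub) (auto simp: d_def)
    finally show ?thesis .
  qed
  have inj: "inj (\<lambda>k. axis k 1 :: real ^ 'n)" by (auto simp: inj_def axis_eq_axis)
  define Bs where "Bs = (\<lambda>k. axis k 1 :: real ^ 'n) ` (- {p})"
  have reindex: "(\<Sum>e\<in>Bs. G e) = (\<Sum>k\<in>- {p}. G (axis k 1))" for G :: "real ^ 'n \<Rightarrow> real"
    unfolding Bs_def using inj by (subst sum.reindex) (auto simp: inj_on_def)
  define f where "f e = d (inv (\<lambda>k. axis k 1 :: real ^ 'n) e)" for e
  have f_axis: "f (axis k 1) = d k" for k by (simp add: f_def inv_f_f[OF inj])
  have "((\<lambda>\<beta>. \<integral>\<theta>. cos (sqrt \<beta> * (\<Sum>e\<in>Bs. \<Sum>y\<in>l1_ball R0. f e y * (\<theta> (torus_proj (n \<beta>) y) \<bullet> e)) + a)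
      \<partial>rooted_spin_model \<beta> (n \<beta>) (axis p 1))
    \<longlongrightarrow> cos a * exp (- (\<Sum>e\<in>Bs. \<Sum>x\<in>l1_ball R0. \<Sum>y\<in>l1_ball R0. f e x * f e y * green0 x y) / 2)) at_top"
  proof (rule cos_mean_limit[OF _ _ _ _ _ n])
    show "finite Bs" by (simp add: Bs_def)
  qed (auto simp: Bs_def inner_axis_axis axis_eq_axis split: if_splits)
  then have "((\<lambda>\<beta>. \<integral>\<theta>. cos ((\<Sum>k\<in>- {p}. \<Sum>y\<in>l1_ball R0. d k y * (sqrt \<beta> * \<theta> (torus_proj (n \<beta>) y) $ k)) + a)
      \<partial>rooted_spin_model \<beta> (n \<beta>) (axis p 1 :: real ^ 'n))
    \<longlongrightarrow> cos a * exp (- (\<Sum>k\<in>- {p}. \<Sum>x\<in>l1_ball R0. \<Sum>y\<in>l1_ball R0. d k x * d k y * green0 x y) / 2)) at_top"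
    unfolding reindex f_axis by (simp add: inner_axis sum_distrib_left mult.left_commute)
  moreover have "(\<integral>\<omega>. cos ((\<Sum>k\<in>- {p}. \<Sum>y\<in>l1_ball R0. d k y * \<phi> k y \<omega>) + a) \<partial>\<Omega>)
      = cos a * exp (- (\<Sum>k\<in>- {p}. \<Sum>x\<in>l1_ball R0. \<Sum>y\<in>l1_ball R0. d k x * d k y * green0 x y) / 2)"
    by (rule gff_cos_mean[OF gff]) (auto simp: finite_l1_ball)
  ultimately show ?thesis unfolding regroup by simp
qed

text \<open>Orthogonality of \<open>e\<close> to \<open>v\<close> allows \<theta>(x) to be replaced
  by \<theta>(x) - v, whose second moment of order 1/\<beta> cancels the rescaling. This is the
  uniform bound behind tightness.\<close>

lemma (in rooted_spins) spin_component_second_moment: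
  assumes e: "norm e = 1" "e \<bullet> v = 0"
  shows "integrable (rooted_spin_model \<beta> n v) (\<lambda>\<theta>. (sqrt \<beta> * (\<theta> (torus_proj n x) \<bullet> e))\<^sup>2)"
    "(\<integral>\<theta>. (sqrt \<beta> * (\<theta> (torus_proj n x) \<bullet> e))\<^sup>2 \<partial>rooted_spin_model \<beta> n v) \<le> 8 * real DIM('a) * (real (l1_norm x))\<^sup>2"
proof -
  note [measurable] = proj_measurable[of x]
  have le: "\<bar>(sqrt \<beta> * (u \<bullet> e))\<^sup>2\<bar> \<le> \<beta> * (norm (u - v))\<^sup>2" for u
  proof -
    have "u \<bullet> e = (u - v) \<bullet> e" using e(2) by (simp add: inner_diff_left inner_commute[of v])
    then have "\<bar>u \<bullet> e\<bar> \<le> norm (u - v)" using Cauchy_Schwarz_ineq2[of "u - v" e] e(1) by simp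
    then have "(u \<bullet> e)\<^sup>2 \<le> (norm (u - v))\<^sup>2" by (metis abs_ge_zero power2_abs power_mono)
    then show ?thesis using \<beta>_pos by (simp add: power_mult_distrib)
  qed
  have bound: "\<beta> * (norm (u - v))\<^sup>2 \<le> \<beta> * 2\<^sup>2" if "norm u = 1" for u
    using norm_triangle_ineq4[of u v] that v \<beta>_pos by (intro mult_left_mono power_mono) auto
  from this have bound': "\<bar>\<beta> * (norm (u - v))\<^sup>2\<bar> \<le> \<beta> * 2\<^sup>2" if "norm u = 1" for u
    using that \<beta>_pos by (simp add: abs_mult)
  have int: "integrable (rooted_spin_model \<beta> n v) (\<lambda>\<theta>. \<beta> * (norm (\<theta> (torus_proj n x) - v))\<^sup>2)"
    by (rule integrable_bounded[of _ "\<beta> * 2\<^sup>2"]) (measurable, rule bound', blast)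
  show sq: "integrable (rooted_spin_model \<beta> n v) (\<lambda>\<theta>. (sqrt \<beta> * (\<theta> (torus_proj n x) \<bullet> e))\<^sup>2)"
    by (rule integrable_bounded[of _ "\<beta> * 2\<^sup>2"]) (measurable, rule order_trans[OF le bound], blast)
  have "(\<integral>\<theta>. (sqrt \<beta> * (\<theta> (torus_proj n x) \<bullet> e))\<^sup>2 \<partial>rooted_spin_model \<beta> n v)
      \<le> (\<integral>\<theta>. \<beta> * (norm (\<theta> (torus_proj n x) - v))\<^sup>2 \<partial>rooted_spin_model \<beta> n v)"
    by (rule integral_mono[OF sq int]) (rule order_trans[OF abs_ge_self le])
  also have "\<dots> = \<beta> * (\<integral>\<theta>. (norm (\<theta> (torus_proj n x) - v))\<^sup>2 \<partial>rooted_spin_model \<beta> n v)"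
      by (rule integral_mult_right_zero)
  also have "\<dots> \<le> \<beta> * (8 * real DIM('a) * (real (l1_norm x))\<^sup>2 / \<beta>)"
    using \<beta>_pos site_second_moment by (intro mult_left_mono) auto
  also have "\<dots> = 8 * real DIM('a) * (real (l1_norm x))\<^sup>2" using \<beta>_pos by simp
  finally show "(\<integral>\<theta>. (sqrt \<beta> * (\<theta> (torus_proj n x) \<bullet> e))\<^sup>2 \<partial>rooted_spin_model \<beta> n v)
      \<le> 8 * real DIM('a) * (real (l1_norm x))\<^sup>2" .
qed

theorem theorem1p3:
  fixes n :: "real \<Rightarrow> nat"
    and p :: "'n::finite"
    and \<Omega> :: "'w measure"
    and \<phi> :: "'n \<Rightarrow> int \<times> int \<Rightarrow> 'w \<Rightarrow> real"
    and F :: "(int \<times> int) set"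
  assumes "CARD('n) \<ge> 2"
    and "\<And>\<beta>. 0 < \<beta> \<Longrightarrow> 1 \<le> n \<beta>"
    and "filterlim n at_top at_top"
    and "rooted_vectorial_gff \<Omega> (- {p}) \<phi>"
    and "finite F"
  shows "converges_weakly
           (product_topology (\<lambda>_. euclideanreal) (F \<times> - {p}))
           (\<lambda>\<beta>. law_on (rooted_spin_model \<beta> (n \<beta>) (axis p 1 :: real ^ 'n)) (F \<times> - {p})
                  (\<lambda>\<theta> (x, k). sqrt \<beta> * \<theta> (torus_proj (n \<beta>) x) $ k))
           (law_on \<Omega> (F \<times> - {p}) (\<lambda>\<omega> (x, k). \<phi> k x \<omega>))
           at_top"
proof -
  let ?J = "F \<times> - {p}"
  let ?M = "\<lambda>\<beta>. rooted_spin_model \<beta> (n \<beta>) (axis p 1 :: real ^ 'n)"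
  define X where "X \<beta> \<theta> = (\<lambda>(x, k). sqrt \<beta> * \<theta> (torus_proj (n \<beta>) x) $ k)"
    for \<beta> and \<theta> :: "int \<times> int \<Rightarrow> real ^ 'n"
  define Y where "Y \<omega> = (\<lambda>(x, k). \<phi> k x \<omega>)" for \<omega>
  have J: "finite ?J" using assms(5) by simp
  define C where "C = 8 * real CARD('n) * (real (\<Sum>x\<in>F. l1_norm x))\<^sup>2"
  have gauss: "centred_gaussian_field \<Omega> (\<phi> k) green0" if "k \<noteq> p" for k
    using assms(4) that by (simp add: rooted_vectorial_gff_def)
  have Y: "(\<lambda>\<omega>. Y \<omega> i) \<in> borel_measurable \<Omega>" "integrable \<Omega> (\<lambda>\<omega>. (Y \<omega> i)\<^sup>2)" if "i \<in> ?J" for i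
  proof -
    from that have "snd i \<noteq> p" by auto
    then have G: "centred_gaussian_field \<Omega> (\<phi> (snd i)) green0" by (rule gauss)
    have "\<phi> (snd i) (fst i) \<in> borel_measurable \<Omega>"
      by (rule G[unfolded centred_gaussian_field_def, THEN conjunct2, THEN conjunct1, rule_format])
    then show "(\<lambda>\<omega>. Y \<omega> i) \<in> borel_measurable \<Omega>" "integrable \<Omega> (\<lambda>\<omega>. (Y \<omega> i)\<^sup>2)"
      using gaussian_field_square_integrable[OF G, of "fst i"] by (simp_all add: Y_def split_def)
  qed
  have "eventually (\<lambda>\<beta>. 2 \<le> n \<beta>) at_top" using assms(3) by (simp add: filterlim_at_top)
  then have ev: "eventually (\<lambda>\<beta>. prob_space (?M \<beta>) \<and> (\<forall>i\<in>?J. (\<lambda>\<theta>. X \<beta> \<theta> i) \<in> borel_measurable (?M \<beta>)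
      \<and> integrable (?M \<beta>) (\<lambda>\<theta>. (X \<beta> \<theta> i)\<^sup>2) \<and> (\<integral>\<theta>. (X \<beta> \<theta> i)\<^sup>2 \<partial>?M \<beta>) \<le> C)) at_top"
    using eventually_gt_at_top[of 0]
  proof eventually_elim
    case (elim \<beta>)
    then interpret rooted_spins \<beta> "n \<beta>" "axis p 1 :: real ^ 'n" by unfold_locales simp_all
    have "(\<lambda>\<theta>. X \<beta> \<theta> (x, k)) \<in> borel_measurable (?M \<beta>) \<and> integrable (?M \<beta>) (\<lambda>\<theta>. (X \<beta> \<theta> (x, k))\<^sup>2)
        \<and> (\<integral>\<theta>. (X \<beta> \<theta> (x, k))\<^sup>2 \<partial>?M \<beta>) \<le> C" if x: "x \<in> F" and k: "k \<noteq> p" for x k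
    proof -
      have X_eq: "X \<beta> \<theta> (x, k) = sqrt \<beta> * (\<theta> (torus_proj (n \<beta>) x) \<bullet> axis k 1)" for \<theta>
        by (simp add: X_def inner_axis)
      have e: "norm (axis k 1 :: real ^ 'n) = 1" "axis k 1 \<bullet> (axis p 1 :: real ^ 'n) = 0"
        using k by (simp_all add: inner_axis_axis)
      note [measurable] = proj_measurable[of x]
      have "real (l1_norm x) \<le> real (\<Sum>x\<in>F. l1_norm x)" using x assms(5) by (simp only: of_nat_le_iff member_le_sum)
      then have "8 * real DIM(real ^ 'n) * (real (l1_norm x))\<^sup>2 \<le> C"
        unfolding C_def by (simp add: power_mono mult_left_mono)
      then show ?thesis
        unfolding X_eq using spin_component_second_moment[OF e, of x] by auto
    qed
    then show ?case using prob_space_model by auto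
  qed
  have trig: "((\<lambda>\<beta>. \<integral>\<theta>. cos ((\<Sum>i\<in>?J. c i * X \<beta> \<theta> i) + a) \<partial>?M \<beta>)
      \<longlongrightarrow> (\<integral>\<omega>. cos ((\<Sum>i\<in>?J. c i * Y \<omega> i) + a) \<partial>\<Omega>)) at_top" for c a
    unfolding X_def Y_def by (rule spin_field_cos_limit[OF assms(3-5)])
  have N: "prob_space \<Omega>" using assms(4) by (simp add: rooted_vectorial_gff_def)
  have "converges_weakly (product_topology (\<lambda>_. euclideanreal) ?J) (\<lambda>\<beta>. law_on (?M \<beta>) ?J (X \<beta>)) (law_on \<Omega> ?J Y) at_top"
    unfolding converges_weakly_def
  proof (intro allI impI)
    fix f :: "((int \<times> int) \<times> 'n \<Rightarrow> real) \<Rightarrow> real"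
    assume f: "continuous_map (product_topology (\<lambda>_. euclideanreal) ?J) euclideanreal f"
      and "bounded (f ` topspace (product_topology (\<lambda>_. euclideanreal) ?J))"
    then obtain B where B: "\<And>x. x \<in> (\<Pi>\<^sub>E i\<in>?J. UNIV) \<Longrightarrow> \<bar>f x\<bar> \<le> B"
      by (auto simp: bounded_iff)
    \<comment> \<open>One restriction belongs to the extended test function, which is bounded
      everywhere although \<open>f\<close> is bounded only on extensional functions; the other comes
      from the convergence criterion.\<close>
    have "((\<lambda>\<beta>. \<integral>\<theta>. f (restrict (restrict (X \<beta> \<theta>) ?J) ?J) \<partial>?M \<beta>) \<longlongrightarrow> (\<integral>\<omega>. f (restrict (restrict (Y \<omega>) ?J) ?J) \<partial>\<Omega>)) at_top"
      by (rule weak_convergence_of_cosines[OF J ev N Y trig continuous_on_restrict_product[OF f] B]) auto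
    then have "((\<lambda>\<beta>. \<integral>\<theta>. f (restrict (X \<beta> \<theta>) ?J) \<partial>?M \<beta>) \<longlongrightarrow> (\<integral>x. f x \<partial>law_on \<Omega> ?J Y)) at_top"
      by (simp add: integral_law_on[OF f Y(1)])
    then show "((\<lambda>\<beta>. \<integral>x. f x \<partial>law_on (?M \<beta>) ?J (X \<beta>)) \<longlongrightarrow> (\<integral>x. f x \<partial>law_on \<Omega> ?J Y)) at_top"
    proof (rule Lim_transform_eventually)
      show "eventually (\<lambda>\<beta>. (\<integral>\<theta>. f (restrict (X \<beta> \<theta>) ?J) \<partial>?M \<beta>) = (\<integral>x. f x \<partial>law_on (?M \<beta>) ?J (X \<beta>))) at_top"
        using ev by eventually_elim (rule integral_law_on[OF f, symmetric], blast)
    qed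
  qed
  then show ?thesis unfolding X_def[abs_def] Y_def[abs_def] .
qed

end
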